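(* Let $\tau_A:A\to Q$ be a (smooth, real, finite rank) vector bundle with dual bundle $\tau_{A^*}:A^*\to Q$, let $\Pi_{A^*}$ be a linear Poisson structure on $A^*$ (with bracket $\{\cdot,\cdot\}_{A^*}$), and let $g:A\times_Q A\to\mathbb{R}$ be a bundle metric on $A$. Let $\kappa_{(A,g)}:A^*\to\mathbb{R}$ be the kinetic energy $\kappa_{(A,g)}(\alpha_q)=\frac12\|\alpha_q\|_g^2$, let $X_{\kappa_{(A,g)}}=-i(d\kappa_{(A,g)})\Pi_{A^*}$ be its Hamiltonian vector field with respect to $\Pi_{A^*}$, let $\Delta_{A^*}$ be the Liouville vector field of $A^*$, and let $\mathbb{S}_g(A^* )=\kappa_{(A,g)}^{-1}(\frac12)$, with inclusion $\iota:\mathbb{S}_g(A^* )\to A^*$. Then: (i) The pair $(\Lambda_{A^*},E_{A^*})$ consisting of the $2$-vector and the vector field on $A^*$ given by $$\Lambda_{A^*}=\Pi_{A^*}+\Delta_{A^*}\wedge X_{\kappa_{(A,g)}},\qquad E_{A^*}=-X_{\kappa_{(A,g)}}$$ is a Jacobi structure on $A^*$. (ii) The Jacobi structure $(\Lambda_{A^*},E_{A^*})$ induces (by restriction) a Jacobi structure $(\Lambda_{\mathbb{S}_g(A^* )},E_{\mathbb{S}_g(A^* )})$ on $\mathbb{S}_g(A^* )$ such that, if $\mathcal{O}_Q$ is the zero section of $A^*$, the map $$\Psi:\mathbb{S}_g(A^* )\times\mathbb{R}\to A^*-\mathcal{O}_Q,\qquad \Psi(\beta_q,t)=e^t\beta_q,$$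 is a Poisson isomorphism, when $A^*-\mathcal{O}_Q$ is endowed with the Poisson structure induced by $\Pi_{A^*}$ and $\mathbb{S}_g(A^* )\times\mathbb{R}$ is endowed with the Poissonization of the Jacobi structure on $\mathbb{S}_g(A^* )$, i.e. with $$e^{-t}\Big(\Lambda_{\mathbb{S}_g(A^* )}-E_{\mathbb{S}_g(A^* )}\wedge\frac{\partial}{\partial t}\Big).$$ (iii) The Jacobi bracket $\{\cdot,\cdot\}_{\mathbb{S}_g(A^* )}$ of $(\Lambda_{\mathbb{S}_g(A^* )},E_{\mathbb{S}_g(A^* )})$ and the Poisson bracket $\{\cdot,\cdot\}_{A^*}$ are related by $$\{G_1\circ\iota,G_2\circ\iota\}_{\mathbb{S}_g(A^* )}=\Big(\{G_1,G_2\}_{A^*}-\{\kappa_{(A,g)},G_1\}_{A^*}\big(G_2-\Delta_{A^*}(G_2)\big)+\{\kappa_{(A,g)},G_2\}_{A^*}\big(G_1-\Delta_{A^*}(G_1)\big)\Big)\circ\iota$$ for all $G_1,G_2\in C^\infty(A^* )$.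
   Context: All manifolds, bundles and maps are smooth. A bundle metric on $A$ is a smoothly varying positive definite scalar product on the fibers of $A$; $\|\cdot\|_g$ denotes the induced (dual) norm on the fibers of $A^*$. A Poisson structure on $A^*$ is a $2$-vector $\Pi_{A^*}$ whose bracket $\{F_1,F_2\}_{A^*}=\Pi_{A^*}(dF_1,dF_2)$ satisfies the Jacobi identity. It is called linear if the bracket of any two fiberwise linear functions on $A^*$ is again fiberwise linear. For a $1$-form $\alpha$, $i(\alpha)\Pi$ is the vector field $\Pi(\alpha,\cdot)$; thus the Hamiltonian vector field $X_F=-i(dF)\Pi_{A^*}$ satisfies $X_F(G)=\{G,F\}_{A^*}$. For vector fields $X,Y$, $(X\wedge Y)(\alpha,\beta)=\alpha(X)\beta(Y)-\alpha(Y)\beta(X)$. The Liouville vector field $\Delta_{A^*}$ is the infinitesimal generator of the dilation flow $(t,\alpha_q)\mapsto e^t\alpha_q$; in linear fiber coordinates $y_\alpha$ it is $\sum_\alpha y_\alpha\,\partial/\partial y_\alpha$. A Jacobi structure on a manifold $M$ is a pair $(\Lambda,E)$, with $\Lambda$ a $2$-vector and $E$ a vector field on $M$, such that $[\Lambda,\Lambda]=2\Lambda\wedge E$ and $\mathcal{L}_E\Lambda=0$, where $[\cdot,\cdot]$ is the Schouten-Nijenhuis bracket. The associated Jacobi bracket on $C^\infty(M)$ is $\{f_1,f_2\}=\Lambda(df_1,df_2)+f_1E(f_2)-f_2E(f_1)$; the sign convention of the Schouten-Nijenhuis bracket is the one for which $(\Lambda,E)$ is a Jacobi structure if and only if this bracket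 satisfies the Jacobi identity. That $(\Lambda_{A^*},E_{A^*})$ induces a Jacobi structure on the submanifold $\mathbb{S}_g(A^* )$ by restriction means that at points of $\mathbb{S}_g(A^* )$ the tensors $\Lambda_{A^*}$ and $E_{A^*}$ are tangent to $\mathbb{S}_g(A^* )$ (i.e. lie in $\Lambda^2T\mathbb{S}_g(A^* )$ and $T\mathbb{S}_g(A^* )$ respectively), and the resulting tensors $(\Lambda_{\mathbb{S}_g(A^* )},E_{\mathbb{S}_g(A^* )})$ on $\mathbb{S}_g(A^* )$ form a Jacobi structure. On $\mathbb{S}_g(A^* )\times\mathbb{R}$, $t$ is the coordinate on $\mathbb{R}$, and tensors on $\mathbb{S}_g(A^* )$ are regarded as tensors on the product in the obvious way. A Poisson isomorphism is a diffeomorphism carrying one Poisson structure to the other. *)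

theory Defs
  imports "HOL-Analysis.Analysis"
begin

section \<open>Smooth maps between subsets of Euclidean spaces\<close>

primrec Ck_on :: "nat \<Rightarrow> 'a::euclidean_space set \<Rightarrow> ('a \<Rightarrow> 'b::real_normed_vector) \<Rightarrow> bool" where
  "Ck_on 0 S f \<longleftrightarrow> continuous_on S f"
| "Ck_on (Suc k) S f \<longleftrightarrow>
     (\<forall>x\<in>S. f differentiable at x) \<and> (\<forall>v. Ck_on k S (\<lambda>x. frechet_derivative f (at x) v))"

text \<open>Smoothness on an arbitrary set \<open>X\<close>: local extendability to a \<open>C\<^sup>\<infinity>\<close> map on an open set.
  For \<open>X\<close> open in a linear subspace this is ordinary smoothness of a map on that subspace.\<close>

definition smooth_on :: "'a::euclidean_space set \<Rightarrow> ('a \<Rightarrow> 'b::real_normed_vector) \<Rightarrow> bool" where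
  "smooth_on X f \<longleftrightarrow>
     (\<forall>x\<in>X. \<exists>W F. open W \<and> x \<in> W \<and> (\<forall>k. Ck_on k W F) \<and> (\<forall>y\<in>W \<inter> X. F y = f y))"

section \<open>Manifolds\<close>

text \<open>A manifold is given by an atlas on a set; its topology is the one defined by the charts.
  A chart \<open>(U, \<phi>)\<close> takes values in a linear subspace of a Euclidean space type, so that every
  dimension, including 0, is covered (a type of class \<open>euclidean_space\<close> has positive dimension)
  and a submanifold can be charted with values in the same type as its ambient manifold.\<close>

type_synonym ('m, 'e) chart = "'m set \<times> ('m \<Rightarrow> 'e)"
type_synonym ('m, 'e) atlas = "('m, 'e) chart set"

definition carrier :: "('m, 'e) atlas \<Rightarrow> 'm set" where
  "carrier M = \<Union> (fst ` M)"

definition smooth_atlas :: "('m, 'e::euclidean_space) atlas \<Rightarrow> bool" where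
  "smooth_atlas M \<longleftrightarrow>
     (\<forall>(U, \<phi>)\<in>M. inj_on \<phi> U \<and> (\<exists>V. subspace V \<and> openin (top_of_set V) (\<phi> ` U))) \<and>
     (\<forall>(U, \<phi>)\<in>M. \<forall>(U', \<phi>')\<in>M.
        openin (top_of_set (\<phi> ` U)) (\<phi> ` (U \<inter> U')) \<and>
        smooth_on (\<phi> ` (U \<inter> U')) (\<phi>' \<circ> inv_into U \<phi>))"

definition mtopology :: "('m, 'e::euclidean_space) atlas \<Rightarrow> 'm topology" where
  "mtopology M = topology (\<lambda>W. W \<subseteq> carrier M \<and>
     (\<forall>(U, \<phi>)\<in>M. \<exists>T. open T \<and> U \<inter> W = U \<inter> \<phi> -` T))"

lemma openin_mtopology:
  "openin (mtopology M) W \<longleftrightarrow>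
     W \<subseteq> carrier M \<and> (\<forall>(U, \<phi>)\<in>M. \<exists>T. open T \<and> U \<inter> W = U \<inter> \<phi> -` T)"
proof -
  define P where "P W \<longleftrightarrow> W \<subseteq> carrier M \<and>
    (\<forall>(U, \<phi>)\<in>M. \<exists>T. open T \<and> U \<inter> W = U \<inter> \<phi> -` T)" for W
  have P_chart: "\<exists>T. open T \<and> U \<inter> W = U \<inter> \<phi> -` T" if "P W" "(U, \<phi>) \<in> M" for W U \<phi>
    using that(1)[unfolded P_def, THEN conjunct2, THEN bspec, OF that(2)] by simp
  have "P (S \<inter> T)" if S: "P S" and T: "P T" for S T
    unfolding P_def
  proof (intro conjI ballI, goal_cases)
    case 1
    from S have "S \<subseteq> carrier M" by (simp add: P_def)
    then show ?case by (rule order_trans[OF Int_lower1])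
  next
    case (2 c)
    obtain U \<phi> where c: "c = (U, \<phi>)" by (cases c)
    obtain A where A: "open A" "U \<inter> S = U \<inter> \<phi> -` A" using P_chart[OF S] 2 c by meson
    obtain B where B: "open B" "U \<inter> T = U \<inter> \<phi> -` B" using P_chart[OF T] 2 c by meson
    have "U \<inter> (S \<inter> T) = (U \<inter> S) \<inter> (U \<inter> T)" by (simp add: Int_ac)
    also have "\<dots> = U \<inter> \<phi> -` (A \<inter> B)" unfolding A(2) B(2) by (simp add: Int_ac)
    finally show ?case unfolding c using A(1) B(1) by (auto intro!: exI[of _ "A \<inter> B"])
  qed
  moreover have "P (\<Union>K)" if K: "\<forall>S\<in>K. P S" for K
    unfolding P_def
  proof (intro conjI ballI, goal_cases)
    case 1
    from K have "\<forall>S\<in>K. S \<subseteq> carrier M" by (simp add: P_def)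
    then show ?case by (simp add: Sup_le_iff)
  next
    case (2 c)
    obtain U \<phi> where c: "c = (U, \<phi>)" by (cases c)
    have "\<forall>S\<in>K. \<exists>A. open A \<and> U \<inter> S = U \<inter> \<phi> -` A"
      using P_chart K 2 c by simp
    then obtain A where A: "\<forall>S\<in>K. open (A S) \<and> U \<inter> S = U \<inter> \<phi> -` A S"
      by (rule bchoice[THEN exE])
    have "U \<inter> \<Union>K = (\<Union>S\<in>K. U \<inter> S)" by (rule Int_Union)
    also have "\<dots> = (\<Union>S\<in>K. U \<inter> \<phi> -` A S)" using A by (intro SUP_cong) simp_all
    also have "\<dots> = U \<inter> \<phi> -` (\<Union>S\<in>K. A S)" by (simp add: vimage_UN)
    finally have eq: "U \<inter> \<Union>K = U \<inter> \<phi> -` (\<Union>S\<in>K. A S)" .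
    have "open (\<Union>S\<in>K. A S)" using A by (intro open_UN) simp
    with eq show ?case unfolding c prod.case by (intro exI conjI)
  qed
  ultimately have "istopology P" unfolding istopology_def by simp
  then have "openin (topology P) W \<longleftrightarrow> P W" by (simp add: topology_inverse')
  then show ?thesis unfolding mtopology_def P_def .
qed

definition manifold :: "nat \<Rightarrow> ('m, 'e::euclidean_space) atlas \<Rightarrow> bool" where
  "manifold n M \<longleftrightarrow> smooth_atlas M \<and>
     (\<forall>(U, \<phi>)\<in>M. \<exists>V. subspace V \<and> dim V = n \<and> openin (top_of_set V) (\<phi> ` U)) \<and>
     Hausdorff_space (mtopology M) \<and> second_countable (mtopology M)"

text \<open>Functions on \<open>M\<close> are total functions whose values off \<open>carrier M\<close> are irrelevant.\<close>

definition smooth_fun :: "('m, 'e::euclidean_space) atlas \<Rightarrow> ('m \<Rightarrow> real) \<Rightarrow> bool" where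
  "smooth_fun M f \<longleftrightarrow> (\<forall>(U, \<phi>)\<in>M. smooth_on (\<phi> ` U) (f \<circ> inv_into U \<phi>))"

definition smooth_map ::
  "('m, 'e::euclidean_space) atlas \<Rightarrow> ('n, 'd::euclidean_space) atlas \<Rightarrow> ('m \<Rightarrow> 'n) \<Rightarrow> bool" where
  "smooth_map M N \<Phi> \<longleftrightarrow> continuous_map (mtopology M) (mtopology N) \<Phi> \<and>
     (\<forall>(U, \<phi>)\<in>M. \<forall>(U', \<psi>)\<in>N. smooth_on (\<phi> ` (U \<inter> \<Phi> -` U')) (\<psi> \<circ> \<Phi> \<circ> inv_into U \<phi>))"

definition diffeomorphism ::
  "('m, 'e::euclidean_space) atlas \<Rightarrow> ('n, 'd::euclidean_space) atlas \<Rightarrow> ('m \<Rightarrow> 'n) \<Rightarrow> bool" where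
  "diffeomorphism M N \<Phi> \<longleftrightarrow> bij_betw \<Phi> (carrier M) (carrier N) \<and>
     smooth_map M N \<Phi> \<and> smooth_map N M (inv_into (carrier M) \<Phi>)"

definition linear_atlas :: "'e::euclidean_space set \<Rightarrow> ('e, 'e) atlas" where
  "linear_atlas V = {(V, \<lambda>x. x)}"

definition open_atlas :: "('m, 'e) atlas \<Rightarrow> 'm set \<Rightarrow> ('m, 'e) atlas" where
  "open_atlas M W = {(U \<inter> W, \<phi>) | U \<phi>. (U, \<phi>) \<in> M}"

definition prod_atlas :: "('m, 'e) atlas \<Rightarrow> ('n, 'd) atlas \<Rightarrow> ('m \<times> 'n, 'e \<times> 'd) atlas" where
  "prod_atlas M N = {(U \<times> U', map_prod \<phi> \<psi>) | U \<phi> U' \<psi>. (U, \<phi>) \<in> M \<and> (U', \<psi>) \<in> N}"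

definition maximal_atlas :: "('m, 'e::euclidean_space) atlas \<Rightarrow> ('m, 'e) atlas" where
  "maximal_atlas M = {(U, \<phi>). U \<subseteq> carrier M \<and> smooth_atlas (insert (U, \<phi>) M)}"

text \<open>The \<open>k\<close>-dimensional slice charts of \<open>S\<close>; \<open>S\<close> is an embedded submanifold of dimension \<open>k\<close> if
  these cover it, and they are then an atlas of its submanifold structure.\<close>

definition slice_atlas :: "nat \<Rightarrow> ('m, 'e::euclidean_space) atlas \<Rightarrow> 'm set \<Rightarrow> ('m, 'e) atlas" where
  "slice_atlas k M S = {(U \<inter> S, \<phi>) | U \<phi>. (U, \<phi>) \<in> maximal_atlas M \<and>
     (\<exists>V W. subspace V \<and> openin (top_of_set V) (\<phi> ` U) \<and>
        subspace W \<and> W \<subseteq> V \<and> dim W = k \<and> \<phi> ` (U \<inter> S) = \<phi> ` U \<inter> W)}"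

definition embedded_submanifold ::
  "nat \<Rightarrow> ('m, 'e::euclidean_space) atlas \<Rightarrow> 'm set \<Rightarrow> bool" where
  "embedded_submanifold k M S \<longleftrightarrow> S \<subseteq> carrier M \<and> carrier (slice_atlas k M S) = S"

section \<open>Tangent vectors and multivectors\<close>

text \<open>Tangent vectors at \<open>p\<close> are derivations at \<open>p\<close> of the algebra of smooth functions (set to 0 on
  non-smooth arguments).\<close>

type_synonym 'm vec = "('m \<Rightarrow> real) \<Rightarrow> real"
type_synonym 'm bivec = "('m \<Rightarrow> real) \<Rightarrow> ('m \<Rightarrow> real) \<Rightarrow> real"
type_synonym 'm trivec = "('m \<Rightarrow> real) \<Rightarrow> ('m \<Rightarrow> real) \<Rightarrow> ('m \<Rightarrow> real) \<Rightarrow> real"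

definition tangent_space :: "('m, 'e::euclidean_space) atlas \<Rightarrow> 'm \<Rightarrow> 'm vec set" where
  "tangent_space M p = {v.
     (\<forall>f. \<not> smooth_fun M f \<longrightarrow> v f = 0) \<and>
     (\<forall>f h a b. smooth_fun M f \<and> smooth_fun M h \<longrightarrow>
        v (\<lambda>x. a * f x + b * h x) = a * v f + b * v h) \<and>
     (\<forall>f h. smooth_fun M f \<and> smooth_fun M h \<longrightarrow>
        v (\<lambda>x. f x * h x) = v f * h p + f p * v h)}"

text \<open>Covectors at \<open>p\<close> are the differentials at \<open>p\<close> of smooth functions, so a multivector is
  represented by its values on them: \<open>P f h\<close> stands for \<open>P (df, dh)\<close> at \<open>p\<close>, and \<open>v f\<close> for
  \<open>df (v)\<close>.\<close>

definition wedge :: "'m vec \<Rightarrow> 'm vec \<Rightarrow> 'm bivec" where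
  "wedge v w = (\<lambda>f h. v f * w h - v h * w f)"

definition wedge21 :: "'m bivec \<Rightarrow> 'm vec \<Rightarrow> 'm trivec" where
  "wedge21 P v = (\<lambda>f g h. P f g * v h + P g h * v f + P h f * v g)"

definition bivectors :: "('m, 'e::euclidean_space) atlas \<Rightarrow> 'm \<Rightarrow> 'm bivec set" where
  "bivectors M p = {\<lambda>f h. \<Sum>i<k. wedge (v i) (w i) f h | (k::nat) v w.
     \<forall>i<k. v i \<in> tangent_space M p \<and> w i \<in> tangent_space M p}"

definition vector_field :: "('m, 'e::euclidean_space) atlas \<Rightarrow> ('m \<Rightarrow> 'm vec) \<Rightarrow> bool" where
  "vector_field M X \<longleftrightarrow> (\<forall>p\<in>carrier M. X p \<in> tangent_space M p) \<and>
     (\<forall>f. smooth_fun M f \<longrightarrow> smooth_fun M (\<lambda>p. X p f))"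

definition bivector_field :: "('m, 'e::euclidean_space) atlas \<Rightarrow> ('m \<Rightarrow> 'm bivec) \<Rightarrow> bool" where
  "bivector_field M P \<longleftrightarrow> (\<forall>p\<in>carrier M. P p \<in> bivectors M p) \<and>
     (\<forall>f h. smooth_fun M f \<and> smooth_fun M h \<longrightarrow> smooth_fun M (\<lambda>p. P p f h))"

definition push_vec :: "('n, 'd::euclidean_space) atlas \<Rightarrow> ('m \<Rightarrow> 'n) \<Rightarrow> 'm vec \<Rightarrow> 'n vec" where
  "push_vec N \<Phi> v = (\<lambda>f. if smooth_fun N f then v (f \<circ> \<Phi>) else 0)"

definition push_bivec :: "('n, 'd::euclidean_space) atlas \<Rightarrow> ('m \<Rightarrow> 'n) \<Rightarrow> 'm bivec \<Rightarrow> 'n bivec" where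
  "push_bivec N \<Phi> P = (\<lambda>f h. if smooth_fun N f \<and> smooth_fun N h then P (f \<circ> \<Phi>) (h \<circ> \<Phi>) else 0)"

text \<open>For an (open or embedded) submanifold \<open>S\<close> of \<open>M\<close>: tangency at points of \<open>S\<close>, and the tensor on
  \<open>S\<close> that the (injective) push-forward by the inclusion sends to the given one.\<close>

definition vec_tangent_to ::
  "('m, 'e::euclidean_space) atlas \<Rightarrow> ('m, 'd::euclidean_space) atlas \<Rightarrow> ('m \<Rightarrow> 'm vec) \<Rightarrow> bool" where
  "vec_tangent_to M S X \<longleftrightarrow> (\<forall>p\<in>carrier S. X p \<in> push_vec M id ` tangent_space S p)"

definition bivec_tangent_to ::
  "('m, 'e::euclidean_space) atlas \<Rightarrow> ('m, 'd::euclidean_space) atlas \<Rightarrow> ('m \<Rightarrow> 'm bivec) \<Rightarrow> bool" where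
  "bivec_tangent_to M S P \<longleftrightarrow> (\<forall>p\<in>carrier S. P p \<in> push_bivec M id ` bivectors S p)"

definition restrict_vec ::
  "('m, 'e::euclidean_space) atlas \<Rightarrow> ('m, 'd::euclidean_space) atlas \<Rightarrow>
     ('m \<Rightarrow> 'm vec) \<Rightarrow> 'm \<Rightarrow> 'm vec" where
  "restrict_vec M S X = (\<lambda>p. the_inv_into (tangent_space S p) (push_vec M id) (X p))"

definition restrict_bivec ::
  "('m, 'e::euclidean_space) atlas \<Rightarrow> ('m, 'd::euclidean_space) atlas \<Rightarrow>
     ('m \<Rightarrow> 'm bivec) \<Rightarrow> 'm \<Rightarrow> 'm bivec" where
  "restrict_bivec M S P = (\<lambda>p. the_inv_into (bivectors S p) (push_bivec M id) (P p))"

section \<open>Poisson and Jacobi structures\<close>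

definition poisson_bracket ::
  "('m \<Rightarrow> 'm bivec) \<Rightarrow> ('m \<Rightarrow> real) \<Rightarrow> ('m \<Rightarrow> real) \<Rightarrow> 'm \<Rightarrow> real" where
  "poisson_bracket P f h = (\<lambda>p. P p f h)"

definition poisson_structure ::
  "('m, 'e::euclidean_space) atlas \<Rightarrow> ('m \<Rightarrow> 'm bivec) \<Rightarrow> bool" where
  "poisson_structure M P \<longleftrightarrow> bivector_field M P \<and>
     (\<forall>f g h. smooth_fun M f \<and> smooth_fun M g \<and> smooth_fun M h \<longrightarrow>
        (\<forall>p\<in>carrier M. poisson_bracket P (poisson_bracket P f g) h p
           + poisson_bracket P (poisson_bracket P g h) f p
           + poisson_bracket P (poisson_bracket P h f) g p = 0))"

definition hamiltonian_vf :: "('m \<Rightarrow> 'm bivec) \<Rightarrow> ('m \<Rightarrow> real) \<Rightarrow> 'm \<Rightarrow> 'm vec" where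
  "hamiltonian_vf P F = (\<lambda>p h. - P p F h)"

definition poisson_isomorphism ::
  "('m, 'e::euclidean_space) atlas \<Rightarrow> ('m \<Rightarrow> 'm bivec) \<Rightarrow>
   ('n, 'd::euclidean_space) atlas \<Rightarrow> ('n \<Rightarrow> 'n bivec) \<Rightarrow> ('m \<Rightarrow> 'n) \<Rightarrow> bool" where
  "poisson_isomorphism M P N R \<Phi> \<longleftrightarrow> poisson_structure M P \<and> poisson_structure N R \<and>
     diffeomorphism M N \<Phi> \<and> (\<forall>p\<in>carrier M. push_bivec N \<Phi> (P p) = R (\<Phi> p))"

text \<open>Schouten-Nijenhuis bracket of two 2-vectors, as the graded commutator of the insertion
  \<open>P \<circ> R (f, g, h) = P (R (f, g), h) + cyclic\<close>. On decomposable 2-vectors it is the extension of the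
  Lie bracket with sign \<open>[X \<and> Y, Z \<and> W] = - [X, Z] \<and> Y \<and> W + \<dots>\<close>. This sign is the one for which
  the condition \<open>[\<Lambda>, \<Lambda>] = 2 \<Lambda> \<and> E\<close> below fits the Jacobi identity of the Jacobi bracket
  \<open>\<Lambda> (df, dh) + f E h - h E f\<close>.\<close>

definition insertion :: "('m \<Rightarrow> 'm bivec) \<Rightarrow> ('m \<Rightarrow> 'm bivec) \<Rightarrow> 'm \<Rightarrow> 'm trivec" where
  "insertion P R = (\<lambda>p f g h.
     P p (\<lambda>x. R x f g) h + P p (\<lambda>x. R x g h) f + P p (\<lambda>x. R x h f) g)"

definition schouten_bracket :: "('m \<Rightarrow> 'm bivec) \<Rightarrow> ('m \<Rightarrow> 'm bivec) \<Rightarrow> 'm \<Rightarrow> 'm trivec" where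
  "schouten_bracket P R = (\<lambda>p f g h. insertion P R p f g h + insertion R P p f g h)"

definition lie_derivative :: "('m \<Rightarrow> 'm vec) \<Rightarrow> ('m \<Rightarrow> 'm bivec) \<Rightarrow> 'm \<Rightarrow> 'm bivec" where
  "lie_derivative X P = (\<lambda>p f h.
     X p (\<lambda>x. P x f h) - P p (\<lambda>x. X x f) h - P p f (\<lambda>x. X x h))"

definition jacobi_structure ::
  "('m, 'e::euclidean_space) atlas \<Rightarrow> ('m \<Rightarrow> 'm bivec) \<Rightarrow> ('m \<Rightarrow> 'm vec) \<Rightarrow> bool" where
  "jacobi_structure M \<Lambda> E \<longleftrightarrow> bivector_field M \<Lambda> \<and> vector_field M E \<and>
     (\<forall>p\<in>carrier M. \<forall>f g h. smooth_fun M f \<and> smooth_fun M g \<and> smooth_fun M h \<longrightarrow>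
        schouten_bracket \<Lambda> \<Lambda> p f g h = 2 * wedge21 (\<Lambda> p) (E p) f g h) \<and>
     (\<forall>p\<in>carrier M. \<forall>f h. smooth_fun M f \<and> smooth_fun M h \<longrightarrow> lie_derivative E \<Lambda> p f h = 0)"

definition jacobi_bracket ::
  "('m \<Rightarrow> 'm bivec) \<Rightarrow> ('m \<Rightarrow> 'm vec) \<Rightarrow> ('m \<Rightarrow> real) \<Rightarrow> ('m \<Rightarrow> real) \<Rightarrow> 'm \<Rightarrow> real" where
  "jacobi_bracket \<Lambda> E f h = (\<lambda>p. \<Lambda> p f h + f p * E p h - h p * E p f)"

abbreviation real_line :: "(real, real) atlas" where
  "real_line \<equiv> linear_atlas UNIV"

definition partial_t :: "('m, 'e::euclidean_space) atlas \<Rightarrow> 'm \<times> real \<Rightarrow> ('m \<times> real) vec" where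
  "partial_t M = (\<lambda>(p, t) f.
     if smooth_fun (prod_atlas M real_line) f then deriv (\<lambda>s. f (p, s)) t else 0)"

text \<open>Tensors on \<open>M\<close> are lifted to \<open>M \<times> \<real>\<close> by pushing forward along the slices \<open>M \<times> {t}\<close>.\<close>

definition poissonization ::
  "('m, 'e::euclidean_space) atlas \<Rightarrow> ('m \<Rightarrow> 'm bivec) \<Rightarrow> ('m \<Rightarrow> 'm vec) \<Rightarrow>
     'm \<times> real \<Rightarrow> ('m \<times> real) bivec" where
  "poissonization M \<Lambda> E = (\<lambda>(p, t) f h. exp (- t) *
     (push_bivec (prod_atlas M real_line) (\<lambda>x. (x, t)) (\<Lambda> p) f h
      - wedge (push_vec (prod_atlas M real_line) (\<lambda>x. (x, t)) (E p)) (partial_t M (p, t)) f h))"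

section \<open>Vector bundles\<close>

text \<open>\<open>typ_fibre\<close> is the typical fibre, a linear subspace of a Euclidean space type, so that rank 0
  is included.\<close>

record ('q, 'a, 'b, 'e, 'f) vbundle =
  base :: "('q, 'b) atlas"
  total :: "('a, 'e) atlas"
  proj :: "'a \<Rightarrow> 'q"
  fadd :: "'a \<Rightarrow> 'a \<Rightarrow> 'a"
  fscale :: "real \<Rightarrow> 'a \<Rightarrow> 'a"
  typ_fibre :: "'f set"

definition fibre :: "('q, 'a, 'b, 'e, 'f) vbundle \<Rightarrow> 'q \<Rightarrow> 'a set" where
  "fibre A q = {a \<in> carrier (total A). proj A a = q}"

definition local_triv ::
  "('q, 'a, 'b::euclidean_space, 'e::euclidean_space, 'f::euclidean_space) vbundle \<Rightarrow>
     'q set \<Rightarrow> ('a \<Rightarrow> 'q \<times> 'f) \<Rightarrow> bool" where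
  "local_triv A U \<theta> \<longleftrightarrow> openin (mtopology (base A)) U \<and>
     diffeomorphism (open_atlas (total A) (proj A -` U))
       (prod_atlas (open_atlas (base A) U) (linear_atlas (typ_fibre A))) \<theta> \<and>
     (\<forall>q\<in>U. \<forall>a\<in>fibre A q. fst (\<theta> a) = q \<and>
        (\<forall>b\<in>fibre A q. snd (\<theta> (fadd A a b)) = snd (\<theta> a) + snd (\<theta> b)) \<and>
        (\<forall>c. snd (\<theta> (fscale A c a)) = c *\<^sub>R snd (\<theta> a)))"

text \<open>The vector space axioms of the fibres need not be listed: a local trivialization restricts to a
  bijection of each fibre onto \<open>typ_fibre\<close> that respects \<open>fadd\<close> and \<open>fscale\<close>.\<close>

definition vector_bundle ::
  "nat \<Rightarrow> ('q, 'a, 'b::euclidean_space, 'e::euclidean_space, 'f::euclidean_space) vbundle \<Rightarrow> bool" where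
  "vector_bundle n A \<longleftrightarrow>
     subspace (typ_fibre A) \<and> manifold n (base A) \<and> manifold (n + dim (typ_fibre A)) (total A) \<and>
     smooth_map (total A) (base A) (proj A) \<and>
     proj A ` carrier (total A) = carrier (base A) \<and>
     (\<forall>q\<in>carrier (base A). \<forall>a\<in>fibre A q.
        (\<forall>b\<in>fibre A q. fadd A a b \<in> fibre A q) \<and> (\<forall>c. fscale A c a \<in> fibre A q)) \<and>
     (\<forall>q\<in>carrier (base A). \<exists>U \<theta>. q \<in> U \<and> local_triv A U \<theta>)"

definition bundle_metric ::
  "('q, 'a, 'b::euclidean_space, 'e::euclidean_space, 'f) vbundle \<Rightarrow> ('a \<Rightarrow> 'a \<Rightarrow> real) \<Rightarrow> bool" where
  "bundle_metric A g \<longleftrightarrow>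
     (\<forall>q\<in>carrier (base A). \<forall>a\<in>fibre A q. \<forall>b\<in>fibre A q.
        g a b = g b a \<and>
        (\<forall>c\<in>fibre A q. g (fadd A a b) c = g a c + g b c) \<and>
        (\<forall>c. g (fscale A c a) b = c * g a b) \<and>
        (a \<noteq> fscale A 0 a \<longrightarrow> g a a > 0)) \<and>
     (\<forall>U s s'. openin (mtopology (base A)) U \<and>
        smooth_map (open_atlas (base A) U) (total A) s \<and> (\<forall>q\<in>U. s q \<in> fibre A q) \<and>
        smooth_map (open_atlas (base A) U) (total A) s' \<and> (\<forall>q\<in>U. s' q \<in> fibre A q) \<longrightarrow>
        smooth_fun (open_atlas (base A) U) (\<lambda>q. g (s q) (s' q)))"

section \<open>The dual bundle\<close>

text \<open>A point of the dual bundle is a pair \<open>(q, \<alpha>)\<close> with \<open>\<alpha>\<close> linear on the fibre over \<open>q\<close> and, to make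
  the representation unique, 0 elsewhere.\<close>

definition dual_set :: "('q, 'a, 'b, 'e, 'f) vbundle \<Rightarrow> ('q \<times> ('a \<Rightarrow> real)) set" where
  "dual_set A = {(q, \<alpha>). q \<in> carrier (base A) \<and>
     (\<forall>a\<in>fibre A q. \<forall>b\<in>fibre A q. \<alpha> (fadd A a b) = \<alpha> a + \<alpha> b) \<and>
     (\<forall>a\<in>fibre A q. \<forall>c. \<alpha> (fscale A c a) = c * \<alpha> a) \<and>
     (\<forall>a. a \<notin> fibre A q \<longrightarrow> \<alpha> a = 0)}"

text \<open>A chart \<open>(U, \<phi>)\<close> of the base and a trivialization \<open>\<theta>\<close> over \<open>U'\<close> give the chart \<open>(q, \<alpha>) \<mapsto> (\<phi> q, y)\<close>
  of the dual, where the dual of \<open>typ_fibre\<close> is identified with \<open>typ_fibre\<close> by the Euclidean inner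
  product.\<close>

definition dual_atlas ::
  "('q, 'a, 'b::euclidean_space, 'e::euclidean_space, 'f::euclidean_space) vbundle \<Rightarrow>
     ('q \<times> ('a \<Rightarrow> real), 'b \<times> 'f) atlas" where
  "dual_atlas A = {({x \<in> dual_set A. fst x \<in> U \<inter> U'},
       \<lambda>(q, \<alpha>). (\<phi> q, THE y. y \<in> typ_fibre A \<and> (\<forall>a\<in>fibre A q. \<alpha> a = y \<bullet> snd (\<theta> a)))) | U \<phi> U' \<theta>.
     (U, \<phi>) \<in> base A \<and> local_triv A U' \<theta>}"

definition zero_section :: "('q, 'a, 'b, 'e, 'f) vbundle \<Rightarrow> ('q \<times> ('a \<Rightarrow> real)) set" where
  "zero_section A = {(q, \<lambda>_. 0) | q. q \<in> carrier (base A)}"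

definition dilation :: "real \<Rightarrow> 'q \<times> ('a \<Rightarrow> real) \<Rightarrow> 'q \<times> ('a \<Rightarrow> real)" where
  "dilation c = (\<lambda>(q, \<alpha>). (q, \<lambda>a. c * \<alpha> a))"

definition liouville_vf ::
  "('q, 'a, 'b::euclidean_space, 'e::euclidean_space, 'f::euclidean_space) vbundle \<Rightarrow>
     'q \<times> ('a \<Rightarrow> real) \<Rightarrow> ('q \<times> ('a \<Rightarrow> real)) vec" where
  "liouville_vf A = (\<lambda>x f.
     if smooth_fun (dual_atlas A) f then deriv (\<lambda>t. f (dilation (exp t) x)) 0 else 0)"

definition fibrewise_linear ::
  "('q, 'a, 'b, 'e, 'f) vbundle \<Rightarrow> ('q \<times> ('a \<Rightarrow> real) \<Rightarrow> real) \<Rightarrow> bool" where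
  "fibrewise_linear A F \<longleftrightarrow>
     (\<forall>q \<alpha> \<beta>. (q, \<alpha>) \<in> dual_set A \<and> (q, \<beta>) \<in> dual_set A \<longrightarrow>
        F (q, \<lambda>a. \<alpha> a + \<beta> a) = F (q, \<alpha>) + F (q, \<beta>)) \<and>
     (\<forall>q \<alpha> c. (q, \<alpha>) \<in> dual_set A \<longrightarrow> F (q, \<lambda>a. c * \<alpha> a) = c * F (q, \<alpha>))"

definition linear_poisson ::
  "('q, 'a, 'b::euclidean_space, 'e::euclidean_space, 'f::euclidean_space) vbundle \<Rightarrow>
     ('q \<times> ('a \<Rightarrow> real) \<Rightarrow> ('q \<times> ('a \<Rightarrow> real)) bivec) \<Rightarrow> bool" where
  "linear_poisson A P \<longleftrightarrow> poisson_structure (dual_atlas A) P \<and>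
     (\<forall>F G. smooth_fun (dual_atlas A) F \<and> fibrewise_linear A F \<and>
            smooth_fun (dual_atlas A) G \<and> fibrewise_linear A G \<longrightarrow>
        fibrewise_linear A (poisson_bracket P F G))"

definition dual_norm ::
  "('q, 'a, 'b, 'e, 'f) vbundle \<Rightarrow> ('a \<Rightarrow> 'a \<Rightarrow> real) \<Rightarrow> 'q \<times> ('a \<Rightarrow> real) \<Rightarrow> real" where
  "dual_norm A g = (\<lambda>(q, \<alpha>). Sup {\<bar>\<alpha> a\<bar> | a. a \<in> fibre A q \<and> g a a \<le> 1})"

definition kinetic_energy ::
  "('q, 'a, 'b, 'e, 'f) vbundle \<Rightarrow> ('a \<Rightarrow> 'a \<Rightarrow> real) \<Rightarrow> 'q \<times> ('a \<Rightarrow> real) \<Rightarrow> real" where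
  "kinetic_energy A g = (\<lambda>x. (dual_norm A g x)\<^sup>2 / 2)"

definition sphere_bundle ::
  "('q, 'a, 'b, 'e, 'f) vbundle \<Rightarrow> ('a \<Rightarrow> 'a \<Rightarrow> real) \<Rightarrow> ('q \<times> ('a \<Rightarrow> real)) set" where
  "sphere_bundle A g = {x \<in> dual_set A. kinetic_energy A g x = 1 / 2}"

end

theory Submission
  imports Defs
begin

text \<open>Linearity makes \<open>P\<close> homogeneous of degree \<open>-1\<close> under dilations: off the zero section a
  biderivation is determined by its values on fibrewise linear functions, and the zero section is
  reached by continuity (in rank 0 the kinetic energy vanishes and \<open>\<Lambda> = P\<close>). Infinitesimally,
  \<open>\<Delta>\<close> acts on \<open>P\<close> with weight \<open>-1\<close> and on \<open>\<kappa>\<close> with weight \<open>2\<close>, and the Jacobi identities for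
  \<open>(\<Lambda>, E)\<close> become consequences of the Leibniz rule and the Jacobi identity of \<open>P\<close>. On the sphere
  bundle \<open>\<Lambda> (d\<kappa>, -)\<close> and \<open>E \<kappa>\<close> vanish, which is tangency. Functions on the sphere bundle are extended
  along the radial retraction, with a cut-off in \<open>\<kappa>\<close> near the zero section; this reduces every identity
  there to one on the dual bundle. Finally \<open>\<Psi>\<close> is given by polar coordinates, and it is Poisson by the
  homogeneity of \<open>P\<close>.\<close>

section \<open>Calculus of smooth maps on open sets\<close>

text \<open>A tangent vector is a derivation of the algebra of global smooth functions, so it cannot
  be applied to coordinates, nor to a function known only on an open set or on the sphere bundle.
  Every local argument has to become an identity between global functions, and this dictates two
  families of cut-offs. Those pulled back from the base preserve fibrewise linearity, so that the
  hypothesis on linear functions stays applicable; they exist because compact subsets of the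
  Hausdorff base are closed. Those that are functions of \<open>\<kappa>\<close> serve off the zero
  section. With X the Hamiltonian vector field of \<open>\<kappa>\<close>, the weights -1 and 2 add
  up to \<Delta> X - X \<Delta> = X, which enters both Jacobi conditions. The level 1/2 is the one
  where \<Delta> \<kappa> = 1, the value at which the two contributions to \<Lambda> (d\<kappa>, -)
  cancel. Restricted tensors are defined by inverting a push-forward, so each is exhibited by a
  formula, the ambient tensor evaluated on extended functions. The Jacobi identity of the
  Poissonization is carried over along \<Psi> from the complement of the zero section.\<close>

abbreviation Cinf_on :: "'a::euclidean_space set \<Rightarrow> ('a \<Rightarrow> 'b::real_normed_vector) \<Rightarrow> bool" where
  "Cinf_on S f \<equiv> (\<forall>k. Ck_on k S f)"

lemma Ck_on_subset: "Ck_on k S f \<Longrightarrow> T \<subseteq> S \<Longrightarrow> Ck_on k T f"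
  by (induction k arbitrary: f) (auto intro: continuous_on_subset)

text \<open>The derivatives are taken at \<open>x\<close> in the full space, so agreement on
  \<open>S\<close> fixes them only because \<open>S\<close> is open.\<close>

lemma Ck_on_cong:
  assumes "open S" "\<And>x. x \<in> S \<Longrightarrow> f x = g x" "Ck_on k S f"
  shows "Ck_on k S g"
  using assms(2,3)
proof (induction k arbitrary: f g)
  case 0
  then show ?case by (simp cong: continuous_on_cong)
next
  case (Suc k)
  have *: "g differentiable at x \<and> frechet_derivative f (at x) = frechet_derivative g (at x)" if "x \<in> S" for x
  proof -
    have f: "f differentiable at x" using Suc.prems that by simp
    then have "(g has_derivative frechet_derivative f (at x)) (at x)"
      using has_derivative_transform_within_open[OF _ assms(1) that Suc.prems(1)]
      by (simp add: frechet_derivative_works)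
    then show ?thesis
      using frechet_derivative_at differentiableI by blast
  qed
  have "Ck_on k S (\<lambda>x. frechet_derivative g (at x) v)" for v
    using Suc.IH[of "\<lambda>x. frechet_derivative f (at x) v" "\<lambda>x. frechet_derivative g (at x) v"] * Suc.prems(2)
    by simp
  with * show ?case by simp
qed

text \<open>Lets the derivative be supplied as any formula \<open>f'\<close>, so that later
  inductions do not handle \<open>frechet_derivative\<close> of a compound expression.\<close>

lemma Ck_on_SucI:
  assumes "open S" "\<And>x. x \<in> S \<Longrightarrow> (f has_derivative f' x) (at x)" "\<And>v. Ck_on k S (\<lambda>x. f' x v)"
  shows "Ck_on (Suc k) S f"
proof -
  have "frechet_derivative f (at x) = f' x" if "x \<in> S" for x
    using frechet_derivative_at[OF assms(2)[OF that]] by simp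
  then have "Ck_on k S (\<lambda>x. frechet_derivative f (at x) v)" for v
    by (intro Ck_on_cong[OF assms(1) _ assms(3)[of v]]) simp
  moreover have "f differentiable at x" if "x \<in> S" for x
    using assms(2)[OF that] by (rule differentiableI)
  ultimately show ?thesis by simp
qed

lemma Ck_on_SucD:
  assumes "Ck_on (Suc k) S f" "x \<in> S"
  shows "(f has_derivative frechet_derivative f (at x)) (at x)"
  using assms by (simp add: frechet_derivative_works)

lemma Ck_on_Suc_imp: "Ck_on (Suc k) S f \<Longrightarrow> Ck_on k S f"
proof (induction k arbitrary: f)
  case 0
  then show ?case
    by (auto intro!: differentiable_imp_continuous_on differentiable_at_imp_differentiable_on)
next
  case (Suc k)
  then show ?case by (metis Ck_on.simps(2))
qed

lemma Ck_on_imp_continuous: "Ck_on k S f \<Longrightarrow> continuous_on S f"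
  by (induction k) (simp_all del: Ck_on.simps(2) add: Ck_on_Suc_imp)

lemma Ck_on_const: "open S \<Longrightarrow> Ck_on k S (\<lambda>x. c)"
proof (induction k arbitrary: c)
  case (Suc k)
  then show ?case by (intro Ck_on_SucI[where f' = "\<lambda>_ _. 0"]) auto
qed simp

lemma Ck_on_bounded_linear:
  assumes "open S" "bounded_linear f"
  shows "Ck_on k S f"
proof (cases k)
  case 0
  then show ?thesis using assms(2) by (simp add: linear_continuous_on)
next
  case (Suc k)
  show ?thesis unfolding Suc
    by (rule Ck_on_SucI[OF assms(1)]) (auto intro: bounded_linear_imp_has_derivative assms Ck_on_const)
qed

lemma Ck_on_add:
  assumes "open S" "Ck_on k S f" "Ck_on k S g"
  shows "Ck_on k S (\<lambda>x. f x + g x)"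
  using assms(2,3)
proof (induction k arbitrary: f g)
  case 0
  then show ?case by (simp add: continuous_on_add)
next
  case (Suc k)
  show ?case
    by (rule Ck_on_SucI[OF assms(1) has_derivative_add[OF Ck_on_SucD[OF Suc.prems(1)] Ck_on_SucD[OF Suc.prems(2)]]])
      (use Suc in auto)
qed

lemma Ck_on_sum:
  assumes "open S" "\<And>i. i \<in> I \<Longrightarrow> Ck_on k S (f i)"
  shows "Ck_on k S (\<lambda>x. \<Sum>i\<in>I. f i x)"
  using assms(2)
  by (induction I rule: infinite_finite_induct)
    (simp_all add: Ck_on_const[OF assms(1)] Ck_on_add[OF assms(1)])

lemma Ck_on_bilinear:
  assumes "open S" "bounded_bilinear B" "Ck_on k S f" "Ck_on k S g"
  shows "Ck_on k S (\<lambda>x. B (f x) (g x))"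
  using assms(3,4)
proof (induction k arbitrary: f g)
  case 0
  then show ?case by (simp add: bounded_bilinear.continuous_on[OF assms(2)])
next
  case (Suc k)
  show ?case
  proof (rule Ck_on_SucI[OF assms(1)
      bounded_bilinear.FDERIV[OF assms(2) Ck_on_SucD[OF Suc.prems(1)] Ck_on_SucD[OF Suc.prems(2)]]])
    fix v
    show "Ck_on k S (\<lambda>x. B (f x) (frechet_derivative g (at x) v) + B (frechet_derivative f (at x) v) (g x))"
      using Suc.prems Ck_on_Suc_imp[OF Suc.prems(1)] Ck_on_Suc_imp[OF Suc.prems(2)]
      by (intro Ck_on_add[OF assms(1)] Suc.IH) auto
  qed
qed

lemmas Ck_on_scaleR = Ck_on_bilinear[OF _ bounded_bilinear_scaleR]
lemmas Ck_on_mult = Ck_on_bilinear[OF _ bounded_bilinear_mult]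
lemmas Ck_on_inner = Ck_on_bilinear[OF _ bounded_bilinear_inner]

lemma linear_basis_sum:
  fixes f :: "'a::euclidean_space \<Rightarrow> 'b::real_vector"
  assumes "linear f"
  shows "f v = (\<Sum>b\<in>Basis. (v \<bullet> b) *\<^sub>R f b)"
proof -
  have "f v = f (\<Sum>b\<in>Basis. (v \<bullet> b) *\<^sub>R b)" by (simp add: euclidean_representation)
  also have "\<dots> = (\<Sum>b\<in>Basis. (v \<bullet> b) *\<^sub>R f b)"
    using assms by (simp add: linear_sum linear_scale)
  finally show ?thesis .
qed

text \<open>\<open>Ck_on\<close> speaks of derivatives in a fixed direction, whereas the chain rule
  differentiates \<open>g\<close> in the direction Df(x) v, which moves with \<open>x\<close>.
  Expanding that direction in \<open>Basis\<close> reduces to fixed ones.\<close>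

lemma Ck_on_compose:
  fixes f :: "'a::euclidean_space \<Rightarrow> 'b::euclidean_space" and g :: "'b \<Rightarrow> 'c::real_normed_vector"
  assumes "open S" "open T" "Ck_on k S f" "Ck_on k T g" "f ` S \<subseteq> T"
  shows "Ck_on k S (\<lambda>x. g (f x))"
  using assms(3-5)
proof (induction k arbitrary: f g)
  case 0
  then show ?case
    using continuous_on_compose2[of T g S f] by simp
next
  case (Suc k)
  let ?D = "\<lambda>f x. frechet_derivative f (at x)"
  have g: "(g has_derivative ?D g (f x)) (at (f x))" if "x \<in> S" for x
    using Ck_on_SucD[OF Suc.prems(2)] Suc.prems(3) that by blast
  show ?case
  proof (rule Ck_on_SucI[OF assms(1)])
    show "((\<lambda>x. g (f x)) has_derivative (\<lambda>v. ?D g (f x) (?D f x v))) (at x)" if "x \<in> S" for x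
      using has_derivative_compose[OF Ck_on_SucD[OF Suc.prems(1) that] g[OF that]] .
    fix v
    have "Ck_on k S (\<lambda>x. \<Sum>b\<in>Basis. (?D f x v \<bullet> b) *\<^sub>R ?D g (f x) b)"
      using Suc.prems Ck_on_Suc_imp[OF Suc.prems(1)]
      by (intro Ck_on_sum Ck_on_scaleR Ck_on_inner Ck_on_const Suc.IH assms(1)) auto
    then show "Ck_on k S (\<lambda>x. ?D g (f x) (?D f x v))"
      by (rule Ck_on_cong[OF assms(1), rotated])
        (simp add: linear_basis_sum[OF has_derivative_linear[OF g], of _ "?D f _ v"])
  qed
qed

lemma Ck_on_Pair:
  assumes "open S" "Ck_on k S f" "Ck_on k S g"
  shows "Ck_on k S (\<lambda>x. (f x, g x))"
  using assms(2,3)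
proof (induction k arbitrary: f g)
  case 0
  then show ?case by (simp add: continuous_on_Pair)
next
  case (Suc k)
  show ?case
    by (rule Ck_on_SucI[OF assms(1) has_derivative_Pair[OF Ck_on_SucD[OF Suc.prems(1)] Ck_on_SucD[OF Suc.prems(2)]]])
      (use Suc in auto)
qed

section \<open>Inverse, exponential, logarithm and square root\<close>

lemma Ck_on_real_SucI:
  fixes f :: "real \<Rightarrow> real"
  assumes "open S" "\<And>x. x \<in> S \<Longrightarrow> (f has_real_derivative f' x) (at x)" "Ck_on k S f'"
  shows "Ck_on (Suc k) S f"
  by (rule Ck_on_SucI[OF assms(1) assms(2)[unfolded has_field_derivative_def]])
    (auto intro!: Ck_on_mult Ck_on_const assms)

text \<open>The derivative is a polynomial in \<open>inverse\<close> itself, so the induction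
  hypothesis covers it. \<open>Ck_on_sqrt\<close> closes up the same way, with derivative 1/2 times
  \<open>inverse (sqrt x)\<close>.\<close>

lemma Ck_on_inverse: "Ck_on k (- {0::real}) inverse"
proof (induction k)
  case 0
  then show ?case by (auto intro!: continuous_intros)
next
  case (Suc k)
  have o: "open (- {0::real})" by auto
  show ?case
  proof (rule Ck_on_real_SucI[OF o])
    show "Ck_on k (- {0::real}) (\<lambda>x. - 1 * (inverse x * inverse x))"
      by (intro Ck_on_mult Suc Ck_on_const o)
  qed (auto intro!: derivative_eq_intros simp: power2_eq_square)
qed

lemma Ck_on_exp: "Ck_on k UNIV (exp :: real \<Rightarrow> real)"
  by (induction k) (auto intro!: continuous_intros Ck_on_real_SucI DERIV_exp simp del: Ck_on.simps(2))

lemma Ck_on_ln: "Ck_on k {0<..} (ln :: real \<Rightarrow> real)"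
proof (cases k)
  case 0
  then show ?thesis by (auto intro!: continuous_intros)
next
  case (Suc k)
  show ?thesis unfolding Suc
    by (rule Ck_on_real_SucI[where f' = inverse])
      (auto intro!: derivative_eq_intros Ck_on_subset[OF Ck_on_inverse] simp: inverse_eq_divide)
qed

lemma Ck_on_sqrt: "Ck_on k {0<..} sqrt"
proof (induction k)
  case 0
  then show ?case by (auto intro!: continuous_intros)
next
  case (Suc k)
  show ?case
  proof (rule Ck_on_real_SucI)
    show "Ck_on k {0<..} (\<lambda>x. 1/2 * inverse (sqrt x))"
      by (intro Ck_on_mult Ck_on_const Ck_on_compose[OF _ _ Suc Ck_on_inverse]) auto
  qed (auto intro!: derivative_eq_intros simp: inverse_eq_divide)
qed

section \<open>Flat functions, bump functions and smooth steps\<close>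

definition flat :: "nat \<Rightarrow> real \<Rightarrow> real" where
  "flat n x = (if x > 0 then exp (- inverse x) * inverse x ^ n else 0)"

text \<open>The extra factor \<open>inverse x ^ n\<close> in \<open>flat\<close> makes derivatives
  of members of the family linear combinations of members. \<open>flat 0\<close> is the classical
  function exp (-1/x), and smoothness at 0 is proved for all \<open>n\<close> at once.\<close>

lemma flat_deriv: "(flat n has_real_derivative (flat (n + 2) x - real n * flat (n + 1) x)) (at x)"
proof (cases x "0::real" rule: linorder_cases)
  case less
  have "((\<lambda>x. 0::real) has_real_derivative 0) (at x)" by simp
  then have "(flat n has_real_derivative 0) (at x)"
    by (rule has_field_derivative_transform_within_open[where S = "{..<0}"]) (use less in \<open>auto simp: flat_def\<close>)
  then show ?thesis using less by (simp add: flat_def)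
next
  case greater
  have i: "(inverse has_real_derivative - (inverse x * inverse x)) (at x)"
    using greater by (auto intro!: derivative_eq_intros)
  have e: "((\<lambda>x. exp (- inverse x)) has_real_derivative exp (- inverse x) * (inverse x * inverse x)) (at x)"
    using greater by (auto intro!: derivative_eq_intros)
  have p: "((\<lambda>x. inverse x ^ n) has_real_derivative - (real n * inverse x ^ (n + 1))) (at x)"
  proof (cases n)
    case (Suc m)
    show ?thesis unfolding Suc
      by (rule DERIV_cong[OF DERIV_power_Suc[OF i]]) (simp add: algebra_simps)
  qed simp
  have "((\<lambda>x. exp (- inverse x) * inverse x ^ n) has_real_derivative (flat (n + 2) x - real n * flat (n + 1) x)) (at x)"
    by (rule DERIV_cong[OF DERIV_mult[OF e p]]) (use greater in \<open>simp add: flat_def algebra_simps\<close>)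
  then show ?thesis
    by (rule has_field_derivative_transform_within_open[where S = "{0<..}"]) (use greater in \<open>auto simp: flat_def\<close>)
next
  case equal
  \<comment> \<open>For y > 0 the difference quotient of \<open>flat n\<close> at 0 is exp (-1/y)
    (1/y)^(n+1), which tends to 0 because z^(n+1) / exp z does at infinity.\<close>
  have lim: "((\<lambda>y. exp (- inverse y) * inverse y ^ Suc n) \<longlongrightarrow> (0::real)) (at_right 0)"
  proof -
    have "((\<lambda>z. z ^ Suc n / exp z) \<longlongrightarrow> (0::real)) at_top" by (rule tendsto_power_div_exp_0)
    then have "((\<lambda>y. inverse y ^ Suc n / exp (inverse y)) \<longlongrightarrow> (0::real)) (at_right 0)"
      by (rule filterlim_compose[OF _ filterlim_inverse_at_top_right])
    then show ?thesis by (simp only: exp_minus divide_inverse mult.commute)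
  qed
  have "((\<lambda>y. (flat n y - flat n 0) / (y - 0)) \<longlongrightarrow> 0) (at 0)"
  proof (rule filterlim_split_at)
    show "((\<lambda>y. (flat n y - flat n 0) / (y - 0)) \<longlongrightarrow> 0) (at_left 0)"
      by (rule tendsto_eventually) (auto simp: eventually_at_left_field flat_def intro!: exI[of _ "-1"])
    show "((\<lambda>y. (flat n y - flat n 0) / (y - 0)) \<longlongrightarrow> 0) (at_right 0)"
      by (rule Lim_transform_eventually[OF lim])
        (auto simp: eventually_at_right_field flat_def divide_inverse intro!: exI[of _ 1])
  qed
  then show ?thesis unfolding equal has_field_derivative_iff by (simp add: flat_def)
qed

lemma Ck_on_flat: "Ck_on k UNIV (flat n)"
proof (induction k arbitrary: n)
  case 0
  have "flat n differentiable at x" for x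
    using flat_deriv[of n x] unfolding has_field_derivative_def by (rule differentiableI)
  then show ?case
    by (auto intro!: differentiable_imp_continuous_on differentiable_at_imp_differentiable_on)
next
  case (Suc k)
  have "Ck_on k UNIV (\<lambda>x. flat (n + 2) x + (- real n) * flat (n + 1) x)"
    by (intro Ck_on_add Ck_on_mult Ck_on_const Suc) auto
  then show ?case
    by (intro Ck_on_real_SucI[OF _ flat_deriv]) auto
qed

text \<open>The squared distance is used because the norm is not smooth at the centre.\<close>

definition bump :: "real \<Rightarrow> 'a::euclidean_space \<Rightarrow> 'a \<Rightarrow> real" where
  "bump e z0 z = flat 0 (e\<^sup>2 - (z - z0) \<bullet> (z - z0)) / flat 0 (e\<^sup>2)"

lemma bump_center: "e > 0 \<Longrightarrow> bump e z0 z0 = 1"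
  by (simp add: bump_def flat_def)

lemma bump_eq_0: "e \<le> dist z z0 \<Longrightarrow> e > 0 \<Longrightarrow> bump e z0 z = 0"
  by (auto simp: bump_def flat_def dist_norm dot_square_norm not_less intro!: power_mono)

lemma Ck_on_bump: "Ck_on k UNIV (bump e z0)"
proof -
  have "Ck_on k UNIV (\<lambda>z. z - z0)"
    using Ck_on_add[OF _ Ck_on_bounded_linear[OF _ bounded_linear_ident] Ck_on_const[of _ _ "- z0"], of UNIV k] by simp
  then have "Ck_on k UNIV (\<lambda>z. e\<^sup>2 + (- 1) * ((z - z0) \<bullet> (z - z0)))"
    by (intro Ck_on_add Ck_on_mult Ck_on_const Ck_on_inner) auto
  then have "Ck_on k UNIV (\<lambda>z. e\<^sup>2 - (z - z0) \<bullet> (z - z0))" by simp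
  then have "Ck_on k UNIV (\<lambda>z. flat 0 (e\<^sup>2 - (z - z0) \<bullet> (z - z0)) * inverse (flat 0 (e\<^sup>2)))"
    by (intro Ck_on_mult Ck_on_const Ck_on_compose[OF _ _ _ Ck_on_flat]) auto
  then show ?thesis by (simp add: bump_def[abs_def] divide_inverse)
qed

text \<open>Meant for \<open>a < b\<close>: then at every \<open>s\<close> at least one of the two
  flat terms is positive, so the quotient is smooth.\<close>

definition smooth_step :: "real \<Rightarrow> real \<Rightarrow> real \<Rightarrow> real" where
  "smooth_step a b s = flat 0 (s - a) / (flat 0 (s - a) + flat 0 (b - s))"

lemma flat_nonneg: "flat 0 x \<ge> 0" and flat_pos: "x > 0 \<Longrightarrow> flat 0 x > 0" and flat_zero: "x \<le> 0 \<Longrightarrow> flat 0 x = 0"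
  by (simp_all add: flat_def)

lemma smooth_step_0: "s \<le> a \<Longrightarrow> smooth_step a b s = 0"
  by (simp add: smooth_step_def flat_zero)

lemma smooth_step_1: "a < b \<Longrightarrow> b \<le> s \<Longrightarrow> smooth_step a b s = 1"
  using flat_pos[of "s - a"] by (simp add: smooth_step_def flat_zero)

lemma Ck_on_smooth_step:
  assumes "a < b" shows "Ck_on k UNIV (smooth_step a b)"
proof -
  have l: "Ck_on k UNIV (\<lambda>s. s - a)" "Ck_on k UNIV (\<lambda>s. b - s)"
    using Ck_on_add[OF _ Ck_on_bounded_linear[OF _ bounded_linear_ident] Ck_on_const[of _ _ "- a"], of UNIV k]
      Ck_on_add[OF _ Ck_on_bounded_linear[OF _ bounded_linear_minus[OF bounded_linear_ident]] Ck_on_const[of _ _ "b"], of UNIV k]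
    by simp_all
  have f: "Ck_on k UNIV (\<lambda>s. flat 0 (s - a))" "Ck_on k UNIV (\<lambda>s. flat 0 (b - s))"
    by (intro Ck_on_compose[OF _ _ _ Ck_on_flat] l; simp)+
  have "flat 0 (s - a) + flat 0 (b - s) \<noteq> 0" for s
    using flat_nonneg[of "s - a"] flat_nonneg[of "b - s"] flat_pos[of "s - a"] flat_pos[of "b - s"] assms
    by (cases "s > a") linarith+
  then have "Ck_on k UNIV (\<lambda>s. inverse (flat 0 (s - a) + flat 0 (b - s)))"
    by (intro Ck_on_compose[OF _ _ _ Ck_on_inverse] Ck_on_add f) auto
  then have "Ck_on k UNIV (\<lambda>s. flat 0 (s - a) * inverse (flat 0 (s - a) + flat 0 (b - s)))"
    by (intro Ck_on_mult f) auto
  then show ?thesis by (simp add: smooth_step_def[abs_def] divide_inverse)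
qed

section \<open>Integration along segments and Hadamard's lemma\<close>

lemma segment_in_ball:
  fixes z z0 :: "'a::real_normed_vector"
  assumes "z \<in> ball z0 e" "0 \<le> t" "t \<le> 1"
  shows "z0 + t *\<^sub>R (z - z0) \<in> ball z0 e"
proof -
  have "norm (t *\<^sub>R (z - z0)) \<le> norm (z - z0)" using assms by (simp add: mult_left_le_one_le)
  then show ?thesis using assms(1) by (simp add: dist_norm norm_minus_commute)
qed

text \<open>Differentiating under the integral in direction \<open>v\<close> replaces
  \<open>f\<close> by its derivative along \<open>v\<close> and produces a factor \<open>t\<close>
  from the chain rule. The arbitrary weight \<open>h\<close> absorbs that factor, so the induction
  hypothesis applies with weight \<open>h t * t\<close>.\<close>

lemma Ck_on_segment_integral:
  fixes f :: "'a::euclidean_space \<Rightarrow> real" and h :: "real \<Rightarrow> real"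
  assumes "continuous_on {0..1} h" "Ck_on k (ball z0 e) f"
  shows "Ck_on k (ball z0 e) (\<lambda>z. integral {0..1} (\<lambda>t. h t * f (z0 + t *\<^sub>R (z - z0))))"
  using assms
proof (induction k arbitrary: f h)
  case 0
  have "continuous_on (ball z0 e \<times> cbox 0 1) (\<lambda>(z, t). h t * f (z0 + t *\<^sub>R (z - z0)))"
    unfolding case_prod_beta
    by (intro continuous_intros continuous_on_compose2[OF 0(1)] continuous_on_compose2[OF 0(2)[unfolded Ck_on.simps]])
      (use segment_in_ball in auto)
  from integral_continuous_on_param[OF this] show ?case by simp
next
  case (Suc k)
  let ?D = "\<lambda>z. frechet_derivative f (at z)"
  let ?B = "ball z0 e"
  have D: "(f has_derivative ?D z) (at z)" if "z \<in> ?B" for z using Ck_on_SucD[OF Suc.prems(2) that] .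
  have cont_f: "continuous_on ?B f" using Ck_on_imp_continuous[OF Suc.prems(2)] .
  have cont_D: "continuous_on ?B (\<lambda>z. ?D z v)" for v
    using Suc.prems(2) by (intro Ck_on_imp_continuous) auto
  \<comment> \<open>\<open>leibniz_rule\<close> asks for a derivative that is jointly continuous
    with values in the bounded linear maps. Written as a combination of the fixed maps
    \<open>blinfun_inner_left b\<close>, it leaves only scalar coefficients to be
    continuous.\<close>
  let ?G = "\<lambda>z t. \<Sum>b\<in>Basis. (h t * t * ?D (z0 + t *\<^sub>R (z - z0)) b) *\<^sub>R blinfun_inner_left b"
  have G: "blinfun_apply (?G z t) v = h t * t * ?D (z0 + t *\<^sub>R (z - z0)) v" if "z \<in> ?B" "0 \<le> t" "t \<le> 1" for z t v
  proof -
    have "?D (z0 + t *\<^sub>R (z - z0)) v = (\<Sum>b\<in>Basis. (v \<bullet> b) * ?D (z0 + t *\<^sub>R (z - z0)) b)"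
      using linear_basis_sum[OF has_derivative_linear[OF D[OF segment_in_ball[OF that]]], of v] by (simp only: real_scaleR_def)
    then have "h t * t * ?D (z0 + t *\<^sub>R (z - z0)) v = (\<Sum>b\<in>Basis. (h t * t * ?D (z0 + t *\<^sub>R (z - z0)) b) * (v \<bullet> b))"
      by (simp only: sum_distrib_left mult_ac)
    then show ?thesis by (simp add: blinfun.sum_left blinfun.scaleR_left blinfun_inner_left.rep_eq inner_commute)
  qed
  have cD: "continuous_on (?B \<times> cbox 0 (1::real)) (\<lambda>(z, t). ?G z t)"
    unfolding case_prod_beta
    by (intro continuous_intros continuous_on_compose2[OF Suc.prems(1)] continuous_on_compose2[OF cont_D])
      (use segment_in_ball in auto)
  have der: "((\<lambda>z. integral (cbox 0 1) (\<lambda>t. h t * f (z0 + t *\<^sub>R (z - z0)))) has_derivative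
      blinfun_apply (integral (cbox 0 1) (?G z))) (at z within ?B)" if z: "z \<in> ?B" for z
  proof (rule leibniz_rule[OF _ _ cD z convex_ball])
    fix y t assume y: "y \<in> ?B" and t: "t \<in> cbox (0::real) 1"
    have "((\<lambda>z. f (z0 + t *\<^sub>R (z - z0))) has_derivative (\<lambda>v. ?D (z0 + t *\<^sub>R (y - z0)) (t *\<^sub>R v))) (at y)"
      using t by (intro has_derivative_compose[OF _ D] segment_in_ball y) (auto intro!: derivative_eq_intros)
    then have "((\<lambda>z. h t * f (z0 + t *\<^sub>R (z - z0))) has_derivative (\<lambda>v. h t * ?D (z0 + t *\<^sub>R (y - z0)) (t *\<^sub>R v))) (at y)"
      by (rule has_derivative_mult_right)
    moreover have "(\<lambda>v. h t * ?D (z0 + t *\<^sub>R (y - z0)) (t *\<^sub>R v)) = blinfun_apply (?G y t)"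
      using t G[OF y] linear_scale[OF has_derivative_linear[OF D[OF segment_in_ball[OF y]]]]
      by (auto simp: fun_eq_iff)
    ultimately show "((\<lambda>z. h t * f (z0 + t *\<^sub>R (z - z0))) has_derivative blinfun_apply (?G y t)) (at y within ?B)"
      by (metis has_derivative_at_withinI)
  next
    fix y assume "y \<in> ?B"
    then show "(\<lambda>t. h t * f (z0 + t *\<^sub>R (y - z0))) integrable_on cbox 0 1"
      by (intro integrable_continuous continuous_intros continuous_on_compose2[OF Suc.prems(1)]
          continuous_on_compose2[OF cont_f]) (use segment_in_ball in auto)
  qed
  have int: "blinfun_apply (integral {0..1} (?G z)) v = integral {0..1} (\<lambda>t. (h t * t) * ?D (z0 + t *\<^sub>R (z - z0)) v)"
    if z: "z \<in> ?B" for z v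
  proof -
    have "?G z integrable_on {0..1}"
    proof (rule integrable_continuous_real)
      have "continuous_on {0..1} (\<lambda>t. (\<lambda>(z, t). ?G z t) (z, t))"
        by (rule continuous_on_compose2[OF cD]) (use z in \<open>auto intro!: continuous_intros\<close>)
      then show "continuous_on {0..1} (?G z)" by simp
    qed
    then have "blinfun_apply (integral {0..1} (?G z)) v = integral {0..1} (\<lambda>t. blinfun_apply (?G z t) v)"
      by (rule blinfun_apply_integral)
    also have "\<dots> = integral {0..1} (\<lambda>t. (h t * t) * ?D (z0 + t *\<^sub>R (z - z0)) v)"
      by (intro integral_cong) (use G[OF z] in auto)
    finally show ?thesis .
  qed
  show ?case
  proof (rule Ck_on_SucI[OF open_ball])
    show "((\<lambda>z. integral {0..1} (\<lambda>t. h t * f (z0 + t *\<^sub>R (z - z0)))) has_derivative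
      blinfun_apply (integral {0..1} (?G z))) (at z)" if "z \<in> ?B" for z
      using der[OF that] at_within_open[OF that open_ball] by simp
    fix v
    have "Ck_on k ?B (\<lambda>z. integral {0..1} (\<lambda>t. (h t * t) * ?D (z0 + t *\<^sub>R (z - z0)) v))"
      using Suc.prems by (intro Suc.IH) (auto intro!: continuous_intros)
    then show "Ck_on k ?B (\<lambda>z. blinfun_apply (integral {0..1} (?G z)) v)"
      by (rule Ck_on_cong[OF open_ball, rotated]) (use int in auto)
  qed
qed

text \<open>Fundamental theorem of calculus for \<open>f\<close> along the segment from
  \<open>z0\<close> to \<open>z\<close>: \<open>G i\<close> is the mean over the segment of the
  partial derivative in direction \<open>i\<close>.\<close>

lemma Hadamard:
  fixes f :: "'a::euclidean_space \<Rightarrow> real"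
  assumes "Cinf_on (ball z0 e) f"
  obtains G where "\<And>i. i \<in> Basis \<Longrightarrow> Cinf_on (ball z0 e) (G i)"
    "\<And>z. z \<in> ball z0 e \<Longrightarrow> f z = f z0 + (\<Sum>i\<in>Basis. ((z - z0) \<bullet> i) * G i z)"
proof
  let ?D = "\<lambda>z. frechet_derivative f (at z)"
  let ?B = "ball z0 e"
  \<comment> \<open>The factor 1 is the constant weight that \<open>Ck_on_segment_integral\<close>
    expects.\<close>
  define G where "G i z = integral {0..1} (\<lambda>t. 1 * ?D (z0 + t *\<^sub>R (z - z0)) i)" for i z
  have Ck_D: "Cinf_on ?B (\<lambda>z. ?D z i)" for i
    using assms Ck_on.simps(2) by blast
  show "Cinf_on ?B (G i)" for i
    unfolding G_def by (intro allI Ck_on_segment_integral continuous_on_const Ck_D[rule_format])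
  fix z assume z: "z \<in> ?B"
  have D: "(f has_derivative ?D z) (at z)" if "z \<in> ?B" for z
    using assms Ck_on_SucD that by blast
  have "((\<lambda>t. ?D (z0 + t *\<^sub>R (z - z0)) (z - z0)) has_integral
      f (z0 + 1 *\<^sub>R (z - z0)) - f (z0 + 0 *\<^sub>R (z - z0))) {0..1}"
  proof (rule fundamental_theorem_of_calculus)
    fix t :: real assume t: "t \<in> {0..1}"
    have "((\<lambda>t. f (z0 + t *\<^sub>R (z - z0))) has_derivative (\<lambda>s. ?D (z0 + t *\<^sub>R (z - z0)) (s *\<^sub>R (z - z0)))) (at t)"
      using t by (intro has_derivative_compose[OF _ D] segment_in_ball z) (auto intro!: derivative_eq_intros)
    then show "((\<lambda>t. f (z0 + t *\<^sub>R (z - z0))) has_vector_derivative ?D (z0 + t *\<^sub>R (z - z0)) (z - z0)) (at t within {0..1})"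
      using t linear_scale[OF has_derivative_linear[OF D[OF segment_in_ball[OF z]]]]
      by (auto simp: has_vector_derivative_def intro!: has_derivative_at_withinI)
  qed simp
  then have "f z - f z0 = integral {0..1} (\<lambda>t. ?D (z0 + t *\<^sub>R (z - z0)) (z - z0))"
    by (simp add: integral_unique)
  also have "\<dots> = integral {0..1} (\<lambda>t. \<Sum>i\<in>Basis. ((z - z0) \<bullet> i) * ?D (z0 + t *\<^sub>R (z - z0)) i)"
    using linear_basis_sum[OF has_derivative_linear[OF D[OF segment_in_ball[OF z]]], of _ "z - z0"]
    by (intro integral_cong) (simp only: atLeastAtMost_iff real_scaleR_def)
  also have "\<dots> = (\<Sum>i\<in>Basis. integral {0..1} (\<lambda>t. ((z - z0) \<bullet> i) * ?D (z0 + t *\<^sub>R (z - z0)) i))"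
  proof (rule integral_sum)
    fix i :: 'a
    have "continuous_on ?B (\<lambda>z. ?D z i)" using Ck_D Ck_on_imp_continuous by blast
    then have "continuous_on {0..1} (\<lambda>t. ?D (z0 + t *\<^sub>R (z - z0)) i)"
      by (rule continuous_on_compose2) (use segment_in_ball[OF z] in \<open>auto intro!: continuous_intros\<close>)
    then show "(\<lambda>t. ((z - z0) \<bullet> i) * ?D (z0 + t *\<^sub>R (z - z0)) i) integrable_on {0..1}"
      by (intro integrable_continuous_real continuous_on_mult continuous_on_const)
  qed simp
  finally show "f z = f z0 + (\<Sum>i\<in>Basis. ((z - z0) \<bullet> i) * G i z)" by (simp add: G_def)
qed


section \<open>Smoothness in charts\<close>

text \<open>Chart images are open only in a subspace of \<open>'e\<close>, so the coordinate
  expression has to extend to an open set \<open>W\<close> of the whole Euclidean space. The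
  agreement runs over \<open>U\<close> itself and thus involves no inverse chart.\<close>

definition smooth_in ::
  "'m set \<Rightarrow> ('m \<Rightarrow> 'e::euclidean_space) \<Rightarrow> ('m \<Rightarrow> 'v::real_normed_vector) \<Rightarrow> 'm \<Rightarrow> bool" where
  "smooth_in U \<phi> f x \<longleftrightarrow>
     (\<exists>W F. open W \<and> \<phi> x \<in> W \<and> Cinf_on W F \<and> (\<forall>y\<in>U. \<phi> y \<in> W \<longrightarrow> f y = F (\<phi> y)))"

lemma smooth_inI:
  "open W \<Longrightarrow> \<phi> x \<in> W \<Longrightarrow> Cinf_on W F \<Longrightarrow> (\<And>y. y \<in> U \<Longrightarrow> \<phi> y \<in> W \<Longrightarrow> f y = F (\<phi> y)) \<Longrightarrow> smooth_in U \<phi> f x"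
  unfolding smooth_in_def by blast

lemma smooth_inE:
  assumes "smooth_in U \<phi> f x"
  obtains W F where "open W" "\<phi> x \<in> W" "Cinf_on W F" "\<And>y. y \<in> U \<Longrightarrow> \<phi> y \<in> W \<Longrightarrow> f y = F (\<phi> y)"
  using assms unfolding smooth_in_def by blast

lemma smooth_on_chart:
  assumes "inj_on \<phi> U" "A \<subseteq> U"
  shows "smooth_on (\<phi> ` A) (f \<circ> inv_into U \<phi>) \<longleftrightarrow> (\<forall>x\<in>A. smooth_in A \<phi> f x)"
proof -
  have inv: "inv_into U \<phi> (\<phi> y) = y" if "y \<in> A" for y using that assms by (simp add: subset_iff)
  have "(\<forall>y\<in>W \<inter> \<phi> ` A. F y = (f \<circ> inv_into U \<phi>) y) \<longleftrightarrow> (\<forall>y\<in>A. \<phi> y \<in> W \<longrightarrow> f y = F (\<phi> y))" for W F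
    using inv by force
  then show ?thesis unfolding smooth_on_def smooth_in_def by simp
qed

lemma smooth_on_chartD:
  "smooth_on (\<phi> ` A) (f \<circ> inv_into U \<phi>) \<Longrightarrow> inj_on \<phi> U \<Longrightarrow> A \<subseteq> U \<Longrightarrow> x \<in> A \<Longrightarrow> smooth_in A \<phi> f x"
  using smooth_on_chart by blast

lemma smooth_in_subset: "smooth_in U \<phi> f x \<Longrightarrow> A \<subseteq> U \<Longrightarrow> smooth_in A \<phi> f x"
  unfolding smooth_in_def by blast

lemma smooth_in_chart: "smooth_in U \<phi> \<phi> x"
  by (rule smooth_inI[where W = UNIV and F = "\<lambda>x. x"]) (auto intro: Ck_on_bounded_linear bounded_linear_ident)

lemma smooth_in_const: "smooth_in U \<phi> (\<lambda>_. c) x"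
  by (rule smooth_inI[where W = UNIV and F = "\<lambda>_. c"]) (auto intro: Ck_on_const)

text \<open>The extension \<open>F\<close> is tied to \<open>f\<close> only over the image of the
  chart; off it \<open>F\<close> may leave \<open>T\<close>. Shrinking \<open>W\<close> prevents
  that, as needed before composing with a map defined on \<open>T\<close>.\<close>

lemma smooth_in_open_vimage:
  fixes f :: "'m \<Rightarrow> 'v::real_normed_vector"
  assumes "smooth_in U \<phi> f x" "open T" "f x \<in> T" "x \<in> U"
  obtains W F where "open W" "\<phi> x \<in> W" "Cinf_on W F" "F ` W \<subseteq> T" "\<And>y. y \<in> U \<Longrightarrow> \<phi> y \<in> W \<Longrightarrow> f y = F (\<phi> y)"
proof -
  obtain W F where W: "open W" "\<phi> x \<in> W" "Cinf_on W F" "\<And>y. y \<in> U \<Longrightarrow> \<phi> y \<in> W \<Longrightarrow> f y = F (\<phi> y)"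
    using smooth_inE[OF assms(1)] by metis
  have "continuous_on W F" using W(3) Ck_on_imp_continuous by blast
  then have o: "open (W \<inter> F -` T)" using assms(2) W(1) continuous_on_open_vimage by (metis Int_commute)
  show thesis
  proof (rule that[of "W \<inter> F -` T" F])
    show "\<phi> x \<in> W \<inter> F -` T" using W assms by fastforce
    show "Cinf_on (W \<inter> F -` T) F" using W(3) Ck_on_subset[of _ W F "W \<inter> F -` T"] by simp
  qed (use o W in auto)
qed

lemma Cinf_on_compose:
  fixes f :: "'a::euclidean_space \<Rightarrow> 'b::euclidean_space" and g :: "'b \<Rightarrow> 'c::real_normed_vector"
  assumes "open S" "open T" "Cinf_on S f" "Cinf_on T g" "f ` S \<subseteq> T"
  shows "Cinf_on S (\<lambda>x. g (f x))"
proof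
  show "Ck_on k S (\<lambda>x. g (f x))" for k
    by (rule Ck_on_compose[OF assms(1,2) assms(3)[rule_format] assms(4)[rule_format] assms(5)])
qed

lemma smooth_in_compose:
  fixes g :: "'m \<Rightarrow> 'v::euclidean_space"
  assumes "smooth_in U \<phi> g x" "open T" "g x \<in> T" "Cinf_on T h" "x \<in> U"
    and "\<And>y. y \<in> U \<Longrightarrow> g y \<in> T \<Longrightarrow> f y = h (g y)"
  shows "smooth_in U \<phi> f x"
proof -
  obtain W F where W: "open W" "\<phi> x \<in> W" "Cinf_on W F" "F ` W \<subseteq> T" "\<And>y. y \<in> U \<Longrightarrow> \<phi> y \<in> W \<Longrightarrow> g y = F (\<phi> y)"
    using smooth_in_open_vimage[OF assms(1-3,5)] by metis
  show ?thesis
  proof (rule smooth_inI[where W = W and F = "\<lambda>z. h (F z)"])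
    show "Cinf_on W (\<lambda>z. h (F z))"
      by (rule Cinf_on_compose[OF W(1) assms(2) W(3) assms(4) W(4)])
    show "f y = h (F (\<phi> y))" if "y \<in> U" "\<phi> y \<in> W" for y
    proof -
      have "g y \<in> T" using W(4) W(5)[OF that] that(2) by auto
      then show ?thesis using assms(6)[OF that(1)] W(5)[OF that] by simp
    qed
  qed (use W in simp_all)
qed

lemma smooth_in_Pair:
  assumes "smooth_in U \<phi> f x" "smooth_in U \<phi> g x"
  shows "smooth_in U \<phi> (\<lambda>y. (f y, g y)) x"
proof -
  obtain W F where W: "open W" "\<phi> x \<in> W" "Cinf_on W F" "\<And>y. y \<in> U \<Longrightarrow> \<phi> y \<in> W \<Longrightarrow> f y = F (\<phi> y)"
    using smooth_inE[OF assms(1)] by metis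
  obtain W' G where W': "open W'" "\<phi> x \<in> W'" "Cinf_on W' G" "\<And>y. y \<in> U \<Longrightarrow> \<phi> y \<in> W' \<Longrightarrow> g y = G (\<phi> y)"
    using smooth_inE[OF assms(2)] by metis
  show ?thesis
  proof (rule smooth_inI[of "W \<inter> W'" _ _ "\<lambda>z. (F z, G z)"])
    show "Cinf_on (W \<inter> W') (\<lambda>z. (F z, G z))"
      using W(1,3) W'(1,3) Ck_on_subset[of _ W F "W \<inter> W'"] Ck_on_subset[of _ W' G "W \<inter> W'"]
      by (intro allI Ck_on_Pair) auto
  qed (use W W' in auto)
qed

lemma smooth_in_local:
  assumes "smooth_in (U \<inter> A) \<phi> f x" "open T" "\<phi> x \<in> T" "\<And>y. y \<in> U \<Longrightarrow> \<phi> y \<in> T \<Longrightarrow> y \<in> A \<and> f' y = f y"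
  shows "smooth_in U \<phi> f' x"
proof -
  obtain W F where W: "open W" "\<phi> x \<in> W" "Cinf_on W F" "\<And>y. y \<in> U \<inter> A \<Longrightarrow> \<phi> y \<in> W \<Longrightarrow> f y = F (\<phi> y)"
    using smooth_inE[OF assms(1)] by metis
  show ?thesis
  proof (rule smooth_inI[of "W \<inter> T" _ _ F])
    show "Cinf_on (W \<inter> T) F" using W(3) Ck_on_subset[of _ W F "W \<inter> T"] by simp
  qed (use W assms in auto)
qed

lemma openin_image_iff:
  assumes "inj_on \<phi> U" "A \<subseteq> U"
  shows "openin (top_of_set (\<phi> ` U)) (\<phi> ` A) \<longleftrightarrow> (\<exists>T. open T \<and> A = U \<inter> \<phi> -` T)"
proof
  assume "openin (top_of_set (\<phi> ` U)) (\<phi> ` A)"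
  then obtain T where T: "open T" "\<phi> ` A = \<phi> ` U \<inter> T" by (auto simp: openin_open)
  have "A = U \<inter> \<phi> -` T"
  proof
    show "A \<subseteq> U \<inter> \<phi> -` T" using T assms by blast
    show "U \<inter> \<phi> -` T \<subseteq> A"
    proof
      fix y assume y: "y \<in> U \<inter> \<phi> -` T"
      then have "\<phi> y \<in> \<phi> ` A" using T by blast
      then show "y \<in> A" using y assms by (auto dest: inj_onD)
    qed
  qed
  with T show "\<exists>T. open T \<and> A = U \<inter> \<phi> -` T" by blast
next
  assume "\<exists>T. open T \<and> A = U \<inter> \<phi> -` T"
  then obtain T where "open T" "A = U \<inter> \<phi> -` T" by blast
  then have "\<phi> ` A = \<phi> ` U \<inter> T" by auto
  with \<open>open T\<close> show "openin (top_of_set (\<phi> ` U)) (\<phi> ` A)" by (auto simp: openin_open)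
qed

section \<open>Atlases\<close>

lemma smooth_atlasD:
  assumes M: "smooth_atlas M" and U: "(U, \<phi>) \<in> M"
  shows "inj_on \<phi> U" "\<exists>V. subspace V \<and> openin (top_of_set V) (\<phi> ` U)"
    "\<And>U' \<phi>'. (U', \<phi>') \<in> M \<Longrightarrow> \<exists>T. open T \<and> U \<inter> U' = U \<inter> \<phi> -` T"
    "\<And>U' \<phi>' x. (U', \<phi>') \<in> M \<Longrightarrow> x \<in> U \<inter> U' \<Longrightarrow> smooth_in (U \<inter> U') \<phi> \<phi>' x"
proof -
  note D = M[unfolded smooth_atlas_def]
  show inj: "inj_on \<phi> U" and "\<exists>V. subspace V \<and> openin (top_of_set V) (\<phi> ` U)"
    using D[THEN conjunct1, THEN bspec, OF U] by simp_all
  fix U' \<phi>' assume U': "(U', \<phi>') \<in> M"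
  have *: "openin (top_of_set (\<phi> ` U)) (\<phi> ` (U \<inter> U'))" "smooth_on (\<phi> ` (U \<inter> U')) (\<phi>' \<circ> inv_into U \<phi>)"
    using D[THEN conjunct2, THEN bspec, OF U, unfolded prod.case, THEN bspec, OF U'] by simp_all
  show "\<exists>T. open T \<and> U \<inter> U' = U \<inter> \<phi> -` T"
    using * openin_image_iff[OF inj Int_lower1] by simp
  show "smooth_in (U \<inter> U') \<phi> \<phi>' x" if "x \<in> U \<inter> U'" for x
    using *(2) that smooth_on_chart[OF inj Int_lower1, of U' \<phi>'] by blast
qed

lemma smooth_atlasI:
  assumes inj: "\<And>U \<phi>. (U, \<phi>) \<in> M \<Longrightarrow> inj_on \<phi> U"
    and V: "\<And>U \<phi>. (U, \<phi>) \<in> M \<Longrightarrow> \<exists>V. subspace V \<and> openin (top_of_set V) (\<phi> ` U)"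
    and "\<And>U \<phi> U' \<phi>'. (U, \<phi>) \<in> M \<Longrightarrow> (U', \<phi>') \<in> M \<Longrightarrow> \<exists>T. open T \<and> U \<inter> U' = U \<inter> \<phi> -` T"
    and "\<And>U \<phi> U' \<phi>' x. (U, \<phi>) \<in> M \<Longrightarrow> (U', \<phi>') \<in> M \<Longrightarrow> x \<in> U \<inter> U' \<Longrightarrow> smooth_in (U \<inter> U') \<phi> \<phi>' x"
  shows "smooth_atlas M"
proof -
  have "openin (top_of_set (\<phi> ` U)) (\<phi> ` (U \<inter> U')) \<and> smooth_on (\<phi> ` (U \<inter> U')) (\<phi>' \<circ> inv_into U \<phi>)"
    if U: "(U, \<phi>) \<in> M" "(U', \<phi>') \<in> M" for U U' \<phi> \<phi>'
    using assms(3,4)[OF U] openin_image_iff[OF inj[OF U(1)] Int_lower1, of U'] smooth_on_chart[OF inj[OF U(1)] Int_lower1, of U' \<phi>']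
    by blast
  note * = this
  show ?thesis unfolding smooth_atlas_def
  proof (intro conjI ballI, goal_cases)
    case (1 c)
    then show ?case using inj V by (cases c) simp
  next
    case (2 c)
    then show ?case using * by (cases c) auto
  qed
qed

lemma chart_trans:
  assumes M: "smooth_atlas M" "(U, \<phi>) \<in> M" "(U', \<phi>') \<in> M" "x \<in> U \<inter> U'"
  shows "smooth_in U \<phi> \<phi>' x"
proof -
  obtain T where "open T" "U \<inter> U' = U \<inter> \<phi> -` T" using smooth_atlasD(3)[OF M(1,2,3)] by blast
  then show ?thesis using M
    by (intro smooth_in_local[OF smooth_atlasD(4)[OF M(1,2,3,4)], of T]) auto
qed

lemma chart_change:
  assumes M: "smooth_atlas M" "(U, \<phi>) \<in> M" "(U', \<phi>') \<in> M" "x \<in> U \<inter> U'"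
    and f: "smooth_in U \<phi> f x"
  shows "smooth_in U' \<phi>' f x"
proof -
  obtain W F where W: "open W" "\<phi> x \<in> W" "Cinf_on W F" "\<And>y. y \<in> U \<Longrightarrow> \<phi> y \<in> W \<Longrightarrow> f y = F (\<phi> y)"
    using smooth_inE[OF f] by metis
  obtain T where T: "open T" "U' \<inter> U = U' \<inter> \<phi>' -` T" using smooth_atlasD(3)[OF M(1,3,2)] by blast
  have x: "x \<in> U' \<inter> U" using M(4) by blast
  have "smooth_in (U' \<inter> U) \<phi>' f x"
    by (rule smooth_in_compose[OF smooth_atlasD(4)[OF M(1,3,2) x] W(1,2,3) x]) (use W(4) in auto)
  then show ?thesis
    by (rule smooth_in_local[OF _ T(1)]) (use T x in auto)
qed

text \<open>One chart is enough: \<open>smooth_nearD\<close> passes to any other by the transition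
  maps. The value type is left general so that charts and real functions share one calculus.\<close>

definition smooth_near ::
  "('m, 'e::euclidean_space) atlas \<Rightarrow> ('m \<Rightarrow> 'v::real_normed_vector) \<Rightarrow> 'm \<Rightarrow> bool" where
  "smooth_near M f x \<longleftrightarrow> (\<exists>(U, \<phi>)\<in>M. x \<in> U \<and> smooth_in U \<phi> f x)"

lemma smooth_nearI: "(U, \<phi>) \<in> M \<Longrightarrow> x \<in> U \<Longrightarrow> smooth_in U \<phi> f x \<Longrightarrow> smooth_near M f x"
  unfolding smooth_near_def by blast

lemma smooth_nearD:
  assumes "smooth_atlas M" "smooth_near M f x" "(U, \<phi>) \<in> M" "x \<in> U"
  shows "smooth_in U \<phi> f x"
  using assms chart_change[OF assms(1) _ assms(3)] unfolding smooth_near_def by blast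

lemma carrierI: "(U, \<phi>) \<in> M \<Longrightarrow> x \<in> U \<Longrightarrow> x \<in> carrier M"
  unfolding carrier_def by force

lemma carrierE:
  assumes "x \<in> carrier M" obtains U \<phi> where "(U, \<phi>) \<in> M" "x \<in> U"
  using assms unfolding carrier_def by force

lemma smooth_near_carrier: "smooth_near M f x \<Longrightarrow> x \<in> carrier M"
  unfolding smooth_near_def by (auto intro: carrierI)

lemma smooth_fun_iff:
  assumes "smooth_atlas M"
  shows "smooth_fun M f \<longleftrightarrow> (\<forall>x\<in>carrier M. smooth_near M f x)"
proof -
  have "smooth_fun M f \<longleftrightarrow> (\<forall>(U, \<phi>)\<in>M. \<forall>x\<in>U. smooth_in U \<phi> f x)"
    unfolding smooth_fun_def
  proof (intro ball_cong refl, goal_cases)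
    case (1 c)
    then show ?case using smooth_on_chart[OF smooth_atlasD(1)[OF assms], of _ _ _ f] by (cases c) simp
  qed
  also have "\<dots> \<longleftrightarrow> (\<forall>x\<in>carrier M. smooth_near M f x)"
    using smooth_nearD[OF assms] by (blast elim: carrierE intro: smooth_nearI carrierI)
  finally show ?thesis .
qed

lemma smooth_near_const: "x \<in> carrier M \<Longrightarrow> smooth_near M (\<lambda>_. c) x"
  by (erule carrierE) (blast intro: smooth_nearI smooth_in_const)

lemma smooth_near_compose:
  fixes g :: "'m \<Rightarrow> 'v::euclidean_space"
  assumes "smooth_near M g x" "open T" "g x \<in> T" "Cinf_on T h" "\<And>y. y \<in> carrier M \<Longrightarrow> g y \<in> T \<Longrightarrow> f y = h (g y)"
  shows "smooth_near M f x"
proof -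
  obtain U \<phi> where U: "(U, \<phi>) \<in> M" "x \<in> U" "smooth_in U \<phi> g x" using assms(1) unfolding smooth_near_def by blast
  show ?thesis
    using smooth_in_compose[OF U(3) assms(2-4) U(2)] assms(5) U(1,2) by (blast intro: smooth_nearI carrierI)
qed

lemma smooth_near_Pair:
  assumes "smooth_atlas M" "smooth_near M f x" "smooth_near M g x"
  shows "smooth_near M (\<lambda>y. (f y, g y)) x"
proof -
  obtain U \<phi> where U: "(U, \<phi>) \<in> M" "x \<in> U" "smooth_in U \<phi> f x" using assms(2) unfolding smooth_near_def by blast
  show ?thesis using smooth_in_Pair[OF U(3) smooth_nearD[OF assms(1,3) U(1,2)]] U by (blast intro: smooth_nearI)
qed

lemma smooth_near_bilinear:
  fixes f :: "'m \<Rightarrow> 'v::euclidean_space" and g :: "'m \<Rightarrow> 'w::euclidean_space"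
  assumes "smooth_atlas M" "bounded_bilinear B" "smooth_near M f x" "smooth_near M g x"
  shows "smooth_near M (\<lambda>y. B (f y) (g y)) x"
proof (rule smooth_near_compose[OF smooth_near_Pair[OF assms(1,3,4)] open_UNIV UNIV_I])
  show "Cinf_on UNIV (\<lambda>p. B (fst p) (snd p))"
    by (rule allI, rule Ck_on_bilinear[OF open_UNIV assms(2)];
      rule Ck_on_bounded_linear[OF open_UNIV]; rule bounded_linear_fst bounded_linear_snd)
qed simp

lemma smooth_near_linear:
  fixes f :: "'m \<Rightarrow> 'v::euclidean_space"
  assumes "bounded_linear B" "smooth_near M f x"
  shows "smooth_near M (\<lambda>y. B (f y)) x"
  by (rule smooth_near_compose[OF assms(2) open_UNIV UNIV_I]) (auto intro: Ck_on_bounded_linear assms)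

lemma smooth_near_add:
  fixes f g :: "'m \<Rightarrow> 'v::euclidean_space"
  assumes "smooth_atlas M" "smooth_near M f x" "smooth_near M g x"
  shows "smooth_near M (\<lambda>y. f y + g y) x"
  using smooth_near_linear[OF bounded_linear_add[OF bounded_linear_fst bounded_linear_snd] smooth_near_Pair[OF assms]]
  by simp

lemmas smooth_near_scaleR = smooth_near_bilinear[OF _ bounded_bilinear_scaleR]
lemmas smooth_near_mult = smooth_near_bilinear[OF _ bounded_bilinear_mult[where 'a = real]]
lemmas smooth_near_inner = smooth_near_bilinear[OF _ bounded_bilinear_inner]

lemma smooth_near_diff:
  fixes f g :: "'m \<Rightarrow> 'v::euclidean_space"
  assumes "smooth_atlas M" "smooth_near M f x" "smooth_near M g x"
  shows "smooth_near M (\<lambda>y. f y - g y) x"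
  using smooth_near_linear[OF bounded_linear_sub[OF bounded_linear_fst bounded_linear_snd] smooth_near_Pair[OF assms]]
  by simp

lemma smooth_near_sum:
  fixes f :: "'i \<Rightarrow> 'm \<Rightarrow> 'v::euclidean_space"
  assumes "smooth_atlas M" "x \<in> carrier M" "\<And>i. i \<in> I \<Longrightarrow> smooth_near M (f i) x"
  shows "smooth_near M (\<lambda>y. \<Sum>i\<in>I. f i y) x"
  using assms(3)
  by (induction I rule: infinite_finite_induct) (simp_all add: smooth_near_const assms smooth_near_add)

lemma smooth_near_inverse:
  fixes f :: "'m \<Rightarrow> real"
  assumes "smooth_near M f x" "f x \<noteq> 0"
  shows "smooth_near M (\<lambda>y. inverse (f y)) x"
  by (rule smooth_near_compose[OF assms(1), of "- {0}" inverse]) (use assms in \<open>auto intro: Ck_on_inverse\<close>)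

lemma smooth_near_divide:
  fixes f g :: "'m \<Rightarrow> real"
  assumes "smooth_atlas M" "smooth_near M f x" "smooth_near M g x" "g x \<noteq> 0"
  shows "smooth_near M (\<lambda>y. f y / g y) x"
  unfolding divide_inverse by (intro smooth_near_mult smooth_near_inverse assms)

lemma smooth_near_sqrt:
  fixes f :: "'m \<Rightarrow> real"
  assumes "smooth_near M f x" "f x > 0"
  shows "smooth_near M (\<lambda>y. sqrt (f y)) x"
  by (rule smooth_near_compose[OF assms(1), of "{0<..}" sqrt]) (use assms in \<open>auto intro: Ck_on_sqrt\<close>)

lemma smooth_near_ln:
  fixes f :: "'m \<Rightarrow> real"
  assumes "smooth_near M f x" "f x > 0"
  shows "smooth_near M (\<lambda>y. ln (f y)) x"
  by (rule smooth_near_compose[OF assms(1), of "{0<..}" ln]) (use assms in \<open>auto intro: Ck_on_ln\<close>)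

subsection \<open>The topology of an atlas\<close>

lemma topspace_mtopology: "topspace (mtopology M) = carrier M"
proof -
  have "openin (mtopology M) (carrier M)"
    unfolding openin_mtopology
  proof (intro conjI ballI, goal_cases)
    case (2 c)
    obtain U \<phi> where c: "c = (U, \<phi>)" by (cases c)
    have "U \<inter> carrier M = U" using 2 c by (auto intro: carrierI)
    then show ?case unfolding c prod.case by (intro exI[of _ UNIV]) simp
  qed simp
  then show ?thesis unfolding topspace_def using openin_mtopology[of M] by blast
qed

lemma openin_mtopologyD:
  "openin (mtopology M) W \<Longrightarrow> (U, \<phi>) \<in> M \<Longrightarrow> \<exists>T. open T \<and> U \<inter> W = U \<inter> \<phi> -` T"
  unfolding openin_mtopology by fast

text \<open>\<open>mtopology\<close> tests a set in every chart; here one chart around each point is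
  enough, since the transition map into it pulls \<open>T\<close> back to an open condition in the
  given chart.\<close>

lemma openin_mtopologyI:
  assumes M: "smooth_atlas M"
    and "\<And>x. x \<in> W \<Longrightarrow> \<exists>U \<phi> T. (U, \<phi>) \<in> M \<and> x \<in> U \<and> open T \<and> \<phi> x \<in> T \<and> (\<forall>y\<in>U. \<phi> y \<in> T \<longrightarrow> y \<in> W)"
  shows "openin (mtopology M) W"
  unfolding openin_mtopology
proof (intro conjI ballI, goal_cases)
  case 1
  show ?case using assms(2) by (blast intro: carrierI)
next
  case (2 c)
  obtain U \<phi> where c: "c = (U, \<phi>)" by (cases c)
  have U: "(U, \<phi>) \<in> M" using 2 c by simp
  have "\<exists>T. open T \<and> \<phi> x \<in> T \<and> U \<inter> \<phi> -` T \<subseteq> W" if x: "x \<in> U \<inter> W" for x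
  proof -
    obtain U' \<phi>' T where T: "(U', \<phi>') \<in> M" "x \<in> U'" "open T" "\<phi>' x \<in> T" "\<forall>y\<in>U'. \<phi>' y \<in> T \<longrightarrow> y \<in> W"
      using assms(2) x by blast
    obtain T' where T': "open T'" "U \<inter> U' = U \<inter> \<phi> -` T'" using smooth_atlasD(3)[OF M U T(1)] by blast
    have "smooth_in U \<phi> \<phi>' x" by (rule chart_trans[OF M U T(1)]) (use x T in auto)
    then obtain V F where V: "open V" "\<phi> x \<in> V" "F ` V \<subseteq> T" "\<And>y. y \<in> U \<Longrightarrow> \<phi> y \<in> V \<Longrightarrow> \<phi>' y = F (\<phi> y)"
      by (rule smooth_in_open_vimage[OF _ T(3)]) (use T(4) x in auto)
    have "U \<inter> \<phi> -` (V \<inter> T') \<subseteq> W"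
    proof
      fix y assume y: "y \<in> U \<inter> \<phi> -` (V \<inter> T')"
      then have "y \<in> U'" "\<phi>' y \<in> T" using T' V(3,4) by auto
      then show "y \<in> W" using T(5) by blast
    qed
    then show ?thesis using V(1,2) T' T(2) x by (intro exI[of _ "V \<inter> T'"]) auto
  qed
  then obtain T where T: "\<And>x. x \<in> U \<inter> W \<Longrightarrow> open (T x) \<and> \<phi> x \<in> T x \<and> U \<inter> \<phi> -` T x \<subseteq> W" by metis
  have "U \<inter> W = U \<inter> \<phi> -` (\<Union>x\<in>U \<inter> W. T x)" using T by blast
  then show ?case unfolding c prod.case using T by (intro exI[of _ "\<Union>x\<in>U \<inter> W. T x"]) auto
qed

lemma openin_chart_vimage:
  assumes "smooth_atlas M" "(U, \<phi>) \<in> M" "open T"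
  shows "openin (mtopology M) (U \<inter> \<phi> -` T)"
  by (rule openin_mtopologyI[OF assms(1)]) (use assms in blast)

lemma openin_chart: "smooth_atlas M \<Longrightarrow> (U, \<phi>) \<in> M \<Longrightarrow> openin (mtopology M) U"
  using openin_chart_vimage[of M U \<phi> UNIV] by simp

lemma smooth_near_nbhd:
  fixes f :: "'m \<Rightarrow> 'v::real_normed_vector"
  assumes "smooth_atlas M" "smooth_near M f x" "open T" "f x \<in> T"
  obtains N where "openin (mtopology M) N" "x \<in> N" "f ` N \<subseteq> T"
proof -
  obtain U \<phi> where U: "(U, \<phi>) \<in> M" "x \<in> U" "smooth_in U \<phi> f x" using assms(2) unfolding smooth_near_def by blast
  obtain W F where W: "open W" "\<phi> x \<in> W" "F ` W \<subseteq> T" "\<And>y. y \<in> U \<Longrightarrow> \<phi> y \<in> W \<Longrightarrow> f y = F (\<phi> y)"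
    using smooth_in_open_vimage[OF U(3) assms(3,4) U(2)] by metis
  show thesis
    by (rule that[OF openin_chart_vimage[OF assms(1) U(1) W(1)]]) (use W U in auto)
qed

lemma smooth_near_cong:
  assumes "smooth_near M f x" "openin (mtopology M) N" "x \<in> N" "\<And>y. y \<in> N \<Longrightarrow> f' y = f y"
  shows "smooth_near M f' x"
proof -
  obtain U \<phi> where U: "(U, \<phi>) \<in> M" "x \<in> U" "smooth_in U \<phi> f x" using assms(1) unfolding smooth_near_def by blast
  obtain T where T: "open T" "U \<inter> N = U \<inter> \<phi> -` T" using openin_mtopologyD[OF assms(2) U(1)] by blast
  have "smooth_in U \<phi> f' x"
  proof (rule smooth_in_local[OF _ T(1), of U UNIV])
    show "\<phi> x \<in> T" using T(2) U(2) assms(3) by blast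
    show "y \<in> UNIV \<and> f' y = f y" if "y \<in> U" "\<phi> y \<in> T" for y using that T(2) assms(4) by blast
  qed (use U in simp)
  then show ?thesis using U by (blast intro: smooth_nearI)
qed

lemma smooth_near_cong_carrier:
  assumes "smooth_near M f x" "\<And>y. y \<in> carrier M \<Longrightarrow> f' y = f y"
  shows "smooth_near M f' x"
  by (rule smooth_near_cong[OF assms(1), of "carrier M"])
    (use assms smooth_near_carrier openin_topspace[of "mtopology M"] in \<open>auto simp: topspace_mtopology\<close>)

subsection \<open>Smooth maps\<close>

lemma smooth_map_carrier: "smooth_map M N \<Phi> \<Longrightarrow> x \<in> carrier M \<Longrightarrow> \<Phi> x \<in> carrier N"
  unfolding smooth_map_def continuous_map_def by (auto simp: topspace_mtopology)

lemma smooth_map_open: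
  "smooth_map M N \<Phi> \<Longrightarrow> openin (mtopology N) W \<Longrightarrow> openin (mtopology M) {x \<in> carrier M. \<Phi> x \<in> W}"
  unfolding smooth_map_def continuous_map_def by (auto simp: topspace_mtopology)

lemma smooth_near_map:
  assumes M: "smooth_atlas M" and N: "smooth_atlas N" and \<Phi>: "smooth_map M N \<Phi>"
    and f: "smooth_near N f (\<Phi> x)" and x: "x \<in> carrier M"
  shows "smooth_near M (\<lambda>x. f (\<Phi> x)) x"
proof -
  obtain U \<phi> where U: "(U, \<phi>) \<in> M" "x \<in> U" using carrierE[OF x] by metis
  obtain V \<psi> where V: "(V, \<psi>) \<in> N" "\<Phi> x \<in> V" "smooth_in V \<psi> f (\<Phi> x)" using f unfolding smooth_near_def by blast
  obtain W F where W: "open W" "\<psi> (\<Phi> x) \<in> W" "Cinf_on W F" "\<And>y. y \<in> V \<Longrightarrow> \<psi> y \<in> W \<Longrightarrow> f y = F (\<psi> y)"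
    using smooth_inE[OF V(3)] by metis
  have "smooth_on (\<phi> ` (U \<inter> \<Phi> -` V)) ((\<psi> \<circ> \<Phi>) \<circ> inv_into U \<phi>)"
    using \<Phi> U V unfolding smooth_map_def by fast
  then have s: "smooth_in (U \<inter> \<Phi> -` V) \<phi> (\<psi> \<circ> \<Phi>) x"
    by (rule smooth_on_chartD[OF _ smooth_atlasD(1)[OF M U(1)]]) (use U V in auto)
  have s: "smooth_in (U \<inter> \<Phi> -` V) \<phi> (\<lambda>x. f (\<Phi> x)) x"
    by (rule smooth_in_compose[OF s W(1) _ W(3)]) (use U(2) V(2) W(2,4) in auto)
  have "openin (mtopology M) {x \<in> carrier M. \<Phi> x \<in> V}"
    using smooth_map_open[OF \<Phi> openin_chart[OF N V(1)]] .
  then obtain T where T: "open T" "U \<inter> {x \<in> carrier M. \<Phi> x \<in> V} = U \<inter> \<phi> -` T"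
    using openin_mtopologyD[OF _ U(1)] by blast
  have "smooth_in U \<phi> (\<lambda>x. f (\<Phi> x)) x"
    by (rule smooth_in_local[OF s T(1)]) (use T(2) U V x in auto)
  then show ?thesis using U by (blast intro: smooth_nearI)
qed

lemma smooth_fun_map:
  assumes "smooth_atlas M" "smooth_atlas N" "smooth_map M N \<Phi>" "smooth_fun N f"
  shows "smooth_fun M (\<lambda>x. f (\<Phi> x))"
  using assms(4) smooth_near_map[OF assms(1-3)] smooth_map_carrier[OF assms(3)]
  unfolding smooth_fun_iff[OF assms(1)] smooth_fun_iff[OF assms(2)] by blast

text \<open>\<open>smooth_map\<close> quantifies over all pairs of charts and asks for continuity
  separately. One chart of \<open>N\<close> per point that receives a whole neighbourhood
  \<open>W\<close> gives both: continuity comes from the smooth coordinate expression.\<close>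

lemma smooth_mapI:
  assumes M: "smooth_atlas M" and N: "smooth_atlas N"
    and *: "\<And>x. x \<in> carrier M \<Longrightarrow> \<exists>V \<psi> W. (V, \<psi>) \<in> N \<and> openin (mtopology M) W \<and> x \<in> W \<and> \<Phi> ` W \<subseteq> V
      \<and> smooth_near M (\<lambda>x. \<psi> (\<Phi> x)) x"
  shows "smooth_map M N \<Phi>"
  unfolding smooth_map_def
proof (intro conjI ballI, goal_cases)
  case 1
  have "\<Phi> x \<in> carrier N" if "x \<in> carrier M" for x using *[OF that] by (blast intro: carrierI)
  moreover have "openin (mtopology M) {x \<in> carrier M. \<Phi> x \<in> X}" if X: "openin (mtopology N) X" for X
  proof (subst openin_subopen, intro ballI)
    fix x assume x: "x \<in> {x \<in> carrier M. \<Phi> x \<in> X}"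
    then obtain V \<psi> W where V: "(V, \<psi>) \<in> N" "openin (mtopology M) W" "x \<in> W" "\<Phi> ` W \<subseteq> V"
      "smooth_near M (\<lambda>x. \<psi> (\<Phi> x)) x" using * by blast
    obtain T where T: "open T" "V \<inter> X = V \<inter> \<psi> -` T" using openin_mtopologyD[OF X V(1)] by blast
    have "\<psi> (\<Phi> x) \<in> T" using x T V by auto
    then obtain O' where O': "openin (mtopology M) O'" "x \<in> O'" "(\<lambda>x. \<psi> (\<Phi> x)) ` O' \<subseteq> T"
      using smooth_near_nbhd[OF M V(5) T(1)] by metis
    have "O' \<inter> W \<subseteq> {x \<in> carrier M. \<Phi> x \<in> X}"
      using O'(3) V(4) T(2) openin_subset[OF V(2)] by (auto simp: topspace_mtopology)
    then show "\<exists>T. openin (mtopology M) T \<and> x \<in> T \<and> T \<subseteq> {x \<in> carrier M. \<Phi> x \<in> X}"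
      using O' V by (intro exI[of _ "O' \<inter> W"]) auto
  qed
  ultimately show ?case unfolding continuous_map_def by (auto simp: topspace_mtopology)
next
  case (2 c)
  obtain U \<phi> where c: "c = (U, \<phi>)" by (cases c)
  have "smooth_on (\<phi> ` (U \<inter> \<Phi> -` V)) (\<psi> \<circ> \<Phi> \<circ> inv_into U \<phi>)" if V: "(V, \<psi>) \<in> N" for V \<psi>
  proof -
  have U: "(U, \<phi>) \<in> M" "(V, \<psi>) \<in> N" using 2 c V by auto
  have "smooth_in (U \<inter> \<Phi> -` V) \<phi> (\<lambda>x. \<psi> (\<Phi> x)) x" if x: "x \<in> U \<inter> \<Phi> -` V" for x
  proof -
    obtain V' \<psi>' W where V: "(V', \<psi>') \<in> N" "openin (mtopology M) W" "x \<in> W" "\<Phi> ` W \<subseteq> V'"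
      "smooth_near M (\<lambda>x. \<psi>' (\<Phi> x)) x" using * x U by (blast intro: carrierI)
    have s: "smooth_in U \<phi> (\<lambda>x. \<psi>' (\<Phi> x)) x" using smooth_nearD[OF M V(5) U(1)] x by blast
    have "smooth_in V' \<psi>' \<psi> (\<Phi> x)" using chart_trans[OF N V(1) U(2)] x V by blast
    then obtain Q F where Q: "open Q" "\<psi>' (\<Phi> x) \<in> Q" "Cinf_on Q F" "\<And>y. y \<in> V' \<Longrightarrow> \<psi>' y \<in> Q \<Longrightarrow> \<psi> y = F (\<psi>' y)"
      using smooth_inE by metis
    have s: "smooth_in (U \<inter> W) \<phi> (\<lambda>x. \<psi> (\<Phi> x)) x"
      by (rule smooth_in_compose[OF smooth_in_subset[OF s] Q(1,2,3)]) (use V x Q(4) in auto)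
    obtain T where T: "open T" "U \<inter> W = U \<inter> \<phi> -` T" using openin_mtopologyD[OF V(2) U(1)] by blast
    have "smooth_in U \<phi> (\<lambda>x. \<psi> (\<Phi> x)) x"
      by (rule smooth_in_local[OF s T(1)]) (use T V x in auto)
    then show ?thesis by (rule smooth_in_subset) simp
  qed
  then show ?thesis
    using smooth_on_chart[OF smooth_atlasD(1)[OF M U(1)], of "U \<inter> \<Phi> -` V" "\<psi> \<circ> \<Phi>"] by (simp add: comp_def)
  qed
  then show ?case unfolding c by auto
qed

subsection \<open>Open subsets\<close>

lemma carrier_open_atlas: "carrier (open_atlas M W) = carrier M \<inter> W"
  unfolding carrier_def open_atlas_def by force

lemma smooth_atlas_open:
  assumes M: "smooth_atlas M" and W: "openin (mtopology M) W"
  shows "smooth_atlas (open_atlas M W)"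
proof (rule smooth_atlasI; clarsimp simp: open_atlas_def)
  fix U \<phi> assume U: "(U, \<phi>) \<in> M"
  show "inj_on \<phi> (U \<inter> W)" using smooth_atlasD(1)[OF M U] by (rule inj_on_subset) simp
  obtain V where V: "subspace V" "openin (top_of_set V) (\<phi> ` U)" using smooth_atlasD(2)[OF M U] by blast
  have "openin (top_of_set (\<phi> ` U)) (\<phi> ` (U \<inter> W))"
    using openin_image_iff[OF smooth_atlasD(1)[OF M U], of "U \<inter> W"] openin_mtopologyD[OF W U] by auto
  then have "openin (top_of_set V) (\<phi> ` (U \<inter> W))" using V(2) openin_trans by blast
  with V(1) show "\<exists>V. subspace V \<and> openin (top_of_set V) (\<phi> ` (U \<inter> W))" by blast
  fix U' \<phi>' assume U': "(U', \<phi>') \<in> M"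
  obtain T where "open T" "U \<inter> U' = U \<inter> \<phi> -` T" using smooth_atlasD(3)[OF M U U'] by blast
  then show "\<exists>T. open T \<and> U \<inter> W \<inter> (U' \<inter> W) = U \<inter> W \<inter> \<phi> -` T" by (intro exI[of _ T]) auto
  fix x assume x: "x \<in> U" "x \<in> W" "x \<in> U'"
  have "smooth_in (U \<inter> U') \<phi> \<phi>' x" using smooth_atlasD(4)[OF M U U'] x by blast
  then show "smooth_in (U \<inter> W \<inter> (U' \<inter> W)) \<phi> \<phi>' x" by (rule smooth_in_subset) auto
qed

lemma openin_open_atlas:
  assumes M: "smooth_atlas M" and W: "openin (mtopology M) W"
  shows "openin (mtopology (open_atlas M W)) X \<longleftrightarrow> openin (mtopology M) X \<and> X \<subseteq> W"
proof safe
  assume X: "openin (mtopology (open_atlas M W)) X"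
  have sub: "X \<subseteq> carrier M \<inter> W" using X unfolding openin_mtopology carrier_open_atlas by blast
  then show "x \<in> W" if "x \<in> X" for x using that by blast
  show "openin (mtopology M) X"
  proof (rule openin_mtopologyI[OF M])
    fix x assume x: "x \<in> X"
    then obtain U \<phi> where U: "(U, \<phi>) \<in> M" "x \<in> U" using sub by (blast elim: carrierE)
    obtain T where T: "open T" "U \<inter> W = U \<inter> \<phi> -` T" using openin_mtopologyD[OF W U(1)] by blast
    have "(U \<inter> W, \<phi>) \<in> open_atlas M W" using U unfolding open_atlas_def by blast
    then obtain T' where T': "open T'" "U \<inter> W \<inter> X = U \<inter> W \<inter> \<phi> -` T'" using openin_mtopologyD[OF X] by blast
    show "\<exists>U \<phi> T. (U, \<phi>) \<in> M \<and> x \<in> U \<and> open T \<and> \<phi> x \<in> T \<and> (\<forall>y\<in>U. \<phi> y \<in> T \<longrightarrow> y \<in> X)"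
    proof (intro exI[of _ U] exI[of _ \<phi>] exI[of _ "T \<inter> T'"] conjI ballI impI)
      show "\<phi> x \<in> T \<inter> T'" using T T' U x sub by blast
      show "y \<in> X" if "y \<in> U" "\<phi> y \<in> T \<inter> T'" for y using T T' that by blast
    qed (use U T T' in auto)
  qed
next
  assume X: "openin (mtopology M) X" "X \<subseteq> W"
  show "openin (mtopology (open_atlas M W)) X"
    unfolding openin_mtopology carrier_open_atlas
  proof (intro conjI ballI, goal_cases)
    case 1
    show ?case using X openin_subset[OF X(1)] by (auto simp: topspace_mtopology)
  next
    case (2 c)
    then obtain U \<phi> where c: "c = (U \<inter> W, \<phi>)" "(U, \<phi>) \<in> M" unfolding open_atlas_def by blast
    obtain T where "open T" "U \<inter> X = U \<inter> \<phi> -` T" using openin_mtopologyD[OF X(1) c(2)] by blast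
    then show ?case unfolding c prod.case by (intro exI[of _ T]) auto
  qed
qed

lemma smooth_near_open_atlas:
  assumes M: "smooth_atlas M" and W: "openin (mtopology M) W" and x: "x \<in> W"
  shows "smooth_near (open_atlas M W) f x \<longleftrightarrow> smooth_near M f x"
proof
  assume "smooth_near (open_atlas M W) f x"
  then obtain U \<phi> where U: "(U, \<phi>) \<in> M" "x \<in> U" "smooth_in (U \<inter> W) \<phi> f x"
    unfolding smooth_near_def open_atlas_def by blast
  obtain T where "open T" "U \<inter> W = U \<inter> \<phi> -` T" using openin_mtopologyD[OF W U(1)] by blast
  then have "smooth_in U \<phi> f x" by (intro smooth_in_local[OF U(3)]) (use U x in auto)
  then show "smooth_near M f x" using U by (blast intro: smooth_nearI)
next
  assume "smooth_near M f x"
  then obtain U \<phi> where U: "(U, \<phi>) \<in> M" "x \<in> U" "smooth_in U \<phi> f x" unfolding smooth_near_def by blast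
  have "(U \<inter> W, \<phi>) \<in> open_atlas M W" using U unfolding open_atlas_def by blast
  then show "smooth_near (open_atlas M W) f x"
    using smooth_in_subset[OF U(3), of "U \<inter> W"] U(2) x by (blast intro: smooth_nearI)
qed

subsection \<open>Linear spaces and products\<close>

lemma carrier_linear_atlas [simp]: "carrier (linear_atlas V) = V"
  unfolding carrier_def linear_atlas_def by simp

lemma smooth_atlas_linear: "subspace V \<Longrightarrow> smooth_atlas (linear_atlas V)"
  by (rule smooth_atlasI; fastforce simp: linear_atlas_def intro: smooth_in_chart)

lemma carrier_prod_atlas: "carrier (prod_atlas M N) = carrier M \<times> carrier N"
  unfolding carrier_def prod_atlas_def by force

lemma smooth_in_fst: "smooth_in U \<phi> f x \<Longrightarrow> smooth_in (U \<times> U') (map_prod \<phi> \<psi>) (\<lambda>z. f (fst z)) (x, x')"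
  by (erule smooth_inE, rule smooth_inI[where W = "_ \<times> UNIV" and F = "\<lambda>z. _ (fst z)"],
      erule open_Times[OF _ open_UNIV], simp, rule Cinf_on_compose[where f = fst])
    (auto intro!: open_Times Ck_on_bounded_linear bounded_linear_fst)

lemma smooth_in_snd: "smooth_in U' \<psi> f x' \<Longrightarrow> smooth_in (U \<times> U') (map_prod \<phi> \<psi>) (\<lambda>z. f (snd z)) (x, x')"
  by (erule smooth_inE, rule smooth_inI[where W = "UNIV \<times> _" and F = "\<lambda>z. _ (snd z)"],
      erule open_Times[OF open_UNIV], simp, rule Cinf_on_compose[where f = snd])
    (auto intro!: open_Times Ck_on_bounded_linear bounded_linear_snd)

lemma smooth_atlas_prod:
  assumes M: "smooth_atlas M" and N: "smooth_atlas N"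
  shows "smooth_atlas (prod_atlas M N)"
proof (rule smooth_atlasI; clarsimp simp: prod_atlas_def)
  fix U \<phi> V \<psi> assume U: "(U, \<phi>) \<in> M" and V: "(V, \<psi>) \<in> N"
  show "inj_on (map_prod \<phi> \<psi>) (U \<times> V)"
    using smooth_atlasD(1)[OF M U] smooth_atlasD(1)[OF N V] by (rule map_prod_inj_on)
  obtain X where X: "subspace X" "openin (top_of_set X) (\<phi> ` U)" using smooth_atlasD(2)[OF M U] by blast
  obtain Y where Y: "subspace Y" "openin (top_of_set Y) (\<psi> ` V)" using smooth_atlasD(2)[OF N V] by blast
  show "\<exists>Z. subspace Z \<and> openin (top_of_set Z) (map_prod \<phi> \<psi> ` (U \<times> V))"
    using subspace_Times[OF X(1) Y(1)] openin_Times[OF X(2) Y(2)] map_prod_surj_on[OF refl[of "\<phi> ` U"] refl[of "\<psi> ` V"]]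
    by (intro exI[of _ "X \<times> Y"]) simp
  fix U' \<phi>' V' \<psi>' assume U': "(U', \<phi>') \<in> M" and V': "(V', \<psi>') \<in> N"
  obtain T T' where "open T" "U \<inter> U' = U \<inter> \<phi> -` T" "open T'" "V \<inter> V' = V \<inter> \<psi> -` T'"
    using smooth_atlasD(3)[OF M U U'] smooth_atlasD(3)[OF N V V'] by metis
  then show "\<exists>T. open T \<and> U \<times> V \<inter> U' \<times> V' = U \<times> V \<inter> map_prod \<phi> \<psi> -` T"
    by (intro exI[of _ "T \<times> T'"] conjI open_Times) auto
  fix x y assume x: "x \<in> U" "x \<in> U'" "y \<in> V" "y \<in> V'"
  have "smooth_in ((U \<inter> U') \<times> (V \<inter> V')) (map_prod \<phi> \<psi>) (\<lambda>z. (\<phi>' (fst z), \<psi>' (snd z))) (x, y)"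
    using smooth_atlasD(4)[OF M U U'] smooth_atlasD(4)[OF N V V'] x
    by (intro smooth_in_Pair smooth_in_fst smooth_in_snd) auto
  moreover have "map_prod \<phi>' \<psi>' = (\<lambda>z. (\<phi>' (fst z), \<psi>' (snd z)))" by (auto simp: fun_eq_iff)
  ultimately show "smooth_in (U \<times> V \<inter> U' \<times> V') (map_prod \<phi> \<psi>) (map_prod \<phi>' \<psi>') (x, y)"
    by (simp add: Times_Int_Times)
qed

lemma prod_atlasI: "(U, \<phi>) \<in> M \<Longrightarrow> (V, \<psi>) \<in> N \<Longrightarrow> (U \<times> V, map_prod \<phi> \<psi>) \<in> prod_atlas M N"
  unfolding prod_atlas_def by blast

lemma smooth_near_fst:
  "smooth_near M f (fst z) \<Longrightarrow> snd z \<in> carrier N \<Longrightarrow> smooth_near (prod_atlas M N) (\<lambda>z. f (fst z)) z"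
  unfolding smooth_near_def[of M]
  by (cases z) (auto elim!: carrierE intro!: smooth_nearI[OF prod_atlasI] smooth_in_fst)

lemma smooth_near_snd:
  "smooth_near N f (snd z) \<Longrightarrow> fst z \<in> carrier M \<Longrightarrow> smooth_near (prod_atlas M N) (\<lambda>z. f (snd z)) z"
  unfolding smooth_near_def[of N]
  by (cases z) (auto elim!: carrierE intro!: smooth_nearI[OF prod_atlasI] smooth_in_snd)

lemma openin_prod_atlas:
  assumes M: "smooth_atlas M" and N: "smooth_atlas N"
    and W: "openin (mtopology M) W" and W': "openin (mtopology N) W'"
  shows "openin (mtopology (prod_atlas M N)) (W \<times> W')"
proof (rule openin_mtopologyI[OF smooth_atlas_prod[OF M N]])
  fix z assume "z \<in> W \<times> W'"
  then obtain x y where z: "z = (x, y)" "x \<in> W" "y \<in> W'" by blast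
  have "x \<in> carrier M" "y \<in> carrier N"
    using openin_subset[OF W] openin_subset[OF W'] z by (auto simp: topspace_mtopology)
  then obtain U \<phi> V \<psi> where U: "(U, \<phi>) \<in> M" "x \<in> U" and V: "(V, \<psi>) \<in> N" "y \<in> V"
    by (meson carrierE)
  obtain T T' where "open T" "U \<inter> W = U \<inter> \<phi> -` T" "open T'" "V \<inter> W' = V \<inter> \<psi> -` T'"
    using openin_mtopologyD[OF W U(1)] openin_mtopologyD[OF W' V(1)] by metis
  then show "\<exists>U \<phi> T. (U, \<phi>) \<in> prod_atlas M N \<and> z \<in> U \<and> open T \<and> \<phi> z \<in> T \<and> (\<forall>y\<in>U. \<phi> y \<in> T \<longrightarrow> y \<in> W \<times> W')"
    using prod_atlasI[OF U(1) V(1)] z U V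
    by (intro exI[of _ "U \<times> V"] exI[of _ "map_prod \<phi> \<psi>"] exI[of _ "T \<times> T'"]) (auto intro: open_Times)
qed

subsection \<open>The maximal atlas and submanifolds\<close>

text \<open>Compatibility with every chart of \<open>M\<close> follows from comparison with a single
  chart \<open>\<psi>\<close> whose domain contains \<open>U\<close>: \<open>to\<close> is
  smoothness of \<open>\<phi>\<close> on \<open>M\<close>, \<open>from'\<close> that of
  \<open>\<psi>\<close> in terms of \<open>\<phi>\<close>, and any other chart is locally a smooth
  function of \<open>\<psi>\<close>.\<close>

lemma maximal_atlasI:
  assumes M: "smooth_atlas M" and C: "(C, \<psi>) \<in> M" "U \<subseteq> C" and U: "openin (mtopology M) U"
    and inj: "inj_on \<phi> U" and V: "\<exists>V. subspace V \<and> openin (top_of_set V) (\<phi> ` U)"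
    and to: "\<And>x. x \<in> U \<Longrightarrow> smooth_near M \<phi> x" and from': "\<And>x. x \<in> U \<Longrightarrow> smooth_in U \<phi> \<psi> x"
  shows "(U, \<phi>) \<in> maximal_atlas M"
proof -
  have *: "(\<exists>T. open T \<and> U \<inter> U' = U \<inter> \<phi> -` T) \<and> (\<forall>x\<in>U \<inter> U'. smooth_in (U \<inter> U') \<phi> \<phi>' x)
    \<and> (\<exists>T. open T \<and> U' \<inter> U = U' \<inter> \<phi>' -` T) \<and> (\<forall>x\<in>U' \<inter> U. smooth_in (U' \<inter> U) \<phi>' \<phi> x)"
    if U': "(U', \<phi>') \<in> M" for U' \<phi>'
  proof (intro conjI ballI)
    obtain T0 where T0: "open T0" "C \<inter> U' = C \<inter> \<psi> -` T0" using smooth_atlasD(3)[OF M C(1) U'] by blast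
    have "\<exists>T. open T \<and> \<phi> x \<in> T \<and> U \<inter> \<phi> -` T \<subseteq> U'" if x: "x \<in> U \<inter> U'" for x
    proof -
      have "\<psi> x \<in> T0" using x C T0 by blast
      then obtain W G where "open W" "\<phi> x \<in> W" "G ` W \<subseteq> T0" "\<And>y. y \<in> U \<Longrightarrow> \<phi> y \<in> W \<Longrightarrow> \<psi> y = G (\<phi> y)"
        using smooth_in_open_vimage[OF from' T0(1)] x by (metis IntD1)
      then show ?thesis using T0 C by (intro exI[of _ W]) auto
    qed
    then obtain T where T: "\<And>x. x \<in> U \<inter> U' \<Longrightarrow> open (T x) \<and> \<phi> x \<in> T x \<and> U \<inter> \<phi> -` T x \<subseteq> U'" by metis
    have "U \<inter> U' = U \<inter> \<phi> -` (\<Union>x\<in>U \<inter> U'. T x)" using T by blast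
    then show "\<exists>T. open T \<and> U \<inter> U' = U \<inter> \<phi> -` T" using T by (intro exI[of _ "\<Union>x\<in>U \<inter> U'. T x"]) auto
    show "\<exists>T. open T \<and> U' \<inter> U = U' \<inter> \<phi>' -` T" using openin_mtopologyD[OF U U'] .
    show "smooth_in (U \<inter> U') \<phi> \<phi>' x" if x: "x \<in> U \<inter> U'" for x
    proof -
      obtain W F where W: "open W" "\<psi> x \<in> W" "Cinf_on W F" "\<And>y. y \<in> C \<Longrightarrow> \<psi> y \<in> W \<Longrightarrow> \<phi>' y = F (\<psi> y)"
        using smooth_inE[OF chart_trans[OF M C(1) U', of x]] x C by blast
      show ?thesis
        by (rule smooth_in_compose[OF smooth_in_subset[OF from'] W(1-3)]) (use x W C in auto)
    qed
    show "smooth_in (U' \<inter> U) \<phi>' \<phi> x" if x: "x \<in> U' \<inter> U" for x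
      by (rule smooth_in_subset[OF smooth_nearD[OF M to U']]) (use x in auto)
  qed
  have "smooth_atlas (insert (U, \<phi>) M)"
  proof (rule smooth_atlasI, goal_cases)
    case (1 A \<alpha>)
    then show ?case using inj smooth_atlasD(1)[OF M] by auto
  next
    case (2 A \<alpha>)
    then show ?case using V smooth_atlasD(2)[OF M] by auto
  next
    case (3 A \<alpha> B \<beta>)
    have "\<exists>T. open T \<and> U = U \<inter> \<phi> -` T" by (rule exI[of _ UNIV]) simp
    with 3 show ?case using smooth_atlasD(3)[OF M, of A \<alpha> B \<beta>] *[of A \<alpha>] *[of B \<beta>]
      by (cases "(A, \<alpha>) \<in> M"; cases "(B, \<beta>) \<in> M") simp_all
  next
    case (4 A \<alpha> B \<beta> x)
    then show ?case using smooth_atlasD(4)[OF M, of A \<alpha> B \<beta>] *[of A \<alpha>] *[of B \<beta>] smooth_in_chart[of U \<phi> x]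
      by (cases "(A, \<alpha>) \<in> M"; cases "(B, \<beta>) \<in> M") simp_all
  qed
  moreover have "U \<subseteq> carrier M" using C by (auto intro: carrierI)
  ultimately show ?thesis unfolding maximal_atlas_def by simp
qed

lemma maximal_atlasD:
  assumes M: "smooth_atlas M" and U: "(U, \<phi>) \<in> maximal_atlas M"
  shows "U \<subseteq> carrier M" "smooth_atlas (insert (U, \<phi>) M)" "inj_on \<phi> U"
    "\<And>X. openin (mtopology M) X \<Longrightarrow> \<exists>T. open T \<and> U \<inter> X = U \<inter> \<phi> -` T"
    "openin (mtopology M) U"
    "\<And>x. x \<in> U \<Longrightarrow> smooth_near M \<phi> x"
    "\<And>(f :: _ \<Rightarrow> 'v::real_normed_vector) x. smooth_near M f x \<Longrightarrow> x \<in> U \<Longrightarrow> smooth_in U \<phi> f x"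
proof -
  show sub: "U \<subseteq> carrier M" and I: "smooth_atlas (insert (U, \<phi>) M)" using U unfolding maximal_atlas_def by auto
  show "inj_on \<phi> U" using smooth_atlasD(1)[OF I] by blast
  show "\<exists>T. open T \<and> U \<inter> X = U \<inter> \<phi> -` T" if X: "openin (mtopology M) X" for X
  proof -
    have "openin (mtopology (insert (U, \<phi>) M)) X"
    proof (rule openin_mtopologyI[OF I])
      fix x assume x: "x \<in> X"
      then have "x \<in> carrier M" using openin_subset[OF X] by (auto simp: topspace_mtopology)
      then obtain C \<psi> where C: "(C, \<psi>) \<in> M" "x \<in> C" by (rule carrierE)
      then obtain T where "open T" "C \<inter> X = C \<inter> \<psi> -` T" using openin_mtopologyD[OF X] by blast
      then show "\<exists>V \<psi> T. (V, \<psi>) \<in> insert (U, \<phi>) M \<and> x \<in> V \<and> open T \<and> \<psi> x \<in> T \<and> (\<forall>y\<in>V. \<psi> y \<in> T \<longrightarrow> y \<in> X)"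
        using C x by (intro exI[of _ C] exI[of _ \<psi>] exI[of _ T]) blast
    qed
    then show ?thesis by (rule openin_mtopologyD) simp
  qed
  have "openin (mtopology (insert (U, \<phi>) M)) U" by (rule openin_chart[OF I, of _ \<phi>]) simp
  then show "openin (mtopology M) U" unfolding openin_mtopology using sub by auto
  show "smooth_near M \<phi> x" if x: "x \<in> U" for x
  proof -
    obtain C \<psi> where C: "(C, \<psi>) \<in> M" "x \<in> C" using sub x by (blast elim: carrierE)
    have "smooth_in C \<psi> \<phi> x" by (rule chart_trans[OF I, of C \<psi> U]) (use C x in auto)
    then show ?thesis using C by (blast intro: smooth_nearI)
  qed
  show "smooth_in U \<phi> f x" if "smooth_near M f x" "x \<in> U" for f :: "_ \<Rightarrow> 'v" and x
  proof -
    have "smooth_near (insert (U, \<phi>) M) f x" using that(1) unfolding smooth_near_def by blast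
    then show ?thesis by (rule smooth_nearD[OF I]) (use that in auto)
  qed
qed

lemma slice_atlasE:
  assumes "(B, \<phi>) \<in> slice_atlas k M S"
  obtains U V W where "B = U \<inter> S" "(U, \<phi>) \<in> maximal_atlas M" "subspace V" "openin (top_of_set V) (\<phi> ` U)"
    "subspace W" "W \<subseteq> V" "dim W = k" "\<phi> ` (U \<inter> S) = \<phi> ` U \<inter> W"
  using assms unfolding slice_atlas_def by blast

lemma smooth_atlas_slice:
  fixes M :: "('m, 'e::euclidean_space) atlas"
  assumes M: "smooth_atlas M"
  shows "smooth_atlas (slice_atlas k M S)"
proof (rule smooth_atlasI)
  fix B \<phi> assume B: "(B, \<phi>) \<in> slice_atlas k M S"
  obtain U V W where U: "B = U \<inter> S" "(U, \<phi>) \<in> maximal_atlas M" "subspace V" "openin (top_of_set V) (\<phi> ` U)"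
    "subspace W" "W \<subseteq> V" "\<phi> ` (U \<inter> S) = \<phi> ` U \<inter> W" using slice_atlasE[OF B] by metis
  show "inj_on \<phi> B" using maximal_atlasD(3)[OF M U(2)] U(1) by (auto intro: inj_on_subset)
  obtain T where "open T" "\<phi> ` U = V \<inter> T" using U(4) by (auto simp: openin_open)
  then have "\<phi> ` B = W \<inter> T" using U by auto
  then have "openin (top_of_set W) (\<phi> ` B)" using \<open>open T\<close> by (auto simp: openin_open)
  then show "\<exists>V. subspace V \<and> openin (top_of_set V) (\<phi> ` B)" using U(5) by blast
  fix B' \<phi>' assume B': "(B', \<phi>') \<in> slice_atlas k M S"
  obtain U' where U': "B' = U' \<inter> S" "(U', \<phi>') \<in> maximal_atlas M" using slice_atlasE[OF B'] by metis
  obtain T where "open T" "U \<inter> U' = U \<inter> \<phi> -` T"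
    using maximal_atlasD(4)[OF M U(2) maximal_atlasD(5)[OF M U'(2)]] by blast
  then show "\<exists>T. open T \<and> B \<inter> B' = B \<inter> \<phi> -` T" unfolding U(1) U'(1) by (intro exI[of _ T]) auto
  fix x assume x: "x \<in> B \<inter> B'"
  have "smooth_in U \<phi> \<phi>' x"
    using maximal_atlasD(7)[OF M U(2) maximal_atlasD(6)[OF M U'(2)]] x U U' by blast
  then show "smooth_in (B \<inter> B') \<phi> \<phi>' x" by (rule smooth_in_subset) (use U in auto)
qed

lemma carrier_slice_subset: "carrier (slice_atlas k M S) \<subseteq> S"
  unfolding carrier_def slice_atlas_def by auto

lemma smooth_near_slice:
  assumes M: "smooth_atlas M" and f: "smooth_near M f x" and x: "x \<in> carrier (slice_atlas k M S)"
  shows "smooth_near (slice_atlas k M S) f x"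
proof -
  obtain B \<phi> where B: "(B, \<phi>) \<in> slice_atlas k M S" "x \<in> B" using carrierE[OF x] by metis
  obtain U where U: "B = U \<inter> S" "(U, \<phi>) \<in> maximal_atlas M" using slice_atlasE[OF B(1)] by metis
  have "smooth_in U \<phi> f x" using maximal_atlasD(7)[OF M U(2) f] B U by blast
  then have "smooth_in B \<phi> f x" by (rule smooth_in_subset) (use U in auto)
  then show ?thesis using B by (blast intro: smooth_nearI)
qed

lemma openin_slice:
  assumes M: "smooth_atlas M" and X: "openin (mtopology M) X"
  shows "openin (mtopology (slice_atlas k M S)) (X \<inter> carrier (slice_atlas k M S))"
  unfolding openin_mtopology
proof (intro conjI ballI, goal_cases)
  case (2 c)
  obtain B \<phi> where c: "c = (B, \<phi>)" by (cases c)
  obtain U where U: "B = U \<inter> S" "(U, \<phi>) \<in> maximal_atlas M" using slice_atlasE[of B \<phi>] 2 c by metis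
  have "B \<subseteq> carrier (slice_atlas k M S)" using 2 c by (auto intro: carrierI)
  moreover obtain T where "open T" "U \<inter> X = U \<inter> \<phi> -` T" using maximal_atlasD(4)[OF M U(2) X] by blast
  ultimately show ?case unfolding c prod.case using U by (intro exI[of _ T]) auto
qed simp

text \<open>Slice charts are restrictions of charts of the maximal atlas of \<open>M\<close>, so the
  coordinate expressions of \<open>\<Phi>\<close> into the slice are among those into
  \<open>M\<close>.\<close>

lemma smooth_map_slice:
  assumes M: "smooth_atlas M" and N: "smooth_atlas N" and \<Phi>: "smooth_map N M \<Phi>"
    and im: "\<And>x. x \<in> carrier N \<Longrightarrow> \<Phi> x \<in> carrier (slice_atlas k M S)"
  shows "smooth_map N (slice_atlas k M S) \<Phi>"
proof (rule smooth_mapI[OF N smooth_atlas_slice[OF M]])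
  fix x assume x: "x \<in> carrier N"
  obtain B \<phi> where B: "(B, \<phi>) \<in> slice_atlas k M S" "\<Phi> x \<in> B" using im[OF x] by (rule carrierE)
  obtain U where U: "B = U \<inter> S" "(U, \<phi>) \<in> maximal_atlas M" using slice_atlasE[OF B(1)] by metis
  have "smooth_near N (\<lambda>x. \<phi> (\<Phi> x)) x"
    using smooth_near_map[OF N M \<Phi> maximal_atlasD(6)[OF M U(2)] x] B U by blast
  moreover have "openin (mtopology N) {x \<in> carrier N. \<Phi> x \<in> U}"
    using smooth_map_open[OF \<Phi> maximal_atlasD(5)[OF M U(2)]] .
  moreover have "\<Phi> ` {x \<in> carrier N. \<Phi> x \<in> U} \<subseteq> B"
    using im carrier_slice_subset[of k M S] U by blast
  ultimately show "\<exists>V \<psi> W. (V, \<psi>) \<in> slice_atlas k M S \<and> openin (mtopology N) W \<and> x \<in> W \<and> \<Phi> ` W \<subseteq> V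
      \<and> smooth_near N (\<lambda>x. \<psi> (\<Phi> x)) x"
    using B U x by (intro exI[of _ B] exI[of _ \<phi>] exI[of _ "{x \<in> carrier N. \<Phi> x \<in> U}"]) auto
qed


lemma smooth_in_bilinear:
  fixes f :: "'m \<Rightarrow> 'v::euclidean_space" and g :: "'m \<Rightarrow> 'w::euclidean_space"
  assumes "bounded_bilinear B" "smooth_in U \<phi> f x" "smooth_in U \<phi> g x" "x \<in> U"
  shows "smooth_in U \<phi> (\<lambda>y. B (f y) (g y)) x"
proof (rule smooth_in_compose[OF smooth_in_Pair[OF assms(2,3)] open_UNIV UNIV_I _ assms(4)])
  show "Cinf_on UNIV (\<lambda>p. B (fst p) (snd p))"
    by (rule allI, rule Ck_on_bilinear[OF open_UNIV assms(1)];
      rule Ck_on_bounded_linear[OF open_UNIV]; rule bounded_linear_fst bounded_linear_snd)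
qed simp

lemma smooth_in_sum:
  fixes f :: "'i \<Rightarrow> 'm \<Rightarrow> 'v::euclidean_space"
  assumes "\<And>i. i \<in> I \<Longrightarrow> smooth_in U \<phi> (f i) x" "x \<in> U"
  shows "smooth_in U \<phi> (\<lambda>y. \<Sum>i\<in>I. f i y) x"
  using assms(1)
proof (induction I rule: infinite_finite_induct)
  case (insert i I)
  have "smooth_in U \<phi> (\<lambda>y. f i y + (\<Sum>i\<in>I. f i y)) x"
  proof (rule smooth_in_compose[OF smooth_in_Pair open_UNIV UNIV_I _ assms(2)])
    show "Cinf_on UNIV (\<lambda>p. fst p + snd p :: 'v)"
      by (rule allI, rule Ck_on_bounded_linear[OF open_UNIV];
        rule bounded_linear_add[OF bounded_linear_fst bounded_linear_snd])
    show "smooth_in U \<phi> (f i) x" "smooth_in U \<phi> (\<lambda>y. \<Sum>i\<in>I. f i y) x"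
      using insert by simp_all
  qed simp
  then show ?case using insert by simp
qed (simp_all add: smooth_in_const)

lemma smooth_map_compose:
  assumes M: "smooth_atlas M" and N: "smooth_atlas N" and K: "smooth_atlas K"
    and \<Phi>: "smooth_map M N \<Phi>" and \<Psi>: "smooth_map N K \<Psi>"
  shows "smooth_map M K (\<lambda>x. \<Psi> (\<Phi> x))"
proof (rule smooth_mapI[OF M K])
  fix x assume x: "x \<in> carrier M"
  note c = smooth_map_carrier[OF \<Phi> x]
  obtain V \<psi> where V: "(V, \<psi>) \<in> K" "\<Psi> (\<Phi> x) \<in> V" using smooth_map_carrier[OF \<Psi> c] by (rule carrierE)
  have "smooth_near K \<psi> (\<Psi> (\<Phi> x))" using V smooth_in_chart by (rule smooth_nearI)
  then have "smooth_near M (\<lambda>x. \<psi> (\<Psi> (\<Phi> x))) x"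
    using smooth_near_map[OF M N \<Phi> smooth_near_map[OF N K \<Psi> _ c] x] by blast
  moreover have "openin (mtopology M) {x \<in> carrier M. \<Phi> x \<in> {x \<in> carrier N. \<Psi> x \<in> V}}"
    by (rule smooth_map_open[OF \<Phi> smooth_map_open[OF \<Psi> openin_chart[OF K V(1)]]])
  ultimately show "\<exists>V \<psi> W. (V, \<psi>) \<in> K \<and> openin (mtopology M) W \<and> x \<in> W \<and> (\<lambda>x. \<Psi> (\<Phi> x)) ` W \<subseteq> V
      \<and> smooth_near M (\<lambda>x. \<psi> (\<Psi> (\<Phi> x))) x"
    using V x c
    by (intro exI[of _ V] exI[of _ \<psi>] exI[of _ "{x \<in> carrier M. \<Phi> x \<in> {x \<in> carrier N. \<Psi> x \<in> V}}"]) auto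
qed

lemma smooth_map_inclusion:
  assumes N: "smooth_atlas N" and M: "smooth_atlas M" and sub: "carrier N \<subseteq> carrier M"
    and op: "\<And>X. openin (mtopology M) X \<Longrightarrow> openin (mtopology N) (X \<inter> carrier N)"
    and sm: "\<And>(f :: 'm \<Rightarrow> 'e::euclidean_space) x. x \<in> carrier N \<Longrightarrow> smooth_near M f x \<Longrightarrow> smooth_near N f x"
  shows "smooth_map N (M :: ('m, 'e) atlas) (\<lambda>x. x)"
proof (rule smooth_mapI[OF N M])
  fix x assume x: "x \<in> carrier N"
  then obtain V \<psi> where V: "(V, \<psi>) \<in> M" "x \<in> V" using sub by (blast elim: carrierE)
  have "smooth_near N \<psi> x" using V smooth_in_chart by (intro sm[OF x] smooth_nearI)
  then show "\<exists>V \<psi> W. (V, \<psi>) \<in> M \<and> openin (mtopology N) W \<and> x \<in> W \<and> (\<lambda>x. x) ` W \<subseteq> V \<and> smooth_near N \<psi> x"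
    using V x op[OF openin_chart[OF M V(1)]]
    by (intro exI[of _ V] exI[of _ \<psi>] exI[of _ "V \<inter> carrier N"]) auto
qed

lemma smooth_map_open_inclusion:
  assumes M: "smooth_atlas M" and W: "openin (mtopology M) W"
  shows "smooth_map (open_atlas M W) M (\<lambda>x. x)"
proof (rule smooth_map_inclusion[OF smooth_atlas_open[OF M W] M])
  show "openin (mtopology (open_atlas M W)) (X \<inter> carrier (open_atlas M W))" if "openin (mtopology M) X" for X
    using that W openin_subset[OF W] openin_Int[OF that W]
    by (simp add: openin_open_atlas[OF M W] carrier_open_atlas topspace_mtopology Int_absorb1)
qed (auto simp: carrier_open_atlas smooth_near_open_atlas[OF M W])

lemma smooth_map_slice_inclusion:
  assumes M: "smooth_atlas M" and S: "S \<subseteq> carrier M"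
  shows "smooth_map (slice_atlas k M S) M (\<lambda>x. x)"
  by (rule smooth_map_inclusion[OF smooth_atlas_slice[OF M] M])
    (use S carrier_slice_subset[of k M S] openin_slice[OF M] smooth_near_slice[OF M] in blast)+

lemma smooth_map_open_target:
  assumes M: "smooth_atlas M" and N: "smooth_atlas N" and W: "openin (mtopology M) W"
    and \<Phi>: "smooth_map N M \<Phi>" and im: "\<And>x. x \<in> carrier N \<Longrightarrow> \<Phi> x \<in> W"
  shows "smooth_map N (open_atlas M W) \<Phi>"
proof (rule smooth_mapI[OF N smooth_atlas_open[OF M W]])
  fix x assume x: "x \<in> carrier N"
  obtain V \<psi> where V: "(V, \<psi>) \<in> M" "\<Phi> x \<in> V" using smooth_map_carrier[OF \<Phi> x] by (rule carrierE)
  have "smooth_near M \<psi> (\<Phi> x)" using V smooth_in_chart by (rule smooth_nearI)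
  then have "smooth_near N (\<lambda>x. \<psi> (\<Phi> x)) x" by (rule smooth_near_map[OF N M \<Phi> _ x])
  moreover have "(V \<inter> W, \<psi>) \<in> open_atlas M W" using V unfolding open_atlas_def by blast
  ultimately show "\<exists>V \<psi> X. (V, \<psi>) \<in> open_atlas M W \<and> openin (mtopology N) X \<and> x \<in> X \<and> \<Phi> ` X \<subseteq> V
      \<and> smooth_near N (\<lambda>x. \<psi> (\<Phi> x)) x"
    using V x im smooth_map_open[OF \<Phi> openin_chart[OF M V(1)]]
    by (intro exI[of _ "V \<inter> W"] exI[of _ \<psi>] exI[of _ "{x \<in> carrier N. \<Phi> x \<in> V}"]) auto
qed

text \<open>\<open>local_triv\<close> restricts the total space to the full preimage of
  \<open>U\<close> under \<open>proj A\<close>. That set may contain points outside the carrier and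
  is then not open in the sense of \<open>mtopology\<close>.\<close>

lemma open_atlas_Int_carrier: "open_atlas M (carrier M \<inter> W) = open_atlas M W"
proof -
  have "U \<inter> (carrier M \<inter> W) = U \<inter> W" if "(U, \<phi>) \<in> M" for U \<phi> using that by (auto intro: carrierI)
  then show ?thesis unfolding open_atlas_def by (auto; metis)
qed

subsection \<open>Derivations\<close>

lemma smooth_fun_const: "smooth_atlas M \<Longrightarrow> smooth_fun M (\<lambda>_. c)"
  by (simp add: smooth_fun_iff smooth_near_const)

lemma smooth_fun_add: "smooth_atlas M \<Longrightarrow> smooth_fun M f \<Longrightarrow> smooth_fun M h \<Longrightarrow> smooth_fun M (\<lambda>x. f x + h x)"
  by (simp add: smooth_fun_iff smooth_near_add)

lemma smooth_fun_mult: "smooth_atlas M \<Longrightarrow> smooth_fun M f \<Longrightarrow> smooth_fun M h \<Longrightarrow> smooth_fun M (\<lambda>x. f x * h x)"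
  by (simp add: smooth_fun_iff smooth_near_mult)

lemma smooth_fun_scale: "smooth_atlas M \<Longrightarrow> smooth_fun M f \<Longrightarrow> smooth_fun M (\<lambda>x. a * f x)"
  by (intro smooth_fun_mult smooth_fun_const)

lemma smooth_fun_diff: "smooth_atlas M \<Longrightarrow> smooth_fun M f \<Longrightarrow> smooth_fun M h \<Longrightarrow> smooth_fun M (\<lambda>x. f x - h x)"
  by (simp add: smooth_fun_iff smooth_near_diff)

lemma smooth_fun_minus: "smooth_atlas M \<Longrightarrow> smooth_fun M f \<Longrightarrow> smooth_fun M (\<lambda>x. - f x)"
  using smooth_fun_scale[of M f "-1"] by simp

lemma smooth_fun_sum:
  "smooth_atlas M \<Longrightarrow> (\<And>i. i \<in> I \<Longrightarrow> smooth_fun M (f i)) \<Longrightarrow> smooth_fun M (\<lambda>x. \<Sum>i\<in>I. f i x)"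
  by (simp add: smooth_fun_iff smooth_near_sum)

lemmas smooth_fun_intros = smooth_fun_const smooth_fun_add smooth_fun_diff smooth_fun_minus smooth_fun_mult

lemma smooth_fun_cong:
  assumes "smooth_atlas M" "\<And>x. x \<in> carrier M \<Longrightarrow> f x = h x" "smooth_fun M h"
  shows "smooth_fun M f"
  using assms(3) smooth_near_cong_carrier[of M h _ f] assms(2) unfolding smooth_fun_iff[OF assms(1)] by blast

context
  fixes M :: "('m, 'e::euclidean_space) atlas" and p :: 'm and v :: "'m vec"
  assumes M: "smooth_atlas M" and v: "v \<in> tangent_space M p"
begin

lemma tangent_nonsmooth: "\<not> smooth_fun M f \<Longrightarrow> v f = 0"
  using v unfolding tangent_space_def by blast

lemma tangent_linear: "smooth_fun M f \<Longrightarrow> smooth_fun M h \<Longrightarrow> v (\<lambda>x. a * f x + b * h x) = a * v f + b * v h"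
  using v unfolding tangent_space_def by blast

lemma tangent_mult: "smooth_fun M f \<Longrightarrow> smooth_fun M h \<Longrightarrow> v (\<lambda>x. f x * h x) = v f * h p + f p * v h"
  using v unfolding tangent_space_def by blast

lemma tangent_const: "v (\<lambda>_. c) = 0"
proof -
  have "v (\<lambda>_. 1) = 0" using tangent_mult[OF smooth_fun_const[OF M, of 1] smooth_fun_const[OF M, of 1]] by simp
  then show ?thesis
    using tangent_linear[OF smooth_fun_const[OF M, of 1] smooth_fun_const[OF M, of 1], of c 0] by simp
qed

lemma tangent_add: "smooth_fun M f \<Longrightarrow> smooth_fun M h \<Longrightarrow> v (\<lambda>x. f x + h x) = v f + v h"
  using tangent_linear[of f h 1 1] by simp

lemma tangent_diff: "smooth_fun M f \<Longrightarrow> smooth_fun M h \<Longrightarrow> v (\<lambda>x. f x - h x) = v f - v h"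
  using tangent_linear[of f h 1 "-1"] by simp

lemma tangent_scale: "smooth_fun M f \<Longrightarrow> v (\<lambda>x. a * f x) = a * v f"
  using tangent_linear[of f f a 0] by simp

lemma tangent_minus: "smooth_fun M f \<Longrightarrow> v (\<lambda>x. - f x) = - v f"
  using tangent_scale[of f "-1"] by simp

lemma tangent_sum:
  assumes "\<And>i. i \<in> I \<Longrightarrow> smooth_fun M (f i)"
  shows "v (\<lambda>x. \<Sum>i\<in>I. f i x) = (\<Sum>i\<in>I. v (f i))"
  using assms
proof (induction I rule: infinite_finite_induct)
  case (insert i I)
  have "v (\<lambda>x. f i x + (\<Sum>i\<in>I. f i x)) = v (f i) + v (\<lambda>x. \<Sum>i\<in>I. f i x)"
    using insert by (intro tangent_add smooth_fun_sum[OF M]) auto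
  then show ?case using insert by simp
qed (simp_all add: tangent_const)

text \<open>Derivations depend on germs only: c (f - h) vanishes on the carrier, and the Leibniz
  rule at \<open>p\<close> turns this into c(p) v(f - h) = 0.\<close>

lemma tangent_local:
  assumes p: "p \<in> carrier M" and f: "smooth_fun M f" "smooth_fun M h" and c: "smooth_fun M c" "c p \<noteq> 0"
    and eq: "\<And>x. x \<in> carrier M \<Longrightarrow> c x \<noteq> 0 \<Longrightarrow> f x = h x"
  shows "v f = v h"
proof -
  \<comment> \<open>Functions are total, so vanishing on the carrier does not make c (f - h) the
    zero function. It is however unchanged by the factor \<open>u\<close>; both factors vanish at
    \<open>p\<close>, so the Leibniz rule kills the product.\<close>
  define u where "u x = (if x \<in> carrier M then 0 else 1 :: real)" for x
  have u: "smooth_fun M u" by (rule smooth_fun_cong[OF M _ smooth_fun_const[OF M, of 0]]) (simp add: u_def)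
  have d: "smooth_fun M (\<lambda>x. f x - h x)" by (rule smooth_fun_diff[OF M f])
  have cd: "smooth_fun M (\<lambda>x. c x * (f x - h x))" by (rule smooth_fun_mult[OF M c(1) d])
  have "(\<lambda>x. c x * (f x - h x)) = (\<lambda>x. u x * (c x * (f x - h x)))" using eq by (auto simp: u_def fun_eq_iff)
  then have "v (\<lambda>x. c x * (f x - h x)) = v (\<lambda>x. u x * (c x * (f x - h x)))" by (rule arg_cong)
  also have "\<dots> = 0" using tangent_mult[OF u cd] p eq[OF p c(2)] by (simp add: u_def)
  finally have "v (\<lambda>x. c x * (f x - h x)) = 0" .
  then have "c p * v (\<lambda>x. f x - h x) = 0" using tangent_mult[OF c(1) d] eq[OF p c(2)] by simp
  then show ?thesis using c(2) tangent_diff[OF f] by simp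
qed

text \<open>The case of the constant cut-off 1; it discards the irrelevant values off the
  carrier.\<close>

lemma tangent_cong:
  assumes "p \<in> carrier M" "smooth_fun M h" "\<And>x. x \<in> carrier M \<Longrightarrow> f x = h x"
  shows "v f = v h"
  by (rule tangent_local[OF assms(1) smooth_fun_cong[OF M assms(3,2)] assms(2) smooth_fun_const[OF M, of 1]])
    (use assms in auto)

end

lemma tangent_spaceI:
  assumes "\<And>f. \<not> smooth_fun M f \<Longrightarrow> v f = 0"
    "\<And>f h a b. smooth_fun M f \<Longrightarrow> smooth_fun M h \<Longrightarrow> v (\<lambda>x. a * f x + b * h x) = a * v f + b * v h"
    "\<And>f h. smooth_fun M f \<Longrightarrow> smooth_fun M h \<Longrightarrow> v (\<lambda>x. f x * h x) = v f * h p + f p * v h"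
  shows "v \<in> tangent_space M p"
  using assms unfolding tangent_space_def by blast

lemma tangent_lincomb:
  assumes M: "smooth_atlas M" and v: "\<And>i. i \<in> I \<Longrightarrow> v i \<in> tangent_space M p"
  shows "(\<lambda>f. \<Sum>i\<in>I. c i * v i f) \<in> tangent_space M p"
proof (rule tangent_spaceI)
  show "(\<Sum>i\<in>I. c i * v i f) = 0" if "\<not> smooth_fun M f" for f
    using tangent_nonsmooth[OF M v that] by (auto intro!: sum.neutral)
  fix f h assume fh: "smooth_fun M f" "smooth_fun M h"
  show "(\<Sum>i\<in>I. c i * v i (\<lambda>x. a * f x + b * h x)) = a * (\<Sum>i\<in>I. c i * v i f) + b * (\<Sum>i\<in>I. c i * v i h)" for a b
    using tangent_linear[OF M v fh] by (simp add: sum_distrib_left sum.distrib[symmetric] algebra_simps)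
  show "(\<Sum>i\<in>I. c i * v i (\<lambda>x. f x * h x)) = (\<Sum>i\<in>I. c i * v i f) * h p + f p * (\<Sum>i\<in>I. c i * v i h)"
    using tangent_mult[OF M v fh]
    by (simp add: sum_distrib_left sum_distrib_right sum.distrib[symmetric] algebra_simps)
qed

lemma tangent_lincomb2:
  assumes M: "smooth_atlas M" and v: "v \<in> tangent_space M p" "w \<in> tangent_space M p"
  shows "(\<lambda>f. a * v f + b * w f) \<in> tangent_space M p"
proof -
  have "(\<lambda>f. \<Sum>i\<in>{True, False}. (if i then a else b) * (if i then v else w) f) \<in> tangent_space M p"
    by (rule tangent_lincomb[OF M]) (use v in auto)
  then show ?thesis by simp
qed

lemma bivectorsE:
  assumes "B \<in> bivectors M p"
  obtains k v w where "B = (\<lambda>f h. \<Sum>i<(k::nat). wedge (v i) (w i) f h)"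
    "\<And>i. i < k \<Longrightarrow> v i \<in> tangent_space M p" "\<And>i. i < k \<Longrightarrow> w i \<in> tangent_space M p"
  using assms unfolding bivectors_def by blast

lemma bivectorsI:
  "(\<And>i. i < k \<Longrightarrow> v i \<in> tangent_space M p) \<Longrightarrow> (\<And>i. i < k \<Longrightarrow> w i \<in> tangent_space M p) \<Longrightarrow>
    (\<lambda>f h. \<Sum>i<(k::nat). wedge (v i) (w i) f h) \<in> bivectors M p"
  unfolding bivectors_def by blast

lemma bivectors_antisym: "B \<in> bivectors M p \<Longrightarrow> B f h = - B h f"
  by (erule bivectorsE) (simp add: wedge_def sum_negf[symmetric] algebra_simps)

lemma bivectors_tangent_right:
  assumes M: "smooth_atlas M" and B: "B \<in> bivectors M p"
  shows "B f \<in> tangent_space M p"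
proof -
  obtain k v w where k: "B = (\<lambda>f h. \<Sum>i<(k::nat). wedge (v i) (w i) f h)"
    and v: "\<And>i. i < k \<Longrightarrow> v i \<in> tangent_space M p" and w: "\<And>i. i < k \<Longrightarrow> w i \<in> tangent_space M p"
    by (rule bivectorsE[OF B]) (rule that, assumption, blast, blast)
  have "(\<lambda>h. 1 * (\<Sum>i<k. v i f * w i h) + (-1) * (\<Sum>i<k. w i f * v i h)) \<in> tangent_space M p"
    by (rule tangent_lincomb2[OF M tangent_lincomb[OF M] tangent_lincomb[OF M]]) (use v w in auto)
  moreover have "B f = (\<lambda>h. 1 * (\<Sum>i<k. v i f * w i h) + (-1) * (\<Sum>i<k. w i f * v i h))"
    unfolding k wedge_def by (simp add: fun_eq_iff sum_subtractf mult.commute)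
  ultimately show ?thesis by simp
qed

lemma bivectors_tangent_left:
  assumes M: "smooth_atlas M" and B: "B \<in> bivectors M p"
  shows "(\<lambda>h. B h f) \<in> tangent_space M p"
proof -
  have "B h f = (-1) * B f h + 0 * B f h" for h using bivectors_antisym[OF B, of h f] by simp
  then have "(\<lambda>h. B h f) = (\<lambda>h. (-1) * B f h + 0 * B f h)" by (rule ext)
  then show ?thesis using tangent_lincomb2[OF M, of "B f" p "B f" "-1" 0] bivectors_tangent_right[OF M B] by simp
qed

lemma bivectors_add:
  assumes "B \<in> bivectors M p" "C \<in> bivectors M p"
  shows "(\<lambda>f h. B f h + C f h) \<in> bivectors M p"
proof -
  obtain k v w where k: "B = (\<lambda>f h. \<Sum>i<(k::nat). wedge (v i) (w i) f h)"
    and v: "\<And>i. i < k \<Longrightarrow> v i \<in> tangent_space M p" "\<And>i. i < k \<Longrightarrow> w i \<in> tangent_space M p"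
    by (rule bivectorsE[OF assms(1)]) (rule that, assumption, blast, blast)
  obtain l v' w' where l: "C = (\<lambda>f h. \<Sum>i<(l::nat). wedge (v' i) (w' i) f h)"
    and v': "\<And>i. i < l \<Longrightarrow> v' i \<in> tangent_space M p" "\<And>i. i < l \<Longrightarrow> w' i \<in> tangent_space M p"
    by (rule bivectorsE[OF assms(2)]) (rule that, assumption, blast, blast)
  let ?v = "\<lambda>i. if i < k then v i else v' (i - k)" and ?w = "\<lambda>i. if i < k then w i else w' (i - k)"
  have "(\<lambda>f h. \<Sum>i<k + l. wedge (?v i) (?w i) f h) \<in> bivectors M p"
    by (rule bivectorsI) (use v v' in auto)
  moreover have "(\<Sum>i<k + l. wedge (?v i) (?w i) f h) = B f h + C f h" for f h
  proof -
    have "(\<Sum>i<k + l. wedge (?v i) (?w i) f h) = (\<Sum>i<k. wedge (?v i) (?w i) f h) + (\<Sum>i<l. wedge (?v (i + k)) (?w (i + k)) f h)"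
      unfolding lessThan_atLeast0 using sum.atLeastLessThan_concat[of 0 k "k + l" "\<lambda>i. wedge (?v i) (?w i) f h"]
        sum.shift_bounds_nat_ivl[of "\<lambda>i. wedge (?v i) (?w i) f h" 0 k l] by (simp add: add.commute)
    then show ?thesis by (simp add: k l)
  qed
  ultimately show ?thesis by simp
qed

lemma bivectors_wedge:
  assumes "v \<in> tangent_space M p" "w \<in> tangent_space M p"
  shows "wedge v w \<in> bivectors M p"
  using bivectorsI[of 1 "\<lambda>_. v" M p "\<lambda>_. w"] assms by (simp add: fun_eq_iff)

lemma bivectors_scale:
  assumes M: "smooth_atlas M" and B: "B \<in> bivectors M p"
  shows "(\<lambda>f h. c * B f h) \<in> bivectors M p"
proof -
  obtain k v w where k: "B = (\<lambda>f h. \<Sum>i<(k::nat). wedge (v i) (w i) f h)"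
    and v: "\<And>i. i < k \<Longrightarrow> v i \<in> tangent_space M p" "\<And>i. i < k \<Longrightarrow> w i \<in> tangent_space M p"
    by (rule bivectorsE[OF B]) (rule that, assumption, blast, blast)
  have "(\<lambda>f h. \<Sum>i<k. wedge (\<lambda>f. c * v i f + 0 * v i f) (w i) f h) \<in> bivectors M p"
    by (rule bivectorsI[OF tangent_lincomb2[OF M]]) (use v in auto)
  then show ?thesis unfolding k by (simp add: wedge_def sum_distrib_left algebra_simps)
qed

subsection \<open>Cut-off functions\<close>

text \<open>The Hausdorff property enters here: \<open>K\<close>, a compact ball read in a chart, is
  closed in the manifold, so extending by 0 outside the chart stays smooth. \<open>K\<close> is
  returned so that products with functions given only over \<open>N\<close> can be extended by 0
  too.\<close>

lemma base_bump:
  fixes Q :: "('q, 'b::euclidean_space) atlas"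
  assumes Q: "smooth_atlas Q" and H: "Hausdorff_space (mtopology Q)"
    and N: "openin (mtopology Q) N" "q \<in> N"
  obtains c K where "smooth_fun Q c" "c q = 1" "K \<subseteq> N" "openin (mtopology Q) (carrier Q - K)" "\<And>x. x \<notin> K \<Longrightarrow> c x = 0"
proof -
  have "q \<in> carrier Q" using openin_subset[OF N(1)] N(2) by (auto simp: topspace_mtopology)
  then obtain U \<phi> where U: "(U, \<phi>) \<in> Q" "q \<in> U" by (rule carrierE)
  note inj = smooth_atlasD(1)[OF Q U(1)]
  obtain V where V: "subspace V" "openin (top_of_set V) (\<phi> ` U)" using smooth_atlasD(2)[OF Q U(1)] by blast
  obtain T where T: "open T" "U \<inter> N = U \<inter> \<phi> -` T" using openin_mtopologyD[OF N(1) U(1)] by blast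
  obtain T' where T': "open T'" "\<phi> ` U = V \<inter> T'" using V(2) by (auto simp: openin_open)
  have "\<phi> q \<in> T \<inter> T'" using T T' U N by blast
  moreover have "open (T \<inter> T')" using T T' by blast
  ultimately obtain e where e: "e > 0" "cball (\<phi> q) e \<subseteq> T \<inter> T'" using open_contains_cball by metis
  define K where "K = inv_into U \<phi> ` (V \<inter> cball (\<phi> q) e)"
  have sub: "V \<inter> cball (\<phi> q) e \<subseteq> \<phi> ` U" using e T' by blast
  have K_eq: "K = U \<inter> \<phi> -` cball (\<phi> q) e"
  proof
    show "K \<subseteq> U \<inter> \<phi> -` cball (\<phi> q) e"
    proof
      fix x assume "x \<in> K"
      then obtain z where z: "z \<in> V \<inter> cball (\<phi> q) e" "x = inv_into U \<phi> z" unfolding K_def by blast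
      then have "z \<in> \<phi> ` U" using sub by blast
      then show "x \<in> U \<inter> \<phi> -` cball (\<phi> q) e" using z by (simp add: inv_into_into f_inv_into_f)
    qed
    show "U \<inter> \<phi> -` cball (\<phi> q) e \<subseteq> K"
    proof
      fix x assume x: "x \<in> U \<inter> \<phi> -` cball (\<phi> q) e"
      then have "\<phi> x \<in> V \<inter> cball (\<phi> q) e" using T'(2) by blast
      moreover have "x = inv_into U \<phi> (\<phi> x)" using x inj by simp
      ultimately show "x \<in> K" unfolding K_def by blast
    qed
  qed
  have "continuous_map (top_of_set (\<phi> ` U)) (mtopology Q) (inv_into U \<phi>)"
    unfolding continuous_map_def topspace_mtopology
  proof (intro conjI allI impI)
    show "inv_into U \<phi> \<in> topspace (top_of_set (\<phi> ` U)) \<rightarrow> carrier Q"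
      using U by (auto intro!: carrierI simp: inv_into_into)
    fix X assume "openin (mtopology Q) X"
    then obtain Y where Y: "open Y" "U \<inter> X = U \<inter> \<phi> -` Y" using openin_mtopologyD[OF _ U(1)] by blast
    have "{x \<in> topspace (top_of_set (\<phi> ` U)). inv_into U \<phi> x \<in> X} = \<phi> ` U \<inter> Y"
      using Y(2) inj by auto
    then show "openin (top_of_set (\<phi> ` U)) {x \<in> topspace (top_of_set (\<phi> ` U)). inv_into U \<phi> x \<in> X}"
      using Y(1) by (auto simp: openin_open)
  qed
  \<comment> \<open>A linear subspace of a Euclidean space is closed, so its trace on the closed
    ball is compact.\<close>
  moreover have "compactin (top_of_set (\<phi> ` U)) (V \<inter> cball (\<phi> q) e)"
    using sub V(1) by (simp add: compactin_subtopology closed_subspace closed_Int_compact)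
  ultimately have "compactin (mtopology Q) K" unfolding K_def by (rule image_compactin[rotated])
  then have "closedin (mtopology Q) K" using compactin_imp_closedin[OF H] by blast
  then have K_open: "openin (mtopology Q) (carrier Q - K)" by (simp add: closedin_def topspace_mtopology)
  define c where "c x = (if x \<in> U then bump e (\<phi> q) (\<phi> x) else 0)" for x
  have c0: "c x = 0" if "x \<notin> K" for x
    using that e(1) unfolding c_def K_eq by (auto intro!: bump_eq_0 simp: dist_commute)
  have "smooth_near Q c x" if x: "x \<in> carrier Q" for x
  proof (cases "x \<in> U")
    case True
    have "smooth_in U \<phi> c x"
      by (rule smooth_in_compose[OF smooth_in_chart open_UNIV UNIV_I _ True]) (auto simp: c_def Ck_on_bump)
    then show ?thesis using U True by (blast intro: smooth_nearI)
  next
    case False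
    then have "x \<in> carrier Q - K" using x K_eq by blast
    then show ?thesis
      by (rule smooth_near_cong[OF smooth_near_const[OF x] K_open]) (use c0 in auto)
  qed
  then have "smooth_fun Q c" by (simp add: smooth_fun_iff[OF Q])
  moreover have "c q = 1" using U e by (simp add: c_def bump_center)
  moreover have "K \<subseteq> N" using K_eq T e by blast
  ultimately show thesis using that K_open c0 by blast
qed

lemma Ck_on_Un:
  assumes "open S" "open T" "Ck_on k S f" "Ck_on k T f"
  shows "Ck_on k (S \<union> T) f"
  using assms(3,4) by (induction k arbitrary: f) (auto intro: continuous_on_open_Un assms)

text \<open>Extends a function from a ball to the whole space: the product is 0 off the closed ball
  of radius \<open>d\<close>, and \<open>d < e\<close> makes the two open sets cover.\<close>

lemma Cinf_on_bump_mult: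
  fixes g :: "'a::euclidean_space \<Rightarrow> real"
  assumes "0 < d" "d < e" "Cinf_on (ball z0 e) g"
  shows "Cinf_on UNIV (\<lambda>z. bump d z0 z * g z)"
proof
  fix k
  have "Ck_on k (ball z0 e) (\<lambda>z. bump d z0 z * g z)"
    using assms(3) by (intro Ck_on_mult Ck_on_subset[OF Ck_on_bump]) auto
  moreover have "Ck_on k (- cball z0 d) (\<lambda>z. bump d z0 z * g z)"
    by (rule Ck_on_cong[OF _ _ Ck_on_const[of _ _ 0]])
      (use assms(1) bump_eq_0[of d _ z0] in \<open>auto simp: dist_commute open_Compl\<close>)
  moreover have "ball z0 e \<union> - cball z0 d = UNIV" using assms by auto
  ultimately show "Ck_on k UNIV (\<lambda>z. bump d z0 z * g z)"
    using Ck_on_Un[of "ball z0 e" "- cball z0 d"] by (simp add: open_Compl)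
qed


section \<open>The dual bundle as a manifold\<close>

text \<open>The typical fibre is only a subspace of \<open>'f\<close>, and \<open>Basis\<close> need
  not lie in it; orthonormal bases of the subspace take its place.\<close>

lemma orthonormal_expansion:
  fixes B :: "'f::euclidean_space set"
  assumes "pairwise orthogonal B" "\<And>b. b \<in> B \<Longrightarrow> norm b = 1" "finite B" "v \<in> span B"
  shows "(\<Sum>b\<in>B. (v \<bullet> b) *\<^sub>R b) = v"
proof -
  obtain c where c: "v = (\<Sum>b\<in>B. c b *\<^sub>R b)" using assms(3,4) by (auto simp: span_finite)
  have "v \<bullet> b = c b" if b: "b \<in> B" for b
  proof -
    have "v \<bullet> b = (\<Sum>a\<in>B. c a * (a \<bullet> b))" by (simp add: c inner_sum_left)
    also have "\<dots> = (\<Sum>a\<in>B. if a = b then c b else 0)"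
    proof (rule sum.cong[OF refl])
      fix a assume a: "a \<in> B"
      show "c a * (a \<bullet> b) = (if a = b then c b else 0)"
        using assms(1,2) a b by (auto simp: pairwise_def orthogonal_def dot_square_norm)
    qed
    finally show ?thesis using assms(3) b by simp
  qed
  then show ?thesis using c by simp
qed

text \<open>Stated for functions linear on \<open>F\<close> alone: covectors and metrics read
  through a trivialization have no controlled values elsewhere.\<close>

lemma linear_on_sum:
  fixes h :: "'f::real_vector \<Rightarrow> real"
  assumes subspace_F: "subspace F" and add: "\<And>v w. v \<in> F \<Longrightarrow> w \<in> F \<Longrightarrow> h (v + w) = h v + h w"
    and scale: "\<And>c v. v \<in> F \<Longrightarrow> h (c *\<^sub>R v) = c * h v" and B: "finite B" "\<And>b. b \<in> B \<Longrightarrow> u b \<in> F"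
  shows "h (\<Sum>b\<in>B. c b *\<^sub>R u b) = (\<Sum>b\<in>B. c b * h (u b))"
  using B
proof (induction B rule: finite_induct)
  case empty
  show ?case using scale[OF subspace_0[OF subspace_F], of 0] by simp
next
  case (insert b B)
  have "(\<Sum>b\<in>B. c b *\<^sub>R u b) \<in> F" using insert subspace_F by (auto intro!: subspace_sum subspace_scale)
  moreover have "c b *\<^sub>R u b \<in> F" using insert subspace_F by (auto intro!: subspace_scale)
  ultimately show ?case using insert add scale by simp
qed

text \<open>The inverse of the trivialization, inverted over exactly the set that
  \<open>diffeomorphism\<close> uses, so that the smoothness clause of \<open>local_triv\<close>
  applies to it.\<close>

definition lift :: "('q, 'a, 'b::euclidean_space, 'e::euclidean_space, 'f::euclidean_space) vbundle \<Rightarrow>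
    'q set \<Rightarrow> ('a \<Rightarrow> 'q \<times> 'f) \<Rightarrow> 'q \<Rightarrow> 'f \<Rightarrow> 'a" where
  "lift A U \<theta> q v = inv_into (carrier (open_atlas (total A) (proj A -` U))) \<theta> (q, v)"

text \<open>The fibre component of the charts in \<open>dual_atlas\<close>, split off because it
  does not depend on the chart of the base.\<close>

definition coord :: "('q, 'a, 'b::euclidean_space, 'e::euclidean_space, 'f::euclidean_space) vbundle \<Rightarrow>
    ('a \<Rightarrow> 'q \<times> 'f) \<Rightarrow> 'q \<times> ('a \<Rightarrow> real) \<Rightarrow> 'f" where
  "coord A \<theta> x = (THE y. y \<in> typ_fibre A \<and> (\<forall>a\<in>fibre A (fst x). snd x a = y \<bullet> snd (\<theta> a)))"

text \<open>Inverse of \<open>coord\<close> over \<open>q\<close>; the value 0 off the fibre is the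
  one that \<open>dual_set\<close> demands.\<close>

definition covec :: "('q, 'a, 'b::euclidean_space, 'e::euclidean_space, 'f::euclidean_space) vbundle \<Rightarrow>
    ('a \<Rightarrow> 'q \<times> 'f) \<Rightarrow> 'q \<Rightarrow> 'f \<Rightarrow> 'q \<times> ('a \<Rightarrow> real)" where
  "covec A \<theta> q y = (q, \<lambda>a. if a \<in> fibre A q then y \<bullet> snd (\<theta> a) else 0)"

lemma fst_covec [simp]: "fst (covec A \<theta> q y) = q"
  by (simp add: covec_def)

lemma fst_dilation [simp]: "fst (dilation c x) = fst x"
  by (simp add: dilation_def case_prod_beta)

lemma snd_dilation: "snd (dilation c x) = (\<lambda>a. c * snd x a)"
  by (simp add: dilation_def case_prod_beta)

lemma dilation_dilation: "dilation c (dilation d x) = dilation (c * d) x"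
  by (simp add: dilation_def case_prod_beta mult.assoc)

lemma dilation_1 [simp]: "dilation 1 x = x"
  by (simp add: dilation_def)

locale vbundle_setup =
  fixes A :: "('q, 'a, 'b::euclidean_space, 'e::euclidean_space, 'f::euclidean_space) vbundle"
    and n :: nat
  assumes vb: "vector_bundle n A"
begin

abbreviation "F \<equiv> typ_fibre A"
abbreviation "Q \<equiv> base A"
abbreviation "M \<equiv> dual_atlas A"

lemma subspace_F: "subspace F" and smooth_Q: "smooth_atlas Q" and smooth_total: "smooth_atlas (total A)"
  and Hausdorff: "Hausdorff_space (mtopology Q)"
  using vb unfolding vector_bundle_def manifold_def by auto

lemma base_chart_dim: "(U, \<phi>) \<in> Q \<Longrightarrow> \<exists>V. subspace V \<and> dim V = n \<and> openin (top_of_set V) (\<phi> ` U)"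
  using vb unfolding vector_bundle_def manifold_def by blast

lemma proj_smooth: "smooth_map (total A) Q (proj A)"
  using vb unfolding vector_bundle_def by blast

lemma fibre_closed:
  assumes "q \<in> carrier Q" "a \<in> fibre A q"
  shows "b \<in> fibre A q \<Longrightarrow> fadd A a b \<in> fibre A q" "fscale A c a \<in> fibre A q"
  using vb assms unfolding vector_bundle_def by blast+

lemma ex_triv:
  assumes "q \<in> carrier Q" obtains U \<theta> where "local_triv A U \<theta>" "q \<in> U"
  using vb assms unfolding vector_bundle_def by blast

section \<open>Fibre coordinates over one local trivialization\<close>

context
  fixes U \<theta> assumes triv: "local_triv A U \<theta>"
begin

lemma U_open: "openin (mtopology Q) U"
  using triv unfolding local_triv_def by blast

lemma U_sub: "q \<in> U \<Longrightarrow> q \<in> carrier Q"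
  using openin_subset[OF U_open] by (auto simp: topspace_mtopology)

lemma triv_bij: "bij_betw \<theta> (carrier (total A) \<inter> proj A -` U) (U \<times> F)"
proof -
  have "carrier Q \<inter> U = U" using U_sub by blast
  then show ?thesis
    using triv unfolding local_triv_def diffeomorphism_def by (simp add: carrier_open_atlas carrier_prod_atlas)
qed

lemma triv_fst: "q \<in> U \<Longrightarrow> a \<in> fibre A q \<Longrightarrow> fst (\<theta> a) = q"
  and triv_add: "q \<in> U \<Longrightarrow> a \<in> fibre A q \<Longrightarrow> b \<in> fibre A q \<Longrightarrow> snd (\<theta> (fadd A a b)) = snd (\<theta> a) + snd (\<theta> b)"
  and triv_scale: "q \<in> U \<Longrightarrow> a \<in> fibre A q \<Longrightarrow> snd (\<theta> (fscale A c a)) = c *\<^sub>R snd (\<theta> a)"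
  using triv unfolding local_triv_def by blast+

lemma fibre_dom: "q \<in> U \<Longrightarrow> a \<in> fibre A q \<Longrightarrow> a \<in> carrier (total A) \<inter> proj A -` U"
  unfolding fibre_def by auto

lemma triv_snd: "q \<in> U \<Longrightarrow> a \<in> fibre A q \<Longrightarrow> snd (\<theta> a) \<in> F"
  using bij_betwE[OF triv_bij] fibre_dom by (metis mem_Sigma_iff prod.collapse)

lemma lift_eq: "lift A U \<theta> q v = inv_into (carrier (total A) \<inter> proj A -` U) \<theta> (q, v)"
  unfolding lift_def carrier_open_atlas ..

lemma
  assumes "q \<in> U" "v \<in> F"
  shows lift_fibre: "lift A U \<theta> q v \<in> fibre A q" and triv_lift: "\<theta> (lift A U \<theta> q v) = (q, v)"
proof -
  have im: "(q, v) \<in> \<theta> ` (carrier (total A) \<inter> proj A -` U)"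
    using assms bij_betw_imp_surj_on[OF triv_bij] by auto
  show eq: "\<theta> (lift A U \<theta> q v) = (q, v)" unfolding lift_eq using im by (rule f_inv_into_f)
  have d: "lift A U \<theta> q v \<in> carrier (total A) \<inter> proj A -` U" unfolding lift_eq using im by (rule inv_into_into)
  then have "lift A U \<theta> q v \<in> fibre A (proj A (lift A U \<theta> q v))" "proj A (lift A U \<theta> q v) \<in> U"
    unfolding fibre_def by auto
  then show "lift A U \<theta> q v \<in> fibre A q" using triv_fst eq by (metis fst_conv)
qed

lemma lift_triv: "q \<in> U \<Longrightarrow> a \<in> fibre A q \<Longrightarrow> lift A U \<theta> q (snd (\<theta> a)) = a"
  unfolding lift_eq using bij_betw_imp_inj_on[OF triv_bij] fibre_dom[of q a] triv_fst[of q a]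
  by (metis inv_into_f_f prod.collapse)

lemma triv_inj: "q \<in> U \<Longrightarrow> a \<in> fibre A q \<Longrightarrow> b \<in> fibre A q \<Longrightarrow> snd (\<theta> a) = snd (\<theta> b) \<Longrightarrow> a = b"
  using lift_triv by metis

lemma lift_add:
  assumes "q \<in> U" "v \<in> F" "w \<in> F"
  shows "lift A U \<theta> q (v + w) = fadd A (lift A U \<theta> q v) (lift A U \<theta> q w)"
  using assms U_sub lift_fibre triv_lift triv_add fibre_closed subspace_add[OF subspace_F]
  by (intro triv_inj[OF assms(1)]) auto

lemma lift_scale:
  assumes "q \<in> U" "v \<in> F"
  shows "lift A U \<theta> q (c *\<^sub>R v) = fscale A c (lift A U \<theta> q v)"
  using assms U_sub lift_fibre triv_lift triv_scale fibre_closed subspace_scale[OF subspace_F]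
  by (intro triv_inj[OF assms(1)]) auto

lemma E_open: "openin (mtopology (total A)) (carrier (total A) \<inter> proj A -` U)"
proof -
  have "{a \<in> carrier (total A). proj A a \<in> U} = carrier (total A) \<inter> proj A -` U" by blast
  then show ?thesis using smooth_map_open[OF proj_smooth U_open] by simp
qed

lemma
  shows triv_smooth: "smooth_map (open_atlas (total A) (carrier (total A) \<inter> proj A -` U))
      (prod_atlas (open_atlas Q U) (linear_atlas F)) \<theta>"
    and triv_inv_smooth: "smooth_map (prod_atlas (open_atlas Q U) (linear_atlas F))
      (open_atlas (total A) (carrier (total A) \<inter> proj A -` U)) (\<lambda>(q, v). lift A U \<theta> q v)"
proof -
  have "(\<lambda>(q, v). lift A U \<theta> q v) = inv_into (carrier (open_atlas (total A) (proj A -` U))) \<theta>"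
    by (auto simp: lift_def)
  then show "smooth_map (open_atlas (total A) (carrier (total A) \<inter> proj A -` U))
      (prod_atlas (open_atlas Q U) (linear_atlas F)) \<theta>"
    "smooth_map (prod_atlas (open_atlas Q U) (linear_atlas F))
      (open_atlas (total A) (carrier (total A) \<inter> proj A -` U)) (\<lambda>(q, v). lift A U \<theta> q v)"
    using triv unfolding local_triv_def diffeomorphism_def open_atlas_Int_carrier by simp_all
qed

lemma smooth_QU: "smooth_atlas (open_atlas Q U)"
  by (rule smooth_atlas_open[OF smooth_Q U_open])

lemma carrier_QU: "carrier (open_atlas Q U) = U"
  using U_sub by (auto simp: carrier_open_atlas)

lemma lift_smooth:
  assumes v: "v \<in> F"
  shows "smooth_map (open_atlas Q U) (total A) (\<lambda>q. lift A U \<theta> q v)"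
proof -
  have L: "smooth_atlas (linear_atlas F)" by (rule smooth_atlas_linear[OF subspace_F])
  have "smooth_map (open_atlas Q U) (prod_atlas (open_atlas Q U) (linear_atlas F)) (\<lambda>q. (q, v))"
  proof (rule smooth_mapI[OF smooth_QU smooth_atlas_prod[OF smooth_QU L]])
    fix q assume q: "q \<in> carrier (open_atlas Q U)"
    then obtain C \<phi> where C: "(C, \<phi>) \<in> open_atlas Q U" "q \<in> C" by (rule carrierE)
    have p: "(C \<times> F, map_prod \<phi> (\<lambda>x. x)) \<in> prod_atlas (open_atlas Q U) (linear_atlas F)"
      by (rule prod_atlasI[OF C(1)]) (simp add: linear_atlas_def)
    have "smooth_near (open_atlas Q U) (\<lambda>q. (\<phi> q, v)) q"
      by (intro smooth_near_Pair[OF smooth_QU] smooth_near_const[OF q] smooth_nearI[OF C smooth_in_chart])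
    then have "smooth_near (open_atlas Q U) (\<lambda>q. map_prod \<phi> (\<lambda>x. x) (q, v)) q" by simp
    then show "\<exists>V \<psi> W. (V, \<psi>) \<in> prod_atlas (open_atlas Q U) (linear_atlas F) \<and> openin (mtopology (open_atlas Q U)) W
      \<and> q \<in> W \<and> (\<lambda>q. (q, v)) ` W \<subseteq> V \<and> smooth_near (open_atlas Q U) (\<lambda>x. \<psi> (x, v)) q"
      using p C v openin_chart[OF smooth_QU C(1)]
      by (intro exI[of _ "C \<times> F"] exI[of _ "map_prod \<phi> (\<lambda>x. x)"] exI[of _ C]) auto
  qed
  from smooth_map_compose[OF smooth_QU smooth_atlas_prod[OF smooth_QU L] smooth_atlas_open[OF smooth_total E_open] this triv_inv_smooth]
  have "smooth_map (open_atlas Q U) (open_atlas (total A) (carrier (total A) \<inter> proj A -` U)) (\<lambda>q. lift A U \<theta> q v)"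
    by simp
  from smooth_map_compose[OF smooth_QU smooth_atlas_open[OF smooth_total E_open] smooth_total this smooth_map_open_inclusion[OF smooth_total E_open]]
  show ?thesis .
qed

lemma triv_snd_smooth:
  assumes "q \<in> U" "a \<in> fibre A q"
  shows "smooth_near (total A) (\<lambda>a. snd (\<theta> a)) a"
proof -
  have L: "smooth_atlas (linear_atlas F)" by (rule smooth_atlas_linear[OF subspace_F])
  note a = fibre_dom[OF assms]
  have c: "a \<in> carrier (open_atlas (total A) (carrier (total A) \<inter> proj A -` U))"
    using a by (simp add: carrier_open_atlas)
  have "smooth_near (linear_atlas F) (\<lambda>x. x) (snd (\<theta> a))"
    by (rule smooth_nearI[of F "\<lambda>x. x"]) (use triv_snd[OF assms] in \<open>auto simp: linear_atlas_def smooth_in_chart\<close>)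
  then have "smooth_near (prod_atlas (open_atlas Q U) (linear_atlas F)) (\<lambda>z. snd z) (\<theta> a)"
    by (rule smooth_near_snd) (use triv_fst[OF assms] assms(1) in \<open>simp add: carrier_QU\<close>)
  from smooth_near_map[OF smooth_atlas_open[OF smooth_total E_open] smooth_atlas_prod[OF smooth_QU L] triv_smooth this c]
  show ?thesis by (rule smooth_near_open_atlas[OF smooth_total E_open a, THEN iffD1])
qed

text \<open>Riesz representation on \<open>F\<close>: the coordinate is built from the values of the
  covector on an orthonormal basis, and it is unique because the difference of two candidates lies
  in \<open>F\<close> and is orthogonal to itself. This makes the description in
  \<open>coord\<close> well defined.\<close>

lemma coordI:
  assumes x: "x \<in> dual_set A" "fst x \<in> U"
  shows "coord A \<theta> x \<in> F \<and> (\<forall>a\<in>fibre A (fst x). snd x a = coord A \<theta> x \<bullet> snd (\<theta> a))"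
    and coord_eqI: "\<And>y. y \<in> F \<Longrightarrow> (\<And>v. v \<in> F \<Longrightarrow> snd x (lift A U \<theta> (fst x) v) = y \<bullet> v) \<Longrightarrow> coord A \<theta> x = y"
proof -
  define q where "q = fst x"
  have q: "q \<in> U" "q \<in> carrier Q" using x U_sub unfolding q_def by auto
  obtain B where B: "B \<subseteq> F" "pairwise orthogonal B" "\<And>b. b \<in> B \<Longrightarrow> norm b = 1" "independent B" "span B = F"
    using orthonormal_basis_subspace[OF subspace_F] by metis
  have fin: "finite B" using B(4) by (rule independent_imp_finite)
  have al_add: "snd x (fadd A a b) = snd x a + snd x b" if "a \<in> fibre A q" "b \<in> fibre A q" for a b
    using x that unfolding dual_set_def q_def by auto
  have al_scale: "snd x (fscale A c a) = c * snd x a" if "a \<in> fibre A q" for a c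
    using x that unfolding dual_set_def q_def by auto
  define h where "h v = snd x (lift A U \<theta> q v)" for v
  define y where "y = (\<Sum>b\<in>B. h b *\<^sub>R b)"
  have y: "y \<in> F" unfolding y_def using B(1) subspace_F by (auto intro!: subspace_sum subspace_scale)
  have h: "h v = y \<bullet> v" if v: "v \<in> F" for v
  proof -
    have "h v = h (\<Sum>b\<in>B. (v \<bullet> b) *\<^sub>R b)" using orthonormal_expansion[OF B(2,3) fin] v B(5) by simp
    also have "\<dots> = (\<Sum>b\<in>B. (v \<bullet> b) * h b)"
    proof (rule linear_on_sum[OF subspace_F _ _ fin])
      show "h (v + w) = h v + h w" if "v \<in> F" "w \<in> F" for v w
        unfolding h_def lift_add[OF q(1) that] using lift_fibre[OF q(1)] that by (simp add: al_add)
      show "h (c *\<^sub>R v) = c * h v" if "v \<in> F" for c v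
        unfolding h_def lift_scale[OF q(1) that] using lift_fibre[OF q(1)] that by (simp add: al_scale)
    qed (use B in auto)
    also have "\<dots> = y \<bullet> v" unfolding y_def inner_sum_left inner_scaleR_left
      by (intro sum.cong refl) (simp only: inner_commute mult.commute)
    finally show ?thesis .
  qed
  have ex: "y \<in> F \<and> (\<forall>a\<in>fibre A (fst x). snd x a = y \<bullet> snd (\<theta> a))"
    using y h[OF triv_snd[OF q(1)]] lift_triv[OF q(1)] unfolding h_def q_def by simp
  have un: "z = y" if z: "z \<in> F" "\<And>v. v \<in> F \<Longrightarrow> h v = z \<bullet> v" for z
  proof -
    have "z - y \<in> F" using z(1) y subspace_F by (simp add: subspace_diff)
    then have "(z - y) \<bullet> (z - y) = 0" using z(2) h by (simp add: inner_diff_left)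
    then show ?thesis by simp
  qed
  have un': "z = y" if z: "z \<in> F \<and> (\<forall>a\<in>fibre A (fst x). snd x a = z \<bullet> snd (\<theta> a))" for z
    using z lift_fibre[OF q(1)] triv_lift[OF q(1)] by (intro un) (auto simp: h_def q_def)
  have c: "coord A \<theta> x = y" unfolding coord_def using ex un' by (intro the_equality) auto
  show "coord A \<theta> x \<in> F \<and> (\<forall>a\<in>fibre A (fst x). snd x a = coord A \<theta> x \<bullet> snd (\<theta> a))"
    unfolding c by (rule ex)
  show "coord A \<theta> x = z" if "z \<in> F" "\<And>v. v \<in> F \<Longrightarrow> snd x (lift A U \<theta> (fst x) v) = z \<bullet> v" for z
    using un[of z] that unfolding c h_def q_def by simp
qed

lemma coord_F: "x \<in> dual_set A \<Longrightarrow> fst x \<in> U \<Longrightarrow> coord A \<theta> x \<in> F"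
  and coord_apply: "x \<in> dual_set A \<Longrightarrow> fst x \<in> U \<Longrightarrow> a \<in> fibre A (fst x) \<Longrightarrow> snd x a = coord A \<theta> x \<bullet> snd (\<theta> a)"
  using coordI(1) by blast+

lemma coord_lift:
  "x \<in> dual_set A \<Longrightarrow> fst x \<in> U \<Longrightarrow> v \<in> F \<Longrightarrow> snd x (lift A U \<theta> (fst x) v) = coord A \<theta> x \<bullet> v"
  using coord_apply lift_fibre triv_lift by simp

lemma covec_dual:
  assumes "q \<in> U" "y \<in> F" shows "covec A \<theta> q y \<in> dual_set A"
  unfolding covec_def dual_set_def
  using U_sub[OF assms(1)] fibre_closed[of q] triv_add[OF assms(1)] triv_scale[OF assms(1)]
  by (simp add: inner_add_right)

lemma coord_covec:
  assumes "q \<in> U" "y \<in> F" shows "coord A \<theta> (covec A \<theta> q y) = y"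
proof (rule coord_eqI[OF covec_dual[OF assms]])
  show "snd (covec A \<theta> q y) (lift A U \<theta> (fst (covec A \<theta> q y)) v) = y \<bullet> v" if "v \<in> F" for v
    using lift_fibre[OF assms(1) that] triv_lift[OF assms(1) that] by (simp add: covec_def)
qed (use assms in simp_all)

lemma covec_coord:
  assumes "x \<in> dual_set A" "fst x \<in> U" shows "covec A \<theta> (fst x) (coord A \<theta> x) = x"
proof (rule prod_eqI)
  show "snd (covec A \<theta> (fst x) (coord A \<theta> x)) = snd x"
  proof
    fix a
    show "snd (covec A \<theta> (fst x) (coord A \<theta> x)) a = snd x a"
      using coord_apply[OF assms, of a] assms(1) by (auto simp: covec_def dual_set_def)
  qed
qed simp

lemma coord_dilation:
  assumes "x \<in> dual_set A" "fst x \<in> U" shows "coord A \<theta> (dilation c x) = c *\<^sub>R coord A \<theta> x"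
proof (rule coord_eqI)
  show "dilation c x \<in> dual_set A"
    using assms(1) by (auto simp: dual_set_def dilation_def algebra_simps)
  show "c *\<^sub>R coord A \<theta> x \<in> F" using coord_F[OF assms] subspace_F by (simp add: subspace_scale)
qed (use assms coord_lift in \<open>auto simp: snd_dilation\<close>)

lemma coord_add:
  assumes "(q, \<alpha>) \<in> dual_set A" "(q, \<beta>) \<in> dual_set A" "q \<in> U"
  shows "coord A \<theta> (q, \<lambda>a. \<alpha> a + \<beta> a) = coord A \<theta> (q, \<alpha>) + coord A \<theta> (q, \<beta>)"
proof (rule coord_eqI)
  show "(q, \<lambda>a. \<alpha> a + \<beta> a) \<in> dual_set A"
    using assms by (auto simp: dual_set_def algebra_simps)
  show "coord A \<theta> (q, \<alpha>) + coord A \<theta> (q, \<beta>) \<in> F" using coord_F assms subspace_F by (simp add: subspace_add)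
  fix v assume "v \<in> F"
  then show "snd (q, \<lambda>a. \<alpha> a + \<beta> a) (lift A U \<theta> (fst (q, \<lambda>a. \<alpha> a + \<beta> a)) v) = (coord A \<theta> (q, \<alpha>) + coord A \<theta> (q, \<beta>)) \<bullet> v"
    using coord_lift[OF assms(1), of v] coord_lift[OF assms(2), of v] assms(3) by (simp add: inner_add_left)
qed (use assms in simp)

lemma coord_eq_0_iff:
  assumes "x \<in> dual_set A" "fst x \<in> U" shows "coord A \<theta> x = 0 \<longleftrightarrow> x \<in> zero_section A"
proof
  assume "coord A \<theta> x = 0"
  then have "x = covec A \<theta> (fst x) 0" using covec_coord[OF assms] by simp
  then have "x = (fst x, \<lambda>_. 0)" by (auto simp: covec_def fun_eq_iff prod_eq_iff)
  then show "x \<in> zero_section A" using U_sub[OF assms(2)] unfolding zero_section_def by blast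
next
  assume "x \<in> zero_section A"
  then show "coord A \<theta> x = 0" using assms subspace_F by (intro coord_eqI) (auto simp: zero_section_def subspace_0)
qed

end

lemma dilation_dual: "x \<in> dual_set A \<Longrightarrow> dilation c x \<in> dual_set A"
  by (auto simp: dual_set_def dilation_def algebra_simps)

section \<open>The charts of the dual bundle\<close>

lemma dual_atlas_iff:
  "(B, \<Phi>) \<in> M \<longleftrightarrow> (\<exists>C \<phi> U \<theta>. (C, \<phi>) \<in> Q \<and> local_triv A U \<theta> \<and> B = {x \<in> dual_set A. fst x \<in> C \<inter> U}
     \<and> \<Phi> = (\<lambda>x. (\<phi> (fst x), coord A \<theta> x)))"
  unfolding dual_atlas_def coord_def case_prod_beta by blast

lemma dual_atlasI:
  "(C, \<phi>) \<in> Q \<Longrightarrow> local_triv A U \<theta> \<Longrightarrow> ({x \<in> dual_set A. fst x \<in> C \<inter> U}, \<lambda>x. (\<phi> (fst x), coord A \<theta> x)) \<in> M"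
  unfolding dual_atlas_iff by blast

lemma smooth_in_base:
  assumes "smooth_in C \<phi> f (fst x)" "B \<subseteq> fst -` C"
  shows "smooth_in B (\<lambda>x. (\<phi> (fst x), h x)) (\<lambda>x. f (fst x)) x"
proof -
  obtain W G where W: "open W" "\<phi> (fst x) \<in> W" "Cinf_on W G" "\<And>y. y \<in> C \<Longrightarrow> \<phi> y \<in> W \<Longrightarrow> f y = G (\<phi> y)"
    using smooth_inE[OF assms(1)] by metis
  show ?thesis
  proof (rule smooth_inI[where W = "W \<times> UNIV" and F = "\<lambda>z. G (fst z)"])
    show "Cinf_on (W \<times> UNIV) (\<lambda>z. G (fst z))"
      by (rule Cinf_on_compose[OF _ W(1) _ W(3)])
        (auto intro!: open_Times W Ck_on_bounded_linear bounded_linear_fst)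
  qed (use W assms(2) in \<open>auto intro: open_Times\<close>)
qed

lemma smooth_in_fibre: "smooth_in B (\<lambda>x. (h x, g x)) g x"
  by (rule smooth_inI[where W = UNIV and F = snd]) (auto intro: Ck_on_bounded_linear bounded_linear_snd)

lemma M_smooth: "smooth_atlas M"
proof (rule smooth_atlasI)
  fix B \<Phi> assume "(B, \<Phi>) \<in> M"
  then obtain C \<phi> U \<theta> where C: "(C, \<phi>) \<in> Q" and triv: "local_triv A U \<theta>"
    and B: "B = {x \<in> dual_set A. fst x \<in> C \<inter> U}" and \<Phi>: "\<Phi> = (\<lambda>x. (\<phi> (fst x), coord A \<theta> x))"
    unfolding dual_atlas_iff by blast
  note inj = smooth_atlasD(1)[OF smooth_Q C]
  show "inj_on \<Phi> B"
  proof (rule inj_onI)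
    fix x y assume xy: "x \<in> B" "y \<in> B" "\<Phi> x = \<Phi> y"
    then have "fst x = fst y" using inj unfolding B \<Phi> by (auto dest: inj_onD)
    moreover have "coord A \<theta> x = coord A \<theta> y" using xy unfolding \<Phi> by simp
    ultimately show "x = y" using covec_coord[OF triv] xy unfolding B by (metis (no_types, lifting) IntD2 mem_Collect_eq)
  qed
  obtain V where V: "subspace V" "openin (top_of_set V) (\<phi> ` C)" using smooth_atlasD(2)[OF smooth_Q C] by blast
  have "openin (top_of_set (\<phi> ` C)) (\<phi> ` (C \<inter> U))"
    using openin_image_iff[OF inj, of "C \<inter> U"] openin_mtopologyD[OF U_open[OF triv] C] by auto
  then have o: "openin (top_of_set V) (\<phi> ` (C \<inter> U))" using V(2) openin_trans by blast
  have "\<Phi> ` B = \<phi> ` (C \<inter> U) \<times> F"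
  proof
    show "\<Phi> ` B \<subseteq> \<phi> ` (C \<inter> U) \<times> F" unfolding \<Phi> B using coord_F[OF triv] by auto
    show "\<phi> ` (C \<inter> U) \<times> F \<subseteq> \<Phi> ` B"
    proof clarify
      fix q y assume q: "q \<in> C" "q \<in> U" and y: "y \<in> F"
      have "covec A \<theta> q y \<in> B" unfolding B using covec_dual[OF triv q(2) y] q by simp
      moreover have "\<Phi> (covec A \<theta> q y) = (\<phi> q, y)" unfolding \<Phi> using coord_covec[OF triv q(2) y] by simp
      ultimately show "(\<phi> q, y) \<in> \<Phi> ` B" by (metis image_eqI)
    qed
  qed
  then have "openin (top_of_set (V \<times> F)) (\<Phi> ` B)" using openin_Times[OF o openin_subtopology_self] by simp
  then show "\<exists>V. subspace V \<and> openin (top_of_set V) (\<Phi> ` B)" using subspace_Times[OF V(1) subspace_F] by blast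
  fix B' \<Phi>' assume "(B', \<Phi>') \<in> M"
  then obtain C' \<phi>' U' \<theta>' where C': "(C', \<phi>') \<in> Q" and triv': "local_triv A U' \<theta>'"
    and B': "B' = {x \<in> dual_set A. fst x \<in> C' \<inter> U'}" and \<Phi>': "\<Phi>' = (\<lambda>x. (\<phi>' (fst x), coord A \<theta>' x))"
    unfolding dual_atlas_iff by blast
  have "openin (mtopology Q) (U \<inter> (C' \<inter> U'))"
    by (intro openin_Int U_open[OF triv] U_open[OF triv'] openin_chart[OF smooth_Q C'])
  then obtain T where T: "open T" "C \<inter> (U \<inter> (C' \<inter> U')) = C \<inter> \<phi> -` T" using openin_mtopologyD[OF _ C] by blast
  show "\<exists>T. open T \<and> B \<inter> B' = B \<inter> \<Phi> -` T"
  proof (intro exI conjI)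
    show "open (T \<times> UNIV :: ('b \<times> 'f) set)" using T(1) by (intro open_Times) auto
    show "B \<inter> B' = B \<inter> \<Phi> -` (T \<times> UNIV)" unfolding B B' \<Phi> using T(2) by auto
  qed
  fix x assume x: "x \<in> B \<inter> B'"
  obtain O' where O': "O' \<subseteq> F" "pairwise orthogonal O'" "\<And>b. b \<in> O' \<Longrightarrow> norm b = 1" "independent O'" "span O' = F"
    using orthonormal_basis_subspace[OF subspace_F] by metis
  have fin: "finite O'" using O'(4) by (rule independent_imp_finite)
  \<comment> \<open>\<open>?S b q\<close> is the image of \<open>b\<close> under the transition map
    from \<theta>' to \<theta> over \<open>q\<close>. Fibre coordinates of covectors change by the
    transpose of that map, so the new coordinate is linear in the old one with coefficients smooth
    on the base.\<close>
  let ?S = "\<lambda>b q. snd (\<theta> (lift A U' \<theta>' q b))"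
  have S: "smooth_in (B \<inter> B') \<Phi> (\<lambda>x. ?S b (fst x)) x" if b: "b \<in> O'" for b
  proof -
    have bF: "b \<in> F" using b O' by blast
    have q: "fst x \<in> U" "fst x \<in> U'" "fst x \<in> C" using x B B' by auto
    have "smooth_near (open_atlas Q U') (?S b) (fst x)"
      by (rule smooth_near_map[OF smooth_QU[OF triv'] smooth_total lift_smooth[OF triv' bF] triv_snd_smooth[OF triv q(1) lift_fibre[OF triv' q(2) bF]]])
        (simp add: q carrier_QU[OF triv'])
    then have "smooth_near Q (?S b) (fst x)" by (rule smooth_near_open_atlas[OF smooth_Q U_open[OF triv'] q(2), THEN iffD1])
    then have "smooth_in C \<phi> (?S b) (fst x)" by (rule smooth_nearD[OF smooth_Q _ C q(3)])
    then show ?thesis unfolding \<Phi> by (rule smooth_in_base) (auto simp: B)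
  qed
  have coord': "coord A \<theta>' y = (\<Sum>b\<in>O'. (coord A \<theta> y \<bullet> ?S b (fst y)) *\<^sub>R b)" if y: "y \<in> B \<inter> B'" for y
  proof -
    have y': "y \<in> dual_set A" "fst y \<in> U" "fst y \<in> U'" using y unfolding B B' by auto
    have "coord A \<theta>' y \<bullet> b = coord A \<theta> y \<bullet> ?S b (fst y)" if b: "b \<in> O'" for b
    proof -
      have bF: "b \<in> F" using b O' by blast
      show ?thesis
        using coord_lift[OF triv' y'(1,3) bF] coord_apply[OF triv y'(1,2) lift_fibre[OF triv' y'(3) bF]] by simp
    qed
    then show ?thesis
      using orthonormal_expansion[OF O'(2,3) fin, of "coord A \<theta>' y"] coord_F[OF triv' y'(1,3)] O'(5) by simp
  qed
  have cs: "smooth_in (B \<inter> B') \<Phi> (coord A \<theta>) x" unfolding \<Phi> by (rule smooth_in_fibre)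
  have s: "smooth_in (B \<inter> B') \<Phi> (\<lambda>y. \<Sum>b\<in>O'. (coord A \<theta> y \<bullet> ?S b (fst y)) *\<^sub>R b) x"
    using x by (intro smooth_in_sum smooth_in_bilinear[OF bounded_bilinear_scaleR]
        smooth_in_bilinear[OF bounded_bilinear_inner] S cs smooth_in_const) auto
  have "smooth_in (B \<inter> B') \<Phi> (coord A \<theta>') x"
    by (rule smooth_in_local[where A = "B \<inter> B'" and T = UNIV and f = "\<lambda>y. \<Sum>b\<in>O'. (coord A \<theta> y \<bullet> ?S b (fst y)) *\<^sub>R b"])
      (use s coord' x in simp_all)
  moreover have "smooth_in (B \<inter> B') \<Phi> (\<lambda>x. \<phi>' (fst x)) x"
    unfolding \<Phi> by (rule smooth_in_base[OF chart_trans[OF smooth_Q C C']]) (use x in \<open>auto simp: B B'\<close>)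
  ultimately show "smooth_in (B \<inter> B') \<Phi> \<Phi>' x" unfolding \<Phi>' by (intro smooth_in_Pair)
qed

lemma carrier_M: "carrier M = dual_set A"
proof
  show "carrier M \<subseteq> dual_set A"
    by (auto elim!: carrierE simp: dual_atlas_iff)
  show "dual_set A \<subseteq> carrier M"
  proof
    fix x assume x: "x \<in> dual_set A"
    then have q: "fst x \<in> carrier Q" by (auto simp: dual_set_def)
    obtain C \<phi> where C: "(C, \<phi>) \<in> Q" "fst x \<in> C" using q by (rule carrierE)
    obtain U \<theta> where U: "local_triv A U \<theta>" "fst x \<in> U" using q by (rule ex_triv)
    show "x \<in> carrier M" by (rule carrierI[OF dual_atlasI[OF C(1) U(1)]]) (use x C U in simp)
  qed
qed

lemma dual_chartE:
  assumes "x \<in> dual_set A"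
  obtains C \<phi> U \<theta> where "(C, \<phi>) \<in> Q" "local_triv A U \<theta>" "fst x \<in> C" "fst x \<in> U"
proof -
  have q: "fst x \<in> carrier Q" using assms by (auto simp: dual_set_def)
  show thesis by (rule carrierE[OF q], rule ex_triv[OF q]) (rule that)
qed

lemma fst_smooth:
  assumes x: "x \<in> dual_set A" and f: "smooth_near Q f (fst x)"
  shows "smooth_near M (\<lambda>x. f (fst x)) x"
proof -
  obtain C \<phi> U \<theta> where C: "(C, \<phi>) \<in> Q" "local_triv A U \<theta>" "fst x \<in> C" "fst x \<in> U" using x by (rule dual_chartE)
  show ?thesis
    by (rule smooth_nearI[OF dual_atlasI[OF C(1,2)]], use x C in simp, rule smooth_in_base)
      (use smooth_nearD[OF smooth_Q f C(1,3)] in auto)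
qed

lemma coord_smooth:
  assumes triv: "local_triv A U \<theta>" and x: "x \<in> dual_set A" "fst x \<in> U"
  shows "smooth_near M (coord A \<theta>) x"
proof -
  obtain C \<phi> where C: "(C, \<phi>) \<in> Q" "fst x \<in> C" using U_sub[OF triv x(2)] by (rule carrierE)
  show ?thesis
    by (rule smooth_nearI[OF dual_atlasI[OF C(1) triv] _ smooth_in_fibre]) (use x C in simp)
qed

lemma openin_fst:
  assumes "openin (mtopology Q) N" shows "openin (mtopology M) {x \<in> dual_set A. fst x \<in> N}"
proof (rule openin_mtopologyI[OF M_smooth])
  fix x assume x: "x \<in> {x \<in> dual_set A. fst x \<in> N}"
  then have xd: "x \<in> dual_set A" by simp
  obtain C \<phi> U \<theta> where C: "(C, \<phi>) \<in> Q" "local_triv A U \<theta>" "fst x \<in> C" "fst x \<in> U" using xd by (rule dual_chartE)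
  obtain T where T: "open T" "C \<inter> N = C \<inter> \<phi> -` T" using openin_mtopologyD[OF assms C(1)] by blast
  show "\<exists>U \<phi> T. (U, \<phi>) \<in> M \<and> x \<in> U \<and> open T \<and> \<phi> x \<in> T \<and> (\<forall>y\<in>U. \<phi> y \<in> T \<longrightarrow> y \<in> {x \<in> dual_set A. fst x \<in> N})"
    using dual_atlasI[OF C(1,2)] x C T
    by (intro exI[of _ "{x \<in> dual_set A. fst x \<in> C \<inter> U}"] exI[of _ "\<lambda>x. (\<phi> (fst x), coord A \<theta> x)"]
        exI[of _ "T \<times> UNIV"]) (auto intro: open_Times)
qed

text \<open>The factor may vary with the point: besides fixed dilations this covers the radial
  retraction \<open>rho\<close> and the map \<open>Psi\<close>.\<close>

lemma smooth_map_dilation: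
  assumes N: "smooth_atlas N" and \<Phi>: "smooth_map N M \<Phi>" and c: "\<And>x. x \<in> carrier N \<Longrightarrow> smooth_near N c x"
  shows "smooth_map N M (\<lambda>x. dilation (c x) (\<Phi> x))"
proof (rule smooth_mapI[OF N M_smooth])
  fix x assume x: "x \<in> carrier N"
  have xd: "\<Phi> x \<in> dual_set A" using smooth_map_carrier[OF \<Phi> x] by (simp add: carrier_M)
  obtain C \<phi> U \<theta> where C: "(C, \<phi>) \<in> Q" "local_triv A U \<theta>" "fst (\<Phi> x) \<in> C" "fst (\<Phi> x) \<in> U" using xd by (rule dual_chartE)
  let ?B = "{x \<in> dual_set A. fst x \<in> C \<inter> U}" and ?\<Phi> = "\<lambda>x. (\<phi> (fst x), coord A \<theta> x)"
  let ?W = "{x \<in> carrier N. \<Phi> x \<in> ?B}"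
  note ch = dual_atlasI[OF C(1,2)]
  have W: "openin (mtopology N) ?W" by (rule smooth_map_open[OF \<Phi> openin_chart[OF M_smooth ch]])
  have "smooth_near N (\<lambda>x. (\<phi> (fst (\<Phi> x)), c x *\<^sub>R coord A \<theta> (\<Phi> x))) x"
    by (intro smooth_near_Pair smooth_near_scaleR N c x
        smooth_near_map[OF N M_smooth \<Phi> coord_smooth[OF C(2) xd C(4)] x]
        smooth_near_map[OF N M_smooth \<Phi> fst_smooth[OF xd smooth_nearI[OF C(1,3) smooth_in_chart]] x])
  then have "smooth_near N (\<lambda>x. ?\<Phi> (dilation (c x) (\<Phi> x))) x"
    by (rule smooth_near_cong[OF _ W]) (use x xd C coord_dilation[OF C(2)] in auto)
  moreover have "(\<lambda>x. dilation (c x) (\<Phi> x)) ` ?W \<subseteq> ?B"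
    by (rule image_subsetI) (simp add: dilation_dual)
  ultimately show "\<exists>V \<psi> W. (V, \<psi>) \<in> M \<and> openin (mtopology N) W \<and> x \<in> W \<and> (\<lambda>x. dilation (c x) (\<Phi> x)) ` W \<subseteq> V
      \<and> smooth_near N (\<lambda>x. \<psi> (dilation (c x) (\<Phi> x))) x"
    using W ch x xd C
    by (intro exI[of _ ?B] exI[of _ ?\<Phi>] exI[of _ ?W]) auto
qed

end


subsection \<open>The Liouville vector field\<close>

context vbundle_setup
begin

lemma dual_set_base: "x \<in> dual_set A \<Longrightarrow> fst x \<in> carrier Q"
  by (auto simp: dual_set_def)

text \<open>In fibre coordinates the field is the sum of the y d/dy, so it differentiates the
  coordinate expression in direction \<open>(0, y)\<close>. One function \<open>H\<close> on a fixed
  \<open>W\<close> serves all nearby points; this gives existence of the derivative and its smooth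
  dependence together.\<close>

lemma liouville_chart:
  assumes f: "smooth_fun M f" and x: "x \<in> dual_set A"
  obtains B \<Phi> W H where "(B, \<Phi>) \<in> M" "x \<in> B" "open W" "\<Phi> x \<in> W" "Cinf_on W H"
    "\<And>y. y \<in> B \<Longrightarrow> \<Phi> y \<in> W \<Longrightarrow> ((\<lambda>t. f (dilation (exp t) y)) has_real_derivative H (\<Phi> y)) (at 0)"
proof -
  obtain C \<phi> U \<theta> where C: "(C, \<phi>) \<in> Q" "local_triv A U \<theta>" "fst x \<in> C" "fst x \<in> U" using x by (rule dual_chartE)
  define B where "B = {x \<in> dual_set A. fst x \<in> C \<inter> U}"
  define \<Phi> where "\<Phi> = (\<lambda>x. (\<phi> (fst x), coord A \<theta> x))"
  have ch: "(B, \<Phi>) \<in> M" unfolding B_def \<Phi>_def by (rule dual_atlasI[OF C(1,2)])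
  have xB: "x \<in> B" using x C unfolding B_def by simp
  have "smooth_near M f x" using f x by (simp add: smooth_fun_iff[OF M_smooth] carrier_M)
  then have s: "smooth_in B \<Phi> f x" by (rule smooth_nearD[OF M_smooth _ ch xB])
  obtain W G where W: "open W" "\<Phi> x \<in> W" "Cinf_on W G" "\<And>y. y \<in> B \<Longrightarrow> \<Phi> y \<in> W \<Longrightarrow> f y = G (\<Phi> y)"
    using smooth_inE[OF s] by metis
  let ?D = "\<lambda>z. frechet_derivative G (at z)"
  have D: "(G has_derivative ?D z) (at z)" if "z \<in> W" for z using W(3) Ck_on_SucD that by blast
  \<comment> \<open>The direction \<open>(0, snd z)\<close> moves with \<open>z\<close>; expanding
    it in \<open>Basis\<close> makes \<open>H\<close> smooth on all of \<open>W\<close>.\<close>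
  define H where "H z = (\<Sum>b\<in>Basis. ((0, snd z) \<bullet> b) *\<^sub>R ?D z b)" for z
  have H_eq: "H z = ?D z (0, snd z)" if "z \<in> W" for z
    unfolding H_def using linear_basis_sum[OF has_derivative_linear[OF D[OF that]], of "(0, snd z)"] by simp
  have "Cinf_on W (\<lambda>z. ?D z b)" for b using W(3) Ck_on.simps(2) by blast
  moreover have "bounded_linear (\<lambda>z::'b \<times> 'f. ((0, snd z) \<bullet> b) :: real)" for b :: "'b \<times> 'f"
    by (intro bounded_linear_intros)
  ultimately have "Cinf_on W H" unfolding H_def
    using W(1) by (intro allI Ck_on_sum Ck_on_scaleR) (auto intro: Ck_on_bounded_linear)
  moreover have "((\<lambda>t. f (dilation (exp t) y)) has_real_derivative H (\<Phi> y)) (at 0)" if y: "y \<in> B" "\<Phi> y \<in> W" for y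
  proof -
    let ?z = "\<lambda>t::real. (\<phi> (fst y), exp t *\<^sub>R coord A \<theta> y)"
    have z: "(?z has_derivative (\<lambda>s. s *\<^sub>R (0, coord A \<theta> y))) (at 0)"
      by (auto intro!: derivative_eq_intros)
    have "((\<lambda>t. G (?z t)) has_derivative (\<lambda>s. ?D (\<Phi> y) (s *\<^sub>R (0, coord A \<theta> y)))) (at 0)"
      by (rule has_derivative_compose[OF z]) (use D[OF y(2)] in \<open>simp add: \<Phi>_def\<close>)
    moreover have "(\<lambda>s. ?D (\<Phi> y) (s *\<^sub>R (0, coord A \<theta> y))) = (*) (H (\<Phi> y))"
    proof
      fix s
      have "?D (\<Phi> y) (s *\<^sub>R (0, coord A \<theta> y)) = s *\<^sub>R ?D (\<Phi> y) (0, coord A \<theta> y)"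
        by (rule linear_scale[OF has_derivative_linear[OF D[OF y(2)]]])
      also have "?D (\<Phi> y) (0, coord A \<theta> y) = H (\<Phi> y)" unfolding H_eq[OF y(2)] by (simp add: \<Phi>_def)
      finally show "?D (\<Phi> y) (s *\<^sub>R (0, coord A \<theta> y)) = H (\<Phi> y) * s" by simp
    qed
    ultimately have der: "((\<lambda>t. G (?z t)) has_real_derivative H (\<Phi> y)) (at 0)"
      unfolding has_field_derivative_def by simp
    have o: "open (?z -` W)"
      by (rule open_vimage[OF W(1)]) (intro continuous_intros)
    have eq: "G (?z t) = f (dilation (exp t) y)" if "t \<in> ?z -` W" for t
      using W(4)[of "dilation (exp t) y"] that y(1) coord_dilation[OF C(2), of y]
      by (simp add: dilation_dual B_def \<Phi>_def)
    show ?thesis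
      by (rule has_field_derivative_transform_within_open[OF der o _ eq]) (use y in \<open>auto simp: \<Phi>_def\<close>)
  qed
  ultimately show thesis by (intro that[OF ch xB W(1,2)])
qed

lemma
  assumes f: "smooth_fun M f" and x: "x \<in> dual_set A"
  shows liouville_deriv: "((\<lambda>t. f (dilation (exp t) x)) has_real_derivative liouville_vf A x f) (at 0)"
    and liouville_smooth_near: "smooth_near M (\<lambda>x. liouville_vf A x f) x"
proof -
  obtain B \<Phi> W H where B: "(B, \<Phi>) \<in> M" "x \<in> B" "open W" "\<Phi> x \<in> W" "Cinf_on W H"
    "\<And>y. y \<in> B \<Longrightarrow> \<Phi> y \<in> W \<Longrightarrow> ((\<lambda>t. f (dilation (exp t) y)) has_real_derivative H (\<Phi> y)) (at 0)"
    using liouville_chart[OF f x] by metis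
  have eq: "liouville_vf A y f = H (\<Phi> y)" if "y \<in> B" "\<Phi> y \<in> W" for y
    using DERIV_imp_deriv[OF B(6)[OF that]] f by (simp add: liouville_vf_def)
  show "((\<lambda>t. f (dilation (exp t) x)) has_real_derivative liouville_vf A x f) (at 0)"
    using eq[OF B(2,4)] B(6)[OF B(2,4)] by simp
  show "smooth_near M (\<lambda>x. liouville_vf A x f) x"
    by (rule smooth_nearI[OF B(1,2)], rule smooth_inI[where W = W and F = H]) (use B eq in auto)
qed

lemma liouville_eqI:
  "smooth_fun M f \<Longrightarrow> x \<in> dual_set A \<Longrightarrow> ((\<lambda>t. f (dilation (exp t) x)) has_real_derivative d) (at 0) \<Longrightarrow> liouville_vf A x f = d"
  using liouville_deriv DERIV_unique by blast

lemma liouville_smooth: "smooth_fun M f \<Longrightarrow> smooth_fun M (\<lambda>x. liouville_vf A x f)"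
  using liouville_smooth_near by (simp add: smooth_fun_iff[OF M_smooth] carrier_M)

lemma liouville_tangent:
  assumes x: "x \<in> dual_set A" shows "liouville_vf A x \<in> tangent_space M x"
proof (rule tangent_spaceI)
  show "liouville_vf A x f = 0" if "\<not> smooth_fun M f" for f using that by (simp add: liouville_vf_def)
  fix f h assume fh: "smooth_fun M f" "smooth_fun M h"
  note d = liouville_deriv[OF fh(1) x] liouville_deriv[OF fh(2) x]
  show "liouville_vf A x (\<lambda>y. a * f y + b * h y) = a * liouville_vf A x f + b * liouville_vf A x h" for a b
    by (rule liouville_eqI[OF _ x]) (use fh d M_smooth in \<open>auto intro!: smooth_fun_intros derivative_eq_intros\<close>)
  show "liouville_vf A x (\<lambda>y. f y * h y) = liouville_vf A x f * h x + f x * liouville_vf A x h"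
    by (rule liouville_eqI[OF _ x])
      (use fh d M_smooth in \<open>auto intro!: smooth_fun_intros derivative_eq_intros simp: mult.commute\<close>)
qed

text \<open>Euler's identity for functions of degree \<open>k\<close>; it is applied with
  \<open>k = 1\<close> to linear functions and with \<open>k = 2\<close> to the kinetic
  energy.\<close>

lemma liouville_homogeneous:
  assumes "smooth_fun M f" "x \<in> dual_set A" "\<And>t. f (dilation (exp t) x) = exp t ^ k * f x"
  shows "liouville_vf A x f = real k * f x"
proof (rule liouville_eqI[OF assms(1,2)])
  have "((\<lambda>t. exp (real k * t) * f x) has_real_derivative real k * f x) (at 0)"
    by (auto intro!: derivative_eq_intros)
  then show "((\<lambda>t. f (dilation (exp t) x)) has_real_derivative real k * f x) (at 0)"
    by (simp add: assms(3) exp_of_nat_mult)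
qed

subsection \<open>Base functions and fibrewise linear functions\<close>

text \<open>Fibre coordinates have arbitrary values outside their trivialization, since
  \<open>coord\<close> is a definite description; near every point that does not lie over
  \<open>N\<close> the factor \<open>c\<close> vanishes and hides them.\<close>

lemma cutoff_smooth:
  assumes c: "smooth_fun Q c" and K: "K \<subseteq> N" "openin (mtopology Q) (carrier Q - K)" "\<And>q. q \<notin> K \<Longrightarrow> c q = 0"
    and f: "\<And>x. x \<in> dual_set A \<Longrightarrow> fst x \<in> N \<Longrightarrow> smooth_near M f x"
  shows "smooth_fun M (\<lambda>x. c (fst x) * f x)"
  unfolding smooth_fun_iff[OF M_smooth] carrier_M
proof
  fix x assume x: "x \<in> dual_set A"
  have q: "fst x \<in> carrier Q" using x by (auto simp: dual_set_def)
  show "smooth_near M (\<lambda>x. c (fst x) * f x) x"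
  proof (cases "fst x \<in> N")
    case True
    have "smooth_near M (\<lambda>x. c (fst x)) x" using c q by (intro fst_smooth x) (simp add: smooth_fun_iff[OF smooth_Q])
    then show ?thesis by (rule smooth_near_mult[OF M_smooth _ f[OF x True]])
  next
    case False
    have xo: "x \<in> {x \<in> dual_set A. fst x \<in> carrier Q - K}" using False K(1) q x by auto
    show ?thesis
      by (rule smooth_near_cong[OF smooth_near_const[of x M 0] openin_fst[OF K(2)]])
        (use x xo K(3) in \<open>auto simp: carrier_M\<close>)
  qed
qed

lemma base_fun_smooth: "smooth_fun Q h \<Longrightarrow> smooth_fun M (\<lambda>x. h (fst x))"
  using fst_smooth dual_set_base unfolding smooth_fun_iff[OF smooth_Q] smooth_fun_iff[OF M_smooth] carrier_M by blast

text \<open>A cut-off that is constant on fibres keeps a local coordinate fibrewise linear; this is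
  why the cut-off comes from the base.\<close>

lemma fibrewise_linear_coord:
  assumes "local_triv A U \<theta>" "K \<subseteq> U" "\<And>q. q \<notin> K \<Longrightarrow> c q = 0"
  shows "fibrewise_linear A (\<lambda>x. c (fst x) * (coord A \<theta> x \<bullet> y))"
  unfolding fibrewise_linear_def
proof (intro conjI allI impI)
  fix q \<alpha> \<beta> assume d: "(q, \<alpha>) \<in> dual_set A \<and> (q, \<beta>) \<in> dual_set A"
  show "c (fst (q, \<lambda>a. \<alpha> a + \<beta> a)) * (coord A \<theta> (q, \<lambda>a. \<alpha> a + \<beta> a) \<bullet> y) =
    c (fst (q, \<alpha>)) * (coord A \<theta> (q, \<alpha>) \<bullet> y) + c (fst (q, \<beta>)) * (coord A \<theta> (q, \<beta>) \<bullet> y)"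
  proof (cases "q \<in> U")
    case True
    then show ?thesis using coord_add[OF assms(1)] d by (simp add: inner_add_left algebra_simps)
  next
    case False
    then have "c q = 0" using assms by blast
    then show ?thesis by simp
  qed
next
  fix q \<alpha> and s :: real assume d: "(q, \<alpha>) \<in> dual_set A"
  show "c (fst (q, \<lambda>a. s * \<alpha> a)) * (coord A \<theta> (q, \<lambda>a. s * \<alpha> a) \<bullet> y) = s * (c (fst (q, \<alpha>)) * (coord A \<theta> (q, \<alpha>) \<bullet> y))"
  proof (cases "q \<in> U")
    case True
    then show ?thesis using coord_dilation[OF assms(1) d, of s] by (simp add: dilation_def)
  next
    case False
    then have "c q = 0" using assms by blast
    then show ?thesis by simp
  qed
qed

lemma fibrewise_linear_dilation:
  "fibrewise_linear A L \<Longrightarrow> x \<in> dual_set A \<Longrightarrow> L (dilation c x) = c * L x"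
  unfolding fibrewise_linear_def dilation_def by (cases x) auto

text \<open>Base functions and fibrewise linear functions contain local coordinates of \<open>M\<close>, so by
  Hadamard's lemma they determine a derivation.\<close>

lemma derivation_eq_0:
  assumes p: "p \<in> dual_set A" and v: "v \<in> tangent_space M p"
    and base: "\<And>h. smooth_fun Q h \<Longrightarrow> v (\<lambda>x. h (fst x)) = 0"
    and lin: "\<And>L. smooth_fun M L \<Longrightarrow> fibrewise_linear A L \<Longrightarrow> v L = 0"
  shows "v f = 0"
proof (cases "smooth_fun M f")
  case False
  then show ?thesis by (rule tangent_nonsmooth[OF M_smooth v])
next
  case f: True
  have pM: "p \<in> carrier M" using p by (simp add: carrier_M)
  obtain C \<phi> U \<theta> where C: "(C, \<phi>) \<in> Q" "local_triv A U \<theta>" "fst p \<in> C" "fst p \<in> U" using p by (rule dual_chartE)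
  define B where "B = {x \<in> dual_set A. fst x \<in> C \<inter> U}"
  define \<Phi> where "\<Phi> x = (\<phi> (fst x), coord A \<theta> x)" for x
  have ch: "(B, \<Phi>) \<in> M" using dual_atlasI[OF C(1,2)] unfolding \<Phi>_def[abs_def] B_def .
  have "smooth_near M f p" using f pM by (simp add: smooth_fun_iff[OF M_smooth])
  then have s: "smooth_in B \<Phi> f p" by (rule smooth_nearD[OF M_smooth _ ch]) (use p C in \<open>simp add: B_def\<close>)
  obtain W f' where W: "open W" "\<Phi> p \<in> W" "Cinf_on W f'" "\<And>y. y \<in> B \<Longrightarrow> \<Phi> y \<in> W \<Longrightarrow> f y = f' (\<Phi> y)"
    using smooth_inE[OF s] by metis
  obtain e where e: "e > 0" "ball (\<Phi> p) e \<subseteq> W" using W(1,2) open_contains_ball by metis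
  have "Cinf_on (ball (\<Phi> p) e) f'" using W(3) Ck_on_subset e(2) by blast
  then obtain G where G: "\<And>i. i \<in> Basis \<Longrightarrow> Cinf_on (ball (\<Phi> p) e) (G i)"
    "\<And>z. z \<in> ball (\<Phi> p) e \<Longrightarrow> f' z = f' (\<Phi> p) + (\<Sum>i\<in>Basis. ((z - \<Phi> p) \<bullet> i) * G i z)"
    using Hadamard by blast
  \<comment> \<open>Half the radius: the bump has to vanish before the Hadamard factors
    \<open>G i\<close> stop being smooth.\<close>
  let ?b = "bump (e/2) (\<Phi> p)"
  have fp: "f p = f' (\<Phi> p)" using W C p by (simp add: B_def)
  have N: "openin (mtopology Q) (C \<inter> U)" by (intro openin_Int openin_chart[OF smooth_Q C(1)] U_open[OF C(2)])
  obtain c K where c: "smooth_fun Q c" "c (fst p) = 1" "K \<subseteq> C \<inter> U" "openin (mtopology Q) (carrier Q - K)"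
    "\<And>x. x \<notin> K \<Longrightarrow> c x = 0" using base_bump[OF smooth_Q Hausdorff N, of "fst p"] C by blast
  note cut = cutoff_smooth[OF c(1,3,4,5)]
  have \<Phi>: "smooth_near M \<Phi> x" if "x \<in> dual_set A" "fst x \<in> C \<inter> U" for x
    by (rule smooth_nearI[OF ch _ smooth_in_chart]) (use that in \<open>simp add: B_def\<close>)
  \<comment> \<open>The cut-off \<open>c\<close> will enter twice, once for each factor of a
    remainder term: the increment \<open>w i\<close>, which vanishes at \<open>p\<close>, and the
    coefficient \<open>u i\<close> both have to be global functions.\<close>
  define b where "b x = c (fst x) * ?b (\<Phi> x)" for x
  define u where "u i x = c (fst x) * (?b (\<Phi> x) * G i (\<Phi> x))" for i x
  define w where "w i x = c (fst x) * ((\<Phi> x - \<Phi> p) \<bullet> i)" for i x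
  have c_s: "smooth_fun M (\<lambda>x. c (fst x))" by (rule base_fun_smooth[OF c(1)])
  have b_s: "smooth_fun M b" unfolding b_def
  proof (rule cut)
    show "smooth_near M (\<lambda>x. ?b (\<Phi> x)) x" if "x \<in> dual_set A" "fst x \<in> C \<inter> U" for x
      by (rule smooth_near_compose[OF \<Phi>[OF that] open_UNIV UNIV_I _ refl]) (simp add: Ck_on_bump)
  qed
  have u_s: "smooth_fun M (u i)" if i: "i \<in> Basis" for i unfolding u_def
  proof (rule cut)
    have "Cinf_on UNIV (\<lambda>z. ?b z * G i z)" by (rule Cinf_on_bump_mult[OF _ _ G(1)[OF i]]) (use e in auto)
    then show "smooth_near M (\<lambda>x. ?b (\<Phi> x) * G i (\<Phi> x)) x" if "x \<in> dual_set A" "fst x \<in> C \<inter> U" for x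
      by (rule smooth_near_compose[OF \<Phi>[OF that] open_UNIV UNIV_I _ refl])
  qed
  have w_s: "smooth_fun M (w i)" for i unfolding w_def
  proof (rule cut)
    show "smooth_near M (\<lambda>x. (\<Phi> x - \<Phi> p) \<bullet> i) x" if "x \<in> dual_set A" "fst x \<in> C \<inter> U" for x
      using that by (intro smooth_near_inner[OF M_smooth smooth_near_diff[OF M_smooth \<Phi>]] smooth_near_const)
        (simp_all add: carrier_M)
  qed
  have w0: "w i p = 0" for i by (simp add: w_def)
  have vw: "v (w i) = 0" if i: "i \<in> Basis" for i
  proof -
    from i consider i' where "i = (i', 0)" "i' \<in> Basis" | i' where "i = (0, i')" "i' \<in> Basis"
      by (auto simp: Basis_prod_def)
    then show ?thesis
    proof cases
      case 1
      let ?h = "\<lambda>q. c q * ((\<phi> q - \<phi> (fst p)) \<bullet> i')"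
      have "smooth_near Q ?h q" if q: "q \<in> carrier Q" for q
      proof (cases "q \<in> C")
        case True
        have "smooth_near Q c q" using c(1) q by (simp add: smooth_fun_iff[OF smooth_Q])
        then show ?thesis
          by (rule smooth_near_mult[OF smooth_Q _ smooth_near_inner[OF smooth_Q smooth_near_diff[OF smooth_Q
              smooth_nearI[OF C(1) True smooth_in_chart] smooth_near_const[OF q]] smooth_near_const[OF q]]])
      next
        case False
        then have "q \<in> carrier Q - K" using q c(3) by blast
        then show ?thesis by (rule smooth_near_cong[OF smooth_near_const[OF q, of 0] c(4)]) (use c(5) in auto)
      qed
      then have "smooth_fun Q ?h" by (simp add: smooth_fun_iff[OF smooth_Q])
      moreover have "w i = (\<lambda>x. ?h (fst x))" unfolding w_def \<Phi>_def 1 by (simp add: fun_eq_iff)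
      ultimately show ?thesis using base[of ?h] by simp
    next
      case 2
      let ?L = "\<lambda>x. c (fst x) * (coord A \<theta> x \<bullet> i')"
      have L: "smooth_fun M ?L"
      proof (rule cut)
        show "smooth_near M (\<lambda>x. coord A \<theta> x \<bullet> i') x" if "x \<in> dual_set A" "fst x \<in> C \<inter> U" for x
          using that by (intro smooth_near_inner[OF M_smooth coord_smooth[OF C(2)]] smooth_near_const)
            (simp_all add: carrier_M)
      qed
      have "fibrewise_linear A ?L" by (rule fibrewise_linear_coord[OF C(2), of K]) (use c in auto)
      then have "v ?L = 0" by (rule lin[OF L])
      \<comment> \<open>A fibre increment is a linear function minus a constant multiple of a base
        function, so \<open>v\<close> kills it by the two hypotheses together.\<close>
      moreover have "w i = (\<lambda>x. 1 * ?L x + (- (coord A \<theta> p \<bullet> i')) * c (fst x))"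
        unfolding w_def \<Phi>_def 2 by (simp add: fun_eq_iff inner_diff_left algebra_simps)
      ultimately show ?thesis
        using tangent_linear[OF M_smooth v L c_s, of 1 "- (coord A \<theta> p \<bullet> i')"] base[OF c(1)] by simp
    qed
  qed
  have eq: "f x * (b x * c (fst x)) = f p * (b x * c (fst x)) + (\<Sum>i\<in>Basis. w i x * u i x)" if x: "x \<in> carrier M" for x
  proof (cases "fst x \<in> C \<inter> U \<and> \<Phi> x \<in> ball (\<Phi> p) e")
    case True
    then have "f x = f p + (\<Sum>i\<in>Basis. ((\<Phi> x - \<Phi> p) \<bullet> i) * G i (\<Phi> x))"
      using W(4)[of x] x e(2) G(2) fp by (auto simp: carrier_M B_def)
    moreover have "(\<Sum>i\<in>Basis. w i x * u i x) = (b x * c (fst x)) * (\<Sum>i\<in>Basis. ((\<Phi> x - \<Phi> p) \<bullet> i) * G i (\<Phi> x))"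
      unfolding b_def u_def w_def sum_distrib_left by (intro sum.cong refl) (simp only: mult_ac)
    ultimately show ?thesis by (simp add: distrib_right)
  next
    case False
    have "b x = 0 \<and> (\<forall>i. u i x = 0)"
    proof (cases "fst x \<in> C \<inter> U")
      case True
      then have "?b (\<Phi> x) = 0" using False e(1) by (intro bump_eq_0) (simp_all add: dist_commute)
      then show ?thesis by (simp add: b_def u_def)
    next
      case False
      then have "c (fst x) = 0" using c(3,5) by blast
      then show ?thesis by (simp add: b_def u_def)
    qed
    then have "b x = 0" "\<And>i. u i x = 0" by blast+
    then show ?thesis by (simp only: mult_zero_left mult_zero_right sum.neutral_const add_0)
  qed
  have bc: "smooth_fun M (\<lambda>x. b x * c (fst x))" by (rule smooth_fun_mult[OF M_smooth b_s c_s])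
  have wu: "smooth_fun M (\<lambda>x. w i x * u i x)" if "i \<in> Basis" for i
    by (rule smooth_fun_mult[OF M_smooth w_s u_s[OF that]])
  have swu: "smooth_fun M (\<lambda>x. \<Sum>i\<in>Basis. w i x * u i x)" by (rule smooth_fun_sum[OF M_smooth wu])
  have "v (\<lambda>x. f x * (b x * c (fst x))) = v (\<lambda>x. f p * (b x * c (fst x)) + (\<Sum>i\<in>Basis. w i x * u i x))"
    by (rule tangent_cong[OF M_smooth v pM _ eq])
      (use bc swu M_smooth in \<open>auto intro!: smooth_fun_intros\<close>)
  also have "\<dots> = f p * v (\<lambda>x. b x * c (fst x)) + v (\<lambda>x. \<Sum>i\<in>Basis. w i x * u i x)"
    using tangent_linear[OF M_smooth v bc swu, of "f p" 1] by simp
  also have "v (\<lambda>x. \<Sum>i\<in>Basis. w i x * u i x) = (\<Sum>i\<in>Basis. v (\<lambda>x. w i x * u i x))"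
    by (rule tangent_sum[OF M_smooth v wu])
  also have "\<dots> = 0"
    by (rule sum.neutral) (use tangent_mult[OF M_smooth v w_s u_s] w0 vw in auto)
  finally have "v (\<lambda>x. f x * (b x * c (fst x))) = f p * v (\<lambda>x. b x * c (fst x))" by simp
  moreover have "b p * c (fst p) = 1" using c(2) e(1) by (simp add: b_def bump_center)
  ultimately show ?thesis using tangent_mult[OF M_smooth v f bc] by simp
qed

end

section \<open>The kinetic energy\<close>

text \<open>Exposes \<open>j < i\<close> in the recursive calls under the sum, on which termination
  of \<open>gram_schmidt\<close> rests.\<close>

lemmas [fundef_cong] = sum.cong

text \<open>The vectors are not normalized, so that they depend on \<open>G\<close> through field operations only and vary
  smoothly with it.\<close>

fun gram_schmidt :: "('f::real_vector \<Rightarrow> 'f \<Rightarrow> real) \<Rightarrow> (nat \<Rightarrow> 'f) \<Rightarrow> nat \<Rightarrow> 'f" where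
  "gram_schmidt G b i = b i -
     (\<Sum>j<i. (G (b i) (gram_schmidt G b j) / G (gram_schmidt G b j) (gram_schmidt G b j)) *\<^sub>R gram_schmidt G b j)"

declare gram_schmidt.simps [simp del]

text \<open>\<open>G\<close> is constrained on \<open>F\<close> only, since it will be the metric
  read through a trivialization. Independence of the \<open>b i\<close> is stated in the successive
  form that the Gram-Schmidt induction consumes.\<close>

locale scalar_product =
  fixes F :: "'f::euclidean_space set" and G :: "'f \<Rightarrow> 'f \<Rightarrow> real" and b :: "nat \<Rightarrow> 'f" and r :: nat
  assumes F: "subspace F" and sym: "\<And>v w. v \<in> F \<Longrightarrow> w \<in> F \<Longrightarrow> G v w = G w v"
    and add: "\<And>u v w. u \<in> F \<Longrightarrow> v \<in> F \<Longrightarrow> w \<in> F \<Longrightarrow> G (u + v) w = G u w + G v w"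
    and scale: "\<And>c v w. v \<in> F \<Longrightarrow> w \<in> F \<Longrightarrow> G (c *\<^sub>R v) w = c * G v w"
    and pos: "\<And>v. v \<in> F \<Longrightarrow> v \<noteq> 0 \<Longrightarrow> G v v > 0"
    and indep: "\<And>i. i < r \<Longrightarrow> b i \<notin> span (b ` {..<i})" and span: "span (b ` {..<r}) = F"
begin

abbreviation "w \<equiv> gram_schmidt G b"

lemma b_F: "i < r \<Longrightarrow> b i \<in> F"
  using span span_superset[of "b ` {..<r}"] by auto

lemma G_sum:
  "finite I \<Longrightarrow> (\<And>i. i \<in> I \<Longrightarrow> u i \<in> F) \<Longrightarrow> v \<in> F \<Longrightarrow> G (\<Sum>i\<in>I. c i *\<^sub>R u i) v = (\<Sum>i\<in>I. c i * G (u i) v)"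
  by (rule linear_on_sum[OF F, of "\<lambda>x. G x v"]) (use add scale in auto)

lemma G_diff: "u \<in> F \<Longrightarrow> v \<in> F \<Longrightarrow> z \<in> F \<Longrightarrow> G (u - v) z = G u z - G v z"
  using add[of u "(-1) *\<^sub>R v" z] scale[of v z "-1"] subspace_scale[OF F, of v "-1"] by simp

text \<open>One induction for all clauses: orthogonality needs the earlier vectors to be nonzero,
  and nonvanishing comes from their spans and the independence of the \<open>b i\<close>. The last
  clause is there for \<open>span_w\<close>.\<close>

lemma gs_props:
  "i < r \<Longrightarrow> w i \<in> F \<and> w i \<noteq> 0 \<and> (\<forall>j<i. G (w i) (w j) = 0) \<and> w i \<in> span (b ` {..i}) \<and> b i \<in> span (w ` {..i})"
proof (induction i rule: less_induct)
  case (less i)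
  have IH: "w j \<in> F" "w j \<noteq> 0" "\<And>k. k < j \<Longrightarrow> G (w j) (w k) = 0" "w j \<in> span (b ` {..j})" if "j < i" for j
    using less that by auto
  define s where "s = (\<Sum>j<i. (G (b i) (w j) / G (w j) (w j)) *\<^sub>R w j)"
  have wi: "w i = b i - s" unfolding s_def by (rule gram_schmidt.simps)
  have bi: "b i \<in> F" using b_F less by simp
  have sF: "s \<in> F" unfolding s_def using IH(1) F by (auto intro!: subspace_sum subspace_scale)
  have "w j \<in> span (b ` {..<i})" if "j < i" for j
  proof -
    have "b ` {..j} \<subseteq> b ` {..<i}" using that by auto
    then show ?thesis using IH(4)[OF that] span_mono by blast
  qed
  then have s_b: "s \<in> span (b ` {..<i})" unfolding s_def by (auto intro!: span_sum span_scale)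
  have s_w: "s \<in> span (w ` {..<i})" unfolding s_def by (rule span_sum) (auto intro: span_scale span_base)
  have "w i \<noteq> 0" using wi s_b indep[of i] less by auto
  moreover have "G (w i) (w j) = 0" if j: "j < i" for j
  proof -
    have "G s (w j) = (\<Sum>k<i. (G (b i) (w k) / G (w k) (w k)) * G (w k) (w j))"
      unfolding s_def using IH(1) j by (intro G_sum) auto
    \<comment> \<open>Earlier vectors are orthogonal in both orders, one by induction and the other
      by symmetry, so only the term \<open>k = j\<close> survives.\<close>
    also have "\<dots> = (\<Sum>k<i. if k = j then G (b i) (w j) else 0)"
    proof (intro sum.cong refl)
      fix k assume k: "k \<in> {..<i}"
      show "(G (b i) (w k) / G (w k) (w k)) * G (w k) (w j) = (if k = j then G (b i) (w j) else 0)"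
        using IH(3)[of j k] IH(3)[of k j] IH(1,2) sym[of "w j" "w k"] pos[of "w j"] j k
        by (cases j k rule: linorder_cases) auto
    qed
    also have "\<dots> = G (b i) (w j)" using j by simp
    finally show ?thesis using wi G_diff[OF bi sF IH(1)[OF j]] by simp
  qed
  moreover have "w i \<in> span (b ` {..i})"
  proof -
    have "b ` {..<i} \<subseteq> b ` {..i}" by auto
    then have "s \<in> span (b ` {..i})" using s_b span_mono by blast
    then show ?thesis unfolding wi by (intro span_diff) (auto intro: span_base)
  qed
  moreover have "b i \<in> span (w ` {..i})"
  proof -
    have "b i = w i + s" using wi by simp
    moreover have "w ` {..<i} \<subseteq> w ` {..i}" by auto
    then have "s \<in> span (w ` {..i})" using s_w span_mono by blast
    ultimately show ?thesis by (metis atMost_iff image_eqI order_refl span_add span_base)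
  qed
  moreover have "w i \<in> F" using wi bi sF F by (simp add: subspace_diff)
  ultimately show ?case by blast
qed

lemma w_F: "i < r \<Longrightarrow> w i \<in> F" and w_pos: "i < r \<Longrightarrow> G (w i) (w i) > 0"
  using gs_props pos by blast+

lemma w_orth: "i < r \<Longrightarrow> j < r \<Longrightarrow> i \<noteq> j \<Longrightarrow> G (w i) (w j) = 0"
  using gs_props[of i] gs_props[of j] sym[of "w i" "w j"] by (cases i j rule: linorder_cases) auto

lemma span_w: "span (w ` {..<r}) = F"
proof
  have "w ` {..<r} \<subseteq> F" using w_F by auto
  then show "span (w ` {..<r}) \<subseteq> F" using F span_minimal by blast
  have "b i \<in> span (w ` {..<r})" if "i < r" for i
  proof -
    have "w ` {..i} \<subseteq> w ` {..<r}" using that by auto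
    then show ?thesis using gs_props[OF that] span_mono by blast
  qed
  then have "span (b ` {..<r}) \<subseteq> span (w ` {..<r})" by (intro span_minimal subspace_span) auto
  then show "F \<subseteq> span (w ` {..<r})" using span by simp
qed

text \<open>Square of the \<open>G\<close>-dual norm of the functional v \<mapsto> y \<bullet> v, in
  the \<open>G\<close>-orthogonal basis \<open>w\<close>. It arises from values of \<open>G\<close>
  by field operations, so it varies smoothly whenever they do.\<close>

definition "sq y = (\<Sum>i<r. (y \<bullet> w i)\<^sup>2 / G (w i) (w i))"

text \<open>The Riesz representative with respect to \<open>G\<close> of the functional v \<mapsto>
  y \<bullet> v.\<close>

definition "rep y = (\<Sum>i<r. ((y \<bullet> w i) / G (w i) (w i)) *\<^sub>R w i)"

lemma rep_F: "rep y \<in> F"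
  unfolding rep_def using w_F F by (auto intro!: subspace_sum subspace_scale)

lemma G_rep:
  assumes v: "v \<in> F" shows "G (rep y) v = y \<bullet> v"
proof -
  have "G (rep y) (w i) = y \<bullet> w i" if i: "i < r" for i
  proof -
    have "G (rep y) (w i) = (\<Sum>j<r. ((y \<bullet> w j) / G (w j) (w j)) * G (w j) (w i))"
      unfolding rep_def using w_F i by (intro G_sum) auto
    also have "\<dots> = (\<Sum>j<r. if j = i then y \<bullet> w i else 0)"
      using w_orth w_pos i by (intro sum.cong refl) (auto simp: less_imp_neq[symmetric])
    finally show ?thesis using i by simp
  qed
  then have "w ` {..<r} \<subseteq> {v \<in> F. G v (rep y) = y \<bullet> v}" using w_F sym[OF rep_F] by auto
  moreover have "subspace {v \<in> F. G v (rep y) = y \<bullet> v}"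
    using subspace_0[OF F] subspace_add[OF F] subspace_scale[OF F] scale[OF subspace_0[OF F] rep_F, of 0] add scale rep_F
    by (intro subspaceI) (auto simp: inner_add_right)
  ultimately have "F \<subseteq> {v \<in> F. G v (rep y) = y \<bullet> v}" using span_minimal span_w by metis
  then show ?thesis using sym[OF v rep_F] v by auto
qed

lemma sq_rep: "G (rep y) (rep y) = sq y"
  unfolding G_rep[OF rep_F] by (simp add: rep_def sq_def inner_sum_right power2_eq_square)

lemma G_nonneg: "v \<in> F \<Longrightarrow> G v v \<ge> 0"
  using pos[of v] scale[of v v 0] by (cases "v = 0") (auto simp: less_imp_le)

lemma sq_nonneg: "sq y \<ge> 0"
  using G_nonneg[OF rep_F] sq_rep by simp

lemma sq_eq_0: "y \<in> F \<Longrightarrow> sq y = 0 \<Longrightarrow> y = 0"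
  using pos[OF rep_F, of y] sq_rep[of y] G_rep[of y y] scale[of y y 0] by (cases "rep y = 0") auto

lemma cauchy_schwarz:
  assumes "u \<in> F" "v \<in> F" shows "(G u v)\<^sup>2 \<le> G u u * G v v"
proof (cases "v = 0")
  case True
  then show ?thesis using scale[of v u 0] scale[of v v 0] sym assms by simp
next
  case False
  let ?t = "G u v / G v v"
  have p: "G v v > 0" using pos[OF assms(2) False] .
  have tv: "?t *\<^sub>R v \<in> F" using F assms by (simp add: subspace_scale)
  have z: "u - ?t *\<^sub>R v \<in> F" using F assms tv by (simp add: subspace_diff)
  have "0 \<le> G (u - ?t *\<^sub>R v) (u - ?t *\<^sub>R v)" by (rule G_nonneg[OF z])
  also have "\<dots> = G u (u - ?t *\<^sub>R v) - ?t * G v (u - ?t *\<^sub>R v)"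
    using G_diff[OF assms(1) tv z] scale[OF assms(2) z] by simp
  also have "G u (u - ?t *\<^sub>R v) = G u u - ?t * G u v"
    using sym[OF assms(1) z] G_diff[OF assms(1) tv assms(1)] scale[OF assms(2,1)] sym[OF assms] by simp
  also have "G v (u - ?t *\<^sub>R v) = 0"
    using sym[OF assms(2) z] G_diff[OF assms(1) tv assms(2)] scale[OF assms(2,2)] p by simp
  finally have "?t * G u v \<le> G u u" by simp
  then have "?t * G u v * G v v \<le> G u u * G v v" using p by (intro mult_right_mono) auto
  then show ?thesis using p by (simp add: power2_eq_square)
qed

text \<open>Cauchy-Schwarz bounds the values and the normalized Riesz representative attains the
  bound; for \<open>sq y = 0\<close> the maximizer is 0.\<close>

lemma Sup_dual:
  assumes y: "y \<in> F" shows "Sup {\<bar>y \<bullet> v\<bar> | v. v \<in> F \<and> G v v \<le> 1} = sqrt (sq y)"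
proof (rule cSup_eq_maximum)
  let ?v = "if sq y = 0 then 0 else (1 / sqrt (sq y)) *\<^sub>R rep y"
  have "?v \<in> F" using rep_F F by (simp add: subspace_scale subspace_0)
  moreover have "G ?v ?v \<le> 1"
  proof (cases "sq y = 0")
    case True
    then show ?thesis using scale[of 0 0 0] subspace_0[OF F] by simp
  next
    case False
    then have s: "sq y > 0" using sq_nonneg[of y] by simp
    define c where "c = 1 / sqrt (sq y)"
    have cF: "c *\<^sub>R rep y \<in> F" by (rule subspace_scale[OF F rep_F])
    have "G (c *\<^sub>R rep y) (c *\<^sub>R rep y) = c * (c * sq y)"
      unfolding scale[OF rep_F cF] sym[OF rep_F cF] scale[OF rep_F rep_F] sq_rep ..
    also have "\<dots> = 1" using s unfolding c_def by (simp add: field_simps)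
    finally show ?thesis using False by (simp add: c_def)
  qed
  moreover have "\<bar>y \<bullet> ?v\<bar> = sqrt (sq y)"
  proof (cases "sq y = 0")
    case False
    then have s: "sq y > 0" using sq_nonneg[of y] by simp
    have "y \<bullet> rep y = sq y" using G_rep[OF rep_F] sq_rep by simp
    then show ?thesis using s by (simp add: real_div_sqrt)
  qed simp
  ultimately have "?v \<in> F" "G ?v ?v \<le> 1" "sqrt (sq y) = \<bar>y \<bullet> ?v\<bar>" by (simp_all only:)
  then show "sqrt (sq y) \<in> {\<bar>y \<bullet> v\<bar> | v. v \<in> F \<and> G v v \<le> 1}" by blast
next
  fix z assume "z \<in> {\<bar>y \<bullet> v\<bar> | v. v \<in> F \<and> G v v \<le> 1}"
  then obtain v where v: "z = \<bar>y \<bullet> v\<bar>" "v \<in> F" "G v v \<le> 1" by blast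
  have "(y \<bullet> v)\<^sup>2 \<le> sq y * G v v" using cauchy_schwarz[OF rep_F v(2)] G_rep[OF v(2)] sq_rep by simp
  also have "\<dots> \<le> sq y" using sq_nonneg v(3) by (simp add: mult_left_le)
  finally show "z \<le> sqrt (sq y)" unfolding v(1) by (simp add: real_le_rsqrt)
qed

end


section \<open>The kinetic energy in local trivializations\<close>

locale metric_setup = vbundle_setup A n
  for A :: "('q, 'a, 'b::euclidean_space, 'e::euclidean_space, 'f::euclidean_space) vbundle" and n +
  fixes g :: "'a \<Rightarrow> 'a \<Rightarrow> real"
  assumes metric: "bundle_metric A g"
begin

abbreviation "\<kappa> \<equiv> kinetic_energy A g"

lemma metric_sym: "q \<in> carrier Q \<Longrightarrow> a \<in> fibre A q \<Longrightarrow> b \<in> fibre A q \<Longrightarrow> g a b = g b a"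
  and metric_add: "q \<in> carrier Q \<Longrightarrow> a \<in> fibre A q \<Longrightarrow> b \<in> fibre A q \<Longrightarrow> c \<in> fibre A q \<Longrightarrow> g (fadd A a b) c = g a c + g b c"
  and metric_scale: "q \<in> carrier Q \<Longrightarrow> a \<in> fibre A q \<Longrightarrow> b \<in> fibre A q \<Longrightarrow> g (fscale A s a) b = s * g a b"
  and metric_pos: "q \<in> carrier Q \<Longrightarrow> a \<in> fibre A q \<Longrightarrow> a \<noteq> fscale A 0 a \<Longrightarrow> g a a > 0"
  using metric unfolding bundle_metric_def by blast+

lemma metric_smooth:
  assumes "openin (mtopology Q) U" "smooth_map (open_atlas Q U) (total A) s" "smooth_map (open_atlas Q U) (total A) s'"
    "\<And>q. q \<in> U \<Longrightarrow> s q \<in> fibre A q" "\<And>q. q \<in> U \<Longrightarrow> s' q \<in> fibre A q"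
  shows "smooth_fun (open_atlas Q U) (\<lambda>q. g (s q) (s' q))"
  using metric assms unfolding bundle_metric_def by blast

lemma ex_basis: obtains b :: "nat \<Rightarrow> 'f"
  where "\<And>i. i < dim F \<Longrightarrow> b i \<notin> span (b ` {..<i})" "span (b ` {..<dim F}) = F"
proof -
  obtain B where B: "B \<subseteq> F" "independent B" "F \<subseteq> span B" "card B = dim F" using basis_exists by blast
  have "finite B" using B(2) by (rule independent_imp_finite)
  then obtain b where b: "bij_betw b {0..<dim F} B" using ex_bij_betw_nat_finite B(4) by metis
  have im: "b ` {..<dim F} = B" using bij_betw_imp_surj_on[OF b] by (simp add: lessThan_atLeast0)
  have "b i \<notin> span (b ` {..<i})" if i: "i < dim F" for i
  proof
    assume "b i \<in> span (b ` {..<i})"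
    moreover have "b ` {..<i} \<subseteq> B - {b i}"
      using bij_betw_imp_inj_on[OF b] im i by (auto dest: inj_onD)
    ultimately have "b i \<in> span (B - {b i})" using span_mono by blast
    then show False using B(2) im i unfolding dependent_def by blast
  qed
  moreover have "span B = F" using B(1,3) subspace_F by (simp add: span_subspace)
  ultimately show thesis using that im by metis
qed

context
  fixes U \<theta> assumes triv: "local_triv A U \<theta>"
begin

abbreviation "Lift \<equiv> lift A U \<theta>"
abbreviation "Gram q v w \<equiv> g (Lift q v) (Lift q w)"

lemma gram_scalar_product:
  assumes q: "q \<in> U" and b: "\<And>i. i < dim F \<Longrightarrow> b i \<notin> span (b ` {..<i})" "span (b ` {..<dim F}) = F"
  shows "scalar_product F (Gram q) b (dim F)"
proof
  note qQ = U_sub[OF triv q] and l = lift_fibre[OF triv q]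
  show "Gram q v w = Gram q w v" if "v \<in> F" "w \<in> F" for v w using metric_sym[OF qQ] l that by blast
  show "Gram q (u + v) w = Gram q u w + Gram q v w" if "u \<in> F" "v \<in> F" "w \<in> F" for u v w
    using metric_add[OF qQ] l that lift_add[OF triv q] by simp
  show "Gram q (c *\<^sub>R v) w = c * Gram q v w" if "v \<in> F" "w \<in> F" for c v w
    using metric_scale[OF qQ] l that lift_scale[OF triv q] by simp
  show "Gram q v v > 0" if v: "v \<in> F" "v \<noteq> 0" for v
  proof (rule metric_pos[OF qQ l[OF v(1)]])
    show "Lift q v \<noteq> fscale A 0 (Lift q v)"
    proof
      assume "Lift q v = fscale A 0 (Lift q v)"
      also have "\<dots> = Lift q 0" using lift_scale[OF triv q v(1), of 0] by simp
      finally have "\<theta> (Lift q v) = \<theta> (Lift q 0)" by simp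
      then show False using triv_lift[OF triv q] v subspace_0[OF subspace_F] by simp
    qed
  qed
qed (use subspace_F b in auto)

text \<open>\<open>bundle_metric\<close> provides smoothness on smooth local sections; lifts of
  constant vectors are such sections, and bilinearity passes from them to the moving vectors
  \<open>u\<close> and \<open>z\<close>.\<close>

lemma gram_smooth:
  assumes q: "q \<in> U" and u: "smooth_near Q u q" "\<And>q. q \<in> U \<Longrightarrow> u q \<in> F" and z: "smooth_near Q z q" "\<And>q. q \<in> U \<Longrightarrow> z q \<in> F"
  shows "smooth_near Q (\<lambda>q. Gram q (u q) (z q)) q"
proof -
  obtain B where B: "B \<subseteq> F" "pairwise orthogonal B" "\<And>b. b \<in> B \<Longrightarrow> norm b = 1" "independent B" "span B = F"
    using orthonormal_basis_subspace[OF subspace_F] by metis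
  have fin: "finite B" using B(4) by (rule independent_imp_finite)
  obtain b :: "nat \<Rightarrow> 'f" where b: "\<And>i. i < dim F \<Longrightarrow> b i \<notin> span (b ` {..<i})" "span (b ` {..<dim F}) = F"
    by (rule ex_basis) blast
  have const: "smooth_near Q (\<lambda>q. Gram q v w) q" if vw: "v \<in> F" "w \<in> F" for v w
  proof -
    have "smooth_fun (open_atlas Q U) (\<lambda>q. Gram q v w)"
      by (rule metric_smooth[OF U_open[OF triv] lift_smooth[OF triv] lift_smooth[OF triv]])
        (use vw lift_fibre[OF triv] in auto)
    then have "smooth_near (open_atlas Q U) (\<lambda>q. Gram q v w) q"
      using q unfolding smooth_fun_iff[OF smooth_QU[OF triv]] carrier_QU[OF triv] by blast
    then show ?thesis by (rule smooth_near_open_atlas[OF smooth_Q U_open[OF triv] q, THEN iffD1])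
  qed
  have eq: "Gram q (u q) (z q) = (\<Sum>a\<in>B. (u q \<bullet> a) * (\<Sum>c\<in>B. (z q \<bullet> c) * Gram q a c))" if q: "q \<in> U" for q
  proof -
    interpret scalar_product F "Gram q" b "dim F" using gram_scalar_product[OF q b] .
    have "Gram q (u q) (z q) = Gram q (\<Sum>a\<in>B. (u q \<bullet> a) *\<^sub>R a) (z q)"
      using orthonormal_expansion[OF B(2,3) fin] u(2)[OF q] B(5) by simp
    also have "\<dots> = (\<Sum>a\<in>B. (u q \<bullet> a) * Gram q a (z q))" using B(1) fin z(2)[OF q] by (intro G_sum) auto
    also have "\<dots> = (\<Sum>a\<in>B. (u q \<bullet> a) * (\<Sum>c\<in>B. (z q \<bullet> c) * Gram q a c))"
    proof (intro sum.cong refl arg_cong2[where f = "(*)"])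
      fix a assume "a \<in> B"
      then have a: "a \<in> F" using B by blast
      have "Gram q a (z q) = Gram q (z q) a" using sym a z(2)[OF q] by blast
      also have "\<dots> = Gram q (\<Sum>c\<in>B. (z q \<bullet> c) *\<^sub>R c) a"
        using orthonormal_expansion[OF B(2,3) fin] z(2)[OF q] B(5) by simp
      also have "\<dots> = (\<Sum>c\<in>B. (z q \<bullet> c) * Gram q c a)" using B(1) fin a by (intro G_sum) auto
      also have "\<dots> = (\<Sum>c\<in>B. (z q \<bullet> c) * Gram q a c)" using B(1) a sym by (intro sum.cong refl) auto
      finally show "Gram q a (z q) = (\<Sum>c\<in>B. (z q \<bullet> c) * Gram q a c)" .
    qed
    finally show ?thesis .
  qed
  have qc: "q \<in> carrier Q" using U_sub[OF triv q] .
  have "smooth_near Q (\<lambda>q. \<Sum>a\<in>B. (u q \<bullet> a) * (\<Sum>c\<in>B. (z q \<bullet> c) * Gram q a c)) q"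
  proof (rule smooth_near_sum[OF smooth_Q qc], rule smooth_near_mult[OF smooth_Q], goal_cases)
    case (1 a)
    show ?case by (rule smooth_near_inner[OF smooth_Q u(1) smooth_near_const[OF qc]])
  next
    case (2 a)
    show ?case
      by (rule smooth_near_sum[OF smooth_Q qc], rule smooth_near_mult[OF smooth_Q smooth_near_inner[OF smooth_Q z(1) smooth_near_const[OF qc]]],
        rule const) (use B(1) 2 in auto)
  qed
  then show ?thesis by (rule smooth_near_cong[OF _ U_open[OF triv] q eq])
qed

lemma gram_schmidt_smooth:
  assumes b: "\<And>i. i < dim F \<Longrightarrow> b i \<notin> span (b ` {..<i})" "span (b ` {..<dim F}) = F"
    and q: "q \<in> U"
  shows "i < dim F \<Longrightarrow> smooth_near Q (\<lambda>q. gram_schmidt (Gram q) b i) q"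
proof (induction i rule: less_induct)
  case (less i)
  have qc: "q \<in> carrier Q" using U_sub[OF triv q] .
  have wF: "gram_schmidt (Gram q) b j \<in> F" if "q \<in> U" "j < dim F" for q j
    by (rule scalar_product.w_F[OF gram_scalar_product[OF that(1) b] that(2)])
  have bF: "b i \<in> F" by (rule scalar_product.b_F[OF gram_scalar_product[OF q b] less(2)])
  have "smooth_near Q (\<lambda>q. (Gram q (b i) (gram_schmidt (Gram q) b j) /
      Gram q (gram_schmidt (Gram q) b j) (gram_schmidt (Gram q) b j)) *\<^sub>R gram_schmidt (Gram q) b j) q"
    if j: "j \<in> {..<i}" for j
  proof -
    have jr: "j < dim F" using j less by simp
    have s: "smooth_near Q (\<lambda>q. gram_schmidt (Gram q) b j) q" using less j by simp
    have "Gram q (gram_schmidt (Gram q) b j) (gram_schmidt (Gram q) b j) \<noteq> 0"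
      using scalar_product.w_pos[OF gram_scalar_product[OF q b] jr] by simp
    then show ?thesis
      by (intro smooth_near_scaleR[OF smooth_Q smooth_near_divide[OF smooth_Q gram_smooth[OF q] gram_smooth[OF q]] s])
        (use s bF wF jr smooth_near_const[OF qc] in auto)
  qed
  then have "smooth_near Q (\<lambda>q. b i - (\<Sum>j<i. (Gram q (b i) (gram_schmidt (Gram q) b j) /
      Gram q (gram_schmidt (Gram q) b j) (gram_schmidt (Gram q) b j)) *\<^sub>R gram_schmidt (Gram q) b j)) q"
    by (rule smooth_near_diff[OF smooth_Q smooth_near_const[OF qc] smooth_near_sum[OF smooth_Q qc]])
  then show ?case by (subst gram_schmidt.simps)
qed

text \<open>The trivialization carries the unit ball of the fibre to that of \<open>Gram\<close>, so
  the supremum in \<open>dual_norm\<close> becomes the one in \<open>Sup_dual\<close>; smoothness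
  and homogeneity of the energy are then read off from \<open>sq\<close>.\<close>

lemma kinetic_coord:
  assumes b: "\<And>i. i < dim F \<Longrightarrow> b i \<notin> span (b ` {..<i})" "span (b ` {..<dim F}) = F"
    and x: "x \<in> dual_set A" "fst x \<in> U"
  shows "\<kappa> x = scalar_product.sq (Gram (fst x)) b (dim F) (coord A \<theta> x) / 2"
proof -
  interpret scalar_product F "Gram (fst x)" b "dim F" using gram_scalar_product[OF x(2) b] .
  have "{\<bar>snd x a\<bar> | a. a \<in> fibre A (fst x) \<and> g a a \<le> 1} = {\<bar>coord A \<theta> x \<bullet> v\<bar> | v. v \<in> F \<and> Gram (fst x) v v \<le> 1}"
    (is "?l = ?r")
  proof
    show "?l \<subseteq> ?r"
    proof clarify
      fix a assume a: "a \<in> fibre A (fst x)" "g a a \<le> 1"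
      show "\<exists>v. \<bar>snd x a\<bar> = \<bar>coord A \<theta> x \<bullet> v\<bar> \<and> v \<in> F \<and> Gram (fst x) v v \<le> 1"
        using coord_apply[OF triv x a(1)] triv_snd[OF triv x(2) a(1)] lift_triv[OF triv x(2) a(1)] a
        by (intro exI[of _ "snd (\<theta> a)"]) simp
    qed
    show "?r \<subseteq> ?l"
    proof clarify
      fix v assume v: "v \<in> F" "Gram (fst x) v v \<le> 1"
      show "\<exists>a. \<bar>coord A \<theta> x \<bullet> v\<bar> = \<bar>snd x a\<bar> \<and> a \<in> fibre A (fst x) \<and> g a a \<le> 1"
        using coord_lift[OF triv x v(1)] lift_fibre[OF triv x(2) v(1)] v by (intro exI[of _ "Lift (fst x) v"]) simp
    qed
  qed
  then have "dual_norm A g x = sqrt (sq (coord A \<theta> x))"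
    using Sup_dual[OF coord_F[OF triv x]] by (simp add: dual_norm_def case_prod_beta)
  then show ?thesis using sq_nonneg by (simp add: kinetic_energy_def)
qed

end

lemma kinetic_smooth_near: assumes x: "x \<in> dual_set A" shows "smooth_near M \<kappa> x"
proof -
  obtain U \<theta> where U: "local_triv A U \<theta>" "fst x \<in> U" using ex_triv[OF dual_set_base[OF x]] by metis
  obtain b :: "nat \<Rightarrow> 'f" where b: "\<And>i. i < dim F \<Longrightarrow> b i \<notin> span (b ` {..<i})" "span (b ` {..<dim F}) = F"
    by (rule ex_basis) blast
  let ?G = "\<lambda>q v w. g (lift A U \<theta> q v) (lift A U \<theta> q w)"
  let ?w = "\<lambda>i q. gram_schmidt (?G q) b i"
  note sp = gram_scalar_product[OF U(1) _ b]
  have summand: "smooth_near M (\<lambda>x. (coord A \<theta> x \<bullet> ?w i (fst x)) * (coord A \<theta> x \<bullet> ?w i (fst x)) / ?G (fst x) (?w i (fst x)) (?w i (fst x))) x"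
    if i: "i < dim F" for i
  proof -
    have w: "smooth_near Q (?w i) (fst x)" by (rule gram_schmidt_smooth[OF U(1) b U(2) i])
    have wF: "?w i q \<in> F" if "q \<in> U" for q by (rule scalar_product.w_F[OF sp[OF that] i])
    have c: "smooth_near M (\<lambda>x. coord A \<theta> x \<bullet> ?w i (fst x)) x"
      by (rule smooth_near_inner[OF M_smooth coord_smooth[OF U(1) x U(2)] fst_smooth[OF x w]])
    have "?G (fst x) (?w i (fst x)) (?w i (fst x)) \<noteq> 0"
      using scalar_product.w_pos[OF sp[OF U(2)] i] by simp
    then show ?thesis
      by (rule smooth_near_divide[OF M_smooth smooth_near_mult[OF M_smooth c c]
          fst_smooth[OF x gram_smooth[OF U(1,2) w wF w wF]], rotated 2])
  qed
  have "smooth_near M (\<lambda>x. (1/2) * (\<Sum>i<dim F. (coord A \<theta> x \<bullet> ?w i (fst x)) * (coord A \<theta> x \<bullet> ?w i (fst x)) /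
      ?G (fst x) (?w i (fst x)) (?w i (fst x)))) x"
    by (rule smooth_near_mult[OF M_smooth smooth_near_const smooth_near_sum[OF M_smooth]])
      (use x summand in \<open>auto simp: carrier_M\<close>)
  then show ?thesis
  proof (rule smooth_near_cong[OF _ openin_fst[OF U_open[OF U(1)]]])
    show "x \<in> {x \<in> dual_set A. fst x \<in> U}" using x U by simp
    fix y assume y: "y \<in> {x \<in> dual_set A. fst x \<in> U}"
    then show "\<kappa> y = (1/2) * (\<Sum>i<dim F. (coord A \<theta> y \<bullet> ?w i (fst y)) * (coord A \<theta> y \<bullet> ?w i (fst y)) /
      ?G (fst y) (?w i (fst y)) (?w i (fst y)))"
      using kinetic_coord[OF U(1) b, of y] scalar_product.sq_def[OF sp[of "fst y"]] by (simp add: power2_eq_square)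
  qed
qed

lemma kinetic_smooth: "smooth_fun M \<kappa>"
  using kinetic_smooth_near by (simp add: smooth_fun_iff[OF M_smooth] carrier_M)

lemma
  assumes x: "x \<in> dual_set A"
  shows kinetic_nonneg: "\<kappa> x \<ge> 0"
    and kinetic_eq_0: "\<kappa> x = 0 \<Longrightarrow> x \<in> zero_section A"
    and kinetic_dilation: "\<kappa> (dilation c x) = c\<^sup>2 * \<kappa> x"
proof -
  obtain U \<theta> where U: "local_triv A U \<theta>" "fst x \<in> U" using ex_triv[OF dual_set_base[OF x]] by metis
  obtain b :: "nat \<Rightarrow> 'f" where b: "\<And>i. i < dim F \<Longrightarrow> b i \<notin> span (b ` {..<i})" "span (b ` {..<dim F}) = F"
    by (rule ex_basis) blast
  interpret scalar_product F "\<lambda>v w. g (lift A U \<theta> (fst x) v) (lift A U \<theta> (fst x) w)" b "dim F"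
    by (rule gram_scalar_product[OF U b])
  note k = kinetic_coord[OF U(1) b x U(2)]
  show "\<kappa> x \<ge> 0" using k sq_nonneg[of "coord A \<theta> x"] by simp
  show "x \<in> zero_section A" if "\<kappa> x = 0"
    using that sq_eq_0[OF coord_F[OF U(1) x U(2)]] coord_eq_0_iff[OF U(1) x U(2)] k by simp
  have "\<kappa> (dilation c x) = sq (c *\<^sub>R coord A \<theta> x) / 2"
    using kinetic_coord[OF U(1) b dilation_dual[OF x]] U(2) coord_dilation[OF U(1) x U(2)] by simp
  also have "sq (c *\<^sub>R coord A \<theta> x) = c\<^sup>2 * sq (coord A \<theta> x)"
    unfolding sq_def by (simp add: sum_distrib_left power_mult_distrib)
  finally show "\<kappa> (dilation c x) = c\<^sup>2 * \<kappa> x" by (simp add: k)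
qed

lemma kinetic_zero: "x \<in> zero_section A \<Longrightarrow> x \<in> dual_set A \<Longrightarrow> \<kappa> x = 0"
proof -
  assume x: "x \<in> zero_section A" "x \<in> dual_set A"
  then have "dilation 0 x = x" by (auto simp: zero_section_def dilation_def)
  then show "\<kappa> x = 0" using kinetic_dilation[OF x(2), of 0] by simp
qed

lemma liouville_kinetic: "x \<in> dual_set A \<Longrightarrow> liouville_vf A x \<kappa> = 2 * \<kappa> x"
  using liouville_homogeneous[OF kinetic_smooth, of x 2] kinetic_dilation by simp

section \<open>Radius and radial retraction off the zero section\<close>

abbreviation "Sg \<equiv> sphere_bundle A g"
abbreviation "Z0 \<equiv> dual_set A - zero_section A"

lemma Z0_iff: "x \<in> dual_set A \<Longrightarrow> x \<in> Z0 \<longleftrightarrow> \<kappa> x > 0"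
  using kinetic_nonneg kinetic_eq_0 kinetic_zero by (metis DiffD2 DiffI less_eq_real_def order_less_irrefl)

lemma Sg_Z0: "x \<in> Sg \<Longrightarrow> x \<in> Z0"
  unfolding sphere_bundle_def using Z0_iff[of x] by auto

lemma Sg_dual: "x \<in> Sg \<Longrightarrow> x \<in> dual_set A" and Sg_kinetic: "x \<in> Sg \<Longrightarrow> \<kappa> x = 1/2"
  unfolding sphere_bundle_def by auto

lemma openin_kinetic: "open T \<Longrightarrow> openin (mtopology M) {x \<in> dual_set A. \<kappa> x \<in> T}"
proof (subst openin_subopen, intro ballI)
  fix x assume T: "open T" and x: "x \<in> {x \<in> dual_set A. \<kappa> x \<in> T}"
  obtain N where "openin (mtopology M) N" "x \<in> N" "\<kappa> ` N \<subseteq> T"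
    using smooth_near_nbhd[OF M_smooth kinetic_smooth_near T, of x] x by blast
  then show "\<exists>N. openin (mtopology M) N \<and> x \<in> N \<and> N \<subseteq> {x \<in> dual_set A. \<kappa> x \<in> T}"
    using openin_subset[of "mtopology M" N] by (auto simp: topspace_mtopology carrier_M)
qed

lemma openin_Z0: "openin (mtopology M) Z0"
proof -
  have "Z0 = {x \<in> dual_set A. \<kappa> x \<in> {0<..}}" using Z0_iff by blast
  then show ?thesis using openin_kinetic[of "{0<..}"] by simp
qed

text \<open>On the dual bundle this is the dual norm itself, written through \<open>\<kappa>\<close>
  because smoothness is known for \<open>\<kappa>\<close>.\<close>

definition "rad x = sqrt (2 * \<kappa> x)"

lemma rad_smooth: "x \<in> Z0 \<Longrightarrow> smooth_near M rad x"
  unfolding rad_def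
  by (intro smooth_near_sqrt smooth_near_mult[OF M_smooth smooth_near_const kinetic_smooth_near])
    (use Z0_iff[of x] in \<open>auto simp: carrier_M\<close>)

lemma rad_pos: "x \<in> Z0 \<Longrightarrow> rad x > 0"
  unfolding rad_def using Z0_iff[of x] by auto

lemma rad_dilation: "x \<in> dual_set A \<Longrightarrow> c \<ge> 0 \<Longrightarrow> rad (dilation c x) = c * rad x"
  unfolding rad_def using kinetic_dilation by (simp add: real_sqrt_mult)

lemma rad_1_iff: "x \<in> dual_set A \<Longrightarrow> rad x = 1 \<longleftrightarrow> x \<in> Sg"
  unfolding rad_def sphere_bundle_def by auto

definition "rho x = dilation (1 / rad x) x"

lemma rho_Sg: "x \<in> Z0 \<Longrightarrow> rho x \<in> Sg"
  using rad_1_iff[of "rho x"] rad_dilation[of x "1 / rad x"] rad_pos[of x] dilation_dual[of x]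
  unfolding rho_def by simp

lemma rho_id: "x \<in> Sg \<Longrightarrow> rho x = x"
  unfolding rho_def using rad_1_iff[of x] Sg_dual by simp

lemma dilation_Z0: "x \<in> Z0 \<Longrightarrow> c > 0 \<Longrightarrow> dilation c x \<in> Z0"
  using Z0_iff[of x] Z0_iff[of "dilation c x"] kinetic_dilation[of x c] dilation_dual[of x c] by simp

lemma rho_dilation: "x \<in> Z0 \<Longrightarrow> c > 0 \<Longrightarrow> rho (dilation c x) = rho x"
  unfolding rho_def using rad_dilation[of x c] by (simp add: dilation_dilation)

subsection \<open>Slice charts for the sphere bundle\<close>

text \<open>Near a point with fibre coordinate \<open>y1\<close> (up to scaling), the radius together with the radial
  projection of the fibre coordinate onto the hyperplane \<open>y \<bullet> y1 = 1\<close> is a chart adapted to \<open>Sg\<close>;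
  its inverse is explicit, so no inverse function theorem is needed.\<close>

lemma slice_chart:
  assumes p: "p \<in> Sg"
  obtains B where "p \<in> B" "\<exists>\<phi>. (B, \<phi>) \<in> slice_atlas (n + dim F - 1) M Sg"
proof -
  have pd: "p \<in> dual_set A" using p by (rule Sg_dual)
  obtain C \<phi> U \<theta> where C: "(C, \<phi>) \<in> Q" "local_triv A U \<theta>" "fst p \<in> C" "fst p \<in> U" using pd by (rule dual_chartE)
  note triv = C(2)
  define B where "B = {x \<in> dual_set A. fst x \<in> C \<inter> U}"
  define \<Phi> where "\<Phi> = (\<lambda>x. (\<phi> (fst x), coord A \<theta> x))"
  have ch: "(B, \<Phi>) \<in> M" unfolding B_def \<Phi>_def by (rule dual_atlasI[OF C(1,2)])
  have Bd: "x \<in> dual_set A" "fst x \<in> C" "fst x \<in> U" if "x \<in> B" for x using that unfolding B_def by auto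
  define y1 where "y1 = (1 / norm (coord A \<theta> p)) *\<^sub>R coord A \<theta> p"
  have y0: "coord A \<theta> p \<noteq> 0" using coord_eq_0_iff[OF triv pd C(4)] Sg_Z0[OF p] by blast
  have y1F: "y1 \<in> F" unfolding y1_def using coord_F[OF triv pd C(4)] subspace_F by (simp add: subspace_scale)
  have y1n: "y1 \<bullet> y1 = 1" using y0 by (simp add: y1_def dot_square_norm power2_eq_square)
  define s where "s x = coord A \<theta> x \<bullet> y1" for x
  define U' where "U' = {x \<in> B. s x > 0}"
  have U'd: "x \<in> B" "s x > 0" "x \<in> dual_set A" "fst x \<in> C" "fst x \<in> U" "coord A \<theta> x \<in> F" "x \<in> Z0" if "x \<in> U'" for x
  proof -
    show B: "x \<in> B" and s: "s x > 0" using that unfolding U'_def by auto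
    show x: "x \<in> dual_set A" "fst x \<in> C" "fst x \<in> U" using Bd[OF B] by auto
    show "coord A \<theta> x \<in> F" by (rule coord_F[OF triv x(1,3)])
    have "coord A \<theta> x \<noteq> 0" using s unfolding s_def by auto
    then show "x \<in> Z0" using coord_eq_0_iff[OF triv x(1,3)] x(1) by blast
  qed
  \<comment> \<open>Dividing by \<open>s x\<close> moves the coordinate onto the hyperplane
    \<open>y \<bullet> y1 = 1\<close>; adding \<open>rad x - 2\<close> times \<open>y1\<close> turns
    the component along \<open>y1\<close> into \<open>rad x - 1\<close>, which vanishes exactly on
    \<open>Sg\<close>.\<close>
  define \<Psi> where "\<Psi> x = (\<phi> (fst x), (1 / s x) *\<^sub>R coord A \<theta> x + (rad x - 2) *\<^sub>R y1)" for x
  \<comment> \<open>Projection along \<open>y1\<close> onto the hyperplane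
    \<open>y \<bullet> y1 = 1\<close>; it removes the radius from the fibre part of
    \<open>\<Psi> x\<close> and leaves the direction.\<close>
  define dd where "dd y = y + (1 - y \<bullet> y1) *\<^sub>R y1" for y
  have dd_F: "dd y \<in> F" if "y \<in> F" for y unfolding dd_def using that y1F subspace_F by (simp add: subspace_add subspace_scale)
  have dd_1: "dd y \<bullet> y1 = 1" for y unfolding dd_def using y1n by (simp add: inner_add_left)
  have \<Psi>_1: "snd (\<Psi> x) \<bullet> y1 = rad x - 1" and \<Psi>_d: "dd (snd (\<Psi> x)) = (1 / s x) *\<^sub>R coord A \<theta> x"
    and \<Psi>_F: "snd (\<Psi> x) \<in> F" if x: "x \<in> U'" for x
  proof -
    show 1: "snd (\<Psi> x) \<bullet> y1 = rad x - 1"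
      unfolding \<Psi>_def using U'd(2)[OF x] y1n by (simp add: inner_add_left s_def)
    show "dd (snd (\<Psi> x)) = (1 / s x) *\<^sub>R coord A \<theta> x"
      unfolding dd_def 1 by (simp add: \<Psi>_def algebra_simps flip: scaleR_add_left scaleR_diff_left)
    show "snd (\<Psi> x) \<in> F" unfolding \<Psi>_def using U'd(6)[OF x] y1F subspace_F by (simp add: subspace_add subspace_scale)
  qed
  have covec_B: "covec A \<theta> q y \<in> B" "coord A \<theta> (covec A \<theta> q y) = y" if "q \<in> C" "q \<in> U" "y \<in> F" for q y
    unfolding B_def using covec_dual[OF triv that(2,3)] coord_covec[OF triv that(2,3)] that by auto
  have covec_U': "covec A \<theta> q y \<in> U'" if "q \<in> C" "q \<in> U" "y \<in> F" "y \<bullet> y1 > 0" for q y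
    unfolding U'_def s_def using covec_B[OF that(1-3)] that(4) by simp
  have rad_covec: "rad (covec A \<theta> q (c *\<^sub>R y)) = c * rad (covec A \<theta> q y)"
    if "q \<in> C" "q \<in> U" "y \<in> F" "c \<ge> 0" for q y c
  proof -
    have "dilation c (covec A \<theta> q y) = covec A \<theta> q (c *\<^sub>R y)"
      by (auto simp: dilation_def covec_def fun_eq_iff)
    then show ?thesis using rad_dilation[OF covec_dual[OF triv that(2,3)] that(4)] by simp
  qed
  \<comment> \<open>By homogeneity \<open>rad x\<close> is \<open>s x\<close> times the radius of
    the direction vector, so the lost factor \<open>s x\<close> is a quotient of radii, with
    numerator \<open>1 + snd (\<Psi> x) \<bullet> y1\<close>.\<close>
  have inv: "coord A \<theta> x = ((1 + snd (\<Psi> x) \<bullet> y1) / rad (covec A \<theta> (fst x) (dd (snd (\<Psi> x))))) *\<^sub>R dd (snd (\<Psi> x))"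
    if x: "x \<in> U'" for x
  proof -
    have "rad x = rad (covec A \<theta> (fst x) (s x *\<^sub>R dd (snd (\<Psi> x))))"
      using covec_coord[OF triv U'd(3,5)[OF x]] U'd(2)[OF x] \<Psi>_d[OF x] by simp
    also have "\<dots> = s x * rad (covec A \<theta> (fst x) (dd (snd (\<Psi> x))))"
      using U'd[OF x] dd_F[OF \<Psi>_F[OF x]] by (intro rad_covec) auto
    finally have "rad x = s x * rad (covec A \<theta> (fst x) (dd (snd (\<Psi> x))))" .
    moreover have "rad x > 0" using rad_pos[OF U'd(7)[OF x]] .
    ultimately have "rad x / rad (covec A \<theta> (fst x) (dd (snd (\<Psi> x)))) = s x" by (auto simp: field_simps)
    then show ?thesis using \<Psi>_1[OF x] \<Psi>_d[OF x] U'd(2)[OF x] by simp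
  qed
  note injC = smooth_atlasD(1)[OF smooth_Q C(1)]
  have inj: "inj_on \<Psi> U'"
  proof (rule inj_onI)
    fix x y assume xy: "x \<in> U'" "y \<in> U'" "\<Psi> x = \<Psi> y"
    have "\<phi> (fst x) = \<phi> (fst y)" using xy(3) by (simp add: \<Psi>_def)
    then have q: "fst x = fst y" using injC U'd(4)[OF xy(1)] U'd(4)[OF xy(2)] by (auto dest: inj_onD)
    then have "coord A \<theta> x = coord A \<theta> y" using inv[OF xy(1)] inv[OF xy(2)] xy(3) by simp
    then show "x = y" using covec_coord[OF triv U'd(3,5)[OF xy(1)]] covec_coord[OF triv U'd(3,5)[OF xy(2)]] q by metis
  qed
  obtain V where V: "subspace V" "dim V = n" "openin (top_of_set V) (\<phi> ` C)" using base_chart_dim[OF C(1)] by blast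
  have "openin (top_of_set (\<phi> ` C)) (\<phi> ` (C \<inter> U))"
    using openin_image_iff[OF injC, of "C \<inter> U"] openin_mtopologyD[OF U_open[OF triv] C(1)] by auto
  then have o: "openin (top_of_set V) (\<phi> ` (C \<inter> U))" using V(3) openin_trans by blast
  \<comment> \<open>The component along \<open>y1\<close> is \<open>rad x - 1\<close> with
    \<open>rad x > 0\<close>, whence the bound -1.\<close>
  have im: "\<Psi> ` U' = (\<phi> ` (C \<inter> U) \<times> F) \<inter> (UNIV \<times> {y. y \<bullet> y1 > -1})"
  proof
    show "\<Psi> ` U' \<subseteq> (\<phi> ` (C \<inter> U) \<times> F) \<inter> (UNIV \<times> {y. y \<bullet> y1 > -1})"
    proof
      fix z assume "z \<in> \<Psi> ` U'"
      then obtain x where x: "x \<in> U'" "z = \<Psi> x" by blast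
      have "fst z \<in> \<phi> ` (C \<inter> U)" using x U'd(4,5)[OF x(1)] by (simp add: \<Psi>_def)
      moreover have "snd z \<in> F" "snd z \<bullet> y1 > -1"
        using x \<Psi>_F[OF x(1)] \<Psi>_1[OF x(1)] rad_pos[OF U'd(7)[OF x(1)]] by auto
      ultimately show "z \<in> (\<phi> ` (C \<inter> U) \<times> F) \<inter> (UNIV \<times> {y. y \<bullet> y1 > -1})" by (cases z) auto
    qed
    show "(\<phi> ` (C \<inter> U) \<times> F) \<inter> (UNIV \<times> {y. y \<bullet> y1 > -1}) \<subseteq> \<Psi> ` U'"
    proof
      fix z assume z: "z \<in> (\<phi> ` (C \<inter> U) \<times> F) \<inter> (UNIV \<times> {y. y \<bullet> y1 > -1})"
      obtain q y where q: "z = (\<phi> q, y)" "q \<in> C" "q \<in> U" and y: "y \<in> F" "y \<bullet> y1 > -1" using z by auto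
      let ?c = "(1 + y \<bullet> y1) / rad (covec A \<theta> q (dd y))"
      note dF = dd_F[OF y(1)]
      have d1: "dd y \<bullet> y1 > 0" using dd_1 by simp
      have rp: "rad (covec A \<theta> q (dd y)) > 0" by (rule rad_pos[OF U'd(7)[OF covec_U'[OF q(2,3) dF d1]]])
      have c: "?c > 0" using rp y by simp
      let ?x = "covec A \<theta> q (?c *\<^sub>R dd y)"
      have cF: "?c *\<^sub>R dd y \<in> F" using dF subspace_F by (simp add: subspace_scale)
      have xU: "?x \<in> U'"
        by (rule covec_U'[OF q(2,3) cF]) (simp only: inner_scaleR_left mult_pos_pos[OF c d1])
      have "s ?x = ?c" unfolding s_def covec_B(2)[OF q(2,3) cF] using dd_1 by simp
      moreover have "rad ?x = 1 + y \<bullet> y1" using rad_covec[OF q(2,3) dF, of ?c] c rp by simp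
      ultimately have "\<Psi> ?x = (\<phi> q, (1 / ?c) *\<^sub>R (?c *\<^sub>R dd y) + (y \<bullet> y1 - 1) *\<^sub>R y1)"
        unfolding \<Psi>_def covec_B(2)[OF q(2,3) cF] by simp
      also have "(1 / ?c) *\<^sub>R (?c *\<^sub>R dd y) = dd y"
      proof -
        have "(1 / c) *\<^sub>R (c *\<^sub>R v) = v" if "c > 0" for c :: real and v :: 'f using that by simp
        from this[OF c] show ?thesis .
      qed
      also have "dd y + (y \<bullet> y1 - 1) *\<^sub>R y1 = y" unfolding dd_def by (simp add: algebra_simps)
      finally show "z \<in> \<Psi> ` U'" using xU q(1) by (metis image_eqI)
    qed
  qed
  have "openin (top_of_set (V \<times> F)) (\<phi> ` (C \<inter> U) \<times> F)" by (rule openin_Times[OF o openin_subtopology_self])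
  moreover have "open (UNIV \<times> {y. y \<bullet> y1 > -1} :: ('b \<times> 'f) set)"
    by (intro open_Times open_UNIV open_Collect_less continuous_intros)
  ultimately have V': "openin (top_of_set (V \<times> F)) (\<Psi> ` U')" unfolding im by (rule openin_Int_open)
  have U'_open: "openin (mtopology M) U'"
  proof -
    have "U' = B \<inter> \<Phi> -` (UNIV \<times> {y. y \<bullet> y1 > 0})" unfolding U'_def s_def \<Phi>_def by auto
    moreover have "open (UNIV \<times> {y. y \<bullet> y1 > 0} :: ('b \<times> 'f) set)"
      by (intro open_Times open_UNIV open_Collect_less continuous_intros)
    ultimately show ?thesis using openin_chart_vimage[OF M_smooth ch] by simp
  qed
  have to: "smooth_near M \<Psi> x" if x: "x \<in> U'" for x
  proof -
    have xM: "x \<in> carrier M" using U'd(3)[OF x] by (simp add: carrier_M)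
    note cs = coord_smooth[OF triv U'd(3,5)[OF x]]
    have "smooth_near M (\<lambda>x. 1 / s x) x" unfolding s_def
      by (rule smooth_near_divide[OF M_smooth smooth_near_const[OF xM] smooth_near_inner[OF M_smooth cs smooth_near_const[OF xM]]])
        (use U'd(2)[OF x] in \<open>simp add: s_def\<close>)
    then show ?thesis unfolding \<Psi>_def
      by (intro smooth_near_Pair[OF M_smooth fst_smooth[OF U'd(3)[OF x] smooth_nearI[OF C(1) U'd(4)[OF x] smooth_in_chart]]]
          smooth_near_add[OF M_smooth smooth_near_scaleR[OF M_smooth _ cs]]
          smooth_near_scaleR[OF M_smooth smooth_near_diff[OF M_smooth rad_smooth[OF U'd(7)[OF x]] smooth_near_const[OF xM]] smooth_near_const[OF xM]])
  qed
  have from': "smooth_in U' \<Psi> \<Phi> x" if x: "x \<in> U'" for x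
  proof -
    \<comment> \<open>An auxiliary atlas with the single chart \<open>\<Psi>\<close>: the calculus
      of \<open>smooth_near\<close> over it is the calculus of smooth functions of
      \<open>\<Psi>\<close>.\<close>
    define N where "N = {(U', \<Psi>)}"
    have N: "smooth_atlas N"
    proof (rule smooth_atlasI; clarsimp simp: N_def)
      show "\<exists>V. subspace V \<and> openin (top_of_set V) (\<Psi> ` U')" using V' subspace_Times[OF V(1) subspace_F] by blast
      show "\<exists>T. open T \<and> U' = U' \<inter> \<Psi> -` T" by (rule exI[of _ UNIV]) simp
    qed (use inj smooth_in_chart in auto)
    have xN: "x \<in> carrier N" using x by (simp add: carrier_def N_def)
    have carN: "carrier N = U'" by (simp add: carrier_def N_def)
    have \<Psi>N: "smooth_near N \<Psi> x" by (rule smooth_nearI[of U' \<Psi>]) (use x smooth_in_chart in \<open>auto simp: N_def\<close>)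
    have 1: "smooth_near N (\<lambda>x. fst (\<Psi> x)) x" by (rule smooth_near_linear[OF bounded_linear_fst \<Psi>N])
    have 2: "smooth_near N (\<lambda>x. snd (\<Psi> x)) x" by (rule smooth_near_linear[OF bounded_linear_snd \<Psi>N])
    have i: "smooth_near N (\<lambda>x. snd (\<Psi> x) \<bullet> y1) x" by (rule smooth_near_inner[OF N 2 smooth_near_const[OF xN]])
    have d: "smooth_near N (\<lambda>x. dd (snd (\<Psi> x))) x" unfolding dd_def
      by (intro smooth_near_add[OF N 2] smooth_near_scaleR[OF N] smooth_near_diff[OF N] smooth_near_const[OF xN] i)
    let ?c = "\<lambda>x. covec A \<theta> (fst x) (dd (snd (\<Psi> x)))"
    have cov: "?c y \<in> U'" "\<Phi> (?c y) = (fst (\<Psi> y), dd (snd (\<Psi> y)))" if y: "y \<in> U'" for y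
      using covec_U'[OF U'd(4,5)[OF y] dd_F[OF \<Psi>_F[OF y]]] dd_1 covec_B(2)[OF U'd(4,5)[OF y] dd_F[OF \<Psi>_F[OF y]]]
      by (simp_all add: \<Phi>_def \<Psi>_def)
    have "smooth_in B \<Phi> rad (?c x)"
      by (rule smooth_nearD[OF M_smooth rad_smooth[OF U'd(7)] ch U'd(1)]) (rule cov(1)[OF x])+
    then obtain W K where W: "open W" "\<Phi> (?c x) \<in> W" "Cinf_on W K" "\<And>y. y \<in> B \<Longrightarrow> \<Phi> y \<in> W \<Longrightarrow> rad y = K (\<Phi> y)"
      by (rule smooth_inE) blast
    have r: "smooth_near N (\<lambda>x. rad (?c x)) x"
    proof (rule smooth_near_compose[OF smooth_near_Pair[OF N 1 d] W(1) _ W(3)])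
      show "(fst (\<Psi> x), dd (snd (\<Psi> x))) \<in> W" using W(2) cov(2)[OF x] by simp
      show "rad (?c y) = K (fst (\<Psi> y), dd (snd (\<Psi> y)))" if "y \<in> carrier N" "(fst (\<Psi> y), dd (snd (\<Psi> y))) \<in> W" for y
        using W(4)[OF U'd(1)[OF cov(1)[of y]]] cov(2)[of y] that carN by simp
    qed
    have rp: "rad (?c x) \<noteq> 0" using rad_pos[OF U'd(7)[OF cov(1)[OF x]]] by simp
    have "smooth_near N (\<lambda>x. (fst (\<Psi> x), ((1 + snd (\<Psi> x) \<bullet> y1) / rad (?c x)) *\<^sub>R dd (snd (\<Psi> x)))) x"
      by (rule smooth_near_Pair[OF N 1 smooth_near_scaleR[OF N smooth_near_divide[OF N
          smooth_near_add[OF N smooth_near_const[OF xN] i] r rp] d]])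
    then have "smooth_near N \<Phi> x"
      by (rule smooth_near_cong_carrier) (use inv carN in \<open>simp add: \<Phi>_def \<Psi>_def\<close>)
    then show ?thesis by (rule smooth_nearD[OF N]) (use x in \<open>simp_all add: N_def\<close>)
  qed
  have max: "(U', \<Psi>) \<in> maximal_atlas M"
    by (rule maximal_atlasI[OF M_smooth ch _ U'_open inj _ to from'])
      (use V' subspace_Times[OF V(1) subspace_F] U'd(1) in auto)
  let ?H = "{y \<in> F. \<forall>x\<in>span {y1}. orthogonal x y}"
  have H_eq: "?H = {y \<in> F. y \<bullet> y1 = 0}"
    by (auto simp: orthogonal_def span_singleton inner_commute intro: exI[of _ 1])
  \<comment> \<open>The point \<open>p\<close> of \<open>Sg\<close> has a nonzero fibre coordinate,
    so \<open>dim F\<close> is at least 1 here and the truncated subtraction in the dimension of the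
    slice is exact.\<close>
  have dimH: "dim ?H + 1 = dim F"
  proof -
    have "y1 \<noteq> 0" using y1n by auto
    moreover have "span {y1} \<subseteq> F" using y1F subspace_F by (simp add: span_minimal)
    ultimately show ?thesis using dim_subspace_orthogonal_to_vectors[OF subspace_span subspace_F, of "{y1}"] by (simp add: dim_span)
  qed
  have sH: "subspace ?H" using subspace_F unfolding H_eq by (auto simp: subspace_def inner_add_left)
  have "\<Psi> ` (U' \<inter> Sg) = \<Psi> ` U' \<inter> (V \<times> ?H)"
  proof -
    have VC: "\<phi> ` C \<subseteq> V" using openin_imp_subset[OF V(3)] .
    have "\<Psi> x \<in> V \<times> ?H \<longleftrightarrow> x \<in> Sg" if x: "x \<in> U'" for x
    proof -
      have "fst (\<Psi> x) \<in> V" using VC U'd(4)[OF x] by (auto simp: \<Psi>_def)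
      then have "\<Psi> x \<in> V \<times> ?H \<longleftrightarrow> snd (\<Psi> x) \<bullet> y1 = 0" unfolding H_eq using \<Psi>_F[OF x] by (cases "\<Psi> x") auto
      then show ?thesis using \<Psi>_1[OF x] rad_1_iff[OF U'd(3)[OF x]] by auto
    qed
    moreover have "f ` (X \<inter> Y) = f ` X \<inter> W" if "\<And>x. x \<in> X \<Longrightarrow> f x \<in> W \<longleftrightarrow> x \<in> Y"
      for f :: "'q \<times> ('a \<Rightarrow> real) \<Rightarrow> 'b \<times> 'f" and X Y W using that by blast
    ultimately show ?thesis by blast
  qed
  moreover have "subspace (V \<times> ?H)" by (rule subspace_Times[OF V(1) sH])
  moreover have "dim (V \<times> ?H) = n + dim F - 1" using dim_Times[OF V(1) sH] V(2) dimH by simp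
  moreover have "V \<times> ?H \<subseteq> V \<times> F" by auto
  ultimately have "(U' \<inter> Sg, \<Psi>) \<in> slice_atlas (n + dim F - 1) M Sg"
    unfolding slice_atlas_def using max V' subspace_Times[OF V(1) subspace_F] by blast
  moreover have "p \<in> U'" unfolding U'_def B_def s_def y1_def using pd C y0 by (simp add: dot_square_norm)
  ultimately show thesis using that[of "U' \<inter> Sg"] p by blast
qed

abbreviation "S \<equiv> slice_atlas (n + dim F - 1) M Sg"

lemma carrier_S: "carrier S = Sg"
proof
  show "carrier S \<subseteq> Sg" by (rule carrier_slice_subset)
  show "Sg \<subseteq> carrier S"
  proof
    fix p assume "p \<in> Sg"
    then obtain B where "p \<in> B" "\<exists>\<phi>. (B, \<phi>) \<in> S" using slice_chart by metis
    then show "p \<in> carrier S" by (blast intro: carrierI)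
  qed
qed

lemma S_smooth: "smooth_atlas S"
  by (rule smooth_atlas_slice[OF M_smooth])

end


section \<open>Push-forwards\<close>

lemma push_vec_tangent:
  assumes M: "smooth_atlas M" and N: "smooth_atlas N" and \<Phi>: "smooth_map M N \<Phi>" and v: "v \<in> tangent_space M p"
  shows "push_vec N \<Phi> v \<in> tangent_space N (\<Phi> p)"
proof (rule tangent_spaceI)
  note s = smooth_fun_map[OF M N \<Phi>]
  show "push_vec N \<Phi> v f = 0" if "\<not> smooth_fun N f" for f using that by (simp add: push_vec_def)
  fix f h assume fh: "smooth_fun N f" "smooth_fun N h"
  show "push_vec N \<Phi> v (\<lambda>x. a * f x + b * h x) = a * push_vec N \<Phi> v f + b * push_vec N \<Phi> v h" for a b
    using tangent_linear[OF M v s[OF fh(1)] s[OF fh(2)], of a b] fh N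
    by (simp add: push_vec_def comp_def smooth_fun_intros)
  show "push_vec N \<Phi> v (\<lambda>x. f x * h x) = push_vec N \<Phi> v f * h (\<Phi> p) + f (\<Phi> p) * push_vec N \<Phi> v h"
    using tangent_mult[OF M v s[OF fh(1)] s[OF fh(2)]] fh N
    by (simp add: push_vec_def comp_def smooth_fun_intros)
qed

lemma push_bivec_bivectors:
  assumes M: "smooth_atlas M" and N: "smooth_atlas N" and \<Phi>: "smooth_map M N \<Phi>" and B: "B \<in> bivectors M p"
  shows "push_bivec N \<Phi> B \<in> bivectors N (\<Phi> p)"
proof -
  obtain k v w where k: "B = (\<lambda>f h. \<Sum>i<(k::nat). wedge (v i) (w i) f h)"
    and v: "\<And>i. i < k \<Longrightarrow> v i \<in> tangent_space M p" "\<And>i. i < k \<Longrightarrow> w i \<in> tangent_space M p"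
    by (rule bivectorsE[OF B]) (rule that, assumption, blast, blast)
  have "(\<lambda>f h. \<Sum>i<k. wedge (push_vec N \<Phi> (v i)) (push_vec N \<Phi> (w i)) f h) \<in> bivectors N (\<Phi> p)"
    by (rule bivectorsI) (use push_vec_tangent[OF M N \<Phi>] v in auto)
  moreover have "push_bivec N \<Phi> B = (\<lambda>f h. \<Sum>i<k. wedge (push_vec N \<Phi> (v i)) (push_vec N \<Phi> (w i)) f h)"
  proof (intro ext)
    show "push_bivec N \<Phi> B f h = (\<Sum>i<k. wedge (push_vec N \<Phi> (v i)) (push_vec N \<Phi> (w i)) f h)" for f h
      by (cases "smooth_fun N f"; cases "smooth_fun N h") (simp_all add: push_bivec_def k wedge_def push_vec_def)
  qed
  ultimately show ?thesis by simp
qed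

lemma bivectors_cong:
  assumes M: "smooth_atlas M" and B: "B \<in> bivectors M p" and p: "p \<in> carrier M"
    and f: "smooth_fun M f'" "\<And>x. x \<in> carrier M \<Longrightarrow> f x = f' x" and h: "smooth_fun M h'" "\<And>x. x \<in> carrier M \<Longrightarrow> h x = h' x"
  shows "B f h = B f' h'"
proof -
  have "B f h = B f' h" by (rule tangent_cong[OF M bivectors_tangent_left[OF M B] p f])
  also have "\<dots> = B f' h'" by (rule tangent_cong[OF M bivectors_tangent_right[OF M B] p h])
  finally show ?thesis .
qed

lemma bivectors_nonsmooth:
  assumes M: "smooth_atlas M" and B: "B \<in> bivectors M p" and "\<not> (smooth_fun M f \<and> smooth_fun M h)"
  shows "B f h = 0"
  using assms(3) tangent_nonsmooth[OF M bivectors_tangent_left[OF M B, of h], of f]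
    tangent_nonsmooth[OF M bivectors_tangent_right[OF M B, of f], of h] by blast

lemma smooth_map_ident: "smooth_atlas M \<Longrightarrow> smooth_map M M (\<lambda>x. x)"
  by (rule smooth_map_inclusion)
    (use openin_subset[of "mtopology M"] in \<open>auto simp: topspace_mtopology Int_absorb2\<close>)

text \<open>Serves to verify \<open>diffeomorphism\<close>, which speaks of \<open>inv_into\<close>;
  an explicit inverse agrees with it on the carrier only.\<close>

lemma smooth_map_cong:
  assumes M: "smooth_atlas M" and N: "smooth_atlas N" and \<Phi>: "smooth_map M N \<Phi>"
    and eq: "\<And>x. x \<in> carrier M \<Longrightarrow> \<Phi>' x = \<Phi> x"
  shows "smooth_map M N \<Phi>'"
proof (rule smooth_mapI[OF M N])
  fix x assume x: "x \<in> carrier M"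
  obtain V \<psi> where V: "(V, \<psi>) \<in> N" "\<Phi> x \<in> V" using smooth_map_carrier[OF \<Phi> x] by (rule carrierE)
  have "smooth_near N \<psi> (\<Phi> x)" using V smooth_in_chart by (rule smooth_nearI)
  then have "smooth_near M (\<lambda>x. \<psi> (\<Phi> x)) x" by (rule smooth_near_map[OF M N \<Phi> _ x])
  then have "smooth_near M (\<lambda>x. \<psi> (\<Phi>' x)) x" by (rule smooth_near_cong_carrier) (simp add: eq)
  then show "\<exists>V \<psi> X. (V, \<psi>) \<in> N \<and> openin (mtopology M) X \<and> x \<in> X \<and> \<Phi>' ` X \<subseteq> V \<and> smooth_near M (\<lambda>x. \<psi> (\<Phi>' x)) x"
    using V x eq smooth_map_open[OF \<Phi> openin_chart[OF N V(1)]]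
    by (intro exI[of _ V] exI[of _ \<psi>] exI[of _ "{x \<in> carrier M. \<Phi> x \<in> V}"]) auto
qed

lemma smooth_map_fst:
  assumes M: "smooth_atlas M" and N: "smooth_atlas N"
  shows "smooth_map (prod_atlas M N) M fst"
proof (rule smooth_mapI[OF smooth_atlas_prod[OF M N] M])
  fix z assume z: "z \<in> carrier (prod_atlas M N)"
  then have z': "fst z \<in> carrier M" "snd z \<in> carrier N" by (auto simp: carrier_prod_atlas)
  obtain V \<psi> where V: "(V, \<psi>) \<in> M" "fst z \<in> V" using z'(1) by (rule carrierE)
  have "smooth_near (prod_atlas M N) (\<lambda>z. \<psi> (fst z)) z"
    by (rule smooth_near_fst[OF smooth_nearI[OF V smooth_in_chart] z'(2)])
  moreover have "openin (mtopology N) (carrier N)" using openin_topspace[of "mtopology N"] by (simp add: topspace_mtopology)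
  ultimately show "\<exists>V \<psi> W. (V, \<psi>) \<in> M \<and> openin (mtopology (prod_atlas M N)) W \<and> z \<in> W \<and> fst ` W \<subseteq> V
      \<and> smooth_near (prod_atlas M N) (\<lambda>z. \<psi> (fst z)) z"
    using V z' openin_prod_atlas[OF M N openin_chart[OF M V(1)]]
    by (intro exI[of _ V] exI[of _ \<psi>] exI[of _ "V \<times> carrier N"]) (auto simp: mem_Times_iff)
qed

lemma real_line: "smooth_atlas real_line"
  by (rule smooth_atlas_linear) simp

lemma smooth_near_real_line: "Cinf_on UNIV f \<Longrightarrow> smooth_near real_line f t"
  by (rule smooth_nearI[of UNIV "\<lambda>x. x"]) (auto simp: linear_atlas_def intro!: smooth_inI[of UNIV _ _ f])

lemma smooth_map_Pair_real:
  assumes M: "smooth_atlas M" and N: "smooth_atlas N" and a: "smooth_map N M a"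
    and b: "\<And>x. x \<in> carrier N \<Longrightarrow> smooth_near N b x"
  shows "smooth_map N (prod_atlas M real_line) (\<lambda>x. (a x, b x))"
proof (rule smooth_mapI[OF N smooth_atlas_prod[OF M real_line]])
  fix x assume x: "x \<in> carrier N"
  obtain V \<psi> where V: "(V, \<psi>) \<in> M" "a x \<in> V" using smooth_map_carrier[OF a x] by (rule carrierE)
  have "smooth_near M \<psi> (a x)" using V smooth_in_chart by (rule smooth_nearI)
  then have "smooth_near N (\<lambda>x. \<psi> (a x)) x" by (rule smooth_near_map[OF N M a _ x])
  then have "smooth_near N (\<lambda>x. map_prod \<psi> (\<lambda>t. t) (a x, b x)) x"
    using smooth_near_Pair[OF N _ b[OF x], of "\<lambda>x. \<psi> (a x)"] by simp
  moreover have "(V \<times> UNIV, map_prod \<psi> (\<lambda>t. t)) \<in> prod_atlas M real_line"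
    by (rule prod_atlasI[OF V(1)]) (simp add: linear_atlas_def)
  ultimately show "\<exists>V \<psi> W. (V, \<psi>) \<in> prod_atlas M real_line \<and> openin (mtopology N) W \<and> x \<in> W \<and> (\<lambda>x. (a x, b x)) ` W \<subseteq> V
      \<and> smooth_near N (\<lambda>x. \<psi> (a x, b x)) x"
    using V x smooth_map_open[OF a openin_chart[OF M V(1)]]
    by (intro exI[of _ "V \<times> UNIV"] exI[of _ "map_prod \<psi> (\<lambda>t. t)"] exI[of _ "{x \<in> carrier N. a x \<in> V}"]) auto
qed

section \<open>Linear Poisson structures\<close>

context vbundle_setup
begin

lemma dilation_smooth: "smooth_map M M (dilation c)"
  by (rule smooth_map_dilation[OF M_smooth smooth_map_ident[OF M_smooth]]) (rule smooth_near_const)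

text \<open>Pairing with the fibre coordinate of \<open>p\<close> itself takes a positive value at
  \<open>p\<close>, because that coordinate is nonzero off the zero section.\<close>

lemma ex_linear:
  assumes p: "p \<in> dual_set A" "p \<notin> zero_section A"
  obtains L where "smooth_fun M L" "fibrewise_linear A L" "L p \<noteq> 0"
proof -
  obtain U \<theta> where U: "local_triv A U \<theta>" "fst p \<in> U" using ex_triv[OF dual_set_base[OF p(1)]] by metis
  obtain c K where c: "smooth_fun Q c" "c (fst p) = 1" "K \<subseteq> U" "openin (mtopology Q) (carrier Q - K)"
    "\<And>x. x \<notin> K \<Longrightarrow> c x = 0" using base_bump[OF smooth_Q Hausdorff U_open[OF U(1)] U(2)] by blast
  let ?L = "\<lambda>x. c (fst x) * (coord A \<theta> x \<bullet> coord A \<theta> p)"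
  have "smooth_fun M ?L"
  proof (rule cutoff_smooth[OF c(1,3,4,5)])
    show "smooth_near M (\<lambda>x. coord A \<theta> x \<bullet> coord A \<theta> p) x" if "x \<in> dual_set A" "fst x \<in> U" for x
      using that by (intro smooth_near_inner[OF M_smooth coord_smooth[OF U(1)]] smooth_near_const) (simp_all add: carrier_M)
  qed
  moreover have "fibrewise_linear A ?L" by (rule fibrewise_linear_coord[OF U(1) c(3,5)])
  moreover have "?L p \<noteq> 0" using c(2) coord_eq_0_iff[OF U(1) p(1) U(2)] p(2) by simp
  ultimately show thesis by (rule that)
qed

lemma fibrewise_linear_base_mult:
  "fibrewise_linear A L \<Longrightarrow> fibrewise_linear A (\<lambda>x. h (fst x) * L x)"
  unfolding fibrewise_linear_def by (auto simp: algebra_simps)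

text \<open>Writing \<open>L\<close> for a linear function with \<open>L p \<noteq> 0\<close>, the Leibniz rule applied to the linear
  functions \<open>h L\<close> with \<open>h\<close> basic carries the vanishing from linear functions over to basic ones.\<close>

lemma biderivation_eq_0:
  assumes p: "p \<in> dual_set A" "p \<notin> zero_section A"
    and right: "\<And>f. smooth_fun M f \<Longrightarrow> B f \<in> tangent_space M p"
    and left: "\<And>h. smooth_fun M h \<Longrightarrow> (\<lambda>f. B f h) \<in> tangent_space M p"
    and lin: "\<And>L L'. smooth_fun M L \<Longrightarrow> fibrewise_linear A L \<Longrightarrow> smooth_fun M L' \<Longrightarrow> fibrewise_linear A L' \<Longrightarrow> B L L' = 0"
    and f: "smooth_fun M f" and h: "smooth_fun M h"
  shows "B f h = 0"
proof -
  obtain L where L: "smooth_fun M L" "fibrewise_linear A L" "L p \<noteq> 0" using ex_linear[OF p] by metis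
  have hL: "smooth_fun M (\<lambda>x. h (fst x) * L x)" "fibrewise_linear A (\<lambda>x. h (fst x) * L x)" if "smooth_fun Q h" for h
    using smooth_fun_mult[OF M_smooth base_fun_smooth[OF that] L(1)] fibrewise_linear_base_mult[OF L(2)] by auto
  have bl: "B (\<lambda>x. h (fst x)) L' = 0" if h: "smooth_fun Q h" and L': "smooth_fun M L'" "fibrewise_linear A L'" for h L'
    using tangent_mult[OF M_smooth left[OF L'(1)] base_fun_smooth[OF h] L(1)] lin[OF hL[OF h] L'] lin[OF L(1,2) L'] L(3)
    by simp
  have lb: "B L' (\<lambda>x. h (fst x)) = 0" if h: "smooth_fun Q h" and L': "smooth_fun M L'" "fibrewise_linear A L'" for h L'
    using tangent_mult[OF M_smooth right[OF L'(1)] base_fun_smooth[OF h] L(1)] lin[OF L' hL[OF h]] lin[OF L' L(1,2)] L(3)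
    by simp
  have bb: "B (\<lambda>x. h (fst x)) (\<lambda>x. k (fst x)) = 0" if h: "smooth_fun Q h" and k: "smooth_fun Q k" for h k
    using tangent_mult[OF M_smooth right[OF base_fun_smooth[OF h]] base_fun_smooth[OF k] L(1)]
      bl[OF h hL[OF k]] bl[OF h L(1,2)] L(3) by simp
  \<comment> \<open>Now one slot at a time: with a linear or basic function in the second slot,
    \<open>derivation_eq_0\<close> frees the first slot; with the first slot arbitrary it then frees
    the second.\<close>
  have fl: "B f L' = 0" if L': "smooth_fun M L'" "fibrewise_linear A L'" for L'
    by (rule derivation_eq_0[OF p(1) left[OF L'(1)]]) (use bl lin L' in auto)
  have fb: "B f (\<lambda>x. k (fst x)) = 0" if k: "smooth_fun Q k" for k
    by (rule derivation_eq_0[OF p(1) left[OF base_fun_smooth[OF k]]]) (use bb lb k in auto)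
  show ?thesis by (rule derivation_eq_0[OF p(1) right[OF f]]) (use fb fl in auto)
qed

text \<open>In positive rank the zero section has empty interior, so identities between smooth
  functions extend to it by continuity.\<close>

lemma zero_section_limit:
  assumes N: "openin (mtopology M) N" "x \<in> N" "x \<in> zero_section A" and y: "y \<in> F" "y \<noteq> 0"
  obtains z where "z \<in> N" "z \<in> dual_set A" "z \<notin> zero_section A"
proof -
  have xd: "x \<in> dual_set A" using openin_subset[OF N(1)] N(2) by (auto simp: topspace_mtopology carrier_M)
  obtain C \<phi> U \<theta> where C: "(C, \<phi>) \<in> Q" "local_triv A U \<theta>" "fst x \<in> C" "fst x \<in> U" using xd by (rule dual_chartE)
  let ?B = "{x \<in> dual_set A. fst x \<in> C \<inter> U}" and ?\<Phi> = "\<lambda>x. (\<phi> (fst x), coord A \<theta> x)"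
  obtain T where T: "open T" "?B \<inter> N = ?B \<inter> ?\<Phi> -` T" using openin_mtopologyD[OF N(1) dual_atlasI[OF C(1,2)]] by blast
  let ?z = "\<lambda>s::real. (\<phi> (fst x), s *\<^sub>R y)"
  have "coord A \<theta> x = 0" using coord_eq_0_iff[OF C(2) xd C(4)] N(3) by simp
  moreover have "x \<in> ?B \<inter> N" using xd C N(2) by simp
  then have "?\<Phi> x \<in> T" using T(2) by blast
  ultimately have "?z 0 \<in> T" by simp
  moreover have "open (?z -` T)" by (rule open_vimage[OF T(1)]) (intro continuous_intros)
  \<comment> \<open>Along the line through \<open>x\<close> in the fibre direction \<open>y\<close>,
    small parameters stay in the chart image of \<open>N\<close>; the parameter e/2 then gives a
    nonzero covector.\<close>
  ultimately obtain e where e: "e > 0" "\<And>s. dist s 0 < e \<Longrightarrow> ?z s \<in> T"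
    unfolding open_dist by (metis vimageE vimageI)
  let ?w = "covec A \<theta> (fst x) ((e/2) *\<^sub>R y)"
  have yF: "(e/2) *\<^sub>R y \<in> F" using y subspace_F by (simp add: subspace_scale)
  note w = covec_dual[OF C(2,4) yF] coord_covec[OF C(2,4) yF]
  have "?z (e/2) \<in> T" using e by simp
  then have "?w \<in> ?B \<inter> ?\<Phi> -` T" using w C by simp
  then have "?w \<in> N" using T(2) by blast
  moreover have "?w \<notin> zero_section A" using coord_eq_0_iff[OF C(2) w(1)] w(2) e(1) y(2) C(4) by simp
  ultimately show thesis using that w(1) by blast
qed

end

locale poisson_setup = metric_setup A n g
  for A :: "('q, 'a, 'b::euclidean_space, 'e::euclidean_space, 'f::euclidean_space) vbundle" and n g +
  fixes P :: "'q \<times> ('a \<Rightarrow> real) \<Rightarrow> ('q \<times> ('a \<Rightarrow> real)) bivec"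
  assumes poisson: "linear_poisson A P"
begin

lemma P_biv: "x \<in> dual_set A \<Longrightarrow> P x \<in> bivectors M x"
  using poisson unfolding linear_poisson_def poisson_structure_def bivector_field_def carrier_M by blast

lemma P_smooth: "smooth_fun M f \<Longrightarrow> smooth_fun M h \<Longrightarrow> smooth_fun M (\<lambda>x. P x f h)"
  using poisson unfolding linear_poisson_def poisson_structure_def bivector_field_def by blast

lemma P_jacobi:
  "smooth_fun M f \<Longrightarrow> smooth_fun M h \<Longrightarrow> smooth_fun M k \<Longrightarrow> x \<in> dual_set A \<Longrightarrow>
    P x (\<lambda>y. P y f h) k + P x (\<lambda>y. P y h k) f + P x (\<lambda>y. P y k f) h = 0"
  using poisson unfolding linear_poisson_def poisson_structure_def poisson_bracket_def carrier_M by blast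

lemma P_linear:
  "smooth_fun M L \<Longrightarrow> fibrewise_linear A L \<Longrightarrow> smooth_fun M L' \<Longrightarrow> fibrewise_linear A L' \<Longrightarrow>
    fibrewise_linear A (\<lambda>x. P x L L')"
  using poisson unfolding linear_poisson_def poisson_bracket_def by blast

lemmas P_right = bivectors_tangent_right[OF M_smooth P_biv]
lemmas P_left = bivectors_tangent_left[OF M_smooth P_biv]
lemmas P_antisym = bivectors_antisym[OF P_biv]

text \<open>Both sides are bivectors at \<open>dilation c x\<close>, so
  \<open>biderivation_eq_0\<close> leaves linear functions to compare. Their bracket is again linear
  and scales by \<open>c\<close>, while pulling both of them back gives the square of
  \<open>c\<close>, of which the division removes one factor.\<close>

lemma P_homogeneous:
  assumes x: "x \<in> Z0" and c: "c > 0" and f: "smooth_fun M f" and h: "smooth_fun M h"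
  shows "P (dilation c x) f h = (1 / c) * P x (\<lambda>y. f (dilation c y)) (\<lambda>y. h (dilation c y))"
proof -
  have xd: "x \<in> dual_set A" using x by simp
  let ?p = "dilation c x"
  have p: "?p \<in> dual_set A" "?p \<notin> zero_section A" using dilation_Z0[OF x c] by auto
  define B where "B f h = P ?p f h + (- 1 / c) * push_bivec M (dilation c) (P x) f h" for f h
  have B: "B \<in> bivectors M ?p"
    unfolding B_def
    by (rule bivectors_add[OF P_biv[OF p(1)] bivectors_scale[OF M_smooth
        push_bivec_bivectors[OF M_smooth M_smooth dilation_smooth P_biv[OF xd]]]])
  have "B f h = 0"
  proof (rule biderivation_eq_0[OF p bivectors_tangent_right[OF M_smooth B] bivectors_tangent_left[OF M_smooth B] _ f h])
    fix L L' assume L: "smooth_fun M L" "fibrewise_linear A L" and L': "smooth_fun M L'" "fibrewise_linear A L'"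
    have "P x (L \<circ> dilation c) (L' \<circ> dilation c) = P x (\<lambda>y. c * L y) (\<lambda>y. c * L' y)"
      by (rule bivectors_cong[OF M_smooth P_biv[OF xd]])
        (use xd L L' fibrewise_linear_dilation M_smooth in \<open>auto simp: carrier_M intro: smooth_fun_scale\<close>)
    also have "\<dots> = c * (c * P x L L')"
      using tangent_scale[OF M_smooth P_left[OF xd] L(1)] tangent_scale[OF M_smooth P_right[OF xd] L'(1)] by simp
    finally have "P x (L \<circ> dilation c) (L' \<circ> dilation c) = c * (c * P x L L')" .
    moreover have "P ?p L L' = c * P x L L'" by (rule fibrewise_linear_dilation[OF P_linear[OF L L'] xd])
    ultimately show "B L L' = 0" unfolding B_def push_bivec_def using L L' c by simp
  qed
  then show ?thesis using f h by (simp add: B_def push_bivec_def comp_def)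
qed

abbreviation "\<Delta> \<equiv> liouville_vf A"

text \<open>The Lie derivative of \<open>P\<close> along \<Delta> is \<open>- P\<close>: the defect
  is a biderivation, and on linear functions, where \<Delta> acts as the identity, it is bracket -
  bracket - bracket + bracket = 0.\<close>

lemma P_liouville_Z0:
  assumes x: "x \<in> Z0" and f: "smooth_fun M f" and h: "smooth_fun M h"
  shows "\<Delta> x (\<lambda>y. P y f h) = P x (\<lambda>y. \<Delta> y f) h + P x f (\<lambda>y. \<Delta> y h) - P x f h"
proof -
  have xd: "x \<in> dual_set A" and xz: "x \<notin> zero_section A" using x by auto
  have xM: "x \<in> carrier M" using xd by (simp add: carrier_M)
  define D where "D f h = \<Delta> x (\<lambda>y. P y f h) - P x (\<lambda>y. \<Delta> y f) h - P x f (\<lambda>y. \<Delta> y h) + P x f h" for f h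
  \<comment> \<open>Elements of \<open>tangent_space\<close> must vanish on nonsmooth functions,
    which \<open>D\<close> itself need not do.\<close>
  define B where "B f h = (if smooth_fun M f \<and> smooth_fun M h then D f h else 0)" for f h
  note T = liouville_tangent[OF xd] and PR = P_right[OF xd]
  note sm = smooth_fun_intros[OF M_smooth] P_smooth liouville_smooth
  \<comment> \<open>Antisymmetry reduces the derivation property in the two slots to the one in the
    second slot.\<close>
  have anti: "D f h = - D h f" if fh: "smooth_fun M f" "smooth_fun M h" for f h
  proof -
    have "\<Delta> x (\<lambda>y. P y f h) = \<Delta> x (\<lambda>y. - P y h f)"
    proof (rule tangent_cong[OF M_smooth T xM])
      show "P y f h = - P y h f" if "y \<in> carrier M" for y
        using P_antisym[of y f h] that by (simp add: carrier_M)
    qed (use fh sm in auto)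
    also have "\<dots> = - \<Delta> x (\<lambda>y. P y h f)" using fh sm by (intro tangent_minus[OF M_smooth T])
    finally show ?thesis
      unfolding D_def using P_antisym[OF xd, of f h] P_antisym[OF xd, of "\<lambda>y. \<Delta> y f" h] P_antisym[OF xd, of f "\<lambda>y. \<Delta> y h"]
      by simp
  qed
  have right: "B f \<in> tangent_space M x" if f: "smooth_fun M f" for f
  proof (rule tangent_spaceI)
    show "B f h = 0" if "\<not> smooth_fun M h" for h using that by (simp add: B_def)
    fix h k assume hk: "smooth_fun M h" "smooth_fun M k"
    show "B f (\<lambda>x. a * h x + b * k x) = a * B f h + b * B f k" for a b
    proof -
      have s: "smooth_fun M (\<lambda>x. a * h x + b * k x)" using hk by (intro sm)
      have "\<Delta> x (\<lambda>y. P y f (\<lambda>x. a * h x + b * k x)) = \<Delta> x (\<lambda>y. a * P y f h + b * P y f k)"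
        by (rule tangent_cong[OF M_smooth T xM])
          (use f hk sm tangent_linear[OF M_smooth P_right] in \<open>auto simp: carrier_M\<close>)
      also have "\<dots> = a * \<Delta> x (\<lambda>y. P y f h) + b * \<Delta> x (\<lambda>y. P y f k)"
        by (rule tangent_linear[OF M_smooth T]) (use f hk sm in auto)
      finally have 1: "\<Delta> x (\<lambda>y. P y f (\<lambda>x. a * h x + b * k x)) = a * \<Delta> x (\<lambda>y. P y f h) + b * \<Delta> x (\<lambda>y. P y f k)" .
      have "P x f (\<lambda>y. \<Delta> y (\<lambda>x. a * h x + b * k x)) = P x f (\<lambda>y. a * \<Delta> y h + b * \<Delta> y k)"
        by (rule tangent_cong[OF M_smooth PR xM])
          (use f hk sm tangent_linear[OF M_smooth liouville_tangent] in \<open>auto simp: carrier_M\<close>)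
      also have "\<dots> = a * P x f (\<lambda>y. \<Delta> y h) + b * P x f (\<lambda>y. \<Delta> y k)"
        by (rule tangent_linear[OF M_smooth PR]) (use f hk sm in auto)
      finally show ?thesis
        using f hk s 1 tangent_linear[OF M_smooth PR hk] by (simp add: B_def D_def algebra_simps)
    qed
    show "B f (\<lambda>x. h x * k x) = B f h * k x + h x * B f k"
    proof -
      have s: "smooth_fun M (\<lambda>x. h x * k x)" using hk by (intro sm)
      have "\<Delta> x (\<lambda>y. P y f (\<lambda>x. h x * k x)) = \<Delta> x (\<lambda>y. P y f h * k y + h y * P y f k)"
        by (rule tangent_cong[OF M_smooth T xM])
          (use f hk sm tangent_mult[OF M_smooth P_right] in \<open>auto simp: carrier_M\<close>)
      also have "\<dots> = \<Delta> x (\<lambda>y. P y f h * k y) + \<Delta> x (\<lambda>y. h y * P y f k)"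
        by (rule tangent_add[OF M_smooth T]) (use f hk sm in auto)
      finally have 1: "\<Delta> x (\<lambda>y. P y f (\<lambda>x. h x * k x)) = \<Delta> x (\<lambda>y. P y f h) * k x + P x f h * \<Delta> x k
          + (\<Delta> x h * P x f k + h x * \<Delta> x (\<lambda>y. P y f k))"
        using tangent_mult[OF M_smooth T P_smooth[OF f hk(1)] hk(2)] tangent_mult[OF M_smooth T hk(1) P_smooth[OF f hk(2)]]
        by simp
      have "P x f (\<lambda>y. \<Delta> y (\<lambda>x. h x * k x)) = P x f (\<lambda>y. \<Delta> y h * k y + h y * \<Delta> y k)"
        by (rule tangent_cong[OF M_smooth PR xM])
          (use f hk sm tangent_mult[OF M_smooth liouville_tangent] in \<open>auto simp: carrier_M\<close>)
      also have "\<dots> = P x f (\<lambda>y. \<Delta> y h * k y) + P x f (\<lambda>y. h y * \<Delta> y k)"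
        by (rule tangent_add[OF M_smooth PR]) (use f hk sm in auto)
      finally have 2: "P x f (\<lambda>y. \<Delta> y (\<lambda>x. h x * k x)) = P x f (\<lambda>y. \<Delta> y h) * k x + \<Delta> x h * P x f k
          + (P x f h * \<Delta> x k + h x * P x f (\<lambda>y. \<Delta> y k))"
        using tangent_mult[OF M_smooth PR liouville_smooth[OF hk(1)] hk(2)]
          tangent_mult[OF M_smooth PR hk(1) liouville_smooth[OF hk(2)]] by simp
      show ?thesis
        using f hk s 1 2 tangent_mult[OF M_smooth PR hk] by (simp add: B_def D_def algebra_simps)
    qed
  qed
  have B_anti: "B f h = - B h f" for f h using anti[of f h] by (auto simp: B_def)
  have left: "(\<lambda>f. B f h) \<in> tangent_space M x" if h: "smooth_fun M h" for h
  proof -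
    have "B f h = (-1) * B h f + 0 * B h f" for f using B_anti[of f h] by simp
    then have "(\<lambda>f. B f h) = (\<lambda>f. (-1) * B h f + 0 * B h f)" by (rule ext)
    then show ?thesis using tangent_lincomb2[OF M_smooth right[OF h] right[OF h], of "-1" 0] by simp
  qed
  have \<Delta>_lin: "\<Delta> y L = L y" if "smooth_fun M L" "fibrewise_linear A L" "y \<in> dual_set A" for y L
    using liouville_homogeneous[OF that(1,3), of 1] fibrewise_linear_dilation[OF that(2,3)] by simp
  have "B f h = 0"
  proof (rule biderivation_eq_0[OF xd xz right left _ f h])
    fix L L' assume L: "smooth_fun M L" "fibrewise_linear A L" and L': "smooth_fun M L'" "fibrewise_linear A L'"
    have "\<Delta> x (\<lambda>y. P y L L') = P x L L'" by (rule \<Delta>_lin[OF P_smooth[OF L(1) L'(1)] P_linear[OF L L'] xd])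
    moreover have "P x (\<lambda>y. \<Delta> y L) L' = P x L L'"
      by (rule bivectors_cong[OF M_smooth P_biv[OF xd] xM L(1) _ L'(1)]) (use L \<Delta>_lin in \<open>auto simp: carrier_M\<close>)
    moreover have "P x L (\<lambda>y. \<Delta> y L') = P x L L'"
      by (rule bivectors_cong[OF M_smooth P_biv[OF xd] xM L(1) _ L'(1)]) (use L' \<Delta>_lin in \<open>auto simp: carrier_M\<close>)
    ultimately show "B L L' = 0" using L L' by (simp add: B_def D_def)
  qed
  then show ?thesis using f h by (simp add: B_def D_def)
qed

text \<open>For rank 0 there are no nonzero linear functions, so linearity of \<open>P\<close> is void.\<close>

lemma P_liouville:
  assumes F0: "F \<noteq> {0}" and x: "x \<in> dual_set A" and f: "smooth_fun M f" and h: "smooth_fun M h"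
  shows "\<Delta> x (\<lambda>y. P y f h) = P x (\<lambda>y. \<Delta> y f) h + P x f (\<lambda>y. \<Delta> y h) - P x f h"
proof (rule ccontr)
  define D where "D x = \<Delta> x (\<lambda>y. P y f h) - (P x (\<lambda>y. \<Delta> y f) h + P x f (\<lambda>y. \<Delta> y h) - P x f h)" for x
  note sm = smooth_fun_intros[OF M_smooth] P_smooth liouville_smooth
  assume "\<Delta> x (\<lambda>y. P y f h) \<noteq> P x (\<lambda>y. \<Delta> y f) h + P x f (\<lambda>y. \<Delta> y h) - P x f h"
  then have Dx: "D x \<in> - {0}" by (simp add: D_def)
  have xz: "x \<in> zero_section A" using P_liouville_Z0[of x, OF _ f h] x Dx by (auto simp: D_def)
  \<comment> \<open>A nonzero value of \<open>D\<close> would persist on a neighbourhood, and that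
    neighbourhood meets the complement of the zero section, where \<open>D\<close> is 0.\<close>
  have "smooth_fun M D" unfolding D_def using f h by (intro sm)
  then have "smooth_near M D x" using x by (simp add: smooth_fun_iff[OF M_smooth] carrier_M)
  then obtain N where N: "openin (mtopology M) N" "x \<in> N" "D ` N \<subseteq> - {0}"
    using smooth_near_nbhd[of M D x "- {0}"] M_smooth Dx by (metis open_Compl closed_singleton)
  obtain y where "y \<in> F" "y \<noteq> 0" using F0 subspace_0[OF subspace_F] by blast
  then obtain z where "z \<in> N" "z \<in> dual_set A" "z \<notin> zero_section A" using zero_section_limit[OF N(1,2) xz] by metis
  then show False using P_liouville_Z0[of z, OF _ f h] N(3) by (auto simp: D_def)
qed

section \<open>The Hamiltonian vector field and the Jacobi structure on the dual bundle\<close>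

abbreviation "X \<equiv> hamiltonian_vf P \<kappa>"
abbreviation "\<Lambda> \<equiv> (\<lambda>x f h. P x f h + wedge (\<Delta> x) (X x) f h)"
abbreviation "E \<equiv> (\<lambda>x f. - X x f)"

lemma tangent_neg:
  assumes "v \<in> tangent_space M x" shows "(\<lambda>f. - v f) \<in> tangent_space M x"
proof -
  have "(\<lambda>f. - v f) = (\<lambda>f. (-1) * v f + 0 * v f)" by simp
  then show ?thesis using tangent_lincomb2[OF M_smooth assms assms, of "-1" 0] by simp
qed

lemma X_tangent: "x \<in> dual_set A \<Longrightarrow> X x \<in> tangent_space M x"
  unfolding hamiltonian_vf_def by (rule tangent_neg[OF P_right])

lemma E_tangent: "x \<in> dual_set A \<Longrightarrow> E x \<in> tangent_space M x"
  by (rule tangent_neg[OF X_tangent])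

lemma X_smooth: "smooth_fun M f \<Longrightarrow> smooth_fun M (\<lambda>x. X x f)"
  unfolding hamiltonian_vf_def by (intro smooth_fun_minus M_smooth P_smooth kinetic_smooth)

lemma \<Lambda>_biv: "x \<in> dual_set A \<Longrightarrow> \<Lambda> x \<in> bivectors M x"
  by (intro bivectors_add P_biv bivectors_wedge liouville_tangent X_tangent)

lemma \<Lambda>_smooth: "smooth_fun M f \<Longrightarrow> smooth_fun M h \<Longrightarrow> smooth_fun M (\<lambda>x. \<Lambda> x f h)"
  unfolding wedge_def by (intro smooth_fun_intros[OF M_smooth] P_smooth X_smooth liouville_smooth)

lemma X_eq: "x \<in> dual_set A \<Longrightarrow> X x f = P x f \<kappa>"
  unfolding hamiltonian_vf_def using P_antisym by metis

text \<open>The Jacobi identity of \<open>P\<close> with \<open>\<kappa>\<close> in one slot: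
  Hamiltonian vector fields are derivations of the bracket.\<close>

lemma X_P:
  assumes x: "x \<in> dual_set A" and f: "smooth_fun M f" and h: "smooth_fun M h"
  shows "X x (\<lambda>y. P y f h) = P x (\<lambda>y. X y f) h + P x f (\<lambda>y. X y h)"
proof -
  have xM: "x \<in> carrier M" using x by (simp add: carrier_M)
  have "P x (\<lambda>y. X y f) h = - P x (\<lambda>y. P y \<kappa> f) h"
    unfolding hamiltonian_vf_def by (rule tangent_minus[OF M_smooth P_left[OF x] P_smooth[OF kinetic_smooth f]])
  moreover have "P x f (\<lambda>y. X y h) = - P x (\<lambda>y. P y h \<kappa>) f"
  proof -
    have "P x f (\<lambda>y. X y h) = P x f (\<lambda>y. P y h \<kappa>)"
      by (rule tangent_cong[OF M_smooth P_right[OF x] xM P_smooth[OF h kinetic_smooth]]) (simp add: X_eq carrier_M)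
    then show ?thesis using P_antisym[OF x, of f "\<lambda>y. P y h \<kappa>"] by simp
  qed
  ultimately show ?thesis
    using P_jacobi[OF f h kinetic_smooth x] X_eq[OF x, of "\<lambda>y. P y f h"] by simp
qed

lemma X_kinetic: "x \<in> dual_set A \<Longrightarrow> X x \<kappa> = 0"
  using P_antisym[of x \<kappa> \<kappa>] by (simp add: hamiltonian_vf_def)

text \<open>Weight -1 of \<open>P\<close> plus weight 2 of \<open>\<kappa>\<close>: the Hamiltonian
  vector field has weight 1, that is, the commutator of \<Delta> and \<open>X\<close> is
  \<open>X\<close>.\<close>

lemma \<Delta>_X:
  assumes F0: "F \<noteq> {0}" and x: "x \<in> dual_set A" and f: "smooth_fun M f"
  shows "\<Delta> x (\<lambda>y. X y f) = X x (\<lambda>y. \<Delta> y f) + X x f"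
proof -
  have xM: "x \<in> carrier M" using x by (simp add: carrier_M)
  have "\<Delta> x (\<lambda>y. X y f) = \<Delta> x (\<lambda>y. P y f \<kappa>)"
    by (rule tangent_cong[OF M_smooth liouville_tangent[OF x] xM P_smooth[OF f kinetic_smooth]]) (simp add: X_eq carrier_M)
  also have "\<dots> = P x (\<lambda>y. \<Delta> y f) \<kappa> + P x f (\<lambda>y. \<Delta> y \<kappa>) - P x f \<kappa>"
    by (rule P_liouville[OF F0 x f kinetic_smooth])
  also have "P x f (\<lambda>y. \<Delta> y \<kappa>) = P x f (\<lambda>y. 2 * \<kappa> y)"
    by (rule tangent_cong[OF M_smooth P_right[OF x] xM smooth_fun_scale[OF M_smooth kinetic_smooth]])
      (simp add: carrier_M liouville_kinetic)
  also have "\<dots> = 2 * P x f \<kappa>" by (rule tangent_scale[OF M_smooth P_right[OF x] kinetic_smooth])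
  finally show ?thesis by (simp add: X_eq[OF x])
qed

text \<open>Kept for an arbitrary tangent vector \<open>v\<close> because an iterated bracket
  applies three of them to the inner one: the contraction of \<open>P\<close> with the outer
  function, \<Delta> and \<open>X\<close>.\<close>

lemma \<Lambda>_vec:
  assumes x: "x \<in> dual_set A" and v: "v \<in> tangent_space M x" and f: "smooth_fun M f" and h: "smooth_fun M h"
  shows "v (\<lambda>y. \<Lambda> y f h) = v (\<lambda>y. P y f h)
    + (v (\<lambda>y. \<Delta> y f) * X x h + \<Delta> x f * v (\<lambda>y. X y h) - v (\<lambda>y. \<Delta> y h) * X x f - \<Delta> x h * v (\<lambda>y. X y f))"
proof -
  note sm = smooth_fun_intros[OF M_smooth] P_smooth liouville_smooth X_smooth
  have s: "smooth_fun M (\<lambda>y. P y f h)" "smooth_fun M (\<lambda>y. \<Delta> y f * X y h)" "smooth_fun M (\<lambda>y. \<Delta> y h * X y f)"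
    using f h by (auto intro!: sm)
  have "v (\<lambda>y. \<Lambda> y f h) = v (\<lambda>y. P y f h) + (v (\<lambda>y. \<Delta> y f * X y h) - v (\<lambda>y. \<Delta> y h * X y f))"
    unfolding wedge_def
    using tangent_add[OF M_smooth v s(1) smooth_fun_diff[OF M_smooth s(2,3)]] tangent_diff[OF M_smooth v s(2,3)] by simp
  then show ?thesis
    using tangent_mult[OF M_smooth v liouville_smooth[OF f] X_smooth[OF h]]
      tangent_mult[OF M_smooth v liouville_smooth[OF h] X_smooth[OF f]] by simp
qed

text \<open>In rank 0 the pair degenerates to \<open>P\<close> with the zero vector field. The case
  is treated apart because \<open>P_liouville\<close> requires a nonzero fibre.\<close>

lemma jacobi_trivial:
  assumes "F = {0}" "x \<in> dual_set A"
  shows "X x f = 0"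
proof -
  have "\<kappa> y = 0" if y: "y \<in> carrier M" for y
  proof -
    have yd: "y \<in> dual_set A" using y by (simp add: carrier_M)
    obtain U \<theta> where U: "local_triv A U \<theta>" "fst y \<in> U" using ex_triv[OF dual_set_base[OF yd]] by metis
    have "coord A \<theta> y = 0" using coord_F[OF U(1) yd U(2)] assms(1) by simp
    then show ?thesis using kinetic_zero[OF _ yd] coord_eq_0_iff[OF U(1) yd U(2)] by simp
  qed
  then have "P x \<kappa> f = P x (\<lambda>_. 0) f"
    using assms(2) by (intro tangent_cong[OF M_smooth P_left[OF assms(2)] _ smooth_fun_const[OF M_smooth]]) (auto simp: carrier_M)
  also have "\<dots> = 0" by (rule tangent_const[OF M_smooth P_left[OF assms(2)]])
  finally show ?thesis by (simp add: hamiltonian_vf_def)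
qed

text \<open>Half of the Schouten condition, since the bracket of \<open>\<Lambda>\<close> with
  itself is twice the insertion. Expanding every iterated bracket by weights and Leibniz rules
  leaves a polynomial identity between values at \<open>x\<close>.\<close>

lemma \<Lambda>_jacobi:
  assumes x: "x \<in> dual_set A" and f: "smooth_fun M f" and g: "smooth_fun M h" and h: "smooth_fun M k"
  shows "insertion \<Lambda> \<Lambda> x f h k = wedge21 (\<Lambda> x) (E x) f h k"
proof (cases "F = {0}")
  case True
  have "P x (\<lambda>y. \<Lambda> y a b) c = P x (\<lambda>y. P y a b) c" if "smooth_fun M a" "smooth_fun M b" for a b c
    by (rule tangent_cong[OF M_smooth P_left[OF x]])
      (use x that in \<open>auto simp: carrier_M wedge_def jacobi_trivial[OF True] intro: P_smooth\<close>)
  then show ?thesis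
    using jacobi_trivial[OF True x] P_jacobi[OF f g h x] f g h
    by (simp add: insertion_def wedge21_def wedge_def)
next
  case F0: False
  \<comment> \<open>Leibniz expansion by \<open>\<Lambda>_vec\<close>, with \<Delta> moved past
    \<open>P\<close> and \<open>X\<close> by \<open>P_liouville\<close> and
    \<open>\<Delta>_X\<close>, and \<open>X\<close> past \<open>P\<close> by \<open>X_P\<close>. The
    only twice nested \<open>P\<close> left is the one of its Jacobi identity.\<close>
  have ex: "\<Lambda> x (\<lambda>y. \<Lambda> y a b) c = P x (\<lambda>y. P y a b) c
      + (P x (\<lambda>y. \<Delta> y a) c * X x b + \<Delta> x a * P x (\<lambda>y. X y b) c - P x (\<lambda>y. \<Delta> y b) c * X x a - \<Delta> x b * P x (\<lambda>y. X y a) c)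
      + (P x (\<lambda>y. \<Delta> y a) b + P x a (\<lambda>y. \<Delta> y b) - P x a b
        + (\<Delta> x (\<lambda>y. \<Delta> y a) * X x b + \<Delta> x a * (X x (\<lambda>y. \<Delta> y b) + X x b)
           - \<Delta> x (\<lambda>y. \<Delta> y b) * X x a - \<Delta> x b * (X x (\<lambda>y. \<Delta> y a) + X x a))) * X x c
      - \<Delta> x c * (P x (\<lambda>y. X y a) b + P x a (\<lambda>y. X y b)
        + (X x (\<lambda>y. \<Delta> y a) * X x b + \<Delta> x a * X x (\<lambda>y. X y b)
           - X x (\<lambda>y. \<Delta> y b) * X x a - \<Delta> x b * X x (\<lambda>y. X y a)))"
    if ab: "smooth_fun M a" "smooth_fun M b" for a b c
    using \<Lambda>_vec[OF x P_left[OF x, of c] ab] \<Lambda>_vec[OF x liouville_tangent[OF x] ab] \<Lambda>_vec[OF x X_tangent[OF x] ab]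
      P_liouville[OF F0 x ab] X_P[OF x ab] \<Delta>_X[OF F0 x ab(1)] \<Delta>_X[OF F0 x ab(2)]
    by (simp only: wedge_def[of "\<Delta> x" "X x"])
  \<comment> \<open>Moves the differentiated function to the first slot, so that terms from
    different cyclic permutations become equal monomials.\<close>
  have an: "P x a (\<lambda>y. \<Delta> y b) = - P x (\<lambda>y. \<Delta> y b) a" "P x a (\<lambda>y. X y b) = - P x (\<lambda>y. X y b) a" for a b
    using P_antisym[OF x] by blast+
  show ?thesis
    unfolding insertion_def ex[OF f g] ex[OF g h] ex[OF h f] wedge21_def
    unfolding wedge_def an
    using P_jacobi[OF f g h x] by algebra
qed

text \<open>\<open>X\<close> preserves \<open>P\<close>, and the commutator of \<open>X\<close> with
  \<Delta> is \<open>- X\<close>, so the wedge of \<Delta> and \<open>X\<close> changes by a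
  multiple of the wedge of \<open>X\<close> with itself, which is 0.\<close>

lemma \<Lambda>_lie:
  assumes x: "x \<in> dual_set A" and f: "smooth_fun M f" and h: "smooth_fun M h"
  shows "lie_derivative E \<Lambda> x f h = 0"
proof (cases "F = {0}")
  case True
  have "P x (\<lambda>y. E y a) c = P x (\<lambda>_. 0) c" for a c
    by (rule tangent_cong[OF M_smooth P_left[OF x] _ smooth_fun_const[OF M_smooth]])
      (use x in \<open>auto simp: carrier_M jacobi_trivial[OF True]\<close>)
  moreover have "P x (\<lambda>_. 0) c = 0" for c by (rule tangent_const[OF M_smooth P_left[OF x]])
  moreover have "P x c (\<lambda>y. E y a) = - P x (\<lambda>y. E y a) c" for a c by (rule P_antisym[OF x])
  ultimately show ?thesis using jacobi_trivial[OF True x] by (simp add: lie_derivative_def wedge_def)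
next
  case F0: False
  note T = P_left[OF x] P_right[OF x] liouville_tangent[OF x] X_tangent[OF x]
  have m: "P x (\<lambda>y. E y f) h = - P x (\<lambda>y. X y f) h" "P x f (\<lambda>y. E y h) = - P x f (\<lambda>y. X y h)"
    "\<Delta> x (\<lambda>y. E y f) = - \<Delta> x (\<lambda>y. X y f)" "\<Delta> x (\<lambda>y. E y h) = - \<Delta> x (\<lambda>y. X y h)"
    "X x (\<lambda>y. E y f) = - X x (\<lambda>y. X y f)" "X x (\<lambda>y. E y h) = - X x (\<lambda>y. X y h)"
    by (rule tangent_minus[OF M_smooth], rule T, rule X_smooth, rule f h)+
  show ?thesis
    unfolding lie_derivative_def \<Lambda>_vec[OF x X_tangent[OF x] f h]
    unfolding wedge_def m X_P[OF x f h] \<Delta>_X[OF F0 x f] \<Delta>_X[OF F0 x h]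
    by (simp add: algebra_simps)
qed

lemma \<Lambda>_jacobi_structure: "jacobi_structure M \<Lambda> E"
  unfolding jacobi_structure_def bivector_field_def vector_field_def carrier_M
proof (intro conjI ballI allI impI)
  fix f h k p assume "smooth_fun M f \<and> smooth_fun M h \<and> smooth_fun M k" "p \<in> dual_set A"
  then show "schouten_bracket \<Lambda> \<Lambda> p f h k = 2 * wedge21 (\<Lambda> p) (E p) f h k"
    using \<Lambda>_jacobi[of p f h k] by (simp add: schouten_bracket_def)
qed (use \<Lambda>_biv \<Lambda>_smooth E_tangent \<Lambda>_lie smooth_fun_minus[OF M_smooth X_smooth] in auto)

end


section \<open>The sphere bundle\<close>

lemma smooth_near_real_deriv:
  fixes f :: "real \<Rightarrow> real"
  assumes "smooth_near real_line f t"
  shows "(f has_real_derivative deriv f t) (at t)"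
proof -
  have "smooth_in UNIV (\<lambda>x. x) f t" using assms unfolding smooth_near_def by (auto simp: linear_atlas_def)
  then obtain W F where W: "open W" "t \<in> W" "Cinf_on W F" "\<And>y. y \<in> UNIV \<Longrightarrow> y \<in> W \<Longrightarrow> f y = F y"
    by (rule smooth_inE) blast
  have "(F has_derivative frechet_derivative F (at t)) (at t)" using W(3) Ck_on_SucD W(2) by blast
  then have "(f has_derivative frechet_derivative F (at t)) (at t)"
    by (rule has_derivative_transform_within_open[OF _ W(1,2)]) (use W(4) in simp)
  then have "f differentiable at t" by (rule differentiableI)
  then show ?thesis by (simp add: DERIV_deriv_iff_real_differentiable)
qed

section \<open>The coordinate field on a product with the line\<close>

context
  fixes M :: "('m, 'e::euclidean_space) atlas"
  assumes M: "smooth_atlas M"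
begin

lemma smooth_map_prod_slice: "smooth_map M (prod_atlas M real_line) (\<lambda>x. (x, t))"
  by (rule smooth_map_Pair_real[OF M M smooth_map_ident[OF M]]) (rule smooth_near_const)

text \<open>\<open>partial_t\<close> is a bare \<open>deriv\<close>; the derivative exists because s
  \<mapsto> (x, s) is a smooth map from the line.\<close>

lemma partial_t_deriv:
  assumes f: "smooth_fun (prod_atlas M real_line) f" and x: "x \<in> carrier M"
  shows "((\<lambda>s. f (x, s)) has_real_derivative partial_t M (x, t) f) (at t)"
proof -
  have SR: "smooth_atlas (prod_atlas M real_line)" by (rule smooth_atlas_prod[OF M real_line])
  obtain V \<psi> where V: "(V, \<psi>) \<in> M" "x \<in> V" using x by (rule carrierE)
  have "smooth_map real_line M (\<lambda>_. x)"
  proof (rule smooth_mapI[OF real_line M])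
    fix s :: real
    have "openin (mtopology real_line) UNIV" using openin_topspace[of "mtopology real_line"] by (simp add: topspace_mtopology)
    then show "\<exists>V \<psi> W. (V, \<psi>) \<in> M \<and> openin (mtopology real_line) W \<and> s \<in> W \<and> (\<lambda>_. x) ` W \<subseteq> V
        \<and> smooth_near real_line (\<lambda>_. \<psi> x) s"
      using V by (intro exI[of _ V] exI[of _ \<psi>] exI[of _ UNIV]) (auto intro: smooth_near_const)
  qed
  then have "smooth_map real_line (prod_atlas M real_line) (\<lambda>s. (x, s))"
    by (rule smooth_map_Pair_real[OF M real_line])
      (auto intro!: smooth_near_real_line Ck_on_bounded_linear bounded_linear_ident)
  then have "smooth_fun real_line (\<lambda>s. f (x, s))" by (rule smooth_fun_map[OF real_line SR _ f])
  then have "smooth_near real_line (\<lambda>s. f (x, s)) t" by (simp add: smooth_fun_iff[OF real_line])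
  from smooth_near_real_deriv[OF this] show ?thesis using f by (simp add: partial_t_def)
qed

lemma partial_t_tangent:
  assumes x: "x \<in> carrier M"
  shows "partial_t M (x, t) \<in> tangent_space (prod_atlas M real_line) (x, t)"
proof (rule tangent_spaceI)
  note SR = smooth_atlas_prod[OF M real_line]
  show "partial_t M (x, t) f = 0" if "\<not> smooth_fun (prod_atlas M real_line) f" for f
    using that by (simp add: partial_t_def)
  fix f h assume fh: "smooth_fun (prod_atlas M real_line) f" "smooth_fun (prod_atlas M real_line) h"
  note d = partial_t_deriv[OF fh(1) x, of t] partial_t_deriv[OF fh(2) x, of t]
  show "partial_t M (x, t) (\<lambda>z. a * f z + b * h z) = a * partial_t M (x, t) f + b * partial_t M (x, t) h" for a b
  proof (rule DERIV_unique[OF partial_t_deriv[OF _ x]])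
    show "smooth_fun (prod_atlas M real_line) (\<lambda>z. a * f z + b * h z)" using fh by (intro smooth_fun_intros[OF SR])
  qed (use d in \<open>auto intro!: derivative_eq_intros\<close>)
  show "partial_t M (x, t) (\<lambda>z. f z * h z) = partial_t M (x, t) f * h (x, t) + f (x, t) * partial_t M (x, t) h"
  proof (rule DERIV_unique[OF partial_t_deriv[OF _ x]])
    show "smooth_fun (prod_atlas M real_line) (\<lambda>z. f z * h z)" using fh by (intro smooth_fun_intros[OF SR])
  qed (use d in \<open>auto intro!: derivative_eq_intros simp: mult.commute\<close>)
qed

end

context metric_setup
begin

text \<open>The simplifier turns the \<open>1\<close> in the dimension of \<open>S\<close> into \<open>Suc 0\<close>.\<close>

lemmas carrier_Ss = carrier_S carrier_S[unfolded One_nat_def]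

lemma step_kinetic_smooth: "a < b \<Longrightarrow> smooth_fun M (\<lambda>x. smooth_step a b (\<kappa> x))"
  unfolding smooth_fun_iff[OF M_smooth] carrier_M
  by (intro ballI smooth_near_compose[OF kinetic_smooth_near open_UNIV UNIV_I _ refl]) (auto intro: Ck_on_smooth_step)

text \<open>Functions of the radius need not be smooth on the zero section; there
  \<open>\<kappa> = 0 < a\<close>, so the product vanishes on a neighbourhood.\<close>

lemma kinetic_cutoff:
  assumes ab: "0 < a" "a < b" and f: "\<And>x. x \<in> Z0 \<Longrightarrow> smooth_near M f x"
  shows "smooth_fun M (\<lambda>x. smooth_step a b (\<kappa> x) * f x)"
  unfolding smooth_fun_iff[OF M_smooth] carrier_M
proof
  fix x assume x: "x \<in> dual_set A"
  show "smooth_near M (\<lambda>x. smooth_step a b (\<kappa> x) * f x) x"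
  proof (cases "x \<in> Z0")
    case True
    have "smooth_near M (\<lambda>x. smooth_step a b (\<kappa> x)) x"
      using step_kinetic_smooth[OF ab(2)] x by (simp add: smooth_fun_iff[OF M_smooth] carrier_M)
    then show ?thesis by (rule smooth_near_mult[OF M_smooth _ f[OF True]])
  next
    case False
    have c: "smooth_near M (\<lambda>_. 0 :: real) x" by (rule smooth_near_const) (simp add: x carrier_M)
    have xo: "x \<in> {x \<in> dual_set A. \<kappa> x \<in> {..<a}}"
      using x False Z0_iff[OF x] kinetic_nonneg[OF x] ab(1) by auto
    show ?thesis
      by (rule smooth_near_cong[OF c openin_kinetic[OF open_lessThan] xo]) (simp add: smooth_step_0)
  qed
qed

text \<open>Locality with a cut-off depending on \<open>\<kappa>\<close> alone: the step from
  \<open>b\<close> to \<open>\<kappa> p\<close> is 1 at \<open>p\<close> and 0 wherever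
  \<open>\<kappa>\<close> is at most \<open>b\<close>.\<close>

lemma kinetic_local:
  assumes p: "p \<in> dual_set A" "b < \<kappa> p" and N: "smooth_atlas N" "p \<in> carrier N" "carrier N \<subseteq> dual_set A"
    and rest: "\<And>f. smooth_fun M f \<Longrightarrow> smooth_fun N f"
    and v: "v \<in> tangent_space N p" and f: "smooth_fun N f" "smooth_fun N h"
    and eq: "\<And>x. x \<in> carrier N \<Longrightarrow> b < \<kappa> x \<Longrightarrow> f x = h x"
  shows "v f = v h"
proof (rule tangent_local[OF N(1) v N(2) f rest[OF step_kinetic_smooth[OF p(2)]]])
  show "smooth_step b (\<kappa> p) (\<kappa> p) \<noteq> 0" using p(2) by (simp add: smooth_step_1)
  fix x assume x: "x \<in> carrier N" "smooth_step b (\<kappa> p) (\<kappa> x) \<noteq> 0"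
  then have "b < \<kappa> x" using smooth_step_0[of "\<kappa> x" b "\<kappa> p"] by (cases "\<kappa> x \<le> b") auto
  then show "f x = h x" by (rule eq[OF x(1)])
qed

lemmas kinetic_local_M = kinetic_local[OF _ _ M_smooth]

subsection \<open>Restriction of tensors\<close>

text \<open>Here \<open>r\<close> is a retraction of \<open>Z0\<close> onto a submanifold \<open>N\<close>; the cut-off makes the extension of a
  function on \<open>N\<close> smooth across the zero section.\<close>

definition ext where
  "ext a b r f = (\<lambda>x. smooth_step a b (\<kappa> x) * f (r x))"

text \<open>The candidate for the vector on \<open>N\<close> that the inclusion pushes to
  \<open>v\<close>; the value 0 on nonsmooth functions is forced by
  \<open>tangent_space\<close>.\<close>

definition ext_vec where
  "ext_vec N a b r v = (\<lambda>f. if smooth_fun N f then v (ext a b r f) else 0)"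

definition ext_bivec where
  "ext_bivec N a b r B = (\<lambda>f h. if smooth_fun N f \<and> smooth_fun N h then B (ext a b r f) (ext a b r h) else 0)"

text \<open>Two instances follow: \<open>N\<close> the sphere bundle with \<open>r = rho\<close>,
  and \<open>N\<close> the complement of the zero section with \<open>r\<close> the
  identity.\<close>

context
  fixes N :: "('q \<times> ('a \<Rightarrow> real), 'b \<times> 'f) atlas" and a b :: real and r and p
  assumes N: "smooth_atlas N" and sub: "carrier N \<subseteq> dual_set A" and r: "\<And>x. x \<in> carrier N \<Longrightarrow> r x = x"
    and rest: "\<And>f. smooth_fun M f \<Longrightarrow> smooth_fun N f"
    and ext: "\<And>f. smooth_fun N f \<Longrightarrow> smooth_fun M (ext a b r f)"
    and ab: "0 < a" "a < b" "b < \<kappa> p" and p: "p \<in> carrier N"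
begin

lemma pd: "p \<in> dual_set A" using p sub by blast

lemma pM: "p \<in> carrier M" using pd by (simp add: carrier_M)

lemma step_p: "b < \<kappa> x \<Longrightarrow> smooth_step a b (\<kappa> x) = 1"
  using ab by (simp add: smooth_step_1)

lemma ext_p: "ext a b r f p = f p"
  using step_p[OF ab(3)] r[OF p] by (simp add: ext_def)

lemma ext_vec_tangent:
  assumes v: "v \<in> tangent_space M p" shows "ext_vec N a b r v \<in> tangent_space N p"
proof (rule tangent_spaceI)
  show "ext_vec N a b r v f = 0" if "\<not> smooth_fun N f" for f using that by (simp add: ext_vec_def)
  fix f h assume fh: "smooth_fun N f" "smooth_fun N h"
  show "ext_vec N a b r v (\<lambda>x. c * f x + d * h x) = c * ext_vec N a b r v f + d * ext_vec N a b r v h" for c d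
  proof -
    have "ext a b r (\<lambda>x. c * f x + d * h x) = (\<lambda>x. c * ext a b r f x + d * ext a b r h x)"
      by (simp add: ext_def algebra_simps)
    then show ?thesis using tangent_linear[OF M_smooth v ext[OF fh(1)] ext[OF fh(2)], of c d] fh
      by (simp add: ext_vec_def smooth_fun_intros[OF N])
  qed
  have s: "smooth_fun N (\<lambda>x. f x * h x)" using fh by (intro smooth_fun_intros[OF N])
  \<comment> \<open>Extension is multiplicative where the step function is 1; by locality this
    suffices, because \<open>b < \<kappa> p\<close>.\<close>
  have "v (ext a b r (\<lambda>x. f x * h x)) = v (\<lambda>x. ext a b r f x * ext a b r h x)"
    by (rule kinetic_local_M[OF pd ab(3) pM _ _ v ext[OF s]])
      (use step_p fh ext in \<open>auto simp: carrier_M ext_def intro: smooth_fun_mult[OF M_smooth]\<close>)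
  then show "ext_vec N a b r v (\<lambda>x. f x * h x) = ext_vec N a b r v f * h p + f p * ext_vec N a b r v h"
    using tangent_mult[OF M_smooth v ext[OF fh(1)] ext[OF fh(2)]] ext_p fh s by (simp add: ext_vec_def)
qed

lemma ext_bivec_bivectors:
  assumes B: "B \<in> bivectors M p" shows "ext_bivec N a b r B \<in> bivectors N p"
proof -
  obtain k v w where k: "B = (\<lambda>f h. \<Sum>i<(k::nat). wedge (v i) (w i) f h)"
    and v: "\<And>i. i < k \<Longrightarrow> v i \<in> tangent_space M p" "\<And>i. i < k \<Longrightarrow> w i \<in> tangent_space M p"
    by (rule bivectorsE[OF B]) (rule that, assumption, blast, blast)
  have "(\<lambda>f h. \<Sum>i<k. wedge (ext_vec N a b r (v i)) (ext_vec N a b r (w i)) f h) \<in> bivectors N p"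
    by (rule bivectorsI) (use ext_vec_tangent v in auto)
  moreover have "ext_bivec N a b r B = (\<lambda>f h. \<Sum>i<k. wedge (ext_vec N a b r (v i)) (ext_vec N a b r (w i)) f h)"
  proof (intro HOL.ext)
    show "ext_bivec N a b r B f h = (\<Sum>i<k. wedge (ext_vec N a b r (v i)) (ext_vec N a b r (w i)) f h)" for f h
      by (cases "smooth_fun N f"; cases "smooth_fun N h") (simp_all add: ext_bivec_def k wedge_def ext_vec_def)
  qed
  ultimately show ?thesis by simp
qed

lemma tangent_ext:
  assumes w: "w \<in> tangent_space N p" and f: "smooth_fun N f"
  shows "w (ext a b r f) = w f"
  by (rule kinetic_local[OF pd ab(3) N p sub rest w rest[OF ext[OF f]] f])
    (use step_p r in \<open>auto simp: ext_def\<close>)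

text \<open>A left inverse of the push-forward, hence the injectivity that gives meaning to
  \<open>restrict_vec\<close>.\<close>

lemma push_vec_ext:
  assumes w: "w \<in> tangent_space N p" shows "ext_vec N a b r (push_vec M id w) = w"
proof
  fix f
  show "ext_vec N a b r (push_vec M id w) f = w f"
    using tangent_ext[OF w, of f] ext[of f] tangent_nonsmooth[OF N w, of f]
    by (cases "smooth_fun N f") (simp_all add: ext_vec_def push_vec_def)
qed

lemma push_bivec_ext:
  assumes w: "w \<in> bivectors N p" shows "ext_bivec N a b r (push_bivec M id w) = w"
proof (intro HOL.ext)
  fix f h
  show "ext_bivec N a b r (push_bivec M id w) f h = w f h"
  proof (cases "smooth_fun N f \<and> smooth_fun N h")
    case True
    then have "w (ext a b r f) (ext a b r h) = w f h"
      using tangent_ext[OF bivectors_tangent_left[OF N w, of "ext a b r h"], of f]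
        tangent_ext[OF bivectors_tangent_right[OF N w, of f], of h] by simp
    then show ?thesis using True ext by (simp add: ext_bivec_def push_bivec_def)
  next
    case False
    then show ?thesis using bivectors_nonsmooth[OF N w False] by (auto simp: ext_bivec_def)
  qed
qed

text \<open>Tangency criterion: \<open>v\<close> comes from \<open>N\<close> as soon as it cannot
  tell a function from the extension of its restriction. The preimage is explicit, which yields a
  formula for the restricted vector.\<close>

lemma restrict_vec_ext:
  assumes v: "v \<in> tangent_space M p" and eq: "\<And>f. smooth_fun M f \<Longrightarrow> v (ext a b r f) = v f"
  shows "v \<in> push_vec M id ` tangent_space N p"
    and "the_inv_into (tangent_space N p) (push_vec M id) v = ext_vec N a b r v"
proof -
  have pv: "push_vec M id (ext_vec N a b r v) = v"
  proof
    show "push_vec M id (ext_vec N a b r v) f = v f" for f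
      using eq[of f] rest[of f] tangent_nonsmooth[OF M_smooth v, of f]
      by (cases "smooth_fun M f") (simp_all add: push_vec_def ext_vec_def)
  qed
  note t = ext_vec_tangent[OF v]
  show "v \<in> push_vec M id ` tangent_space N p" using pv t by (metis image_eqI)
  have "inj_on (push_vec M id) (tangent_space N p)" by (rule inj_on_inverseI) (rule push_vec_ext)
  then show "the_inv_into (tangent_space N p) (push_vec M id) v = ext_vec N a b r v"
    using pv t by (rule the_inv_into_f_eq)
qed

lemma restrict_bivec_ext:
  assumes B: "B \<in> bivectors M p"
    and eq: "\<And>f h. smooth_fun M f \<Longrightarrow> smooth_fun M h \<Longrightarrow> B (ext a b r f) (ext a b r h) = B f h"
  shows "B \<in> push_bivec M id ` bivectors N p"
    and "the_inv_into (bivectors N p) (push_bivec M id) B = ext_bivec N a b r B"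
proof -
  have pv: "push_bivec M id (ext_bivec N a b r B) = B"
  proof (intro HOL.ext)
    show "push_bivec M id (ext_bivec N a b r B) f h = B f h" for f h
      using eq[of f h] rest[of f] rest[of h] bivectors_nonsmooth[OF M_smooth B, of f h]
      by (cases "smooth_fun M f \<and> smooth_fun M h") (auto simp add: push_bivec_def ext_bivec_def)
  qed
  note t = ext_bivec_bivectors[OF B]
  show "B \<in> push_bivec M id ` bivectors N p" using pv t by (metis image_eqI)
  have "inj_on (push_bivec M id) (bivectors N p)" by (rule inj_on_inverseI) (rule push_bivec_ext)
  then show "the_inv_into (bivectors N p) (push_bivec M id) B = ext_bivec N a b r B"
    using pv t by (rule the_inv_into_f_eq)
qed

end

abbreviation "M0 \<equiv> open_atlas M Z0"

lemma M0_smooth: "smooth_atlas M0"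
  by (rule smooth_atlas_open[OF M_smooth openin_Z0])

lemma carrier_M0: "carrier M0 = Z0"
  by (auto simp: carrier_open_atlas carrier_M)

lemma M0_near: "x \<in> Z0 \<Longrightarrow> smooth_near M0 f x \<longleftrightarrow> smooth_near M f x"
  by (rule smooth_near_open_atlas[OF M_smooth openin_Z0])

lemma M0_rest: "smooth_fun M f \<Longrightarrow> smooth_fun M0 f"
  unfolding smooth_fun_iff[OF M_smooth] smooth_fun_iff[OF M0_smooth] carrier_M0 carrier_M using M0_near by blast

lemma M0_ext: "0 < a \<Longrightarrow> a < b \<Longrightarrow> smooth_fun M0 f \<Longrightarrow> smooth_fun M (ext a b (\<lambda>x. x) f)"
  unfolding ext_def
proof (rule kinetic_cutoff)
  assume f: "smooth_fun M0 f"
  show "smooth_near M f x" if x: "x \<in> Z0" for x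
    using f x M0_near[OF x] unfolding smooth_fun_iff[OF M0_smooth] carrier_M0 by blast
qed

lemma M0_incl: "smooth_map M0 M (\<lambda>x. x)"
  by (rule smooth_map_open_inclusion[OF M_smooth openin_Z0])

lemma S_rest: "smooth_fun M f \<Longrightarrow> smooth_fun S f"
  using smooth_near_slice[OF M_smooth] Sg_dual
  unfolding smooth_fun_iff[OF M_smooth] smooth_fun_iff[OF S_smooth] carrier_Ss carrier_M by (metis carrier_Ss)

lemma rho_smooth: "smooth_map M0 S rho"
proof (rule smooth_map_slice[OF M_smooth M0_smooth])
  have "smooth_map M0 M (\<lambda>x. dilation (1 / rad x) x)"
  proof (rule smooth_map_dilation[OF M0_smooth M0_incl])
    fix x assume "x \<in> carrier M0"
    then have x: "x \<in> Z0" by (simp add: carrier_M0)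
    have "smooth_near M (\<lambda>x. 1 / rad x) x"
      by (rule smooth_near_divide[OF M_smooth smooth_near_const rad_smooth[OF x]])
        (use x rad_pos[OF x] in \<open>auto simp: carrier_M\<close>)
    then show "smooth_near M0 (\<lambda>x. 1 / rad x) x" using M0_near[OF x] by blast
  qed
  then show "smooth_map M0 M rho" unfolding rho_def[abs_def] .
  show "rho x \<in> carrier S" if "x \<in> carrier M0" for x using that rho_Sg by (simp add: carrier_M0 carrier_Ss)
qed

text \<open>Any levels 0 < a < b < 1/2 would do: \<open>\<kappa> = 1/2\<close> on the sphere bundle,
  so the step function is 1 near it.\<close>

abbreviation "eS \<equiv> ext (1/8) (1/4) rho"

lemma S_ext: "smooth_fun S f \<Longrightarrow> smooth_fun M (eS f)"
  unfolding ext_def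
proof (rule kinetic_cutoff)
  assume f: "smooth_fun S f"
  show "smooth_near M (\<lambda>x. f (rho x)) x" if x: "x \<in> Z0" for x
    using smooth_fun_map[OF M0_smooth S_smooth rho_smooth f] x M0_near[OF x]
    unfolding smooth_fun_iff[OF M0_smooth] carrier_M0 by blast
qed auto

lemma eS_eq: "x \<in> Sg \<Longrightarrow> eS f x = f x"
  using rho_id[of x] Sg_kinetic[of x] by (simp add: ext_def smooth_step_1)

lemma S_sub: "carrier S \<subseteq> dual_set A"
  unfolding carrier_Ss using Sg_dual by blast

text \<open>On linear functions the extension multiplies by \<open>u = 1 / rad\<close> (cut off), and \<open>u\<^sup>2 \<kappa> = 1/2\<close>
  forces \<open>v u = 0\<close> when \<open>v \<kappa> = 0\<close>.\<close>

lemma sphere_tangent: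
  assumes p: "p \<in> Sg" and v: "v \<in> tangent_space M p" and v\<kappa>: "v \<kappa> = 0" and f: "smooth_fun M f"
  shows "v (eS f) = v f"
proof -
  have pd: "p \<in> dual_set A" and pM: "p \<in> carrier M" and kp: "1/4 < \<kappa> p"
    using Sg_dual[OF p] Sg_kinetic[OF p] by (auto simp: carrier_M)
  note loc = kinetic_local_M[OF pd kp pM _ _ v]
  define u where "u x = smooth_step (1/8) (1/4) (\<kappa> x) * (1 / rad x)" for x
  have u: "smooth_fun M u" unfolding u_def
  proof (rule kinetic_cutoff)
    show "smooth_near M (\<lambda>x. 1 / rad x) x" if x: "x \<in> Z0" for x
      by (rule smooth_near_divide[OF M_smooth smooth_near_const rad_smooth[OF x]])
        (use x rad_pos[OF x] in \<open>auto simp: carrier_M\<close>)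
  qed auto
  have up: "u p = 1" using rad_1_iff[OF pd] p kp by (simp add: u_def smooth_step_1)
  have "v (\<lambda>x. u x * (u x * \<kappa> x)) = v (\<lambda>_. 1/2)"
  proof (rule loc)
    show "smooth_fun M (\<lambda>x. u x * (u x * \<kappa> x))" by (intro smooth_fun_mult M_smooth u kinetic_smooth)
    show "smooth_fun M (\<lambda>_. 1/2)" by (rule smooth_fun_const[OF M_smooth])
    show "u x * (u x * \<kappa> x) = 1/2" if "x \<in> carrier M" "1/4 < \<kappa> x" for x
    proof -
      have "rad x * rad x = 2 * \<kappa> x" "rad x \<noteq> 0" using that by (simp_all add: rad_def)
      then show ?thesis using that by (simp add: u_def smooth_step_1 field_simps)
    qed
  qed (auto simp: carrier_M)
  also have "\<dots> = 0" by (rule tangent_const[OF M_smooth v])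
  finally have "v (\<lambda>x. u x * (u x * \<kappa> x)) = 0" .
  then have vu: "v u = 0"
    using tangent_mult[OF M_smooth v u smooth_fun_mult[OF M_smooth u kinetic_smooth]]
      tangent_mult[OF M_smooth v u kinetic_smooth] v\<kappa> up Sg_kinetic[OF p] by simp
  \<comment> \<open>Pushing forward again makes f \<mapsto> v (eS f) a tangent vector of
    \<open>M\<close>, so that its difference with \<open>v\<close> falls under
    \<open>derivation_eq_0\<close>.\<close>
  define w where "w = push_vec M id (ext_vec S (1/8) (1/4) rho v)"
  have ev: "ext_vec S (1/8) (1/4) rho v \<in> tangent_space S p"
    by (rule ext_vec_tangent[OF S_smooth S_sub _ S_rest S_ext _ _ kp _ v]) (use p rho_id in \<open>auto simp: carrier_Ss\<close>)
  have Sc: "Sg \<subseteq> carrier M" using Sg_dual by (auto simp: carrier_M)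
  have "w \<in> tangent_space M p"
    unfolding w_def using push_vec_tangent[OF S_smooth M_smooth smooth_map_slice_inclusion[OF M_smooth Sc] ev]
    by (simp add: id_def)
  from tangent_lincomb2[OF M_smooth this v, of 1 "-1"]
  have t: "(\<lambda>f. 1 * w f + (-1) * v f) \<in> tangent_space M p" .
  have w_eq: "w f = v (eS f)" if "smooth_fun M f" for f
    using that S_rest[OF that] by (simp add: w_def push_vec_def ext_vec_def)
  have "1 * w f + (-1) * v f = 0"
  proof (rule derivation_eq_0[OF pd t])
    fix h assume h: "smooth_fun Q h"
    note hs = base_fun_smooth[OF h]
    \<comment> \<open>\<open>rho\<close> stays in the fibre, so a basic function is changed by the
      cut-off alone, and that only away from \<open>p\<close>.\<close>
    have "v (eS (\<lambda>x. h (fst x))) = v (\<lambda>x. h (fst x))"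
      by (rule loc[OF _ _ S_ext[OF S_rest[OF hs]] hs]) (auto simp: carrier_M ext_def rho_def smooth_step_1)
    then show "1 * w (\<lambda>x. h (fst x)) + (-1) * v (\<lambda>x. h (fst x)) = 0" using w_eq[OF hs] by simp
  next
    fix L assume L: "smooth_fun M L" "fibrewise_linear A L"
    have "v (eS L) = v (\<lambda>x. u x * L x)"
      by (rule tangent_cong[OF M_smooth v pM smooth_fun_mult[OF M_smooth u L(1)]])
        (use fibrewise_linear_dilation[OF L(2)] in \<open>auto simp: carrier_M ext_def rho_def u_def\<close>)
    also have "\<dots> = v L" using tangent_mult[OF M_smooth v u L(1)] vu up by simp
    finally show "1 * w L + (-1) * v L = 0" using w_eq[OF L(1)] by simp
  qed
  then show ?thesis using w_eq[OF f] by simp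
qed

end

section \<open>The Jacobi structure induced on the sphere bundle\<close>

context poisson_setup
begin

text \<open>Here the level 1/2 matters: \<Delta> \<kappa> = 2 \<kappa> = 1 on it, so the wedge
  contributes \<open>X p h\<close>, which cancels \<open>P p \<kappa> h\<close>.\<close>

lemma \<Lambda>_kinetic: "p \<in> Sg \<Longrightarrow> \<Lambda> p \<kappa> h = 0"
  using X_kinetic[OF Sg_dual] liouville_kinetic[OF Sg_dual] Sg_kinetic
  by (simp add: wedge_def hamiltonian_vf_def)

lemma \<Lambda>_ext:
  assumes p: "p \<in> Sg" and f: "smooth_fun M f" and h: "smooth_fun M h"
  shows "\<Lambda> p (eS f) (eS h) = \<Lambda> p f h"
proof -
  note B = \<Lambda>_biv[OF Sg_dual[OF p]]
  have a: "\<Lambda> p f \<kappa> = 0" for f using \<Lambda>_kinetic[OF p, of f] bivectors_antisym[OF B, of f \<kappa>] by simp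
  have "\<Lambda> p (eS f) (eS h) = \<Lambda> p f (eS h)"
    by (rule sphere_tangent[OF p bivectors_tangent_left[OF M_smooth B] \<Lambda>_kinetic[OF p] f])
  also have "\<dots> = \<Lambda> p f h"
    by (rule sphere_tangent[OF p bivectors_tangent_right[OF M_smooth B] a h])
  finally show ?thesis .
qed

lemma E_ext: "p \<in> Sg \<Longrightarrow> smooth_fun M f \<Longrightarrow> E p (eS f) = E p f"
  using sphere_tangent[OF _ E_tangent[OF Sg_dual]] X_kinetic[OF Sg_dual] by simp

abbreviation "\<Lambda>S \<equiv> restrict_bivec M S \<Lambda>"
abbreviation "ES \<equiv> restrict_vec M S E"

context
  fixes p assumes p: "p \<in> Sg"
begin

lemma S_facts: "carrier S \<subseteq> dual_set A" "\<And>x. x \<in> carrier S \<Longrightarrow> rho x = x"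
  "0 < (1/8::real)" "1/8 < (1/4::real)" "1/4 < \<kappa> p" "p \<in> carrier S"
  using S_sub rho_id p Sg_kinetic[OF p] by (auto simp: carrier_Ss)

lemmas S_restriction = S_smooth S_facts(1,2) S_rest S_ext S_facts(3,4,5,6)

lemma \<Lambda>_tangent: "\<Lambda> p \<in> push_bivec M id ` bivectors S p"
  by (rule restrict_bivec_ext(1)[OF S_restriction \<Lambda>_biv[OF Sg_dual[OF p]]]) (assumption+, rule \<Lambda>_ext[OF p])

lemma \<Lambda>S_eq: "\<Lambda>S p = ext_bivec S (1/8) (1/4) rho (\<Lambda> p)"
  unfolding restrict_bivec_def
  by (rule restrict_bivec_ext(2)[OF S_restriction \<Lambda>_biv[OF Sg_dual[OF p]]]) (assumption+, rule \<Lambda>_ext[OF p])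

lemma E_tangent_S: "E p \<in> push_vec M id ` tangent_space S p"
  by (rule restrict_vec_ext(1)[OF S_restriction E_tangent[OF Sg_dual[OF p]]]) (assumption+, rule E_ext[OF p])

lemma ES_eq: "ES p = ext_vec S (1/8) (1/4) rho (E p)"
  unfolding restrict_vec_def
  by (rule restrict_vec_ext(2)[OF S_restriction E_tangent[OF Sg_dual[OF p]]]) (assumption+, rule E_ext[OF p])

lemma \<Lambda>S_biv: "\<Lambda>S p \<in> bivectors S p"
  unfolding \<Lambda>S_eq by (rule ext_bivec_bivectors[OF S_restriction \<Lambda>_biv[OF Sg_dual[OF p]]])

lemma ES_tangent: "ES p \<in> tangent_space S p"
  unfolding ES_eq by (rule ext_vec_tangent[OF S_restriction E_tangent[OF Sg_dual[OF p]]])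

lemma \<Lambda>S_apply: "smooth_fun S f \<Longrightarrow> smooth_fun S h \<Longrightarrow> \<Lambda>S p f h = \<Lambda> p (eS f) (eS h)"
  unfolding \<Lambda>S_eq by (simp add: ext_bivec_def)

lemma ES_apply: "smooth_fun S f \<Longrightarrow> ES p f = E p (eS f)"
  unfolding ES_eq by (simp add: ext_vec_def)

lemma \<Lambda>S_rest: "smooth_fun M f \<Longrightarrow> smooth_fun M h \<Longrightarrow> \<Lambda>S p f h = \<Lambda> p f h"
  using \<Lambda>S_apply[OF S_rest S_rest] \<Lambda>_ext[OF p] by simp

lemma ES_rest: "smooth_fun M f \<Longrightarrow> ES p f = E p f"
  using ES_apply[OF S_rest] E_ext[OF p] by simp

text \<open>Made for iterated brackets: the inner one is a function on the sphere bundle, and it may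
  be evaluated through any ambient smooth function that agrees with it there, not just through its
  radial extension.\<close>

lemma \<Lambda>S_cong:
  assumes "smooth_fun M f'" "\<And>x. x \<in> Sg \<Longrightarrow> f x = f' x" "smooth_fun M h'" "\<And>x. x \<in> Sg \<Longrightarrow> h x = h' x"
  shows "\<Lambda>S p f h = \<Lambda> p f' h'"
  using bivectors_cong[OF S_smooth \<Lambda>S_biv _ S_rest[OF assms(1)] _ S_rest[OF assms(3)], of f h] assms p
    \<Lambda>S_rest[OF assms(1,3)] by (simp add: carrier_Ss)

lemma ES_cong:
  assumes "smooth_fun M f'" "\<And>x. x \<in> Sg \<Longrightarrow> f x = f' x"
  shows "ES p f = E p f'"
  using tangent_cong[OF S_smooth ES_tangent _ S_rest[OF assms(1)], of f] assms p ES_rest[OF assms(1)]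
  by (simp add: carrier_Ss)

end

lemma \<Lambda>S_smooth:
  assumes f: "smooth_fun S f" and h: "smooth_fun S h" shows "smooth_fun S (\<lambda>x. \<Lambda>S x f h)"
  by (rule smooth_fun_cong[OF S_smooth _ S_rest[OF \<Lambda>_smooth[OF S_ext[OF f] S_ext[OF h]]]])
    (use \<Lambda>S_apply f h in \<open>simp add: carrier_Ss\<close>)

lemma ES_smooth:
  assumes f: "smooth_fun S f" shows "smooth_fun S (\<lambda>x. ES x f)"
  by (rule smooth_fun_cong[OF S_smooth _ S_rest[OF smooth_fun_minus[OF M_smooth X_smooth[OF S_ext[OF f]]]]])
    (use ES_apply f in \<open>simp add: carrier_Ss\<close>)

text \<open>On the sphere bundle every iterated expression equals the corresponding ambient one on
  extended functions, so the identities follow from those of \<open>\<Lambda>\<close> and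
  \<open>E\<close>.\<close>

lemma S_jacobi_structure: "jacobi_structure S \<Lambda>S ES"
proof -
  have "schouten_bracket \<Lambda>S \<Lambda>S p f h k = 2 * wedge21 (\<Lambda>S p) (ES p) f h k"
    if p: "p \<in> Sg" and f: "smooth_fun S f" and h: "smooth_fun S h" and k: "smooth_fun S k" for p f h k
  proof -
    have i: "\<Lambda>S p (\<lambda>x. \<Lambda>S x f h) k = \<Lambda> p (\<lambda>x. \<Lambda> x (eS f) (eS h)) (eS k)"
      if f: "smooth_fun S f" and h: "smooth_fun S h" and k: "smooth_fun S k" for f h k
      by (rule \<Lambda>S_cong[OF p \<Lambda>_smooth[OF S_ext[OF f] S_ext[OF h]] _ S_ext[OF k]],
          rule \<Lambda>S_apply[OF _ f h], assumption, rule eS_eq[symmetric])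
    have "insertion \<Lambda>S \<Lambda>S p f h k = insertion \<Lambda> \<Lambda> p (eS f) (eS h) (eS k)"
      unfolding insertion_def i[OF f h k] i[OF h k f] i[OF k f h] ..
    also have "\<dots> = wedge21 (\<Lambda> p) (E p) (eS f) (eS h) (eS k)"
      by (rule \<Lambda>_jacobi[OF Sg_dual[OF p] S_ext[OF f] S_ext[OF h] S_ext[OF k]])
    also have "\<dots> = wedge21 (\<Lambda>S p) (ES p) f h k"
      unfolding wedge21_def \<Lambda>S_apply[OF p f h] \<Lambda>S_apply[OF p h k] \<Lambda>S_apply[OF p k f]
        ES_apply[OF p f] ES_apply[OF p h] ES_apply[OF p k] ..
    finally show ?thesis by (simp add: schouten_bracket_def)
  qed
  moreover have "lie_derivative ES \<Lambda>S p f h = 0"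
    if p: "p \<in> Sg" and f: "smooth_fun S f" and h: "smooth_fun S h" for p f h
  proof -
    note sE = smooth_fun_minus[OF M_smooth X_smooth]
    have "ES p (\<lambda>x. \<Lambda>S x f h) = E p (\<lambda>x. \<Lambda> x (eS f) (eS h))"
      by (rule ES_cong[OF p \<Lambda>_smooth[OF S_ext[OF f] S_ext[OF h]]]) (rule \<Lambda>S_apply[OF _ f h])
    moreover have "\<Lambda>S p (\<lambda>x. ES x f) h = \<Lambda> p (\<lambda>x. E x (eS f)) (eS h)"
      by (rule \<Lambda>S_cong[OF p sE[OF S_ext[OF f]] _ S_ext[OF h]],
          rule ES_apply[OF _ f], assumption, rule eS_eq[symmetric])
    moreover have "\<Lambda>S p f (\<lambda>x. ES x h) = \<Lambda> p (eS f) (\<lambda>x. E x (eS h))"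
      by (rule \<Lambda>S_cong[OF p S_ext[OF f] _ sE[OF S_ext[OF h]]],
          rule eS_eq[symmetric], assumption, rule ES_apply[OF _ h])
    ultimately show ?thesis
      using \<Lambda>_lie[OF Sg_dual[OF p] S_ext[OF f] S_ext[OF h]] unfolding lie_derivative_def by linarith
  qed
  ultimately show ?thesis
    unfolding jacobi_structure_def bivector_field_def vector_field_def carrier_S
    by (intro conjI ballI allI impI; (elim conjE)?) (rule \<Lambda>S_biv ES_tangent \<Lambda>S_smooth ES_smooth | assumption | blast)+
qed

text \<open>Expansion of \<open>\<Lambda>\<close> and \<open>E\<close> with \<open>X\<close> written
  as minus the bracket with \<open>\<kappa>\<close>; each difference of a function and its
  \<Delta>-derivative collects one term from \<open>E\<close> and one from the wedge.\<close>

lemma S_jacobi_bracket: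
  assumes b: "\<beta> \<in> Sg" and f: "smooth_fun M f" and h: "smooth_fun M h"
  shows "jacobi_bracket \<Lambda>S ES f h \<beta> = P \<beta> f h - P \<beta> \<kappa> f * (h \<beta> - \<Delta> \<beta> h) + P \<beta> \<kappa> h * (f \<beta> - \<Delta> \<beta> f)"
  unfolding jacobi_bracket_def \<Lambda>S_rest[OF b f h] ES_rest[OF b f] ES_rest[OF b h]
  by (simp add: wedge_def hamiltonian_vf_def algebra_simps)

subsection \<open>The Poisson structure away from the zero section\<close>

abbreviation "R \<equiv> restrict_bivec M M0 P"
abbreviation "e0 a b \<equiv> ext a b (\<lambda>x. x)"

lemma e0_eq: "a < b \<Longrightarrow> b < \<kappa> x \<Longrightarrow> e0 a b f x = f x"
  by (simp add: ext_def smooth_step_1)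

lemma P_local:
  assumes y: "y \<in> dual_set A" "b < \<kappa> y" and s: "smooth_fun M f" "smooth_fun M f'" "smooth_fun M h" "smooth_fun M h'"
    and f: "\<And>x. x \<in> dual_set A \<Longrightarrow> b < \<kappa> x \<Longrightarrow> f x = f' x" and h: "\<And>x. x \<in> dual_set A \<Longrightarrow> b < \<kappa> x \<Longrightarrow> h x = h' x"
  shows "P y f h = P y f' h'"
proof -
  have "P y f h = P y f' h"
    by (rule kinetic_local_M[OF y _ _ _ P_left[OF y(1)] s(1,2)], simp_all only: carrier_M y order_refl) (rule f)
  also have "\<dots> = P y f' h'"
    by (rule kinetic_local_M[OF y _ _ _ P_right[OF y(1)] s(3,4)], simp_all only: carrier_M y order_refl) (rule h)
  finally show ?thesis .
qed

context
  fixes y a b assumes y: "y \<in> Z0" and ab: "0 < a" "a < b" "b < \<kappa> y"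
begin

lemma y_dual: "y \<in> dual_set A" and y_M0: "y \<in> carrier M0" and M0_sub: "carrier M0 \<subseteq> dual_set A"
  using y by (auto simp: carrier_M0)

lemma P_ext: "smooth_fun M f \<Longrightarrow> smooth_fun M h \<Longrightarrow> P y (e0 a b f) (e0 a b h) = P y f h"
  by (rule P_local[OF y_dual ab(3) M0_ext[OF ab(1,2) M0_rest] _ M0_ext[OF ab(1,2) M0_rest]])
    (assumption | rule e0_eq[OF ab(2)])+

lemmas M0_restriction = M0_smooth M0_sub refl M0_rest M0_ext[OF ab(1,2)] ab y_M0

lemma R_eq: "R y = ext_bivec M0 a b (\<lambda>x. x) (P y)"
  unfolding restrict_bivec_def
  by (rule restrict_bivec_ext(2)[where r = "\<lambda>x. x", OF M0_restriction P_biv[OF y_dual]]) (assumption+, rule P_ext)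

lemma R_biv': "R y \<in> bivectors M0 y"
  unfolding R_eq
  by (rule ext_bivec_bivectors[where r = "\<lambda>x. x", OF M0_restriction P_biv[OF y_dual]]) assumption+

lemma R_apply: "smooth_fun M0 f \<Longrightarrow> smooth_fun M0 h \<Longrightarrow> R y f h = P y (e0 a b f) (e0 a b h)"
  unfolding R_eq by (simp add: ext_bivec_def)

end

text \<open>Off the zero section \<open>\<kappa>\<close> can come arbitrarily close to 0, so the
  levels of the cut-off have to depend on the point, unlike on the sphere bundle.\<close>

lemma Z0_cutoff: "y \<in> Z0 \<Longrightarrow> 0 < \<kappa> y / 4 \<and> \<kappa> y / 4 < \<kappa> y / 2 \<and> \<kappa> y / 2 < \<kappa> y"
  using Z0_iff[of y] by auto

lemma R_biv: "y \<in> Z0 \<Longrightarrow> R y \<in> bivectors M0 y"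
  using R_biv' Z0_cutoff by blast

text \<open>The same levels serve all points with \<open>\<kappa>\<close> above \<open>b\<close>, so
  near a given point \<open>R\<close> is evaluated through one pair of global functions; smoothness
  and nested brackets depend on this.\<close>

lemma R_near:
  assumes f: "smooth_fun M0 f" and h: "smooth_fun M0 h" and ab: "0 < a" "a < b" and x: "x \<in> dual_set A" "b < \<kappa> x"
  shows "R x f h = P x (e0 a b f) (e0 a b h)"
  by (rule R_apply[OF _ ab x(2) f h]) (use Z0_iff[OF x(1)] ab x in auto)

lemma R_smooth:
  assumes f: "smooth_fun M0 f" and h: "smooth_fun M0 h"
  shows "smooth_fun M0 (\<lambda>x. R x f h)"
  unfolding smooth_fun_iff[OF M0_smooth] carrier_M0
proof
  fix y assume y: "y \<in> Z0"
  define a b where "a = \<kappa> y / 4" and "b = \<kappa> y / 2"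
  have ab: "0 < a" "a < b" "b < \<kappa> y" using Z0_cutoff[OF y] by (auto simp: a_def b_def)
  have "smooth_fun M (\<lambda>x. P x (e0 a b f) (e0 a b h))"
    by (rule P_smooth[OF M0_ext[OF ab(1,2) f] M0_ext[OF ab(1,2) h]])
  then have "smooth_near M (\<lambda>x. P x (e0 a b f) (e0 a b h)) y"
    using y by (simp add: smooth_fun_iff[OF M_smooth] carrier_M)
  then have "smooth_near M (\<lambda>x. R x f h) y"
    by (rule smooth_near_cong[OF _ openin_kinetic[OF open_greaterThan[of b]]])
      (use y ab R_near[OF f h ab(1,2)] in auto)
  then show "smooth_near M0 (\<lambda>x. R x f h) y" using M0_near[OF y] by blast
qed

lemma R_poisson: "poisson_structure M0 R"
proof -
  have "R y (\<lambda>x. R x f h) k + R y (\<lambda>x. R x h k) f + R y (\<lambda>x. R x k f) h = 0"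
    if f: "smooth_fun M0 f" and h: "smooth_fun M0 h" and k: "smooth_fun M0 k" and y: "y \<in> Z0" for f h k y
  proof -
    define a b where "a = \<kappa> y / 4" and "b = \<kappa> y / 2"
    have ab: "0 < a" "a < b" "b < \<kappa> y" using Z0_cutoff[OF y] by (auto simp: a_def b_def)
    have yd: "y \<in> dual_set A" using y by simp
    note e = M0_ext[OF ab(1,2)]
    have i: "R y (\<lambda>x. R x f h) k = P y (\<lambda>x. P x (e0 a b f) (e0 a b h)) (e0 a b k)"
      if f: "smooth_fun M0 f" and h: "smooth_fun M0 h" and k: "smooth_fun M0 k" for f h k
    proof -
      have "R y (\<lambda>x. R x f h) k = P y (e0 a b (\<lambda>x. R x f h)) (e0 a b k)"
        by (rule R_apply[OF y ab R_smooth[OF f h] k])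
      also have "\<dots> = P y (\<lambda>x. P x (e0 a b f) (e0 a b h)) (e0 a b k)"
        by (rule P_local[OF yd ab(3) e[OF R_smooth[OF f h]] P_smooth[OF e[OF f] e[OF h]] e[OF k] e[OF k]])
          (use e0_eq[OF ab(2)] R_near[OF f h ab(1,2)] in auto)
      finally show ?thesis .
    qed
    show ?thesis unfolding i[OF f h k] i[OF h k f] i[OF k f h] by (rule P_jacobi[OF e[OF f] e[OF h] e[OF k] yd])
  qed
  then show ?thesis
    unfolding poisson_structure_def bivector_field_def poisson_bracket_def carrier_M0
    using R_biv R_smooth by blast
qed

subsection \<open>The Poissonization\<close>

abbreviation "SR \<equiv> prod_atlas S real_line"
abbreviation "PS \<equiv> poissonization S \<Lambda>S ES"

definition "Psi = (\<lambda>(\<beta> :: 'q \<times> ('a \<Rightarrow> real), t). dilation (exp t) \<beta>)"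

lemma SR_smooth: "smooth_atlas SR"
  by (rule smooth_atlas_prod[OF S_smooth real_line])

lemma carrier_SR: "carrier SR = Sg \<times> UNIV"
  by (simp add: carrier_prod_atlas carrier_Ss)

lemmas carrier_SRs = carrier_SR carrier_SR[unfolded One_nat_def]

lemma Psi_Z0: "\<beta> \<in> Sg \<Longrightarrow> Psi (\<beta>, t) \<in> Z0"
  unfolding Psi_def using dilation_Z0[OF Sg_Z0] by simp

lemma Psi_smooth: "smooth_map SR M0 Psi"
proof (rule smooth_map_open_target[OF M_smooth SR_smooth openin_Z0])
  have Sc: "Sg \<subseteq> carrier M" using Sg_dual by (auto simp: carrier_M)
  have i: "smooth_map SR M fst"
    by (rule smooth_map_compose[OF SR_smooth S_smooth M_smooth smooth_map_fst[OF S_smooth real_line]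
        smooth_map_slice_inclusion[OF M_smooth Sc]])
  have "smooth_map SR M (\<lambda>z. dilation (exp (snd z)) (fst z))"
  proof (rule smooth_map_dilation[OF SR_smooth i])
    show "smooth_near SR (\<lambda>z. exp (snd z)) z" if "z \<in> carrier SR" for z
      by (rule smooth_near_snd[OF smooth_near_real_line]) (use that Ck_on_exp in \<open>auto simp: carrier_SRs carrier_Ss\<close>)
  qed
  then show "smooth_map SR M Psi" unfolding Psi_def case_prod_beta .
  show "Psi z \<in> Z0" if "z \<in> carrier SR" for z using that Psi_Z0 by (auto simp: carrier_SRs)
qed

definition "Psi_inv x = (rho x, ln (rad x))"

lemma Psi_inv_smooth: "smooth_map M0 SR Psi_inv"
  unfolding Psi_inv_def[abs_def]
proof (rule smooth_map_Pair_real[OF S_smooth M0_smooth rho_smooth])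
  fix x assume "x \<in> carrier M0"
  then have x: "x \<in> Z0" by (simp add: carrier_M0)
  have "smooth_near M (\<lambda>x. ln (rad x)) x" by (rule smooth_near_ln[OF rad_smooth[OF x] rad_pos[OF x]])
  then show "smooth_near M0 (\<lambda>x. ln (rad x)) x" using M0_near[OF x] by blast
qed

lemma Psi_Psi_inv: "x \<in> Z0 \<Longrightarrow> Psi (Psi_inv x) = x"
  unfolding Psi_def Psi_inv_def rho_def using rad_pos[of x] by (simp add: dilation_dilation)

lemma Psi_inv_Psi: "z \<in> carrier SR \<Longrightarrow> Psi_inv (Psi z) = z"
proof -
  assume "z \<in> carrier SR"
  then obtain \<beta> t where z: "z = (\<beta>, t)" "\<beta> \<in> Sg" by (auto simp: carrier_SRs)
  have "rad (dilation (exp t) \<beta>) = exp t"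
    using rad_dilation[OF Sg_dual[OF z(2)], of "exp t"] rad_1_iff[OF Sg_dual[OF z(2)]] z(2) by simp
  moreover have "rho (dilation (exp t) \<beta>) = \<beta>" using rho_dilation[OF Sg_Z0[OF z(2)], of "exp t"] rho_id[OF z(2)] by simp
  ultimately show "Psi_inv (Psi z) = z" by (simp add: Psi_def Psi_inv_def z(1))
qed

lemma Psi_bij: "bij_betw Psi (carrier SR) (carrier M0)"
proof (rule bij_betw_byWitness[where f' = Psi_inv])
  show "\<forall>a\<in>carrier SR. Psi_inv (Psi a) = a" using Psi_inv_Psi by blast
  show "\<forall>a'\<in>carrier M0. Psi (Psi_inv a') = a'" using Psi_Psi_inv by (simp add: carrier_M0)
  show "Psi ` carrier SR \<subseteq> carrier M0" using smooth_map_carrier[OF Psi_smooth] by blast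
  show "Psi_inv ` carrier M0 \<subseteq> carrier SR" using smooth_map_carrier[OF Psi_inv_smooth] by blast
qed

lemma Psi_diffeo: "diffeomorphism SR M0 Psi"
  unfolding diffeomorphism_def
proof (intro conjI Psi_bij Psi_smooth smooth_map_cong[OF M0_smooth SR_smooth Psi_inv_smooth])
  fix x assume x: "x \<in> carrier M0"
  show "inv_into (carrier SR) Psi x = Psi_inv x"
    by (rule inv_into_f_eq[OF bij_betw_imp_inj_on[OF Psi_bij]])
      (use x smooth_map_carrier[OF Psi_inv_smooth] Psi_Psi_inv in \<open>auto simp: carrier_M0\<close>)
qed

lemma PS_biv:
  assumes b: "\<beta> \<in> Sg" shows "PS (\<beta>, t) \<in> bivectors SR (\<beta>, t)"
proof -
  let ?i = "\<lambda>x. (x, t)"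
  have bS: "\<beta> \<in> carrier S" using b by (simp add: carrier_Ss)
  note i = smooth_map_prod_slice[OF S_smooth, of t]
  have 1: "push_bivec SR ?i (\<Lambda>S \<beta>) \<in> bivectors SR (\<beta>, t)"
    using push_bivec_bivectors[OF S_smooth SR_smooth i \<Lambda>S_biv[OF b]] .
  have 2: "wedge (push_vec SR ?i (ES \<beta>)) (partial_t S (\<beta>, t)) \<in> bivectors SR (\<beta>, t)"
    by (rule bivectors_wedge[OF push_vec_tangent[OF S_smooth SR_smooth i ES_tangent[OF b]] partial_t_tangent[OF S_smooth bS]])
  from bivectors_scale[OF SR_smooth bivectors_add[OF 1 bivectors_scale[OF SR_smooth 2, of "-1"]], of "exp (- t)"]
  show ?thesis by (simp add: poissonization_def)
qed

text \<open>Everything is moved to the point \<open>\<beta>\<close> by the dilation with factor exp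
  t. There d/dt becomes \<Delta> and \<open>E\<close> is \<open>- X\<close>, so the second summand
  of the Poissonization removes the wedge from \<open>\<Lambda>\<close>. What remains,
  \<open>P\<close> with the factor exp (-t), matches the homogeneity of \<open>P\<close>.\<close>

lemma PS_Psi:
  assumes b: "\<beta> \<in> Sg" and f: "smooth_fun M0 f" and h: "smooth_fun M0 h"
  shows "PS (\<beta>, t) (f \<circ> Psi) (h \<circ> Psi) = R (Psi (\<beta>, t)) f h"
proof -
  define c where "c = exp t"
  have c: "c > 0" by (simp add: c_def)
  have bd: "\<beta> \<in> dual_set A" and bZ: "\<beta> \<in> Z0" and kb: "\<kappa> \<beta> = 1/2" and bS: "\<beta> \<in> carrier S"
    using Sg_dual[OF b] Sg_Z0[OF b] Sg_kinetic[OF b] b by (auto simp: carrier_Ss)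
  have kd: "\<kappa> (dilation c x) = c\<^sup>2 * \<kappa> x" if "x \<in> dual_set A" for x by (rule kinetic_dilation[OF that])
  \<comment> \<open>A global smooth function that near the sphere bundle is \<open>f\<close>
    composed with the dilation; the smoothness of \<open>f\<close> is given off the zero section
    only.\<close>
  define tw where "tw f x = smooth_step (1/8) (1/4) (\<kappa> x) * f (dilation c x)" for f :: "'q \<times> ('a \<Rightarrow> real) \<Rightarrow> real" and x
  have dil0: "smooth_map M0 M0 (dilation c)"
  proof (rule smooth_map_open_target[OF M_smooth M0_smooth openin_Z0])
    show "smooth_map M0 M (dilation c)"
      by (rule smooth_map_dilation[OF M0_smooth M0_incl]) (rule smooth_near_const)
  qed (use dilation_Z0[OF _ c] in \<open>simp add: carrier_M0\<close>)
  have tw_s: "smooth_fun M (tw f)" if f: "smooth_fun M0 f" for f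
    unfolding tw_def
  proof (rule kinetic_cutoff)
    show "smooth_near M (\<lambda>x. f (dilation c x)) x" if x: "x \<in> Z0" for x
      using smooth_fun_map[OF M0_smooth M0_smooth dil0 f] x M0_near[OF x]
      unfolding smooth_fun_iff[OF M0_smooth] carrier_M0 by blast
  qed auto
  have tw_eq: "tw f x = f (dilation c x)" if "1/4 < \<kappa> x" for f x using that by (simp add: tw_def smooth_step_1)
  have fP: "smooth_fun SR (f \<circ> Psi)" if f: "smooth_fun M0 f" for f
    unfolding comp_def by (rule smooth_fun_map[OF SR_smooth M0_smooth Psi_smooth f])
  have tw_S: "((f \<circ> Psi) \<circ> (\<lambda>x. (x, t))) x = tw f x" if "x \<in> Sg" for f x
    using tw_eq[of x f] Sg_kinetic[OF that] by (simp add: Psi_def c_def)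
  have E: "push_vec SR (\<lambda>x. (x, t)) (ES \<beta>) (f \<circ> Psi) = E \<beta> (tw f)" if f: "smooth_fun M0 f" for f
    unfolding push_vec_def if_P[OF fP[OF f]] by (rule ES_cong[OF b tw_s[OF f] tw_S])
  have L: "push_bivec SR (\<lambda>x. (x, t)) (\<Lambda>S \<beta>) (f \<circ> Psi) (h \<circ> Psi) = \<Lambda> \<beta> (tw f) (tw h)"
    unfolding push_bivec_def if_P[OF conjI[OF fP[OF f] fP[OF h]]]
    by (rule \<Lambda>S_cong[OF b tw_s[OF f] tw_S tw_s[OF h] tw_S])
  have D: "partial_t S (\<beta>, t) (f \<circ> Psi) = \<Delta> \<beta> (tw f)" if f: "smooth_fun M0 f" for f
  proof (rule DERIV_unique[OF partial_t_deriv[OF S_smooth fP[OF f] bS]])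
    have "((\<lambda>s. tw f (dilation (exp s) \<beta>)) has_real_derivative \<Delta> \<beta> (tw f)) (at (t - t))"
      using liouville_deriv[OF tw_s[OF f] bd] by simp
    from DERIV_shift[THEN iffD1, of "\<lambda>s. tw f (dilation (exp s) \<beta>)" _ t "- t"] this
    have d: "((\<lambda>s. tw f (dilation (exp (s - t)) \<beta>)) has_real_derivative \<Delta> \<beta> (tw f)) (at t)"
      by simp
    \<comment> \<open>By degree 2, \<open>\<kappa>\<close> at the dilation of \<open>\<beta>\<close>
      by exp (s - t) is half the square of that factor; on this set it exceeds 1/4, the level above
      which \<open>tw\<close> has no cut-off.\<close>
    have o: "open {s. 1/2 < (exp (s - t))\<^sup>2}" by (intro open_Collect_less continuous_intros)
    show "((\<lambda>s. (f \<circ> Psi) (\<beta>, s)) has_real_derivative \<Delta> \<beta> (tw f)) (at t)"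
    proof (rule has_field_derivative_transform_within_open[OF d o])
      fix s assume s: "s \<in> {s. 1/2 < (exp (s - t))\<^sup>2}"
      have "1/4 < \<kappa> (dilation (exp (s - t)) \<beta>)" using kinetic_dilation[OF bd, of "exp (s - t)"] kb s by simp
      from tw_eq[OF this, of f] show "tw f (dilation (exp (s - t)) \<beta>) = (f \<circ> Psi) (\<beta>, s)"
        by (simp add: dilation_dilation Psi_def c_def exp_add[symmetric])
    qed simp
  qed
  have "PS (\<beta>, t) (f \<circ> Psi) (h \<circ> Psi) = (1 / c) * P \<beta> (tw f) (tw h)"
    unfolding poissonization_def prod.case L
    unfolding wedge_def E[OF f] E[OF h] D[OF f] D[OF h]
    by (simp add: c_def exp_minus inverse_eq_divide)
  moreover have "R (Psi (\<beta>, t)) f h = (1 / c) * P \<beta> (tw f) (tw h)"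
  proof -
    \<comment> \<open>The levels 1/8 and 1/4 of \<open>tw\<close>, scaled by the degree 2 of
      \<open>\<kappa>\<close>, so that \<open>b < \<kappa> (dilation c x)\<close> whenever
      \<open>1/4 < \<kappa> x\<close>.\<close>
    define a b where "a = c\<^sup>2 * (1/8)" and "b = c\<^sup>2 * (1/4)"
    have ab: "0 < a" "a < b" "b < \<kappa> (dilation c \<beta>)"
    proof -
      have "\<kappa> (dilation c \<beta>) = c\<^sup>2 / 2" "0 < c\<^sup>2" using c kd[OF bd] kb by simp_all
      then show "0 < a" "a < b" "b < \<kappa> (dilation c \<beta>)" unfolding a_def b_def by linarith+
    qed
    have "R (dilation c \<beta>) f h = P (dilation c \<beta>) (e0 a b f) (e0 a b h)"
      by (rule R_apply[OF dilation_Z0[OF bZ c] ab f h])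
    also have "\<dots> = (1 / c) * P \<beta> (\<lambda>x. e0 a b f (dilation c x)) (\<lambda>x. e0 a b h (dilation c x))"
      by (rule P_homogeneous[OF bZ c M0_ext[OF ab(1,2) f] M0_ext[OF ab(1,2) h]])
    also have "P \<beta> (\<lambda>x. e0 a b f (dilation c x)) (\<lambda>x. e0 a b h (dilation c x)) = P \<beta> (tw f) (tw h)"
    proof (rule P_local[OF bd, of "1/4"])
      have "smooth_fun M (\<lambda>x. e0 a b f (dilation c x))" if f: "smooth_fun M0 f" for f
        by (rule smooth_fun_map[OF M_smooth M_smooth dilation_smooth M0_ext[OF ab(1,2) f]])
      then show "smooth_fun M (\<lambda>x. e0 a b f (dilation c x))" "smooth_fun M (\<lambda>x. e0 a b h (dilation c x))"
        using f h by blast+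
      have "e0 a b f (dilation c x) = tw f x" if x: "x \<in> dual_set A" "1/4 < \<kappa> x" for f x
      proof -
        have "b < \<kappa> (dilation c x)" using kd[OF x(1)] x(2) c by (simp add: b_def)
        then show ?thesis using e0_eq[OF ab(2)] tw_eq[OF x(2)] by simp
      qed
      then show "\<And>x. x \<in> dual_set A \<Longrightarrow> 1/4 < \<kappa> x \<Longrightarrow> e0 a b f (dilation c x) = tw f x"
        "\<And>x. x \<in> dual_set A \<Longrightarrow> 1/4 < \<kappa> x \<Longrightarrow> e0 a b h (dilation c x) = tw h x" by blast+
    qed (use kb tw_s f h in auto)
    finally show ?thesis by (simp add: Psi_def c_def)
  qed
  ultimately show ?thesis by simp
qed

text \<open>Expresses the Poissonization through \<open>R\<close>; \<open>PS_smooth\<close> and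
  \<open>PS_poisson\<close> inherit smoothness and the Jacobi identity this way.\<close>

lemma PS_pull:
  assumes z: "z \<in> carrier SR" and u: "smooth_fun SR u" and w: "smooth_fun SR w"
  shows "PS z u w = R (Psi z) (\<lambda>x. u (Psi_inv x)) (\<lambda>x. w (Psi_inv x))"
proof -
  obtain \<beta> t where zb: "z = (\<beta>, t)" "\<beta> \<in> Sg" using z by (auto simp: carrier_SRs)
  note s = smooth_fun_map[OF M0_smooth SR_smooth Psi_inv_smooth]
  note s' = smooth_fun_map[OF SR_smooth M0_smooth Psi_smooth]
  have "PS z u w = PS z ((\<lambda>x. u (Psi_inv x)) \<circ> Psi) ((\<lambda>x. w (Psi_inv x)) \<circ> Psi)"
    unfolding zb(1)
    by (rule bivectors_cong[OF SR_smooth PS_biv[OF zb(2)]])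
      (use z s'[OF s[OF u]] s'[OF s[OF w]] Psi_inv_Psi in \<open>auto simp: comp_def zb(1)[symmetric]\<close>)
  also have "\<dots> = R (Psi z) (\<lambda>x. u (Psi_inv x)) (\<lambda>x. w (Psi_inv x))"
    unfolding zb(1) by (rule PS_Psi[OF zb(2) s[OF u] s[OF w]])
  finally show ?thesis .
qed

lemma PS_smooth:
  assumes u: "smooth_fun SR u" and w: "smooth_fun SR w" shows "smooth_fun SR (\<lambda>z. PS z u w)"
proof -
  note s = smooth_fun_map[OF M0_smooth SR_smooth Psi_inv_smooth]
  show ?thesis
    by (rule smooth_fun_cong[OF SR_smooth PS_pull[OF _ u w]
        smooth_fun_map[OF SR_smooth M0_smooth Psi_smooth R_smooth[OF s[OF u] s[OF w]]]])
qed

lemma PS_poisson: "poisson_structure SR PS"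
proof -
  have "PS z (\<lambda>x. PS x u v) w + PS z (\<lambda>x. PS x v w) u + PS z (\<lambda>x. PS x w u) v = 0"
    if u: "smooth_fun SR u" and v: "smooth_fun SR v" and w: "smooth_fun SR w" and z: "z \<in> carrier SR" for u v w z
  proof -
    note s = smooth_fun_map[OF M0_smooth SR_smooth Psi_inv_smooth]
    let ?p = "\<lambda>u x. u (Psi_inv x)"
    have zM: "Psi z \<in> carrier M0" by (rule smooth_map_carrier[OF Psi_smooth z])
    then have zZ: "Psi z \<in> Z0" by (simp add: carrier_M0)
    \<comment> \<open>The inner bracket is pulled back as well: at \<open>Psi_inv x\<close> it is
      the bracket of \<open>R\<close> at \<open>Psi (Psi_inv x)\<close>, which is
      \<open>x\<close>.\<close>
    have i: "PS z (\<lambda>x. PS x u v) w = R (Psi z) (\<lambda>x. R x (?p u) (?p v)) (?p w)"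
      if u: "smooth_fun SR u" and v: "smooth_fun SR v" and w: "smooth_fun SR w" for u v w
    proof -
      have "PS z (\<lambda>x. PS x u v) w = R (Psi z) (\<lambda>x. PS (Psi_inv x) u v) (?p w)"
        by (rule PS_pull[OF z PS_smooth[OF u v] w])
      also have "\<dots> = R (Psi z) (\<lambda>x. R x (?p u) (?p v)) (?p w)"
      proof (rule bivectors_cong[OF M0_smooth R_biv[OF zZ] zM R_smooth[OF s[OF u] s[OF v]] _ s[OF w]])
        show "PS (Psi_inv x) u v = R x (?p u) (?p v)" if x: "x \<in> carrier M0" for x
          using PS_pull[OF smooth_map_carrier[OF Psi_inv_smooth x] u v] Psi_Psi_inv[of x] x by (simp add: carrier_M0)
      qed simp
      finally show ?thesis .
    qed
    show ?thesis
      unfolding i[OF u v w] i[OF v w u] i[OF w u v]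
      using R_poisson s[OF u] s[OF v] s[OF w] zM unfolding poisson_structure_def poisson_bracket_def by blast
  qed
  moreover have "PS z \<in> bivectors SR z" if "z \<in> carrier SR" for z
    using that PS_biv by (auto simp: carrier_SRs)
  ultimately show ?thesis
    unfolding poisson_structure_def bivector_field_def poisson_bracket_def using PS_smooth by blast
qed

lemma Psi_poisson: "poisson_isomorphism SR PS M0 R Psi"
  unfolding poisson_isomorphism_def
proof (intro conjI ballI PS_poisson R_poisson Psi_diffeo HOL.ext)
  fix z f h assume z: "z \<in> carrier SR"
  obtain \<beta> t where zb: "z = (\<beta>, t)" "\<beta> \<in> Sg" using z by (auto simp: carrier_SRs)
  show "push_bivec M0 Psi (PS z) f h = R (Psi z) f h"
    using PS_Psi[OF zb(2), of f h t] bivectors_nonsmooth[OF M0_smooth R_biv[OF Psi_Z0[OF zb(2), of t]], of f h]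
    by (cases "smooth_fun M0 f \<and> smooth_fun M0 h") (auto simp: push_bivec_def zb(1))
qed

end


theorem theorem3p3:
  fixes A :: "('q, 'a, 'b::euclidean_space, 'e::euclidean_space, 'f::euclidean_space) vbundle"
    and n :: nat
    and P :: "'q \<times> ('a \<Rightarrow> real) \<Rightarrow> ('q \<times> ('a \<Rightarrow> real)) bivec"
    and g :: "'a \<Rightarrow> 'a \<Rightarrow> real"
  assumes "vector_bundle n A"
    and "linear_poisson A P"
    and "bundle_metric A g"
  shows "let
      M = dual_atlas A;
      \<kappa> = kinetic_energy A g;
      X = hamiltonian_vf P \<kappa>;
      \<Delta> = liouville_vf A;
      \<Lambda> = (\<lambda>x f h. P x f h + wedge (\<Delta> x) (X x) f h);
      E = (\<lambda>x f. - X x f);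
      k = n + dim (typ_fibre A) - 1;
      S = slice_atlas k M (sphere_bundle A g);
      \<Lambda>S = restrict_bivec M S \<Lambda>;
      ES = restrict_vec M S E;
      M0 = open_atlas M (dual_set A - zero_section A);
      \<Psi> = (\<lambda>(\<beta>, t). dilation (exp t) \<beta>);
      \<iota> = (\<lambda>\<beta>. \<beta>)
    in
      jacobi_structure M \<Lambda> E \<and>
      (embedded_submanifold k M (sphere_bundle A g) \<and>
       bivec_tangent_to M S \<Lambda> \<and> vec_tangent_to M S E \<and>
       jacobi_structure S \<Lambda>S ES \<and>
       poisson_isomorphism (prod_atlas S real_line) (poissonization S \<Lambda>S ES)
         M0 (restrict_bivec M M0 P) \<Psi>) \<and>
      (\<forall>G1 G2. smooth_fun M G1 \<and> smooth_fun M G2 \<longrightarrow>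
        (\<forall>\<beta>\<in>sphere_bundle A g.
          jacobi_bracket \<Lambda>S ES (G1 \<circ> \<iota>) (G2 \<circ> \<iota>) \<beta> =
          ((\<lambda>x. poisson_bracket P G1 G2 x
              - poisson_bracket P \<kappa> G1 x * (G2 x - \<Delta> x G2)
              + poisson_bracket P \<kappa> G2 x * (G1 x - \<Delta> x G1)) \<circ> \<iota>) \<beta>))"
proof -
  interpret poisson_setup A n g P by unfold_locales (rule assms)+
  have "embedded_submanifold (n + dim F - 1) M Sg"
    unfolding embedded_submanifold_def using carrier_S Sg_dual by (auto simp: carrier_M)
  moreover have "bivec_tangent_to M S \<Lambda>" "vec_tangent_to M S E"
    unfolding bivec_tangent_to_def vec_tangent_to_def carrier_S using \<Lambda>_tangent E_tangent_S by blast+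
  moreover have "poisson_isomorphism SR PS M0 R (\<lambda>(\<beta>, t). dilation (exp t) \<beta>)"
    using Psi_poisson unfolding Psi_def .
  moreover have "jacobi_bracket \<Lambda>S ES (G1 \<circ> (\<lambda>\<beta>. \<beta>)) (G2 \<circ> (\<lambda>\<beta>. \<beta>)) \<beta> =
      ((\<lambda>x. poisson_bracket P G1 G2 x - poisson_bracket P \<kappa> G1 x * (G2 x - \<Delta> x G2)
        + poisson_bracket P \<kappa> G2 x * (G1 x - \<Delta> x G1)) \<circ> (\<lambda>\<beta>. \<beta>)) \<beta>"
    if "smooth_fun M G1 \<and> smooth_fun M G2" "\<beta> \<in> Sg" for G1 G2 \<beta>
    unfolding comp_def poisson_bracket_def using S_jacobi_bracket that by blast
  ultimately show ?thesis
    unfolding Let_def using \<Lambda>_jacobi_structure S_jacobi_structure by (intro conjI allI impI ballI)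
qed

end
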